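(* Let $\Omega$ be a domain in $\mathbb{R}^N$ whose boundary $\Gamma$ satisfies $\Gamma=\partial(\mathbb{R}^N\setminus\overline\Omega)$ and suppose that, for $1<p\le\infty$, $u$ is the bounded viscosity solution of $u_t=\Delta_p^Gu$ in $\Omega\times(0,\infty)$, $u=0$ on $\Omega\times\{0\}$, $u=1$ on $\Gamma\times(0,\infty)$. If $\Sigma\subset\Omega$ is a time-invariant level surface for $u$, then there exists $R>0$ such that $$d_\Gamma(x)=R\quad\text{for every }x\in\Sigma.$$
   Context: $N\ge2$; $\Omega$ is not necessarily bounded. $d_\Gamma(x)=\min_{y\in\Gamma}|x-y|$. A surface $\Sigma\subset\Omega$ (of co-dimension 1) is a time-invariant level surface for $u$ if there is a function $a_\Sigma:(0,\infty)\to\mathbb{R}$ such that $u(x,t)=a_\Sigma(t)$ for any $(x,t)\in\Sigma\times(0,\infty)$. The game-theoretic (normalized) $p$-Laplacian is $\Delta_p^Gu=\frac1p\Big\{\Delta u+(p-2)\frac{\langle\nabla^2u\,\nabla u,\nabla u\rangle}{|\nabla u|^2}\Big\}$, and $\Delta_\infty^G$ is its limit as $p\to\infty$, i.e. $\Delta_\infty^Gu=\frac{\langle\nabla^2u\,\nabla u,\nabla u\rangle}{|\nabla u|^2}$. Put $F(\xi,X)=\frac1p\mathrm{tr}X+(1-\frac2p)\frac{\langle X\xi,\xi\rangle}{|\xi|^2}$ for $\xi\in\mathbb{R}^N\setminus\{0\}$ and $X$ real symmetric $N\times N$ (with $1/p=0$ if $p=\infty$), $F_*(\xi,X)=\lim_{r\to0^+}\inf\{F(\eta,Y):\eta\ne0,|\eta-\xi|<r,|Y-X|<r\}$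 and $F^*=-(-F)_*$. A function $u\in C(\Omega\times(0,\infty))$ is a viscosity solution of $u_t=\Delta_p^Gu$ if at every $(x,t)\in\Omega\times(0,\infty)$: for every $\varphi\in C^2(\Omega\times(0,\infty))$ such that $u-\varphi$ attains its maximum at $(x,t)$, $\varphi_t-F^*(\nabla\varphi,\nabla^2\varphi)\le0$ at $(x,t)$; and for every $\varphi\in C^2(\Omega\times(0,\infty))$ such that $u-\varphi$ attains its minimum at $(x,t)$, $\varphi_t-F_*(\nabla\varphi,\nabla^2\varphi)\ge0$ at $(x,t)$. The initial and boundary conditions are meant classically: $u$ is continuous on $\overline\Omega\times[0,\infty)$ away from $\Gamma\times\{0\}$. *)

theory Defs
  imports "HOL-Analysis.Analysis"
begin

text \<open>
  \<open>\<real>\<^sup>N\<close> is \<^typ>\<open>real^'n\<close> with \<open>N = CARD('n)\<close>; space-time points \<open>(x, t)\<close> are pairs, and a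
  function on a space-time set is a total function whose values outside the set are irrelevant.
  The exponent \<open>p \<in> (1, \<infinity>]\<close> is an extended real; \<open>real_of_ereal (1 / p)\<close> is \<open>1/p\<close>
  with the convention \<open>1/\<infinity> = 0\<close>.
\<close>

definition gradient :: "(real^'n \<Rightarrow> real) \<Rightarrow> real^'n \<Rightarrow> real^'n" where
  "gradient f x = (\<chi> i. frechet_derivative f (at x) (axis i 1))"

definition hessian :: "(real^'n \<Rightarrow> real) \<Rightarrow> real^'n \<Rightarrow> real^'n^'n" where
  "hessian f x = jacobian (gradient f) (at x)"

definition C2_on :: "'a::euclidean_space set \<Rightarrow> ('a \<Rightarrow> real) \<Rightarrow> bool" where
  "C2_on S f \<longleftrightarrow>
     (\<exists>g :: 'a \<Rightarrow> 'a. \<exists>H :: 'a \<Rightarrow> 'a \<Rightarrow>\<^sub>L 'a.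
        (\<forall>z\<in>S. (f has_derivative (\<lambda>v. g z \<bullet> v)) (at z)) \<and>
        (\<forall>z\<in>S. (g has_derivative blinfun_apply (H z)) (at z)) \<and>
        continuous_on S H)"

definition pLap_F :: "ereal \<Rightarrow> real^'n \<Rightarrow> real^'n^'n \<Rightarrow> real" where
  "pLap_F p \<xi> X =
     real_of_ereal (1 / p) * trace X
     + (1 - 2 * real_of_ereal (1 / p)) * (((X *v \<xi>) \<bullet> \<xi>) / (norm \<xi>)\<^sup>2)"

text \<open>
  The semicontinuous envelopes of a function given for \<open>\<xi> \<noteq> 0\<close> and symmetric \<open>X\<close>. The infimum
  below is monotone in \<open>r\<close>; for \<^const>\<open>pLap_F\<close> it is finite and its limit exists in
  \<open>\<real>\<close>, also at \<open>\<xi> = 0\<close>. The choice of the matrix norm does not affect the limit.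
\<close>

definition lower_envelope ::
    "(real^'n \<Rightarrow> real^'n^'n \<Rightarrow> real) \<Rightarrow> real^'n \<Rightarrow> real^'n^'n \<Rightarrow> real" where
  "lower_envelope G \<xi> X =
     Lim (at_right 0) (\<lambda>r::real.
       Inf {G \<eta> Y | \<eta> Y. \<eta> \<noteq> 0 \<and> transpose Y = Y \<and> norm (\<eta> - \<xi>) < r \<and> norm (Y - X) < r})"

definition upper_envelope ::
    "(real^'n \<Rightarrow> real^'n^'n \<Rightarrow> real) \<Rightarrow> real^'n \<Rightarrow> real^'n^'n \<Rightarrow> real" where
  "upper_envelope G \<xi> X = - lower_envelope (\<lambda>\<eta> Y. - G \<eta> Y) \<xi> X"

definition viscosity_solution ::
    "ereal \<Rightarrow> (real^'n) set \<Rightarrow> ((real^'n) \<times> real \<Rightarrow> real) \<Rightarrow> bool" where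
  "viscosity_solution p \<Omega> u \<longleftrightarrow>
     continuous_on (\<Omega> \<times> {0<..}) u \<and>
     (\<forall>x\<in>\<Omega>. \<forall>t>0. \<forall>\<phi>. C2_on (\<Omega> \<times> {0<..}) \<phi> \<longrightarrow>
        ((\<forall>z\<in>\<Omega> \<times> {0<..}. u z - \<phi> z \<le> u (x, t) - \<phi> (x, t)) \<longrightarrow>
           deriv (\<lambda>s. \<phi> (x, s)) t
             - upper_envelope (pLap_F p) (gradient (\<lambda>y. \<phi> (y, t)) x) (hessian (\<lambda>y. \<phi> (y, t)) x)
             \<le> 0) \<and>
        ((\<forall>z\<in>\<Omega> \<times> {0<..}. u (x, t) - \<phi> (x, t) \<le> u z - \<phi> z) \<longrightarrow>
           deriv (\<lambda>s. \<phi> (x, s)) t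
             - lower_envelope (pLap_F p) (gradient (\<lambda>y. \<phi> (y, t)) x) (hessian (\<lambda>y. \<phi> (y, t)) x)
             \<ge> 0))"

text \<open>
  A surface of co-dimension 1, with no smoothness assumed: a subset of \<open>\<real>\<^sup>N\<close> that is locally
  homeomorphic to open subsets of a hyperplane through the origin, that is, of
  \<open>\<real>\<close> to the power \<open>N - 1\<close>.
\<close>

definition hypersurface :: "(real^'n) set \<Rightarrow> bool" where
  "hypersurface S \<longleftrightarrow>
     (\<forall>x\<in>S. \<exists>U V. \<exists>a::real^'n. a \<noteq> 0 \<and> x \<in> U \<and> openin (top_of_set S) U \<and>
        openin (top_of_set {y. a \<bullet> y = 0}) V \<and> U homeomorphic V)"

definition time_invariant_level_surface ::
    "(real^'n) set \<Rightarrow> ((real^'n) \<times> real \<Rightarrow> real) \<Rightarrow> (real^'n) set \<Rightarrow> bool" where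
  "time_invariant_level_surface \<Omega> u S \<longleftrightarrow>
     S \<subseteq> \<Omega> \<and> hypersurface S \<and> (\<exists>a :: real \<Rightarrow> real. \<forall>x\<in>S. \<forall>t>0. u (x, t) = a t)"

end

theory Submission
  imports Defs "HOL-Complex_Analysis.Great_Picard"
begin

text \<open>
  The proof compares the decay of \<open>u\<close> as \<open>t \<rightarrow> 0\<close> at two points of the level surface. Write
  \<open>q = 1/p\<close>, \<open>k = 1/(4 (1 - q))\<close> and \<open>d\<close> for the distance to \<open>\<Gamma>\<close>. Up to factors that are negligible on an
  exponential scale, \<open>u(x, t)\<close> behaves like \<open>exp (-k d(x)\<^sup>2 / t)\<close>; since \<open>u(x, t)\<close> is the same function of
  \<open>t\<close> at all \<open>x\<close> of the surface, \<open>d\<close> must be constant there.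
  
  The upper estimate \<open>upper_decay\<close> comes from an explicit supersolution in a ball around \<open>x\<close> inside
  \<open>\<Omega>\<close>. The lower estimate \<open>lower_barrier\<close> comes from the subsolution
  \<open>t\<^sup>-\<^sup>n exp (-k |x - z'|\<^sup>2 / t)\<close>, bounded on \<open>\<Omega>\<close> because \<open>z'\<close> lies outside the closure of \<open>\<Omega>\<close>; as \<open>\<Gamma>\<close> is
  also the boundary of the exterior, \<open>z'\<close> can be taken close to a boundary point nearest to \<open>x\<close>.
  
  The lower comparison requires \<open>u \<ge> 0\<close>, and this is the delicate part: nothing is known of \<open>u\<close> near
  \<open>\<Gamma> \<times> {0}\<close> except boundedness, so \<open>u\<close> cannot be compared with \<open>0\<close> directly. Let \<open>v\<close> be the
  negative part of \<open>u\<close>, extended by \<open>0\<close> to the whole space, and \<open>m\<close> its supremum. Although \<open>v\<close> need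
  not be uniformly small near time \<open>0\<close>, for every \<open>s > 0\<close> the sum \<open>v(x, t + s) + v(y, t)\<close> is
  at most \<open>m + \<gamma>\<close> for small \<open>t\<close> and nearby \<open>x\<close>, \<open>y\<close>: near a point of \<open>\<Omega>\<close> the second term is small,
  and near any other point the first one is. The operator is odd, so \<open>v\<close> is a subsolution where it is
  positive, and the sum can be followed in time with the doubling function
  \<open>m (c + \<theta>\<^sup>-\<^sup>6 (|x - y|\<^sup>4 + \<theta>\<^sup>7\<^sup>2)\<^bsup>1/8\<^esup> + |x - x0|\<^sup>2 + E \<theta>)\<close>, where \<open>\<theta>\<^sup>2\<^sup>4\<close> is an affine
  function of \<open>t\<close>. It behaves like \<open>|x - y|\<^bsup>1/2\<^esup>\<close>, a concave profile, and concavity is what makes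
  a reflection coupling of the two space variables profitable. The outcome is
  \<open>v(x, t + s) + v(x, t) \<le> 3/2 m\<close> for short times, hence \<open>v \<le> 3/4 m\<close> for short and then for all times,
  so that \<open>m = 0\<close>. This is \<open>nonneg_of_nonneg_boundary_data\<close>.
  
  At a point where the sum touches the doubling function one needs a second-order inequality that couples
  both space variables. It is \<open>coupling_bound\<close>, which takes the place of the theorem on sums of
  viscosity theory. Its proof is elementary: after sup-convolution the two summands have second-order
  blow-ups at the touching point that converge along a sequence, the limits are approximated on the unit
  sphere by polynomials with constant Laplacian (every polynomial agrees on the sphere with a
  harmonic one), and the maximum principle applied to each summand separately contradicts the touching.
\<close>

section \<open>Functions with explicit gradient and Hessian\<close>

text \<open>
  The gradient \<open>g\<close> and the Hessian \<open>H\<close>, a self-adjoint map rather than a matrix, are part of the predicate,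
  so that jets of composite expressions are computed by the rules below.
\<close>

definition twice_diff ::
    "'a::euclidean_space set \<Rightarrow> ('a \<Rightarrow> real) \<Rightarrow> ('a \<Rightarrow> 'a) \<Rightarrow> ('a \<Rightarrow> 'a \<Rightarrow> 'a) \<Rightarrow> bool" where
  "twice_diff S f g H \<longleftrightarrow>
     (\<forall>z\<in>S. (f has_derivative (\<lambda>v. g z \<bullet> v)) (at z)) \<and>
     (\<forall>z\<in>S. (g has_derivative H z) (at z)) \<and>
     (\<forall>v. continuous_on S (\<lambda>z. H z v)) \<and>
     (\<forall>z\<in>S. \<forall>v w. H z v \<bullet> w = v \<bullet> H z w)"

lemma twice_diffI:
  assumes "\<And>z. z \<in> S \<Longrightarrow> (f has_derivative (\<lambda>v. g z \<bullet> v)) (at z)"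
    and "\<And>z. z \<in> S \<Longrightarrow> (g has_derivative H z) (at z)"
    and "\<And>v. continuous_on S (\<lambda>z. H z v)"
    and "\<And>z v w. z \<in> S \<Longrightarrow> H z v \<bullet> w = v \<bullet> H z w"
  shows "twice_diff S f g H"
  using assms unfolding twice_diff_def by blast

lemma twice_diffD:
  assumes "twice_diff S f g H" "z \<in> S"
  shows "(f has_derivative (\<lambda>v. g z \<bullet> v)) (at z)"
    and "(g has_derivative H z) (at z)"
    and "H z v \<bullet> w = v \<bullet> H z w"
    and "linear (H z)"
    and "isCont f z" and "isCont g z"
  using assms unfolding twice_diff_def
  by (auto intro: has_derivative_linear has_derivative_continuous)

lemma twice_diff_cont:
  assumes "twice_diff S f g H"
  shows "continuous_on S f" "continuous_on S g" "continuous_on S (\<lambda>z. H z v)"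
  using assms twice_diffD(5,6)[OF assms]
  by (auto intro: continuous_at_imp_continuous_on simp: twice_diff_def)

lemma twice_diff_subset: "twice_diff S f g H \<Longrightarrow> T \<subseteq> S \<Longrightarrow> twice_diff T f g H"
  unfolding twice_diff_def by (meson continuous_on_subset subsetD)

lemma twice_diff_const: "twice_diff S (\<lambda>_. c) (\<lambda>_. 0) (\<lambda>_ _. 0)"
  by (rule twice_diffI) auto

lemma twice_diff_inner: "twice_diff S (\<lambda>z. b \<bullet> z) (\<lambda>_. b) (\<lambda>_ _. 0)"
  by (rule twice_diffI) (auto intro!: derivative_eq_intros)

lemma twice_diff_inner_self: "twice_diff S (\<lambda>z. z \<bullet> z) (\<lambda>z. 2 *\<^sub>R z) (\<lambda>_ v. 2 *\<^sub>R v)"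
  by (rule twice_diffI) (auto intro!: derivative_eq_intros simp: inner_commute)

lemma twice_diff_add:
  assumes "twice_diff S f1 g1 H1" "twice_diff S f2 g2 H2"
  shows "twice_diff S (\<lambda>z. f1 z + f2 z) (\<lambda>z. g1 z + g2 z) (\<lambda>z v. H1 z v + H2 z v)"
  using assms unfolding twice_diff_def
  by (auto intro!: derivative_eq_intros continuous_intros simp: inner_add_left inner_add_right)

lemma twice_diff_cmult:
  assumes "twice_diff S f g H"
  shows "twice_diff S (\<lambda>z. c * f z) (\<lambda>z. c *\<^sub>R g z) (\<lambda>z v. c *\<^sub>R H z v)"
  using assms unfolding twice_diff_def
  by (auto intro!: derivative_eq_intros continuous_intros)

lemma twice_diff_uminus:
  assumes "twice_diff S f g H"
  shows "twice_diff S (\<lambda>z. - f z) (\<lambda>z. - g z) (\<lambda>z v. - H z v)"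
  using twice_diff_cmult[OF assms, of "-1"] by simp

lemma twice_diff_diff:
  assumes "twice_diff S f1 g1 H1" "twice_diff S f2 g2 H2"
  shows "twice_diff S (\<lambda>z. f1 z - f2 z) (\<lambda>z. g1 z - g2 z) (\<lambda>z v. H1 z v - H2 z v)"
  using twice_diff_add[OF assms(1) twice_diff_uminus[OF assms(2)]] by simp

lemma twice_diff_mult:
  assumes "twice_diff S f1 g1 H1" "twice_diff S f2 g2 H2"
  shows "twice_diff S (\<lambda>z. f1 z * f2 z) (\<lambda>z. f1 z *\<^sub>R g2 z + f2 z *\<^sub>R g1 z)
    (\<lambda>z v. f1 z *\<^sub>R H2 z v + f2 z *\<^sub>R H1 z v + (g1 z \<bullet> v) *\<^sub>R g2 z + (g2 z \<bullet> v) *\<^sub>R g1 z)"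
proof (rule twice_diffI)
  fix z assume z: "z \<in> S"
  note d = twice_diffD[OF assms(1) z] twice_diffD[OF assms(2) z]
  show "((\<lambda>z. f1 z * f2 z) has_derivative (\<lambda>v. (f1 z *\<^sub>R g2 z + f2 z *\<^sub>R g1 z) \<bullet> v)) (at z)"
    by (rule has_derivative_eq_rhs[OF has_derivative_mult[OF d(1) d(7)]])
       (simp add: fun_eq_iff inner_add_left)
  show "((\<lambda>z. f1 z *\<^sub>R g2 z + f2 z *\<^sub>R g1 z) has_derivative
    (\<lambda>v. f1 z *\<^sub>R H2 z v + f2 z *\<^sub>R H1 z v + (g1 z \<bullet> v) *\<^sub>R g2 z + (g2 z \<bullet> v) *\<^sub>R g1 z)) (at z)"
    by (rule has_derivative_eq_rhs[OF has_derivative_add[OF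
       has_derivative_scaleR[OF d(1) d(8)] has_derivative_scaleR[OF d(7) d(2)]]])
       (simp add: fun_eq_iff)
  fix v w
  show "(f1 z *\<^sub>R H2 z v + f2 z *\<^sub>R H1 z v + (g1 z \<bullet> v) *\<^sub>R g2 z + (g2 z \<bullet> v) *\<^sub>R g1 z) \<bullet> w
     = v \<bullet> (f1 z *\<^sub>R H2 z w + f2 z *\<^sub>R H1 z w + (g1 z \<bullet> w) *\<^sub>R g2 z + (g2 z \<bullet> w) *\<^sub>R g1 z)"
    by (simp add: inner_add_left inner_add_right d(3) d(9) inner_commute[of v])
next
  fix v
  show "continuous_on S (\<lambda>z. f1 z *\<^sub>R H2 z v + f2 z *\<^sub>R H1 z v + (g1 z \<bullet> v) *\<^sub>R g2 z + (g2 z \<bullet> v) *\<^sub>R g1 z)"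
    by (intro continuous_intros twice_diff_cont[OF assms(1)] twice_diff_cont[OF assms(2)])
qed

lemma twice_diff_compose:
  assumes f: "twice_diff S f g H"
    and k1: "\<And>z. z \<in> S \<Longrightarrow> (k has_real_derivative k1 (f z)) (at (f z))"
    and k2: "\<And>z. z \<in> S \<Longrightarrow> (k1 has_real_derivative k2 (f z)) (at (f z))"
    and c: "continuous_on (f ` S) k2"
  shows "twice_diff S (\<lambda>z. k (f z)) (\<lambda>z. k1 (f z) *\<^sub>R g z)
    (\<lambda>z v. k1 (f z) *\<^sub>R H z v + (k2 (f z) * (g z \<bullet> v)) *\<^sub>R g z)"
proof (rule twice_diffI)
  fix z assume z: "z \<in> S"
  note d = twice_diffD[OF f z]
  have a: "((\<lambda>z. k (f z)) has_derivative (\<lambda>v. k1 (f z) * (g z \<bullet> v))) (at z)"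
    using has_derivative_compose[OF d(1), of k] k1[OF z] by (simp add: has_field_derivative_def)
  then show "((\<lambda>z. k (f z)) has_derivative (\<lambda>v. (k1 (f z) *\<^sub>R g z) \<bullet> v)) (at z)"
    by simp
  have b: "((\<lambda>z. k1 (f z)) has_derivative (\<lambda>v. k2 (f z) * (g z \<bullet> v))) (at z)"
    using has_derivative_compose[OF d(1), of k1] k2[OF z] by (simp add: has_field_derivative_def)
  show "((\<lambda>z. k1 (f z) *\<^sub>R g z) has_derivative
     (\<lambda>v. k1 (f z) *\<^sub>R H z v + (k2 (f z) * (g z \<bullet> v)) *\<^sub>R g z)) (at z)"
    by (rule has_derivative_eq_rhs[OF has_derivative_scaleR[OF b d(2)]]) (simp add: fun_eq_iff)
  fix v w
  show "(k1 (f z) *\<^sub>R H z v + (k2 (f z) * (g z \<bullet> v)) *\<^sub>R g z) \<bullet> w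
    = v \<bullet> (k1 (f z) *\<^sub>R H z w + (k2 (f z) * (g z \<bullet> w)) *\<^sub>R g z)"
    by (simp add: inner_add_left inner_add_right d(3) inner_commute[of v])
next
  fix v
  have e: "continuous_on (f ` S) k1"
    using k2 by (auto intro!: continuous_at_imp_continuous_on DERIV_isCont)
  have "continuous_on S (\<lambda>z. k1 (f z))" "continuous_on S (\<lambda>z. k2 (f z))"
    using continuous_on_compose2[OF e twice_diff_cont(1)[OF f]]
      continuous_on_compose2[OF c twice_diff_cont(1)[OF f]] by auto
  then show "continuous_on S (\<lambda>z. k1 (f z) *\<^sub>R H z v + (k2 (f z) * (g z \<bullet> v)) *\<^sub>R g z)"
    by (intro continuous_intros twice_diff_cont[OF f])
qed

lemma twice_diff_affine:
  fixes T :: "'a::euclidean_space \<Rightarrow> 'b::euclidean_space"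
  assumes f: "twice_diff S f g H" and T: "linear T" and S: "\<And>z. z \<in> R \<Longrightarrow> c + T z \<in> S"
  shows "twice_diff R (\<lambda>z. f (c + T z)) (\<lambda>z. adjoint T (g (c + T z)))
    (\<lambda>z v. adjoint T (H (c + T z) (T v)))"
proof (rule twice_diffI)
  fix z assume z: "z \<in> R"
  note d = twice_diffD[OF f S[OF z]]
  have T': "((\<lambda>z. c + T z) has_derivative T) (at z)"
    by (auto intro!: derivative_eq_intros linear_imp_has_derivative T)
  show "((\<lambda>z. f (c + T z)) has_derivative (\<lambda>v. adjoint T (g (c + T z)) \<bullet> v)) (at z)"
    using has_derivative_compose[OF T' d(1)] by (simp add: adjoint_clauses[OF T])
  show "((\<lambda>z. adjoint T (g (c + T z))) has_derivative (\<lambda>v. adjoint T (H (c + T z) (T v)))) (at z)"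
    using has_derivative_compose[OF has_derivative_compose[OF T' d(2)]
       linear_imp_has_derivative[OF adjoint_linear[OF T]]] by simp
  fix v w
  show "adjoint T (H (c + T z) (T v)) \<bullet> w = v \<bullet> adjoint T (H (c + T z) (T w))"
    by (simp add: adjoint_clauses[OF T] d(3))
next
  fix v
  have "continuous_on R (\<lambda>z. c + T z)"
    by (intro continuous_intros linear_continuous_on_compose[OF _ T])
  then have "continuous_on R (\<lambda>z. H (c + T z) (T v))"
    using continuous_on_compose2[OF twice_diff_cont(3)[OF f, of "T v"]] S by blast
  then show "continuous_on R (\<lambda>z. adjoint T (H (c + T z) (T v)))"
    by (rule linear_continuous_on_compose[OF _ adjoint_linear[OF T]])
qed

text \<open>
  The Peano form of the remainder needs only differentiability of \<open>g\<close> at \<open>z\<close>: the remainder is Lipschitz on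
  the ball of radius \<open>|h|\<close> with constant \<open>e |h|\<close>.
\<close>

lemma twice_diff_taylor:
  fixes z :: "'a::euclidean_space"
  assumes f: "twice_diff S f g H" and S: "open S" "z \<in> S" and e: "e > 0"
  obtains d where "d > 0"
    "\<And>h. norm h < d \<Longrightarrow> \<bar>f (z + h) - f z - g z \<bullet> h - (H z h \<bullet> h) / 2\<bar> \<le> e * (norm h)\<^sup>2"
proof -
  note d0 = twice_diffD[OF f S(2)]
  obtain d1 where d1: "d1 > 0" "ball z d1 \<subseteq> S"
    using S open_contains_ball by blast
  obtain d2 where d2: "d2 > 0"
    "\<And>y. norm (y - z) < d2 \<Longrightarrow> norm (g y - g z - H z (y - z)) \<le> e * norm (y - z)"
    using d0(2) e unfolding has_derivative_at_alt by blast
  define d where "d = min d1 d2"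
  have dpos: "d > 0" using d1 d2 by (simp add: d_def)
  show thesis
  proof (rule that[OF dpos])
    fix h :: 'a assume h: "norm h < d"
    define R where "R k = f (z + k) - f z - g z \<bullet> k - (H z k \<bullet> k) / 2" for k :: 'a
    have dR: "(R has_derivative (\<lambda>v. (g (z + k) - g z - H z k) \<bullet> v)) (at k within cball 0 (norm h))"
      if k: "k \<in> cball 0 (norm h)" for k :: 'a
    proof -
      have "z + k \<in> ball z d1" using k h by (simp add: dist_norm d_def)
      then have "z + k \<in> S" using d1 by blast
      note dk = twice_diffD(1)[OF f this]
      have 1: "((\<lambda>k. f (z + k)) has_derivative (\<lambda>v. g (z + k) \<bullet> v)) (at k)"
      proof -
        have "((\<lambda>k. z + k) has_derivative (\<lambda>v. v)) (at k)" by (auto intro!: derivative_eq_intros)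
        from has_derivative_compose[OF this dk] show ?thesis .
      qed
      have 2: "(H z has_derivative H z) (at k)"
        by (rule linear_imp_has_derivative[OF d0(4)])
      have "(R has_derivative (\<lambda>v. g (z + k) \<bullet> v - g z \<bullet> v - (H z k \<bullet> v + H z v \<bullet> k) / 2)) (at k)"
        unfolding R_def[abs_def]
        by (auto intro!: derivative_eq_intros 1 2)
      moreover have "H z v \<bullet> k = H z k \<bullet> v" for v
        using d0(3)[of v k] by (simp add: inner_commute)
      ultimately have "(R has_derivative (\<lambda>v. (g (z + k) - g z - H z k) \<bullet> v)) (at k)"
        by (simp add: inner_diff_left algebra_simps)
      then show ?thesis by (rule has_derivative_at_withinI)
    qed
    have "norm (R h - R 0) \<le> (e * norm h) * norm (h - 0)"
    proof (rule differentiable_bound[OF convex_cball dR])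
      fix k :: 'a assume k: "k \<in> cball 0 (norm h)"
      have "norm (g (z + k) - g z - H z k) \<le> e * norm k"
        using d2(2)[of "z + k"] k h by (simp add: d_def)
      also have "\<dots> \<le> e * norm h" using k e by simp
      finally have "norm (g (z + k) - g z - H z k) \<le> e * norm h" .
      then show "onorm (\<lambda>v. (g (z + k) - g z - H z k) \<bullet> v) \<le> e * norm h"
        by (intro onorm_le) (metis Cauchy_Schwarz_ineq2 mult_right_mono norm_ge_zero order_trans real_norm_def)
    qed auto
    then show "\<bar>f (z + h) - f z - g z \<bullet> h - (H z h \<bullet> h) / 2\<bar> \<le> e * (norm h)\<^sup>2"
      using linear_0[OF d0(4)] by (simp add: R_def power2_eq_square mult.assoc)
  qed
qed

text \<open>
  If \<open>f\<close> touches a function \<open>w\<close> from above and the second differences of \<open>w\<close> are at least \<open>-2 L |h|\<^sup>2\<close>, then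
  the second differences of \<open>f\<close> inherit this bound, because the first-order terms cancel in them.
\<close>

lemma hessian_at_local_max:
  assumes f: "twice_diff S f g H" and S: "open S" "z \<in> S"
    and r: "r > 0" and w: "\<And>y. y \<in> ball z r \<Longrightarrow> w y - f y \<le> w z - f z"
    and sc: "\<And>h. norm h < r \<Longrightarrow> w (z + h) + w (z - h) - 2 * w z \<ge> - 2 * L * (norm h)\<^sup>2"
  shows "H z a \<bullet> a \<ge> - 2 * L * (norm a)\<^sup>2"
proof (cases "a = 0")
  case True
  then show ?thesis using linear_0[OF twice_diffD(4)[OF f S(2)]] by simp
next
  case False
  show ?thesis
  proof (rule field_le_epsilon)
    fix e :: real assume e: "e > 0"
    define e' where "e' = e / (2 * (norm a)\<^sup>2)"
    have e': "e' > 0" using e False by (simp add: e'_def)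
    obtain d where d: "d > 0"
      "\<And>h. norm h < d \<Longrightarrow> \<bar>f (z + h) - f z - g z \<bullet> h - (H z h \<bullet> h) / 2\<bar> \<le> e' * (norm h)\<^sup>2"
      using twice_diff_taylor[OF f S e'] by metis
    define t where "t = min d r / (2 * norm a)"
    have t: "t > 0" "norm (t *\<^sub>R a) < d" "norm (t *\<^sub>R a) < r"
      using d r False by (auto simp: t_def min_def field_simps)
    let ?h = "t *\<^sub>R a"
    have lin: "linear (H z)" by (rule twice_diffD(4)[OF f S(2)])
    have 1: "f (z + ?h) + f (z - ?h) - 2 * f z \<le> H z ?h \<bullet> ?h + 2 * e' * (norm ?h)\<^sup>2"
      using d(2)[OF t(2)] d(2)[of "- ?h"] t(2) by (simp add: linear_neg[OF lin] abs_le_iff)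
    have 2: "w (z + ?h) - f (z + ?h) \<le> w z - f z" "w (z - ?h) - f (z - ?h) \<le> w z - f z"
      using w[of "z + ?h"] w[of "z - ?h"] t(3) by (auto simp: dist_norm)
    have "- 2 * L * (norm ?h)\<^sup>2 \<le> H z ?h \<bullet> ?h + 2 * e' * (norm ?h)\<^sup>2"
      using 1 2 sc[OF t(3)] by linarith
    then have "t\<^sup>2 * (- 2 * L * (norm a)\<^sup>2) \<le> t\<^sup>2 * (H z a \<bullet> a + e)"
      using False by (simp add: linear_scale[OF lin] power_mult_distrib power2_eq_square e'_def algebra_simps)
    then show "- 2 * L * (norm a)\<^sup>2 \<le> H z a \<bullet> a + e"
      using t(1) mult_le_cancel_left_pos[of "t\<^sup>2" "- 2 * L * (norm a)\<^sup>2" "H z a \<bullet> a + e"]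
      by simp
  qed
qed

lemma gradient_at_local_max:
  assumes "(f has_derivative (\<lambda>v. g \<bullet> v)) (at z)" "r > 0" "\<And>y. y \<in> ball z r \<Longrightarrow> f y \<le> f z"
  shows "g = 0"
proof -
  have "(\<lambda>v. g \<bullet> v) = (\<lambda>v. 0)"
    using has_derivative_local_max[OF assms(1)] assms(2,3) centre_in_ball eventually_at_ball'
      differential_zero_maxmin[of z "ball z r" f "\<lambda>v. g \<bullet> v"] assms by fastforce
  then have "g \<bullet> g = 0" by metis
  then show ?thesis by simp
qed

section \<open>Harmonic functions with prescribed values on the sphere\<close>

definition has_laplacian :: "('a::euclidean_space \<Rightarrow> real) \<Rightarrow> ('a \<Rightarrow> real) \<Rightarrow> bool" where
  "has_laplacian f L \<longleftrightarrow>
     (\<exists>g H. twice_diff UNIV f g H \<and> (\<forall>x. L x = (\<Sum>b\<in>Basis. H x b \<bullet> b)))"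

lemma has_laplacian_add:
  assumes "has_laplacian f1 L1" "has_laplacian f2 L2"
  shows "has_laplacian (\<lambda>x. f1 x + f2 x) (\<lambda>x. L1 x + L2 x)"
  using assms twice_diff_add unfolding has_laplacian_def
  by (fastforce simp: inner_add_left sum.distrib)

lemma has_laplacian_cmult:
  assumes "has_laplacian f L"
  shows "has_laplacian (\<lambda>x. c * f x) (\<lambda>x. c * L x)"
  using assms twice_diff_cmult unfolding has_laplacian_def
  by (fastforce simp: sum_distrib_left)

lemma has_laplacian_diff:
  assumes "has_laplacian f1 L1" "has_laplacian f2 L2"
  shows "has_laplacian (\<lambda>x. f1 x - f2 x) (\<lambda>x. L1 x - L2 x)"
  using has_laplacian_add[OF assms(1) has_laplacian_cmult[OF assms(2), of "-1"]] by simp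

lemma has_laplacian_norm2:
  "has_laplacian (\<lambda>x::'a::euclidean_space. x \<bullet> x) (\<lambda>_. 2 * DIM('a))"
proof -
  have "(\<Sum>b\<in>(Basis::'a set). (2 *\<^sub>R b) \<bullet> b) = 2 * real DIM('a)"
    by (simp add: inner_Basis)
  then show ?thesis
    unfolding has_laplacian_def
    by (intro exI[of _ "\<lambda>x. 2 *\<^sub>R x"] exI[of _ "\<lambda>_ v. 2 *\<^sub>R v"] conjI allI)
       (rule twice_diff_inner_self, simp)
qed

text \<open>
  Homogeneous polynomials as functions, generated so that Euler's identity and the degree of derivatives
  can be read off by induction. The zero function has every degree.
\<close>

inductive hpoly :: "nat \<Rightarrow> ('a::euclidean_space \<Rightarrow> real) \<Rightarrow> bool" where
  zero: "hpoly j (\<lambda>_. 0)"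
| const: "hpoly 0 (\<lambda>_. c)"
| mult: "b \<in> Basis \<Longrightarrow> hpoly j f \<Longrightarrow> hpoly (Suc j) (\<lambda>x. (b \<bullet> x) * f x)"
| add: "hpoly j f \<Longrightarrow> hpoly j g \<Longrightarrow> hpoly j (\<lambda>x. f x + g x)"

lemma hpoly_cmult: "hpoly j f \<Longrightarrow> hpoly j (\<lambda>x. c * f x)"
proof (induction rule: hpoly.induct)
  case (mult b j f)
  then show ?case using hpoly.mult[of b j "\<lambda>x. c * f x"] by (simp add: mult.left_commute)
next
  case (add j f g)
  then show ?case using hpoly.add by (fastforce simp: distrib_left)
qed (use hpoly.zero hpoly.const in auto)

lemma hpoly_diff: "hpoly j f \<Longrightarrow> hpoly j g \<Longrightarrow> hpoly j (\<lambda>x. f x - g x)"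
  using hpoly.add[of j f "\<lambda>x. -1 * g x"] hpoly_cmult[of j g "-1"] by simp

lemma hpoly_finite_sum: "finite I \<Longrightarrow> (\<And>i. i \<in> I \<Longrightarrow> hpoly j (f i)) \<Longrightarrow> hpoly j (\<lambda>x. \<Sum>i\<in>I. f i x)"
  by (induction I rule: finite_induct) (auto intro: hpoly.zero hpoly.add)

lemma hpoly_mult: "hpoly i f \<Longrightarrow> hpoly j g \<Longrightarrow> hpoly (i + j) (\<lambda>x. f x * g x)"
proof (induction rule: hpoly.induct)
  case (zero i)
  then show ?case using hpoly.zero by simp
next
  case (const c)
  then show ?case using hpoly_cmult by simp
next
  case (mult b i f)
  then show ?case using hpoly.mult[of b "i + j" "\<lambda>x. f x * g x"] by (simp add: mult.assoc)
next
  case (add i f1 f2)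
  then show ?case using hpoly.add[of "i + j" "\<lambda>x. f1 x * g x"] by (simp add: distrib_right)
qed

lemma hpoly_linear: "bounded_linear f \<Longrightarrow> hpoly 1 f"
proof -
  assume "bounded_linear f"
  then have l: "linear f" by (rule bounded_linear.linear)
  have eq: "(\<Sum>b\<in>Basis. (b \<bullet> x) * f b) = f x" for x
  proof -
    have "f x = f (\<Sum>b\<in>Basis. (x \<bullet> b) *\<^sub>R b)" by (simp add: euclidean_representation)
    also have "\<dots> = (\<Sum>b\<in>Basis. (b \<bullet> x) * f b)"
      by (simp add: linear_sum[OF l] linear_scale[OF l] inner_commute)
    finally show ?thesis by (rule sym)
  qed
  have "hpoly 1 (\<lambda>x. \<Sum>b\<in>Basis. (b \<bullet> x) * f b)"
  proof (rule hpoly_finite_sum[OF finite_Basis])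
    fix b :: 'a assume b: "b \<in> Basis"
    show "hpoly 1 (\<lambda>x. (b \<bullet> x) * f b)"
      using hpoly.mult[OF b hpoly.const[of "f b"]] by simp
  qed
  then show ?thesis unfolding eq .
qed

lemma hpoly_norm2: "hpoly 2 (\<lambda>x::'a::euclidean_space. x \<bullet> x)"
proof -
  have eq: "(\<Sum>b\<in>Basis. (b \<bullet> x) * (b \<bullet> x)) = x \<bullet> x" for x :: 'a
    using euclidean_inner[of x x] by (simp only: inner_commute)
  have "hpoly 2 (\<lambda>x::'a. \<Sum>b\<in>Basis. (b \<bullet> x) * (b \<bullet> x))"
  proof (rule hpoly_finite_sum[OF finite_Basis])
    fix b :: 'a
    show "hpoly 2 (\<lambda>x. (b \<bullet> x) * (b \<bullet> x))"
      using hpoly_mult[OF hpoly_linear hpoly_linear, OF bounded_linear_inner_right bounded_linear_inner_right, of b b]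
      by (simp add: numeral_2_eq_2)
  qed
  then show ?thesis unfolding eq .
qed

text \<open>
  The differences \<open>j - 1\<close> and \<open>j - 2\<close> are truncated, so the vanishing of derivatives of order higher than
  the degree is recorded separately.
\<close>

definition hpoly_jet :: "nat \<Rightarrow> ('a::euclidean_space \<Rightarrow> real) \<Rightarrow> ('a \<Rightarrow> 'a) \<Rightarrow> ('a \<Rightarrow> 'a \<Rightarrow> 'a) \<Rightarrow> bool" where
  "hpoly_jet j f g H \<longleftrightarrow> twice_diff UNIV f g H \<and> (\<forall>x. g x \<bullet> x = real j * f x)
    \<and> (\<forall>b\<in>Basis. hpoly (j - 1) (\<lambda>x. g x \<bullet> b))
    \<and> hpoly (j - 2) (\<lambda>x. \<Sum>b\<in>Basis. H x b \<bullet> b)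
    \<and> (j = 0 \<longrightarrow> (\<forall>x. g x = 0)) \<and> (j < 2 \<longrightarrow> (\<forall>x. (\<Sum>b\<in>Basis. H x b \<bullet> b) = 0))"

lemma hpoly_derivatives:
  fixes f :: "'a::euclidean_space \<Rightarrow> real"
  assumes "hpoly j f"
  shows "\<exists>g H. hpoly_jet j f g H"
  using assms
proof (induction rule: hpoly.induct)
  case (zero j)
  have "hpoly_jet j (\<lambda>_. 0) (\<lambda>_. 0::'a) (\<lambda>_ _. 0)"
    by (simp add: hpoly_jet_def twice_diff_const hpoly.zero)
  then show ?case by blast
next
  case (const c)
  have "hpoly_jet 0 (\<lambda>_. c) (\<lambda>_. 0::'a) (\<lambda>_ _. 0)"
    by (simp add: hpoly_jet_def twice_diff_const hpoly.zero)
  then show ?case by blast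
next
  case (add j f1 f2)
  then obtain g1 H1 g2 H2 where d: "hpoly_jet j f1 g1 H1" "hpoly_jet j f2 g2 H2" by blast
  have "hpoly_jet j (\<lambda>x. f1 x + f2 x) (\<lambda>x. g1 x + g2 x) (\<lambda>x v. H1 x v + H2 x v)"
    using d unfolding hpoly_jet_def
    by (simp add: twice_diff_add inner_add_left sum.distrib distrib_left hpoly.add)
  then show ?case by blast
next
  case (mult c j f)
  then obtain g H where jet: "hpoly_jet j f g H" by blast
  have d: "twice_diff UNIV f g H" "\<And>x. g x \<bullet> x = real j * f x"
      "\<And>b. b \<in> Basis \<Longrightarrow> hpoly (j - 1) (\<lambda>x. g x \<bullet> b)"
      "hpoly (j - 2) (\<lambda>x. \<Sum>b\<in>Basis. H x b \<bullet> b)"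
      "\<And>x. j = 0 \<Longrightarrow> g x = 0" "\<And>x. j < 2 \<Longrightarrow> (\<Sum>b\<in>Basis. H x b \<bullet> b) = 0"
    using jet unfolding hpoly_jet_def by auto
  define G where "G x = (c \<bullet> x) *\<^sub>R g x + f x *\<^sub>R c" for x
  define K where "K x v = (c \<bullet> x) *\<^sub>R H x v + f x *\<^sub>R 0 + (c \<bullet> v) *\<^sub>R g x + (g x \<bullet> v) *\<^sub>R c" for x v
  have td: "twice_diff UNIV (\<lambda>x. (c \<bullet> x) * f x) G K"
    unfolding G_def[abs_def] K_def[abs_def] by (rule twice_diff_mult[OF twice_diff_inner d(1)])
  have lap: "(\<Sum>b\<in>Basis. K x b \<bullet> b) = (c \<bullet> x) * (\<Sum>b\<in>Basis. H x b \<bullet> b) + 2 * (g x \<bullet> c)" for x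
  proof -
    have "(\<Sum>b\<in>Basis. (c \<bullet> b) * (g x \<bullet> b)) = g x \<bullet> c"
      using euclidean_inner[of "g x" c] by (simp add: mult.commute)
    moreover have "(\<Sum>b\<in>Basis. K x b \<bullet> b)
      = (\<Sum>b\<in>Basis. (c \<bullet> x) * (H x b \<bullet> b) + 2 * ((c \<bullet> b) * (g x \<bullet> b)))"
      by (rule sum.cong) (simp_all add: K_def inner_add_left)
    ultimately show ?thesis
      by (simp add: sum.distrib flip: sum_distrib_left)
  qed
  have e: "G x \<bullet> x = real (Suc j) * ((c \<bullet> x) * f x)" for x
    by (simp add: G_def inner_add_left d(2) algebra_simps)
  have h1: "hpoly (Suc j - 1) (\<lambda>x. G x \<bullet> b)" if b: "b \<in> Basis" for b
  proof -
    have "hpoly j (\<lambda>x. (c \<bullet> x) * (g x \<bullet> b))"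
    proof (cases j)
      case 0
      then show ?thesis using d(5) hpoly.zero by simp
    next
      case (Suc k)
      then show ?thesis using hpoly.mult[OF mult.hyps(1) d(3)[OF b]] by simp
    qed
    then have "hpoly j (\<lambda>x. (c \<bullet> x) * (g x \<bullet> b) + (c \<bullet> b) * f x)"
      by (intro hpoly.add hpoly_cmult mult.hyps)
    then show ?thesis by (simp add: G_def inner_add_left mult.commute)
  qed
  have h2: "hpoly (Suc j - 2) (\<lambda>x. \<Sum>b\<in>Basis. K x b \<bullet> b)"
  proof -
    have "hpoly (j - 1) (\<lambda>x. (c \<bullet> x) * (\<Sum>b\<in>Basis. H x b \<bullet> b))"
    proof (cases "j < 2")
      case True
      then show ?thesis using d(6) hpoly.zero by simp
    next
      case False
      then have "Suc (j - 2) = j - 1" by simp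
      then show ?thesis using hpoly.mult[OF mult.hyps(1) d(4)] by simp
    qed
    then have "hpoly (j - 1) (\<lambda>x. (c \<bullet> x) * (\<Sum>b\<in>Basis. H x b \<bullet> b) + 2 * (g x \<bullet> c))"
      by (intro hpoly.add hpoly_cmult d(3) mult.hyps)
    then show ?thesis by (simp add: lap)
  qed
  have h3: "(\<Sum>b\<in>Basis. K x b \<bullet> b) = 0" if "Suc j < 2" for x
    using that d(5,6) by (simp add: lap)
  have "hpoly_jet (Suc j) (\<lambda>x. (c \<bullet> x) * f x) G K"
    unfolding hpoly_jet_def using td e h1 h2 h3 by blast
  then show ?case by blast
qed

lemma hpoly_laplacian:
  assumes "hpoly j f"
  obtains L where "has_laplacian f L" "hpoly (j - 2) L" "\<And>x. j < 2 \<Longrightarrow> L x = 0"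
proof -
  obtain g H where "twice_diff UNIV f g H" "hpoly (j - 2) (\<lambda>x. \<Sum>b\<in>Basis. H x b \<bullet> b)"
     "j < 2 \<Longrightarrow> \<forall>x. (\<Sum>b\<in>Basis. H x b \<bullet> b) = 0"
    using hpoly_derivatives[OF assms] unfolding hpoly_jet_def by blast
  then show thesis by (intro that[of "\<lambda>x. \<Sum>b\<in>Basis. H x b \<bullet> b"]) (auto simp: has_laplacian_def)
qed

lemma has_laplacian_unique:
  assumes "has_laplacian f L" "has_laplacian f L'"
  shows "L = L'"
proof -
  obtain g H g' H' where 1: "twice_diff UNIV f g H" "\<And>x. L x = (\<Sum>b\<in>Basis. H x b \<bullet> b)"
    and 2: "twice_diff UNIV f g' H'" "\<And>x. L' x = (\<Sum>b\<in>Basis. H' x b \<bullet> b)"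
    using assms unfolding has_laplacian_def by blast
  have g: "g = g'"
  proof
    fix x
    have "(\<lambda>v. g x \<bullet> v) = (\<lambda>v. g' x \<bullet> v)"
      by (rule has_derivative_unique[OF twice_diffD(1)[OF 1(1)] twice_diffD(1)[OF 2(1)]]) auto
    then have "\<forall>v. g x \<bullet> v = g' x \<bullet> v" by metis
    then show "g x = g' x" by (metis vector_eq_rdot)
  qed
  have "H x = H' x" for x
    by (rule has_derivative_unique[OF twice_diffD(2)[OF 1(1)] twice_diffD(2)[OF 2(1), folded g]]) auto
  then show ?thesis using 1(2) 2(2) by auto
qed

text \<open>
  By Euler's identity \<open>x \<bullet> \<nabla>f = j f\<close>, multiplication by \<open>|x|\<^sup>2\<close> and the Laplacian commute up to the scalar
  \<open>2 N + 4 j\<close>. The recursions below live on its positivity.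
\<close>

lemma laplacian_norm2_mult:
  fixes f :: "'a::euclidean_space \<Rightarrow> real"
  assumes f: "hpoly j f" and L: "has_laplacian f L"
  shows "has_laplacian (\<lambda>x. (x \<bullet> x) * f x)
    (\<lambda>x. (2 * DIM('a) + 4 * real j) * f x + (x \<bullet> x) * L x)"
proof -
  obtain g H where d: "twice_diff UNIV f g H" "\<And>x. g x \<bullet> x = real j * f x"
    using hpoly_derivatives[OF f] unfolding hpoly_jet_def by blast
  have L': "L x = (\<Sum>b\<in>Basis. H x b \<bullet> b)" for x
    using has_laplacian_unique[OF L, of "\<lambda>x. \<Sum>b\<in>Basis. H x b \<bullet> b"] d(1)
    by (auto simp: has_laplacian_def)
  have s: "(\<Sum>b\<in>Basis. (x \<bullet> b) * (g x \<bullet> b)) = real j * f x" for x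
    using d(2)[of x] euclidean_inner[of "g x" x] by (simp add: mult.commute)
  show ?thesis
    unfolding has_laplacian_def
  proof (intro exI conjI allI)
    show "twice_diff UNIV (\<lambda>x. (x \<bullet> x) * f x) (\<lambda>x. (x \<bullet> x) *\<^sub>R g x + f x *\<^sub>R (2 *\<^sub>R x))
      (\<lambda>x v. (x \<bullet> x) *\<^sub>R H x v + f x *\<^sub>R (2 *\<^sub>R v) + ((2 *\<^sub>R x) \<bullet> v) *\<^sub>R g x + (g x \<bullet> v) *\<^sub>R (2 *\<^sub>R x))"
      by (rule twice_diff_mult[OF twice_diff_inner_self d(1)])
    fix x
    have "(\<Sum>b\<in>Basis. ((x \<bullet> x) *\<^sub>R H x b + f x *\<^sub>R (2 *\<^sub>R b) + ((2 *\<^sub>R x) \<bullet> b) *\<^sub>R g x + (g x \<bullet> b) *\<^sub>R (2 *\<^sub>R x)) \<bullet> b)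
      = (\<Sum>b\<in>Basis. (x \<bullet> x) * (H x b \<bullet> b) + 2 * f x + 4 * ((x \<bullet> b) * (g x \<bullet> b)))"
      by (rule sum.cong) (simp_all add: inner_add_left inner_Basis algebra_simps)
    also have "\<dots> = (x \<bullet> x) * L x + 2 * DIM('a) * f x + 4 * (real j * f x)"
      by (simp add: sum.distrib L' s flip: sum_distrib_left)
    finally show "(2 * DIM('a) + 4 * real j) * f x + (x \<bullet> x) * L x
      = (\<Sum>b\<in>Basis. ((x \<bullet> x) *\<^sub>R H x b + f x *\<^sub>R (2 *\<^sub>R b) + ((2 *\<^sub>R x) \<bullet> b) *\<^sub>R g x + (g x \<bullet> b) *\<^sub>R (2 *\<^sub>R x)) \<bullet> b)"
      by (simp add: algebra_simps)
  qed
qed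

text \<open>
  Applying the Laplacian to \<open>c u + |x|\<^sup>2 \<Delta>u = R\<close> gives an equation of the same form for \<open>\<Delta>u\<close>, two degrees
  lower, with right-hand side \<open>\<Delta>R\<close> and a larger constant; once it is solved, the original equation gives
  \<open>u\<close>.
\<close>

lemma hpoly_fischer_solve:
  fixes R :: "'a::euclidean_space \<Rightarrow> real"
  assumes "hpoly k R" "c > 0"
  shows "\<exists>u L. hpoly k u \<and> has_laplacian u L \<and> (\<forall>x. c * u x + (x \<bullet> x) * L x = R x)"
  using assms
proof (induction k arbitrary: R c rule: less_induct)
  case (less k)
  obtain L where L: "has_laplacian R L" "hpoly (k - 2) L" "\<And>x. k < 2 \<Longrightarrow> L x = 0"
    using hpoly_laplacian[OF less.prems(1)] by metis
  show ?case
  proof (cases "k < 2")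
    case True
    show ?thesis
      by (rule exI[of _ "\<lambda>x. (1/c) * R x"], rule exI[of _ "\<lambda>x. (1/c) * L x"])
         (use L True less.prems hpoly_cmult[OF less.prems(1), of "1/c"] has_laplacian_cmult[OF L(1), of "1/c"] in auto)
  next
    case False
    define c' where "c' = c + (2 * DIM('a) + 4 * real (k - 2))"
    have "c' > 0" using less.prems by (simp add: c'_def add_pos_nonneg)
    then obtain B LB where B: "hpoly (k - 2) B" "has_laplacian B LB"
      "\<And>x. c' * B x + (x \<bullet> x) * LB x = L x"
      using less.IH[of "k - 2" L c'] False L(2) by auto
    define u where "u x = (1/c) * (R x - (x \<bullet> x) * B x)" for x
    have k2: "2 + (k - 2) = k" using False by simp
    have hu: "hpoly k u"
      unfolding u_def using hpoly_mult[OF hpoly_norm2 B(1)] k2 less.prems(1)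
      by (intro hpoly_cmult hpoly_diff) auto
    have "has_laplacian u (\<lambda>x. (1/c) * (L x - ((2 * DIM('a) + 4 * real (k - 2)) * B x + (x \<bullet> x) * LB x)))"
      unfolding u_def
      by (intro has_laplacian_cmult has_laplacian_diff L laplacian_norm2_mult B)
    moreover have "(1/c) * (L x - ((2 * DIM('a) + 4 * real (k - 2)) * B x + (x \<bullet> x) * LB x)) = B x" for x
    proof -
      have "L x - ((2 * DIM('a) + 4 * real (k - 2)) * B x + (x \<bullet> x) * LB x) = c * B x"
        using B(3)[of x] by (simp add: c'_def algebra_simps)
      then show ?thesis using less.prems by simp
    qed
    ultimately have "has_laplacian u B" by simp
    moreover have "c * u x + (x \<bullet> x) * B x = R x" for x
      using less.prems by (simp add: u_def)
    ultimately show ?thesis using hu by blast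
  qed
qed

text \<open>
  Subtract \<open>|x|\<^sup>2 u\<close> with \<open>\<Delta>(|x|\<^sup>2 u) = \<Delta>G\<close>, which leaves a harmonic function, and add back a harmonic
  function that agrees with \<open>u\<close>, hence with \<open>|x|\<^sup>2 u\<close>, on the sphere; \<open>u\<close> has lower degree.
\<close>

lemma hpoly_harmonic_on_sphere:
  fixes G :: "'a::euclidean_space \<Rightarrow> real"
  assumes "hpoly j G"
  shows "\<exists>h. has_laplacian h (\<lambda>_. 0) \<and> (\<forall>x. norm x = 1 \<longrightarrow> h x = G x)"
  using assms
proof (induction j arbitrary: G rule: less_induct)
  case (less j)
  obtain L where L: "has_laplacian G L" "hpoly (j - 2) L" "\<And>x. j < 2 \<Longrightarrow> L x = 0"
    using hpoly_laplacian[OF less.prems(1)] by metis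
  show ?case
  proof (cases "j < 2")
    case True
    then have "L = (\<lambda>_. 0)" using L by auto
    then show ?thesis using L by auto
  next
    case False
    define c where "c = 2 * DIM('a) + 4 * real (j - 2)"
    have "c > 0" by (simp add: c_def add_pos_nonneg)
    then obtain u M where u: "hpoly (j - 2) u" "has_laplacian u M"
      "\<And>x. c * u x + (x \<bullet> x) * M x = L x"
      using hpoly_fischer_solve[OF L(2)] by metis
    obtain h where h: "has_laplacian h (\<lambda>_. 0)" "\<And>x. norm x = 1 \<Longrightarrow> h x = u x"
      using less.IH[of "j - 2" u] u(1) False by auto
    have "has_laplacian (\<lambda>x. (x \<bullet> x) * u x) L"
      using laplacian_norm2_mult[OF u(1,2)] u(3) unfolding c_def by simp
    then have "has_laplacian (\<lambda>x. G x - (x \<bullet> x) * u x + h x) (\<lambda>x. L x - L x + 0)"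
      using L h by (intro has_laplacian_add has_laplacian_diff) auto
    then have "has_laplacian (\<lambda>x. G x - (x \<bullet> x) * u x + h x) (\<lambda>x. 0)" by simp
    moreover have "G x - (x \<bullet> x) * u x + h x = G x" if "norm x = 1" for x
      using h(2)[OF that] that by (simp add: dot_square_norm)
    ultimately show ?thesis by blast
  qed
qed

inductive hpoly_sum :: "('a::euclidean_space \<Rightarrow> real) \<Rightarrow> bool" where
  base: "hpoly j f \<Longrightarrow> hpoly_sum f"
| add: "hpoly_sum f \<Longrightarrow> hpoly_sum g \<Longrightarrow> hpoly_sum (\<lambda>x. f x + g x)"

lemma hpoly_sum_mult: "hpoly_sum f \<Longrightarrow> hpoly_sum g \<Longrightarrow> hpoly_sum (\<lambda>x. f x * g x)"
proof (induction arbitrary: g rule: hpoly_sum.induct)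
  case (base j f)
  show ?case
    using base(2,1)
  proof (induction rule: hpoly_sum.induct)
    case (base i g)
    then show ?case by (blast intro: hpoly_sum.base hpoly_mult)
  next
    case (add g1 g2)
    then show ?case using hpoly_sum.add[of "\<lambda>x. f x * g1 x" "\<lambda>x. f x * g2 x"]
      by (simp add: distrib_left)
  qed
next
  case (add f1 f2)
  then show ?case using hpoly_sum.add[of "\<lambda>x. f1 x * g x" "\<lambda>x. f2 x * g x"]
    by (simp add: distrib_right)
qed

lemma polynomial_hpoly_sum: "real_polynomial_function f \<Longrightarrow> hpoly_sum f"
  by (induction rule: real_polynomial_function.induct)
     (blast intro: hpoly_sum.intros hpoly_linear hpoly.const hpoly_sum_mult)+

lemma polynomial_harmonic_on_sphere:
  assumes "hpoly_sum f"
  shows "\<exists>h. has_laplacian h (\<lambda>_. 0) \<and> (\<forall>x. norm x = 1 \<longrightarrow> h x = f x)"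
  using assms
proof (induction rule: hpoly_sum.induct)
  case (base j f)
  then show ?case by (rule hpoly_harmonic_on_sphere)
next
  case (add f g)
  then obtain h k where "has_laplacian h (\<lambda>_. 0)" "\<forall>x. norm x = 1 \<longrightarrow> h x = f x"
    "has_laplacian k (\<lambda>_. 0)" "\<forall>x. norm x = 1 \<longrightarrow> k x = g x" by blast
  then show ?case
    using has_laplacian_add[of h "\<lambda>_. 0" k "\<lambda>_. 0"] by (intro exI[of _ "\<lambda>x. h x + k x"]) auto
qed

text \<open>
  Stone--Weierstrass followed by harmonic replacement; the multiple of \<open>|x|\<^sup>2\<close> that produces the Laplacian
  \<open>c\<close> is constant on the sphere.
\<close>

lemma approx_on_sphere_prescribed_laplacian:
  fixes \<phi> :: "'a::euclidean_space \<Rightarrow> real"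
  assumes "continuous_on (sphere 0 1) \<phi>" "e > 0"
  obtains h g H where "twice_diff UNIV h g H" "\<And>x. (\<Sum>b\<in>Basis. H x b \<bullet> b) = c"
    "\<And>x. norm x = 1 \<Longrightarrow> \<bar>h x - \<phi> x\<bar> < e"
proof -
  define d where "d = c / (2 * DIM('a))"
  have ct: "continuous_on (sphere 0 1) (\<lambda>x. \<phi> x - d * (x \<bullet> x))"
    by (intro continuous_intros assms)
  obtain P where P: "real_polynomial_function P"
    "\<And>x. x \<in> sphere 0 1 \<Longrightarrow> \<bar>(\<phi> x - d * (x \<bullet> x)) - P x\<bar> < e"
    by (rule Stone_Weierstrass_real_polynomial_function[OF compact_sphere ct assms(2)]) blast
  obtain k where k: "has_laplacian k (\<lambda>_. 0)" "\<And>x. norm x = 1 \<Longrightarrow> k x = P x"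
    using polynomial_harmonic_on_sphere[OF polynomial_hpoly_sum[OF P(1)]] by blast
  have "has_laplacian (\<lambda>x. k x + d * (x \<bullet> x)) (\<lambda>x. 0 + d * (2 * DIM('a)))"
    by (intro has_laplacian_add has_laplacian_cmult has_laplacian_norm2 k)
  then obtain g H where gH: "twice_diff UNIV (\<lambda>x. k x + d * (x \<bullet> x)) g H"
      "\<And>x. 0 + d * (2 * DIM('a)) = (\<Sum>b\<in>Basis. H x b \<bullet> b)"
    unfolding has_laplacian_def by blast
  have "(\<Sum>b\<in>Basis. H x b \<bullet> b) = c" for x
    using gH(2)[of x] by (simp add: d_def)
  moreover note gH(1)
  moreover have "\<bar>k x + d * (x \<bullet> x) - \<phi> x\<bar> < e" if "norm x = 1" for x
    using P(2)[of x] k(2)[OF that] that by (simp add: abs_minus_commute algebra_simps)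
  ultimately show thesis using that by blast
qed

section \<open>Test inequalities for the normalized p-Laplacian\<close>

text \<open>
  The right-hand side \<open>F(\<xi>, X)\<close> of the equation with \<open>q = 1/p\<close>, for an operator \<open>X\<close> instead of a matrix.
\<close>

definition pF :: "real \<Rightarrow> 'b::euclidean_space \<Rightarrow> ('b \<Rightarrow> 'b) \<Rightarrow> real" where
  "pF q \<xi> X = q * (\<Sum>b\<in>Basis. X b \<bullet> b) + (1 - 2 * q) * ((X \<xi> \<bullet> \<xi>) / (norm \<xi>)\<^sup>2)"

text \<open>
  The subsolution property, tested locally from above with functions of space-time. The second inequality, through
  the size of the spatial Hessian, holds at all points and stands in for the envelope of \<open>F\<close> at critical
  points. Since \<open>F\<close> is odd, the supersolution property of \<open>u\<close> is the same property of \<open>-u\<close>.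
\<close>

definition ptest ::
    "real \<Rightarrow> ('b::euclidean_space \<times> real) set \<Rightarrow> ('b \<times> real \<Rightarrow> real) \<Rightarrow> bool" where
  "ptest q D w \<longleftrightarrow>
     (\<forall>z\<in>D. \<forall>\<psi> (g::'b\<times>real\<Rightarrow>'b\<times>real) H r. 0 < r \<longrightarrow> twice_diff (ball z r) \<psi> g H \<longrightarrow>
        (\<forall>y\<in>ball z r. w y - \<psi> y \<le> w z - \<psi> z) \<longrightarrow>
        (fst (g z) \<noteq> 0 \<longrightarrow> snd (g z) \<le> pF q (fst (g z)) (\<lambda>a. fst (H z (a, 0)))) \<and>
        (\<forall>M::real. (\<forall>a. \<bar>fst (H z (a, 0)) \<bullet> a\<bar> \<le> M * (norm a)\<^sup>2) \<longrightarrow> snd (g z) \<le> (DIM('b) + 1) * M))"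

lemma ptestD:
  fixes w :: "'b::euclidean_space \<times> real \<Rightarrow> real" and g :: "'b \<times> real \<Rightarrow> 'b \<times> real" and M :: real
  assumes "ptest q D w" "z \<in> D" "0 < r" "twice_diff (ball z r) \<psi> g H"
    and "\<And>y. y \<in> ball z r \<Longrightarrow> w y - \<psi> y \<le> w z - \<psi> z"
  shows "fst (g z) \<noteq> 0 \<Longrightarrow> snd (g z) \<le> pF q (fst (g z)) (\<lambda>a. fst (H z (a, 0)))"
    and "(\<And>a. \<bar>fst (H z (a, 0)) \<bullet> a\<bar> \<le> M * (norm a)\<^sup>2) \<Longrightarrow> snd (g z) \<le> (DIM('b) + 1) * M"
  using assms unfolding ptest_def by blast+

lemma adjoint_id: "adjoint (\<lambda>x::'a::euclidean_space. x) = (\<lambda>x. x)"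
  by (rule adjoint_unique) simp

lemma twice_diff_translate:
  assumes "twice_diff S f g H" "\<And>z. z \<in> R \<Longrightarrow> c + z \<in> S"
  shows "twice_diff R (\<lambda>z. f (c + z)) (\<lambda>z. g (c + z)) (\<lambda>z v. H (c + z) v)"
  using twice_diff_affine[OF assms(1) linear_ident, of R c] assms(2) by (simp add: adjoint_id)

lemma ptest_translate:
  assumes "ptest q D w"
  shows "ptest q {z. c + z \<in> D} (\<lambda>z. w (c + z))"
  unfolding ptest_def
proof (intro ballI allI impI)
  fix z \<psi> H and g :: "'a \<times> real \<Rightarrow> 'a \<times> real" and r :: real
  assume z: "z \<in> {z. c + z \<in> D}" and r: "0 < r" and td: "twice_diff (ball z r) \<psi> g H"
    and m: "\<forall>y\<in>ball z r. w (c + y) - \<psi> y \<le> w (c + z) - \<psi> z"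
  have td': "twice_diff (ball (c + z) r) (\<lambda>y. \<psi> (- c + y)) (\<lambda>y. g (- c + y)) (\<lambda>y v. H (- c + y) v)"
    by (rule twice_diff_translate[OF td]) (simp add: dist_norm algebra_simps)
  have m': "w y - \<psi> (- c + y) \<le> w (c + z) - \<psi> (- c + (c + z))" if "y \<in> ball (c + z) r" for y
    using m[rule_format, of "- c + y"] that by (simp add: dist_norm algebra_simps)
  have "c + z \<in> D" using z by simp
  from ptestD[OF assms this r td' m']
  show "(fst (g z) \<noteq> 0 \<longrightarrow> snd (g z) \<le> pF q (fst (g z)) (\<lambda>a. fst (H z (a, 0)))) \<and>
    (\<forall>M::real. (\<forall>a. \<bar>fst (H z (a, 0)) \<bullet> a\<bar> \<le> M * (norm a)\<^sup>2) \<longrightarrow> snd (g z) \<le> (DIM('a) + 1) * M)"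
    by simp
qed

section \<open>Sup-convolution\<close>

definition semiconvex :: "real \<Rightarrow> ('a::euclidean_space \<Rightarrow> real) \<Rightarrow> bool" where
  "semiconvex L f \<longleftrightarrow> convex_on UNIV (\<lambda>z. f z + L * (z \<bullet> z))"

lemma semiconvex_continuous: "semiconvex L f \<Longrightarrow> continuous_on UNIV f"
proof -
  assume "semiconvex L f"
  then have "continuous_on UNIV (\<lambda>z. (f z + L * (z \<bullet> z)) - L * (z \<bullet> z))"
    unfolding semiconvex_def by (intro continuous_intros convex_on_continuous) auto
  then show ?thesis by simp
qed

lemma semiconvex_second_difference:
  assumes "semiconvex L f"
  shows "f (z + h) + f (z - h) - 2 * f z \<ge> - 2 * L * (norm h)\<^sup>2"
proof -
  have mid: "(1 - 1/2) *\<^sub>R (z + h) + (1/2) *\<^sub>R (z - h) = z"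
    by (simp add: algebra_simps flip: scaleR_add_left)
  have "f z + L * (z \<bullet> z) \<le> (1 - 1/2) * (f (z + h) + L * ((z + h) \<bullet> (z + h)))
      + (1/2) * (f (z - h) + L * ((z - h) \<bullet> (z - h)))"
    using convex_onD[OF assms[unfolded semiconvex_def], of "1/2" "z + h" "z - h"] unfolding mid by simp
  moreover have "(z + h) \<bullet> (z + h) + (z - h) \<bullet> (z - h) = 2 * (z \<bullet> z) + 2 * (norm h)\<^sup>2"
    by (simp add: algebra_simps inner_commute power2_norm_eq_inner)
  then have "L * ((z + h) \<bullet> (z + h) + (z - h) \<bullet> (z - h)) = L * (2 * (z \<bullet> z) + 2 * (norm h)\<^sup>2)"
    by simp
  ultimately show ?thesis by (simp add: distrib_left)
qed

text \<open>
  Regularization that keeps the test inequalities and yields functions with paraboloids below their graph,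
  so that blow-ups at touching points are bounded.
\<close>

definition supconv :: "real \<Rightarrow> 'a::euclidean_space set \<Rightarrow> ('a \<Rightarrow> real) \<Rightarrow> 'a \<Rightarrow> real" where
  "supconv L C w z = (SUP y\<in>C. w y - L * (norm (z - y))\<^sup>2)"

locale sup_convolution =
  fixes L :: real and C :: "'a::euclidean_space set" and w :: "'a \<Rightarrow> real"
  assumes comp: "compact C" and ne: "C \<noteq> {}" and cont: "continuous_on C w"
begin

abbreviation "W \<equiv> supconv L C w"

lemma attained: "\<exists>y\<in>C. W z = w y - L * (norm (z - y))\<^sup>2"
  and upper: "y \<in> C \<Longrightarrow> w y - L * (norm (z - y))\<^sup>2 \<le> W z"
proof -
  let ?k = "\<lambda>y. w y - L * (norm (z - y))\<^sup>2"
  have "continuous_on C ?k" by (intro continuous_intros cont)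
  then obtain y0 where y0: "y0 \<in> C" "\<And>y. y \<in> C \<Longrightarrow> ?k y \<le> ?k y0"
    using continuous_attains_sup[OF comp ne] by blast
  then have "W z = ?k y0" unfolding supconv_def by (intro cSup_eq_maximum) auto
  then show "\<exists>y\<in>C. W z = ?k y" "y \<in> C \<Longrightarrow> ?k y \<le> W z" using y0 by auto
qed

lemma semiconvex: "semiconvex L W"
  unfolding semiconvex_def
proof (rule convex_onI)
  fix t :: real and x y :: 'a assume t: "0 < t" "t < 1"
  let ?z = "(1 - t) *\<^sub>R x + t *\<^sub>R y"
  have aff: "a - L * (norm (u - v))\<^sup>2 + L * (u \<bullet> u) = a - L * (v \<bullet> v) + 2 * L * (u \<bullet> v)" for a and u v :: 'a
    by (simp add: power2_norm_eq_inner inner_diff_left inner_diff_right inner_commute algebra_simps)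
  obtain v where v: "v \<in> C" "W ?z = w v - L * (norm (?z - v))\<^sup>2" using attained by blast
  have "W ?z + L * (?z \<bullet> ?z) = w v - L * (v \<bullet> v) + 2 * L * (?z \<bullet> v)"
    unfolding v(2) by (rule aff)
  also have "\<dots> = (1 - t) * (w v - L * (v \<bullet> v) + 2 * L * (x \<bullet> v)) + t * (w v - L * (v \<bullet> v) + 2 * L * (y \<bullet> v))"
    by (simp add: inner_add_left algebra_simps)
  also have "\<dots> \<le> (1 - t) * (W x + L * (x \<bullet> x)) + t * (W y + L * (y \<bullet> y))"
  proof -
    have "w v - L * (v \<bullet> v) + 2 * L * (x \<bullet> v) \<le> W x + L * (x \<bullet> x)"
      using upper[OF v(1), of x] aff[of "w v" x v] by linarith
    moreover have "w v - L * (v \<bullet> v) + 2 * L * (y \<bullet> v) \<le> W y + L * (y \<bullet> y)"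
      using upper[OF v(1), of y] aff[of "w v" y v] by linarith
    ultimately show ?thesis using t by (intro add_mono[OF mult_left_mono mult_left_mono]) auto
  qed
  finally show "W ?z + L * (?z \<bullet> ?z) \<le> \<dots>" .
qed auto

lemma lower_support:
  "\<exists>p. \<forall>y. W y \<ge> W z + p \<bullet> (y - z) - L * (norm (y - z))\<^sup>2"
proof -
  obtain v where v: "v \<in> C" "W z = w v - L * (norm (z - v))\<^sup>2" using attained by blast
  have "W y \<ge> W z + (- 2 * L) *\<^sub>R (z - v) \<bullet> (y - z) - L * (norm (y - z))\<^sup>2" for y
  proof -
    have "(norm (y - v))\<^sup>2 = (norm (z - v))\<^sup>2 + 2 * ((z - v) \<bullet> (y - z)) + (norm (y - z))\<^sup>2"
      by (simp add: power2_norm_eq_inner inner_diff_left inner_diff_right inner_commute)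
    then have "L * (norm (y - v))\<^sup>2 = L * (norm (z - v))\<^sup>2 + 2 * L * ((z - v) \<bullet> (y - z)) + L * (norm (y - z))\<^sup>2"
      by (simp add: distrib_left)
    moreover have "(- 2 * L) *\<^sub>R (z - v) \<bullet> (y - z) = - (2 * L * ((z - v) \<bullet> (y - z)))" by simp
    ultimately show ?thesis using upper[OF v(1), of y] v(2) by linarith
  qed
  then show ?thesis by blast
qed

end

text \<open>
  A test function touching the sup-convolution at \<open>z\<close> touches \<open>w\<close>, after translation by \<open>z - y\<close>, at any point
  \<open>y\<close> where the supremum is attained; the equation does not depend on the point.
\<close>

lemma ptest_supconv:
  fixes w :: "'b::euclidean_space \<times> real \<Rightarrow> real"
  assumes "sup_convolution C w" and pt: "ptest q D w"
    and O: "\<And>z y. z \<in> O' \<Longrightarrow> y \<in> C \<Longrightarrow> supconv L C w z = w y - L * (norm (z - y))\<^sup>2 \<Longrightarrow> y \<in> D \<and> y \<in> interior C"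
  shows "ptest q O' (supconv L C w)"
  unfolding ptest_def
proof (intro ballI allI impI)
  interpret sup_convolution L C w by fact
  fix z \<psi> H and g :: "'b \<times> real \<Rightarrow> 'b \<times> real" and r :: real
  assume z: "z \<in> O'" and r: "0 < r" and td: "twice_diff (ball z r) \<psi> g H"
    and m: "\<forall>y\<in>ball z r. W y - \<psi> y \<le> W z - \<psi> z"
  obtain v where v: "v \<in> C" "W z = w v - L * (norm (z - v))\<^sup>2" using attained by blast
  have vD: "v \<in> D" "v \<in> interior C" using O[OF z v] by auto
  then obtain r' where r': "r' > 0" "ball v r' \<subseteq> C" by (meson mem_interior)
  define s where "s = min r r'"
  have s: "s > 0" using r r' by (simp add: s_def)
  have td': "twice_diff (ball v s) (\<lambda>y. \<psi> ((z - v) + y)) (\<lambda>y. g ((z - v) + y)) (\<lambda>y u. H ((z - v) + y) u)"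
    by (rule twice_diff_translate[OF td]) (simp add: dist_norm algebra_simps s_def)
  have m': "w y - \<psi> ((z - v) + y) \<le> w v - \<psi> ((z - v) + v)" if "y \<in> ball v s" for y
  proof -
    have "(z - v) + y \<in> ball z r" "y \<in> C"
      using that r'(2) by (auto simp: dist_norm algebra_simps s_def)
    then have "W ((z - v) + y) - \<psi> ((z - v) + y) \<le> W z - \<psi> z"
      "w y - L * (norm ((z - v) + y - y))\<^sup>2 \<le> W ((z - v) + y)"
      using m upper by blast+
    then show ?thesis using v(2) by simp
  qed
  from ptestD[OF pt vD(1) s td' m']
  show "(fst (g z) \<noteq> 0 \<longrightarrow> snd (g z) \<le> pF q (fst (g z)) (\<lambda>a. fst (H z (a, 0)))) \<and>
    (\<forall>M::real. (\<forall>a. \<bar>fst (H z (a, 0)) \<bullet> a\<bar> \<le> M * (norm a)\<^sup>2) \<longrightarrow> snd (g z) \<le> (DIM('b) + 1) * M)"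
    by simp
qed

section \<open>Blow-up at a touching point\<close>

text \<open>
  Prolong the segment from \<open>x\<close> to \<open>y\<close> by a unit length beyond \<open>y\<close>, which stays in the ball of radius \<open>2\<close>,
  and use convexity on the prolonged segment.
\<close>

lemma convex_bounded_lipschitz:
  fixes k :: "'a::euclidean_space \<Rightarrow> real"
  assumes c: "convex_on UNIV k" and K: "\<And>x. norm x \<le> 2 \<Longrightarrow> \<bar>k x\<bar> \<le> K"
    and xy: "norm x \<le> 1" "norm y \<le> 1"
  shows "\<bar>k x - k y\<bar> \<le> 2 * K * norm (x - y)"
proof -
  have *: "k y - k x \<le> 2 * K * norm (x - y)" if xy: "norm x \<le> 1" "norm y \<le> 1" for x y
  proof (cases "x = y")
    case False
    define d where "d = norm (x - y)"
    have d: "d > 0" using False by (simp add: d_def)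
    define t where "t = d / (1 + d)"
    have t: "0 \<le> t" "t \<le> 1" "t \<le> d" using d by (auto simp: t_def field_simps)
    define u where "u = y + (1/d) *\<^sub>R (y - x)"
    have "norm u \<le> norm y + norm ((1/d) *\<^sub>R (y - x))" unfolding u_def by (rule norm_triangle_ineq)
    also have "norm ((1/d) *\<^sub>R (y - x)) = 1" using d by (simp add: d_def norm_minus_commute)
    finally have u: "norm u \<le> 2" using xy by simp
    have dne: "d \<noteq> 0" "1 + d \<noteq> 0" using d by auto
    have "t + t / d = t * ((1 + d) / d)" using dne(1) by (simp add: field_simps)
    also have "\<dots> = 1" using dne by (simp add: t_def)
    finally have c1: "t + t / d = 1" .
    then have c2: "(1 - t) - t / d = 0" by simp
    have "(1 - t) *\<^sub>R x + t *\<^sub>R u = ((1 - t) - t / d) *\<^sub>R x + (t + t / d) *\<^sub>R y"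
      by (simp add: u_def algebra_simps)
    also have "\<dots> = y" unfolding c1 c2 by simp
    finally have "k y \<le> (1 - t) * k x + t * k u"
      using convex_onD[OF c t(1,2), of x u] by simp
    then have "k y - k x \<le> t * (k u - k x)" by (simp add: algebra_simps)
    also have "\<dots> \<le> t * (2 * K)"
      using K[OF u] K[of x] xy t by (intro mult_left_mono) auto
    also have "\<dots> \<le> d * (2 * K)" using t K[of 0] by (intro mult_right_mono) auto
    finally show ?thesis by (simp add: d_def mult.commute)
  qed auto
  show ?thesis using *[OF xy] *[OF xy(2,1)] by (simp add: norm_minus_commute)
qed

text \<open>
  The second-order rescaling of \<open>f\<close> at \<open>z\<close> with slope \<open>p\<close>, in the linear coordinates \<open>T\<close>.
\<close>

definition blowup where
  "blowup f z p T r \<omega> = (f (z + r *\<^sub>R T \<omega>) - f z - r * (p \<bullet> T \<omega>)) / r\<^sup>2" for r :: real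

text \<open>
  The two paraboloids bound the rescalings on the ball of radius \<open>2\<close>, and adding \<open>L |T x|\<^sup>2\<close> makes them
  convex; bounded convex functions are equi-Lipschitz on a smaller ball.
\<close>

lemma blowup_lipschitz:
  fixes f :: "'a::euclidean_space \<Rightarrow> real" and T :: "'a \<Rightarrow> 'a"
  assumes L: "L \<ge> 0" and sc: "semiconvex L f" and T: "linear T"
    and low: "\<And>y. f y \<ge> f z + p \<bullet> (y - z) - L * (norm (y - z))\<^sup>2"
    and r1: "r1 > 0" and K0: "K0 \<ge> 0" and up: "\<And>y. norm (y - z) < r1 \<Longrightarrow> f y \<le> f z + p \<bullet> (y - z) + K0 * (norm (y - z))\<^sup>2"
  obtains r2 K M where "r2 > 0"
    "\<And>r \<omega>. 0 < r \<Longrightarrow> r < r2 \<Longrightarrow> norm \<omega> \<le> 1 \<Longrightarrow> \<bar>blowup f z p T r \<omega>\<bar> \<le> K"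
    "\<And>r \<omega> \<omega>'. 0 < r \<Longrightarrow> r < r2 \<Longrightarrow> norm \<omega> \<le> 1 \<Longrightarrow> norm \<omega>' \<le> 1 \<Longrightarrow>
       \<bar>blowup f z p T r \<omega> - blowup f z p T r \<omega>'\<bar> \<le> M * norm (\<omega> - \<omega>')"
proof -
  obtain B where B: "B > 0" "\<And>x. norm (T x) \<le> B * norm x"
    using linear_bounded_pos[OF T] by blast
  have TB: "norm (T x) \<le> 2 * B" if "norm x \<le> 2" for x
  proof -
    have "B * norm x \<le> B * 2" using that B(1) by (intro mult_left_mono) auto
    then show ?thesis using B(2)[of x] by linarith
  qed
  define r2 where "r2 = r1 / (2 * B)"
  have r2: "r2 > 0" using r1 B by (simp add: r2_def)
  define K where "K = (L + K0) * (2 * B)\<^sup>2"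
  have Kb: "\<bar>blowup f z p T r \<omega>\<bar> \<le> K" if r: "0 < r" "r < r2" and w: "norm \<omega> \<le> 2" for r \<omega>
  proof -
    have n: "norm (T \<omega>) \<le> 2 * B" by (rule TB[OF w])
    have "r * norm (T \<omega>) < r1"
    proof -
      have "r * norm (T \<omega>) \<le> r * (2 * B)" using n r by (intro mult_left_mono) auto
      also have "\<dots> < r2 * (2 * B)" using r B by (intro mult_strict_right_mono) auto
      finally show ?thesis using B by (simp add: r2_def)
    qed
    then have 1: "f (z + r *\<^sub>R T \<omega>) \<le> f z + r * (p \<bullet> T \<omega>) + K0 * (r * norm (T \<omega>))\<^sup>2"
      using up[of "z + r *\<^sub>R T \<omega>"] r by simp
    have 2: "f (z + r *\<^sub>R T \<omega>) \<ge> f z + r * (p \<bullet> T \<omega>) - L * (r * norm (T \<omega>))\<^sup>2"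
      using low[of "z + r *\<^sub>R T \<omega>"] r by simp
    have n2: "(norm (T \<omega>))\<^sup>2 \<le> (2 * B)\<^sup>2" using n by (intro power_mono) auto
    have 3: "blowup f z p T r \<omega> \<le> K0 * (norm (T \<omega>))\<^sup>2" "blowup f z p T r \<omega> \<ge> - L * (norm (T \<omega>))\<^sup>2"
      using 1 2 r unfolding blowup_def by (simp_all add: field_simps power_mult_distrib)
    have "K0 * (norm (T \<omega>))\<^sup>2 \<le> K0 * (2 * B)\<^sup>2" "L * (norm (T \<omega>))\<^sup>2 \<le> L * (2 * B)\<^sup>2"
      using n2 K0 L by (auto intro!: mult_left_mono)
    moreover have "0 \<le> K0 * (2 * B)\<^sup>2" "0 \<le> L * (2 * B)\<^sup>2" using K0 L by auto
    ultimately show ?thesis using 3 unfolding K_def by (simp add: distrib_right)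
  qed
  define M where "M = 2 * (K + L * (2 * B)\<^sup>2) + 2 * L * B\<^sup>2"
  have lip: "\<bar>blowup f z p T r \<omega> - blowup f z p T r \<omega>'\<bar> \<le> M * norm (\<omega> - \<omega>')"
    if r: "0 < r" "r < r2" and w: "norm \<omega> \<le> 1" "norm \<omega>' \<le> 1" for r \<omega> \<omega>'
  proof -
    define c where "c y = f y + L * (y \<bullet> y)" for y
    define k where "k x = blowup f z p T r x + L * (norm (T x))\<^sup>2" for x
    have kc: "k x = (c (z + r *\<^sub>R T x) - c z - r * ((p + (2 * L) *\<^sub>R z) \<bullet> T x)) / r\<^sup>2" for x
      using r unfolding k_def c_def blowup_def
      by (simp add: field_simps power2_norm_eq_inner inner_add_left inner_add_right inner_commute power2_eq_square)
         (simp add: dot_square_norm power2_eq_square)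
    have conv: "convex_on UNIV k"
    proof (rule convex_onI)
      fix t :: real and x y :: 'a assume t: "0 < t" "t < 1"
      have e: "z + r *\<^sub>R T ((1 - t) *\<^sub>R x + t *\<^sub>R y) = (1 - t) *\<^sub>R (z + r *\<^sub>R T x) + t *\<^sub>R (z + r *\<^sub>R T y)"
        unfolding linear_add[OF T] linear_scale[OF T] by (simp add: algebra_simps)
      have "c (z + r *\<^sub>R T ((1 - t) *\<^sub>R x + t *\<^sub>R y)) \<le> (1 - t) * c (z + r *\<^sub>R T x) + t * c (z + r *\<^sub>R T y)"
        unfolding e using convex_onD[OF sc[unfolded semiconvex_def], of t] t by (simp add: c_def)
      from this have "c (z + r *\<^sub>R T ((1 - t) *\<^sub>R x + t *\<^sub>R y)) - c z - r * ((p + (2 * L) *\<^sub>R z) \<bullet> T ((1 - t) *\<^sub>R x + t *\<^sub>R y))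
        \<le> (1 - t) * (c (z + r *\<^sub>R T x) - c z - r * ((p + (2 * L) *\<^sub>R z) \<bullet> T x))
         + t * (c (z + r *\<^sub>R T y) - c z - r * ((p + (2 * L) *\<^sub>R z) \<bullet> T y))"
      proof -
        have "P \<bullet> T ((1 - t) *\<^sub>R x + t *\<^sub>R y) = (1 - t) * (P \<bullet> T x) + t * (P \<bullet> T y)" for P
          unfolding linear_add[OF T] linear_scale[OF T] by (simp add: inner_add_right)
        then show ?thesis
          using \<open>c (z + r *\<^sub>R T ((1 - t) *\<^sub>R x + t *\<^sub>R y)) \<le> _\<close> by (simp only:) argo
      qed
      then have "k ((1 - t) *\<^sub>R x + t *\<^sub>R y) \<le> ((1 - t) * (c (z + r *\<^sub>R T x) - c z - r * ((p + (2 * L) *\<^sub>R z) \<bullet> T x))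
         + t * (c (z + r *\<^sub>R T y) - c z - r * ((p + (2 * L) *\<^sub>R z) \<bullet> T y))) / r\<^sup>2"
        unfolding kc by (rule divide_right_mono) simp
      then show "k ((1 - t) *\<^sub>R x + t *\<^sub>R y) \<le> (1 - t) * k x + t * k y"
        unfolding kc by (simp add: add_divide_distrib)
    qed auto
    have T2: "L * (norm (T x))\<^sup>2 \<le> L * (2 * B)\<^sup>2" if "norm x \<le> 2" for x
    proof -
      from TB[OF that] show ?thesis using L by (intro mult_left_mono power_mono) auto
    qed
    have kb: "\<bar>k x\<bar> \<le> K + L * (2 * B)\<^sup>2" if "norm x \<le> 2" for x
    proof -
      have "0 \<le> L * (norm (T x))\<^sup>2" using L by simp
      then show ?thesis using Kb[OF r that] T2[OF that] unfolding k_def by linarith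
    qed
    have 1: "\<bar>k \<omega> - k \<omega>'\<bar> \<le> 2 * (K + L * (2 * B)\<^sup>2) * norm (\<omega> - \<omega>')"
      by (rule convex_bounded_lipschitz[OF conv kb w])
    have 2: "\<bar>(norm (T \<omega>))\<^sup>2 - (norm (T \<omega>'))\<^sup>2\<bar> \<le> 2 * B\<^sup>2 * norm (\<omega> - \<omega>')"
    proof -
      have "(norm (T \<omega>))\<^sup>2 - (norm (T \<omega>'))\<^sup>2 = T (\<omega> - \<omega>') \<bullet> T (\<omega> + \<omega>')"
        by (simp add: power2_norm_eq_inner linear_add[OF T] linear_diff[OF T] inner_add_right inner_diff_left inner_diff_right inner_commute)
      also have "\<bar>\<dots>\<bar> \<le> norm (T (\<omega> - \<omega>')) * norm (T (\<omega> + \<omega>'))" by (rule Cauchy_Schwarz_ineq2)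
      also have "\<dots> \<le> (B * norm (\<omega> - \<omega>')) * (B * 2)"
      proof (rule mult_mono)
        have "norm (\<omega> + \<omega>') \<le> 2" using w norm_triangle_ineq[of \<omega> \<omega>'] by simp
        then show "norm (T (\<omega> + \<omega>')) \<le> B * 2" using TB by (simp add: mult.commute)
      qed (use B in auto)
      finally show ?thesis by (simp add: power2_eq_square algebra_simps)
    qed
    have "\<bar>L * (norm (T \<omega>))\<^sup>2 - L * (norm (T \<omega>'))\<^sup>2\<bar> \<le> L * (2 * B\<^sup>2 * norm (\<omega> - \<omega>'))"
      using mult_left_mono[OF 2 L] L by (simp add: abs_mult flip: right_diff_distrib)
    then show ?thesis using 1 unfolding M_def k_def by (simp add: algebra_simps)
  qed
  show thesis by (rule that[OF r2 Kb lip]) auto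
qed

lemma sum_Basis_prod:
  fixes F :: "'a::euclidean_space \<times> 'b::euclidean_space \<Rightarrow> real"
  shows "sum F Basis = (\<Sum>b\<in>Basis. F (b, 0)) + (\<Sum>b\<in>Basis. F (0, b))"
proof -
  have "inj_on (\<lambda>u. (u::'a, 0::'b)) Basis" "inj_on (\<lambda>u. (0::'a, u::'b)) Basis"
    by (auto intro!: inj_onI)
  moreover have "(\<lambda>u. (u::'a, 0::'b)) ` Basis \<inter> (\<lambda>u. (0::'a, u::'b)) ` Basis = {}" by auto
  ultimately show ?thesis
    unfolding Basis_prod_def by (subst sum.union_disjoint) (auto simp: sum.reindex)
qed

lemma twice_diff_quadratic:
  assumes A: "linear A" "\<And>v w. A v \<bullet> w = v \<bullet> A w"
  shows "twice_diff S (\<lambda>x. (A x \<bullet> x) / 2) A (\<lambda>_. A)"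
proof (rule twice_diffI)
  fix z
  have d: "(A has_derivative A) (at z)" by (rule linear_imp_has_derivative[OF A(1)])
  show "((\<lambda>x. (A x \<bullet> x) / 2) has_derivative (\<lambda>v. A z \<bullet> v)) (at z)"
  proof -
    have "((\<lambda>x. (1/2) * (A x \<bullet> x)) has_derivative (\<lambda>v. (1/2) * (A z \<bullet> v + A v \<bullet> z))) (at z)"
      by (rule has_derivative_mult_right[OF has_derivative_inner[OF d has_derivative_ident]])
    moreover have "A v \<bullet> z = A z \<bullet> v" for v using A(2)[of v z] by (simp add: inner_commute)
    ultimately show ?thesis by simp
  qed
  show "(A has_derivative A) (at z)" by (rule d)
qed (use A in auto)

text \<open>
  Arzela--Ascoli. The semiconvex \<open>f\<close> may fail to be twice differentiable at \<open>z\<close>, so the limit \<open>\<phi>\<close> need not be a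
  quadratic form and depends on the sequence of radii.
\<close>

lemma blowup_subseq:
  fixes f :: "'a::euclidean_space \<Rightarrow> real" and T :: "'a \<Rightarrow> 'a"
  assumes "L \<ge> 0" "semiconvex L f" "linear T"
    and "\<And>y. f y \<ge> f z + p \<bullet> (y - z) - L * (norm (y - z))\<^sup>2"
    and "r1 > 0" "K0 \<ge> 0" "\<And>y. norm (y - z) < r1 \<Longrightarrow> f y \<le> f z + p \<bullet> (y - z) + K0 * (norm (y - z))\<^sup>2"
  obtains \<phi> where "continuous_on (cball 0 1) \<phi>"
    "\<And>e r0. 0 < e \<Longrightarrow> 0 < r0 \<Longrightarrow> \<exists>r. 0 < r \<and> r < r0 \<and>
       (\<forall>\<omega>. norm \<omega> \<le> 1 \<longrightarrow> \<bar>blowup f z p T r \<omega> - \<phi> \<omega>\<bar> < e)"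
proof -
  obtain r2 K M where r2: "r2 > 0"
    and K: "\<And>r \<omega>. 0 < r \<Longrightarrow> r < r2 \<Longrightarrow> norm \<omega> \<le> 1 \<Longrightarrow> \<bar>blowup f z p T r \<omega>\<bar> \<le> K"
    and M: "\<And>r \<omega> \<omega>'. 0 < r \<Longrightarrow> r < r2 \<Longrightarrow> norm \<omega> \<le> 1 \<Longrightarrow> norm \<omega>' \<le> 1 \<Longrightarrow>
       \<bar>blowup f z p T r \<omega> - blowup f z p T r \<omega>'\<bar> \<le> M * norm (\<omega> - \<omega>')"
    using blowup_lipschitz[OF assms] by blast
  define r where "r n = r2 / (real n + 2)" for n
  have r: "0 < r n" "r n < r2" for n
  proof -
    show "0 < r n" using r2 by (simp add: r_def)
    have "r2 * 1 < r2 * (real n + 2)" using r2 by (intro mult_strict_left_mono) auto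
    then show "r n < r2" by (simp add: r_def divide_less_eq)
  qed
  have M0: "M * norm v \<le> (\<bar>M\<bar> + 1) * norm v" for v :: 'a
    by (intro mult_right_mono) auto
  obtain \<phi> k where \<phi>: "continuous_on (cball 0 1) \<phi>" "strict_mono (k::nat\<Rightarrow>nat)"
    "\<And>e. 0 < e \<Longrightarrow> \<exists>N. \<forall>n x. n \<ge> N \<and> x \<in> cball 0 1 \<longrightarrow> norm (blowup f z p T (r (k n)) x - \<phi> x) < e"
  proof (rule Arzela_Ascoli[of "cball 0 1" "\<lambda>n. blowup f z p T (r n)" K])
    fix n and x :: 'a assume "x \<in> cball 0 1"
    then show "norm (blowup f z p T (r n) x) \<le> K" using K[OF r] by simp
  next
    fix x :: 'a and e :: real assume x: "x \<in> cball 0 1" and e: "0 < e"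
    show "\<exists>d. 0 < d \<and> (\<forall>n y. y \<in> cball 0 1 \<and> norm (x - y) < d \<longrightarrow>
           norm (blowup f z p T (r n) x - blowup f z p T (r n) y) < e)"
    proof (intro exI conjI allI impI)
      show "0 < e / (\<bar>M\<bar> + 1)" using e by simp
      fix n y assume y: "y \<in> cball 0 1 \<and> norm (x - y) < e / (\<bar>M\<bar> + 1)"
      have "\<bar>blowup f z p T (r n) x - blowup f z p T (r n) y\<bar> \<le> M * norm (x - y)"
        using M[OF r] x y by simp
      also have "\<dots> \<le> (\<bar>M\<bar> + 1) * norm (x - y)" by (rule M0)
      also have "\<dots> < (\<bar>M\<bar> + 1) * (e / (\<bar>M\<bar> + 1))" using y by (intro mult_strict_left_mono) auto
      finally show "norm (blowup f z p T (r n) x - blowup f z p T (r n) y) < e" by simp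
    qed
  qed auto
  show thesis
  proof (rule that[OF \<phi>(1)])
    fix e r0 :: real assume e: "0 < e" and r0: "0 < r0"
    obtain N where N: "\<And>n x. n \<ge> N \<Longrightarrow> x \<in> cball 0 1 \<Longrightarrow> norm (blowup f z p T (r (k n)) x - \<phi> x) < e"
      using \<phi>(3)[OF e] by blast
    obtain m :: nat where m: "r2 / r0 < real m" using reals_Archimedean2 by blast
    define n where "n = max N m"
    have "m \<le> k n" using seq_suble[OF \<phi>(2), of n] by (simp add: n_def)
    then have "real m \<le> real (k n) + 2" by simp
    then have "r2 / r0 < real (k n) + 2" using m by linarith
    then have "r (k n) < r0" using r0 by (simp add: r_def divide_less_eq pos_divide_less_eq mult.commute)
    moreover have "0 < r (k n)" by (rule r)
    moreover have "\<bar>blowup f z p T (r (k n)) \<omega> - \<phi> \<omega>\<bar> < e" if "norm \<omega> \<le> 1" for \<omega>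
      using N[of n \<omega>] that by (simp add: n_def)
    ultimately show "\<exists>r. 0 < r \<and> r < r0 \<and> (\<forall>\<omega>. norm \<omega> \<le> 1 \<longrightarrow> \<bar>blowup f z p T r \<omega> - \<phi> \<omega>\<bar> < e)"
      by blast
  qed
qed

text \<open>
  \<open>S S\<^sup>T\<close> is the coefficient matrix of \<open>F\<close> at the gradient \<open>\<xi>\<close> plus \<open>\<kappa>\<^sup>2\<close> times the identity, expressed by its
  pairing with all \<open>X\<close>. The term with \<open>\<kappa>\<close> makes \<open>S\<close> invertible; \<open>\<kappa>\<close> tends to \<open>0\<close> in the end.
\<close>

definition trace_root :: "real \<Rightarrow> real \<Rightarrow> 'b::euclidean_space \<Rightarrow> ('b \<Rightarrow> 'b) \<Rightarrow> bool" where
  "trace_root q \<kappa> \<xi> S \<longleftrightarrow> linear S \<and> inj S \<and>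
     (\<forall>X. linear X \<longrightarrow> (\<Sum>b\<in>Basis. X (S b) \<bullet> S b) = pF q \<xi> X + \<kappa>\<^sup>2 * (\<Sum>b\<in>Basis. X b \<bullet> b))"

text \<open>
  A maximum principle for blow-ups. In the coordinates \<open>T\<close> the operator at slope \<open>p\<close> becomes the Laplacian of
  space-time, up to a full trace with weight \<open>\<kappa>\<^sup>2\<close> that semiconvexity bounds from below. If the
  rescaled \<open>f\<close> lay below \<open>h + \<eta>\<close> on the sphere and above it at the centre, their difference would have an
  interior maximum; scaled back, \<open>h\<close> would be an admissible test function there and the assumption on
  \<open>c\<close> would violate the test inequality. The radius has to be small because the gradient of the scaled test
  function differs from \<open>fst p\<close> by a term of order \<open>r\<close>.
\<close>

lemma blowup_below_harmonic:
  fixes f :: "'b::euclidean_space \<times> real \<Rightarrow> real" and S :: "'b \<Rightarrow> 'b"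
  assumes pt: "ptest q O1 f" and O1: "open O1" "z \<in> O1"
    and sc: "semiconvex L f" and \<kappa>: "\<kappa> > 0"
    and S: "trace_root q \<kappa> (fst p) S" and p: "fst p \<noteq> 0"
    and T: "T = (\<lambda>w. (S (fst w), \<kappa> * snd w))"
    and h: "twice_diff UNIV h g H" "\<And>x. (\<Sum>b\<in>Basis. H x b \<bullet> b) = c"
    and c: "c < snd p - 2 * L * \<kappa>\<^sup>2 * DIM('b \<times> real)"
  obtains r0 where "r0 > 0" "\<And>r \<eta>. 0 < r \<Longrightarrow> r < r0 \<Longrightarrow>
     (\<And>\<omega>. norm \<omega> = 1 \<Longrightarrow> blowup f z p T r \<omega> \<le> h \<omega> + \<eta>) \<Longrightarrow> 0 \<le> h 0 + \<eta>"
proof -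
  have lS: "linear S" and iS: "inj S" using S by (auto simp: trace_root_def)
  have lT: "linear T" unfolding T
    by (rule linearI) (auto simp: linear_add[OF lS] linear_scale[OF lS] algebra_simps)
  have iT: "inj T" using iS \<kappa> unfolding T inj_def by (auto simp: prod_eq_iff)
  obtain R where R: "linear R" "\<And>x. R (T x) = x" "\<And>x. T (R x) = x"
    using linear_injective_isomorphism[OF lT iT] by auto
  define A where "A = adjoint R"
  have lA: "linear A" unfolding A_def by (rule adjoint_linear[OF R(1)])
  define u where "u x = fst (A (g x))" for x
  define w where "w x = snd (A (g x))" for x
  define X where "X x a = fst (A (H x (R (a, 0))))" for x a
  have lH: "linear (H x)" for x using twice_diffD(4)[OF h(1)] by simp
  have lX: "linear (X x)" for x
  proof -
    have *: "X x = fst \<circ> A \<circ> H x \<circ> R \<circ> (\<lambda>a. (a, 0))" by (auto simp: X_def)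
    have "linear (\<lambda>a::'b. (a, 0::real))" by (rule linearI) auto
    moreover have "linear (fst :: 'b \<times> real \<Rightarrow> 'b)" by (rule linear_fst)
    ultimately show ?thesis unfolding * by (intro linear_compose lH lA R(1))
  qed
  have cu: "continuous_on UNIV u" "continuous_on UNIV w"
    unfolding u_def w_def
    by (intro continuous_intros linear_continuous_on_compose[OF twice_diff_cont(2)[OF h(1)] lA])+
  have cX: "continuous_on UNIV (\<lambda>x. X x a)" for a
    unfolding X_def
    by (intro continuous_intros linear_continuous_on_compose[OF twice_diff_cont(3)[OF h(1)] lA])
  have Xexp: "X x v = (\<Sum>b\<in>Basis. (v \<bullet> b) *\<^sub>R X x b)" for x v
  proof -
    have "X x v = X x (\<Sum>b\<in>Basis. (v \<bullet> b) *\<^sub>R b)" by (simp add: euclidean_representation)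
    also have "\<dots> = (\<Sum>b\<in>Basis. (v \<bullet> b) *\<^sub>R X x b)"
      by (simp add: linear_sum[OF lX] linear_scale[OF lX])
    finally show ?thesis .
  qed
  define \<epsilon> where "\<epsilon> = snd p - 2 * L * \<kappa>\<^sup>2 * DIM('b \<times> real) - c"
  have \<epsilon>: "\<epsilon> > 0" using c by (simp add: \<epsilon>_def)
  \<comment> \<open>At \<open>r = 0\<close> the quantity below has its limiting value, and \<open>\<epsilon>\<close> is the margin left by the assumption on \<open>c\<close>; compactness of the unit ball makes \<open>r3\<close> uniform.\<close>
  obtain r3 where r3: "r3 > 0" "\<And>r x. 0 < r \<Longrightarrow> r < r3 \<Longrightarrow> norm x \<le> 1 \<Longrightarrow>
     fst p + r *\<^sub>R u x \<noteq> 0 \<and> pF q (fst p + r *\<^sub>R u x) (X x) - r * w x < pF q (fst p) (X x) + \<epsilon>"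
  proof -
    have "bounded (u ` cball 0 1)"
      by (intro compact_imp_bounded compact_continuous_image continuous_on_subset[OF cu(1)]) auto
    then obtain U where U: "U > 0" "\<And>x. norm x \<le> 1 \<Longrightarrow> norm (u x) \<le> U"
      unfolding bounded_pos by auto
    define r4 where "r4 = norm (fst p) / (2 * U)"
    have r4: "r4 > 0" using U p by (simp add: r4_def)
    have nz: "fst p + r *\<^sub>R u x \<noteq> 0" if "0 \<le> r" "r \<le> r4" "norm x \<le> 1" for r x
    proof
      assume "fst p + r *\<^sub>R u x = 0"
      then have "fst p = - (r *\<^sub>R u x)" by (simp add: eq_neg_iff_add_eq_0)
      then have "norm (fst p) = r * norm (u x)" using that by simp
      also have "\<dots> \<le> r4 * U" using that U r4 by (intro mult_mono) auto
      also have "\<dots> = norm (fst p) / 2" using U by (simp add: r4_def)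
      finally show False using p by simp
    qed
    define J where "J y = pF q (fst p + fst y *\<^sub>R u (snd y)) (X (snd y)) - fst y * w (snd y)" for y :: "real \<times> _"
    define D where "D = {0..r4} \<times> cball (0::'b \<times> real) 1"
    have c1: "continuous_on D (\<lambda>y. u (snd y))" "continuous_on D (\<lambda>y. w (snd y))"
      "continuous_on D (\<lambda>y. X (snd y) a)" for a
      by (auto intro!: continuous_on_compose2[OF cu(1)] continuous_on_compose2[OF cu(2)]
         continuous_on_compose2[OF cX] continuous_intros)
    have "continuous_on D J"
      unfolding J_def pF_def
      by (subst (2) Xexp, intro continuous_intros c1)
         (auto simp: D_def nz)
    moreover have "compact D" unfolding D_def by (intro compact_Times) auto
    ultimately have "uniformly_continuous_on D J" by (rule compact_uniformly_continuous)
    then obtain d where d: "d > 0" "\<And>y y'. y \<in> D \<Longrightarrow> y' \<in> D \<Longrightarrow> dist y' y < d \<Longrightarrow> dist (J y') (J y) < \<epsilon>"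
      using \<epsilon> unfolding uniformly_continuous_on_def by meson
    show thesis
    proof (rule that[of "min d r4"])
      show "min d r4 > 0" using d r4 by simp
      fix r x assume r: "0 < r" "r < min d r4" and x: "norm (x::'b \<times> real) \<le> 1"
      have "dist (J (r, x)) (J (0, x)) < \<epsilon>"
        by (rule d(2)) (use r x r4 in \<open>auto simp: D_def dist_Pair_Pair\<close>)
      then have "J (r, x) < J (0, x) + \<epsilon>" by (simp add: dist_real_def abs_less_iff)
      then show "fst p + r *\<^sub>R u x \<noteq> 0 \<and> pF q (fst p + r *\<^sub>R u x) (X x) - r * w x < pF q (fst p) (X x) + \<epsilon>"
        using nz[of r x] r x by (simp add: J_def)
    qed
  qed
  obtain B where B: "B > 0" "\<And>x. norm (T x) \<le> B * norm x"
    using linear_bounded_pos[OF lT] by blast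
  obtain d1 where d1: "d1 > 0" "ball z d1 \<subseteq> O1" using O1 open_contains_ball by blast
  define r0 where "r0 = min r3 (d1 / B)"
  show thesis
  proof (rule that[of r0])
    show "r0 > 0" using r3 d1 B by (simp add: r0_def)
    fix r \<eta> assume r: "0 < r" "r < r0"
      and bd: "\<And>\<omega>. norm \<omega> = 1 \<Longrightarrow> blowup f z p T r \<omega> \<le> h \<omega> + \<eta>"
    show "0 \<le> h 0 + \<eta>"
    proof (rule ccontr)
      assume neg: "\<not> 0 \<le> h 0 + \<eta>"
      define F where "F \<omega> = blowup f z p T r \<omega>" for \<omega>
      have F0: "F 0 = 0" by (simp add: F_def blowup_def linear_0[OF lT])
      have cf: "continuous_on UNIV f" by (rule semiconvex_continuous[OF sc])
      have cT: "continuous_on A' T" for A' by (intro linear_continuous_on linear_conv_bounded_linear[THEN iffD1] lT)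
      have cFh: "continuous_on (cball 0 1) (\<lambda>\<omega>. F \<omega> - h \<omega>)"
        unfolding F_def blowup_def using r
        by (intro continuous_intros continuous_on_compose2[OF cf] cT continuous_on_subset[OF twice_diff_cont(1)[OF h(1)]]) auto
      obtain o' where o': "o' \<in> cball 0 1" "\<And>\<omega>. \<omega> \<in> cball 0 1 \<Longrightarrow> F \<omega> - h \<omega> \<le> F o' - h o'"
        using continuous_attains_sup[OF compact_cball _ cFh] by auto
      have "F o' - h o' > \<eta>" using o'(2)[of 0] F0 neg by simp
      then have "norm o' \<noteq> 1" using bd[of o'] by (auto simp: F_def)
      then have no: "norm o' < 1" using o'(1) by simp
      define R' where "R' x = (1/r) *\<^sub>R R x" for x
      have lR': "linear R'" unfolding R'_def
        by (rule linearI) (auto simp: linear_add[OF R(1)] linear_scale[OF R(1)] algebra_simps)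
      have adjR': "adjoint R' = (\<lambda>x. (1/r) *\<^sub>R A x)"
      proof (rule adjoint_unique)
        show "\<forall>x y. R' x \<bullet> y = x \<bullet> (1/r) *\<^sub>R A y"
          unfolding A_def R'_def by (simp add: adjoint_clauses[OF R(1)])
      qed
      define y0 where "y0 = z + r *\<^sub>R T o'"
      define k where "k = - R' z"
      have ky0: "k + R' y0 = o'"
        using r by (simp add: k_def y0_def linear_add[OF lR'] linear_scale[OF lR'])
                   (simp add: R'_def R)
      \<comment> \<open>This is \<open>h\<close> scaled back to the scale of \<open>f\<close>, plus the affine part removed in the blow-up.\<close>
      define \<psi> where "\<psi> y = (f z - p \<bullet> z) + p \<bullet> y + r\<^sup>2 * h (k + R' y)" for y
      define G where "G y = 0 + p + r\<^sup>2 *\<^sub>R adjoint R' (g (k + R' y))" for y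
      define Y where "Y y v = 0 + 0 + r\<^sup>2 *\<^sub>R adjoint R' (H (k + R' y) (R' v))" for y v
      have td: "twice_diff UNIV \<psi> G Y"
        unfolding \<psi>_def G_def Y_def
        by (intro twice_diff_add twice_diff_const twice_diff_inner twice_diff_cmult twice_diff_affine[OF h(1) lR']) auto
      have G0: "G y0 = p + r *\<^sub>R A (g o')"
        using r by (simp add: G_def ky0 adjR' power2_eq_square)
      have Y0: "Y y0 v = A (H o' (R v))" for v
        using r unfolding Y_def ky0 adjR'
        by (simp add: R'_def linear_scale[OF lH] linear_scale[OF lA] power2_eq_square)
      define \<rho> where "\<rho> = min (r * (1 - norm o') ) 1 / (onorm R + 1)"
      have bR: "bounded_linear R" by (simp add: R(1) linear_conv_bounded_linear[symmetric])
      have oR: "onorm R \<ge> 0" by (rule onorm_pos_le[OF bR])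
      have \<rho>: "\<rho> > 0" using r no oR by (simp add: \<rho>_def)
      have loc: "f y - \<psi> y \<le> f y0 - \<psi> y0" if y: "y \<in> ball y0 \<rho>" for y
      proof -
        define \<omega> where "\<omega> = k + R' y"
        have yw: "y = z + r *\<^sub>R T \<omega>"
        proof -
          have "T \<omega> = (1/r) *\<^sub>R (y - z)"
            unfolding \<omega>_def k_def R'_def
            by (simp add: linear_add[OF lT] linear_diff[OF lT] linear_scale[OF lT] linear_neg[OF lT] R algebra_simps)
          then show ?thesis using r by simp
        qed
        have "norm (\<omega> - o') = norm (R (y - y0)) / r"
          unfolding \<omega>_def ky0[symmetric] using r by (simp add: R'_def linear_diff[OF R(1)] flip: scaleR_diff_right)
        also have "norm (R (y - y0)) \<le> onorm R * norm (y - y0)" by (rule onorm[OF bR])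
        also have "onorm R * norm (y - y0) \<le> onorm R * \<rho>"
          using y oR by (intro mult_left_mono) (auto simp: dist_norm norm_minus_commute)
        also have "onorm R * \<rho> \<le> (onorm R + 1) * \<rho>" using \<rho> by (intro mult_right_mono) auto
        also have "\<dots> = min (r * (1 - norm o')) 1" using oR by (simp add: \<rho>_def)
        finally have "norm (\<omega> - o') \<le> min (r * (1 - norm o')) 1 / r" using r by (simp add: divide_right_mono)
        also have "\<dots> \<le> 1 - norm o'" using r by (simp add: divide_le_eq mult.commute min_def)
        finally have "norm \<omega> \<le> 1" using norm_triangle_ineq[of "\<omega> - o'" o'] by simp
        then have "F \<omega> - h \<omega> \<le> F o' - h o'" using o'(2) by simp
        then have le: "r\<^sup>2 * F \<omega> - r\<^sup>2 * h \<omega> \<le> r\<^sup>2 * F o' - r\<^sup>2 * h o'"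
          using mult_left_mono[of "F \<omega> - h \<omega>" "F o' - h o'" "r\<^sup>2"] by (simp add: right_diff_distrib)
        have key: "f (z + r *\<^sub>R T v) = f z + r * (p \<bullet> T v) + r\<^sup>2 * F v" for v
          using r by (simp add: F_def blowup_def)
        show ?thesis
          using le key[of \<omega>] key[of o'] unfolding \<psi>_def ky0 \<omega>_def[symmetric]
          unfolding yw y0_def by (simp add: inner_add_right)
      qed
      have y0O: "y0 \<in> O1"
      proof -
        have "r * norm (T o') \<le> r * (B * norm o')" using B(2)[of o'] r by (intro mult_left_mono) auto
        also have "\<dots> \<le> r * (B * 1)" using no B r by (intro mult_left_mono) auto
        also have "\<dots> < d1" using r B by (simp add: r0_def pos_less_divide_eq)
        finally have "y0 \<in> ball z d1" using r by (simp add: y0_def dist_norm)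
        then show ?thesis using d1 by blast
      qed
      have tdb: "twice_diff (ball y0 \<rho>) \<psi> G Y" by (rule twice_diff_subset[OF td]) simp
      have Xeq: "(\<lambda>a. fst (Y y0 (a, 0))) = X o'" by (auto simp: X_def Y0)
      have fG: "fst (G y0) = fst p + r *\<^sub>R u o'" "snd (G y0) = snd p + r * w o'"
        by (simp_all add: G0 u_def w_def)
      have rr: "r < r3" using r by (simp add: r0_def)
      have r3': "fst p + r *\<^sub>R u o' \<noteq> 0" "pF q (fst p + r *\<^sub>R u o') (X o') - r * w o' < pF q (fst p) (X o') + \<epsilon>"
        using r3(2)[OF r(1) rr, of o'] no by auto
      have "snd p + r * w o' \<le> pF q (fst p + r *\<^sub>R u o') (X o')"
        using ptestD(1)[OF pt y0O \<rho> tdb loc] r3'(1) unfolding fG Xeq by blast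
      then have up: "snd p < pF q (fst p) (X o') + \<epsilon>" using r3'(2) by linarith
      have hess: "Y y0 a \<bullet> a \<ge> - 2 * L * (norm a)\<^sup>2" for a
        by (rule hessian_at_local_max[OF tdb open_ball _ \<rho> loc])
           (use \<rho> semiconvex_second_difference[OF sc] in auto)
      have "c = (\<Sum>b\<in>Basis. H o' b \<bullet> b)" by (simp add: h(2))
      also have "\<dots> = (\<Sum>b\<in>Basis. Y y0 (T b) \<bullet> T b)"
      proof (rule sum.cong)
        fix b :: "'b \<times> real"
        have "Y y0 (T b) \<bullet> T b = H o' b \<bullet> R (T b)"
          unfolding Y0 A_def by (simp add: adjoint_clauses[OF R(1)] R)
        then show "H o' b \<bullet> b = Y y0 (T b) \<bullet> T b" by (simp add: R)
      qed simp
      also have "\<dots> = (\<Sum>b\<in>Basis. X o' (S b) \<bullet> S b) + \<kappa>\<^sup>2 * (Y y0 (0, 1) \<bullet> (0, 1))"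
      proof -
        have lY: "linear (Y y0)" using twice_diffD(4)[OF td] by simp
        have "Y y0 (0, \<kappa>) = \<kappa> *\<^sub>R Y y0 (0, 1)"
          using linear_scale[OF lY, of \<kappa> "(0, 1)"] by simp
        then have "Y y0 (0, \<kappa>) \<bullet> (0, \<kappa>) = \<kappa>\<^sup>2 * (Y y0 (0, 1) \<bullet> (0, 1))"
          by (simp add: inner_Pair_0 power2_eq_square)
        then show ?thesis
          by (simp add: sum_Basis_prod T linear_0[OF lS] X_def Y0 inner_Pair_0)
      qed
      also have "(\<Sum>b\<in>Basis. X o' (S b) \<bullet> S b) = pF q (fst p) (X o') + \<kappa>\<^sup>2 * (\<Sum>b\<in>Basis. X o' b \<bullet> b)"
        using S lX unfolding trace_root_def by blast
      also have "pF q (fst p) (X o') + \<kappa>\<^sup>2 * (\<Sum>b\<in>Basis. X o' b \<bullet> b) + \<kappa>\<^sup>2 * (Y y0 (0, 1) \<bullet> (0, 1))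
         = pF q (fst p) (X o') + \<kappa>\<^sup>2 * (\<Sum>b\<in>Basis. Y y0 b \<bullet> b)"
        by (simp add: sum_Basis_prod X_def Y0 inner_Pair_0 distrib_left)
      also have "\<dots> \<ge> pF q (fst p) (X o') + \<kappa>\<^sup>2 * (\<Sum>b\<in>(Basis::('b \<times> real) set). - 2 * L)"
      proof -
        have "- 2 * L \<le> Y y0 b \<bullet> b" if "b \<in> Basis" for b using hess[of b] that by simp
        then show ?thesis by (intro add_left_mono mult_left_mono sum_mono) auto
      qed
      finally have "pF q (fst p) (X o') \<le> c + 2 * L * \<kappa>\<^sup>2 * DIM('b \<times> real)"
        by (simp add: algebra_simps)
      then show False using up unfolding \<epsilon>_def by linarith
    qed
  qed
qed

section \<open>A coupled second-order inequality\<close>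

text \<open>
  The crude test inequality along an affine embedding of space-time into the space of the variables of \<open>\<Phi>\<close>. The
  correction by \<open>\<beta>\<close> and \<open>L\<close> is the contribution of the other summand, whose graph has a paraboloid
  below it.
\<close>

lemma ptest_crude_embedded:
  fixes f :: "'b::euclidean_space \<times> real \<Rightarrow> real" and E :: "'b \<times> real \<Rightarrow> 'c::euclidean_space"
    and M :: real
  assumes pt: "ptest q O1 f" and z0: "z0 \<in> O1"
    and td: "twice_diff O' \<Phi> G H" and O': "open O'" "c + E z0 \<in> O'" and E: "linear E"
    and le: "\<And>z. c + E z \<in> O' \<Longrightarrow> f z \<le> \<Phi> (c + E z) - \<beta> * (snd z - snd z0) + L * (snd z - snd z0)\<^sup>2 + k"
    and eq: "f z0 = \<Phi> (c + E z0) + k"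
    and M: "\<And>a. \<bar>H (c + E z0) (E (a, 0)) \<bullet> E (a, 0)\<bar> \<le> M * (norm a)\<^sup>2"
  shows "G (c + E z0) \<bullet> E (0, 1) - \<beta> \<le> (DIM('b) + 1) * M"
proof -
  have cE: "continuous_on UNIV (\<lambda>z. c + E z)"
    by (intro continuous_intros linear_continuous_on linear_conv_bounded_linear[THEN iffD1] E)
  have "open ((\<lambda>z. c + E z) -` O')" using cE O' by (simp add: open_vimage)
  then obtain r where r: "r > 0" "ball z0 r \<subseteq> (\<lambda>z. c + E z) -` O'"
    using O'(2) by (metis open_contains_ball vimageI2 vimage_eq)
  let ?e = "(0, 1) :: 'b \<times> real"
  define m where "m z = - snd z0 + ?e \<bullet> z" for z
  define \<psi> where "\<psi> z = \<Phi> (c + E z) + (- \<beta> * m z + L * (m z * m z))" for z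
  define G' where "G' z = adjoint E (G (c + E z)) + (- \<beta> *\<^sub>R (0 + ?e) + L *\<^sub>R (m z *\<^sub>R (0 + ?e) + m z *\<^sub>R (0 + ?e)))" for z
  define H' where "H' z v = adjoint E (H (c + E z) (E v)) + (- \<beta> *\<^sub>R (0 + 0) + L *\<^sub>R (m z *\<^sub>R (0 + 0) + m z *\<^sub>R (0 + 0)
     + ((0 + ?e) \<bullet> v) *\<^sub>R (0 + ?e) + ((0 + ?e) \<bullet> v) *\<^sub>R (0 + ?e)))" for z v
  have td': "twice_diff (ball z0 r) \<psi> G' H'"
    unfolding \<psi>_def G'_def H'_def m_def
    by (intro twice_diff_add twice_diff_affine[OF td E] twice_diff_cmult twice_diff_mult twice_diff_const twice_diff_inner)
       (use r in auto)
  have m0: "m z0 = 0" "m z = snd z - snd z0" for z by (auto simp: m_def inner_Pair_0 inner_prod_def)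
  have loc: "f y - \<psi> y \<le> f z0 - \<psi> z0" if "y \<in> ball z0 r" for y
    using le[of y] that r eq by (auto simp: \<psi>_def m0 power2_eq_square)
  have "\<bar>fst (H' z0 (a, 0)) \<bullet> a\<bar> \<le> M * (norm a)\<^sup>2" for a
  proof -
    have "fst (H' z0 (a, 0)) \<bullet> a = adjoint E (H (c + E z0) (E (a, 0))) \<bullet> (a, 0)"
      by (simp add: H'_def m0 inner_prod_def)
    also have "\<dots> = H (c + E z0) (E (a, 0)) \<bullet> E (a, 0)" by (simp add: adjoint_clauses[OF E])
    finally show ?thesis using M by simp
  qed
  from ptestD(2)[OF pt z0 r(1) td' loc this]
  have "snd (G' z0) \<le> (DIM('b) + 1) * M" .
  moreover have "snd (G' z0) = adjoint E (G (c + E z0)) \<bullet> (0, 1) - \<beta>"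
    by (simp add: G'_def m0 inner_prod_def)
  ultimately show ?thesis by (simp add: adjoint_clauses[OF E])
qed

text \<open>
  Two semiconvex subsolutions with a common time variable whose sum is touched from above by a smooth
  function. The paraboloids below the graphs are stated at the touching point only; they provide the first-order
  parts of \<open>f\<close> and \<open>g\<close>, which need not be differentiable elsewhere.
\<close>

locale touching_pair =
  fixes q L :: real and f g :: "'b::euclidean_space \<times> real \<Rightarrow> real"
    and \<Phi> :: "'b \<times> 'b \<times> real \<Rightarrow> real" and G H O1 O2 O3 x0 y0 t0
  assumes L: "L \<ge> 0"
    and scf: "semiconvex L f" and scg: "semiconvex L g"
    and ptf: "ptest q O1 f" and O1: "open O1" "(x0, t0) \<in> O1"
    and ptg: "ptest q O2 g" and O2: "open O2" "(y0, t0) \<in> O2"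
    and lof: "\<exists>p. \<forall>y. f y \<ge> f (x0, t0) + p \<bullet> (y - (x0, t0)) - L * (norm (y - (x0, t0)))\<^sup>2"
    and log: "\<exists>p. \<forall>y. g y \<ge> g (y0, t0) + p \<bullet> (y - (y0, t0)) - L * (norm (y - (y0, t0)))\<^sup>2"
    and td: "twice_diff O3 \<Phi> G H" and O3: "open O3" "(x0, y0, t0) \<in> O3"
    and le: "\<And>x y t. (x, y, t) \<in> O3 \<Longrightarrow> f (x, t) + g (y, t) \<le> \<Phi> (x, y, t)"
    and eq: "f (x0, t0) + g (y0, t0) = \<Phi> (x0, y0, t0)"
begin

definition "z0 = (x0, y0, t0)"
definition "pf = (SOME p. \<forall>y. f y \<ge> f (x0, t0) + p \<bullet> (y - (x0, t0)) - L * (norm (y - (x0, t0)))\<^sup>2)"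
definition "pg = (SOME p. \<forall>y. g y \<ge> g (y0, t0) + p \<bullet> (y - (y0, t0)) - L * (norm (y - (y0, t0)))\<^sup>2)"

lemma pf: "f y \<ge> f (x0, t0) + pf \<bullet> (y - (x0, t0)) - L * (norm (y - (x0, t0)))\<^sup>2"
  using someI_ex[OF lof] unfolding pf_def by blast

lemma pg: "g y \<ge> g (y0, t0) + pg \<bullet> (y - (y0, t0)) - L * (norm (y - (y0, t0)))\<^sup>2"
  using someI_ex[OF log] unfolding pg_def by blast

text \<open>
  Both summands are replaced by their paraboloids from below; the difference with \<open>\<Phi>\<close> is then smooth and has
  a local maximum at the touching point.
\<close>

lemma first_order: "G z0 \<bullet> (u, v, s) = pf \<bullet> (u, s) + pg \<bullet> (v, s)"
proof -
  define P1 where "P1 = (\<lambda>(x::'b, y::'b, t::real). (x, t))"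
  define P2 where "P2 = (\<lambda>(x::'b, y::'b, t::real). (y, t))"
  have l: "linear P1" "linear P2" unfolding P1_def P2_def by (auto intro!: linearI)
  define b where "b p w = p \<bullet> w - L * (w \<bullet> w)" for p w :: "'b \<times> real"
  have tb: "twice_diff UNIV (b p) (\<lambda>w. p - L *\<^sub>R (2 *\<^sub>R w)) (\<lambda>_ v. 0 - L *\<^sub>R (2 *\<^sub>R v))" for p
    unfolding b_def by (intro twice_diff_diff twice_diff_inner twice_diff_cmult twice_diff_inner_self)
  define R where "R z = b pf (- (x0, t0) + P1 z) + b pg (- (y0, t0) + P2 z) - \<Phi> z" for z
  define c1 where "c1 = - (x0, t0)"
  define c2 where "c2 = - (y0, t0)"
  obtain G' H' where td': "twice_diff O3 R G' H'"
    and G': "G' z = adjoint P1 (pf - L *\<^sub>R (2 *\<^sub>R (c1 + P1 z))) + adjoint P2 (pg - L *\<^sub>R (2 *\<^sub>R (c2 + P2 z))) - G z" for z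
    using twice_diff_diff[OF twice_diff_add[OF twice_diff_affine[OF tb l(1)] twice_diff_affine[OF tb l(2)]] td]
    unfolding R_def c1_def c2_def by blast
  obtain r where r: "r > 0" "ball z0 r \<subseteq> O3"
    using O3 open_contains_ball unfolding z0_def by blast
  have loc: "R y \<le> R z0" if y: "y \<in> ball z0 r" for y
  proof -
    obtain x v t where yy: "y = (x, v, t)" by (cases y) auto
    have "f (x, t) + g (v, t) \<le> \<Phi> (x, v, t)" using le y r yy by blast
    then have "b pf ((x, t) - (x0, t0)) + b pg ((v, t) - (y0, t0)) + f (x0, t0) + g (y0, t0) \<le> \<Phi> (x, v, t)"
      using pf[of "(x, t)"] pg[of "(v, t)"] unfolding b_def by (simp add: power2_norm_eq_inner)
    then show ?thesis using eq yy
      by (simp add: R_def z0_def P1_def P2_def b_def zero_prod_def[symmetric])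
  qed
  have "G' z0 = 0"
    by (rule gradient_at_local_max[OF twice_diffD(1)[OF td'] r(1) loc]) (use O3 in \<open>auto simp: z0_def\<close>)
  then have "0 = G' z0 \<bullet> (u, v, s)" by simp
  also have "\<dots> = pf \<bullet> (u, s) + pg \<bullet> (v, s) - G z0 \<bullet> (u, v, s)"
    by (simp add: G' c1_def c2_def z0_def P1_def[symmetric] inner_diff_left inner_add_left adjoint_clauses[OF l(1)] adjoint_clauses[OF l(2)])
       (simp add: P1_def P2_def zero_prod_def[symmetric])
  finally show ?thesis by simp
qed

lemma gradient_parts:
  "fst pf = fst (G z0)" "fst pg = fst (snd (G z0))" "snd pf + snd pg = snd (snd (G z0))"
proof -
  have "fst pf \<bullet> u = fst (G z0) \<bullet> u" for u using first_order[of u 0 0] by (simp add: inner_prod_def)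
  then show "fst pf = fst (G z0)" by (metis vector_eq_rdot)
  have "fst pg \<bullet> u = fst (snd (G z0)) \<bullet> u" for u using first_order[of 0 u 0] by (simp add: inner_prod_def)
  then show "fst pg = fst (snd (G z0))" by (metis vector_eq_rdot)
  show "snd pf + snd pg = snd (snd (G z0))" using first_order[of 0 0 1] by (simp add: inner_prod_def)
qed

text \<open>
  Freezing one space variable turns \<open>\<Phi>\<close> into a test function for the other summand. This is the inequality
  to use when a spatial gradient may vanish.
\<close>

lemma crude_bound:
  fixes M1 M2 :: real
  assumes M1: "\<And>a. \<bar>H z0 (a, 0, 0) \<bullet> (a, 0, 0)\<bar> \<le> M1 * (norm a)\<^sup>2"
    and M2: "\<And>a. \<bar>H z0 (0, a, 0) \<bullet> (0, a, 0)\<bar> \<le> M2 * (norm a)\<^sup>2"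
  shows "snd (snd (G z0)) \<le> (DIM('b) + 1) * (M1 + M2)"
proof -
  define E1 where "E1 = (\<lambda>(x::'b, t::real). (x, 0::'b, t))"
  define E2 where "E2 = (\<lambda>(y::'b, t::real). (0::'b, y, t))"
  have l: "linear E1" "linear E2" unfolding E1_def E2_def by (auto intro!: linearI)
  have e: "(0, y0, 0) + E1 (x0, t0) = z0" "(x0, 0, 0) + E2 (y0, t0) = z0"
    by (auto simp: E1_def E2_def z0_def)
  have n: "(norm (0::'b, s::real))\<^sup>2 = s\<^sup>2" for s by (simp add: norm_Pair)
  have "G z0 \<bullet> E1 (0, 1) - snd pg \<le> (DIM('b) + 1) * M1"
    unfolding e(1)[symmetric]
  proof (rule ptest_crude_embedded[OF ptf O1(2) td O3(1) _ l(1), where L = L and k = "- g (y0, t0)"])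
    fix z :: "'b \<times> real" assume z: "(0, y0, 0) + E1 z \<in> O3"
    obtain x t where zz: "z = (x, t)" by (cases z)
    have "f (x, t) + g (y0, t) \<le> \<Phi> (x, y0, t)" using le z by (simp add: zz E1_def)
    moreover have "g (y0, t) \<ge> g (y0, t0) + snd pg * (t - t0) - L * (t - t0)\<^sup>2"
      using pg[of "(y0, t)"] by (simp add: n inner_prod_def)
    ultimately show "f z \<le> \<Phi> ((0, y0, 0) + E1 z) - snd pg * (snd z - snd (x0, t0)) + L * (snd z - snd (x0, t0))\<^sup>2 + - g (y0, t0)"
      by (simp add: zz E1_def)
  qed (use O3 eq M1 in \<open>auto simp: e z0_def[symmetric] E1_def\<close>)
  moreover have "G z0 \<bullet> E2 (0, 1) - snd pf \<le> (DIM('b) + 1) * M2"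
    unfolding e(2)[symmetric]
  proof (rule ptest_crude_embedded[OF ptg O2(2) td O3(1) _ l(2), where L = L and k = "- f (x0, t0)"])
    fix z :: "'b \<times> real" assume z: "(x0, 0, 0) + E2 z \<in> O3"
    obtain y t where zz: "z = (y, t)" by (cases z)
    have "f (x0, t) + g (y, t) \<le> \<Phi> (x0, y, t)" using le z by (simp add: zz E2_def)
    moreover have "f (x0, t) \<ge> f (x0, t0) + snd pf * (t - t0) - L * (t - t0)\<^sup>2"
      using pf[of "(x0, t)"] by (simp add: n inner_prod_def)
    ultimately show "g z \<le> \<Phi> ((x0, 0, 0) + E2 z) - snd pf * (snd z - snd (y0, t0)) + L * (snd z - snd (y0, t0))\<^sup>2 + - f (x0, t0)"
      by (simp add: zz E2_def)
  qed (use O3 eq M2 in \<open>auto simp: e z0_def[symmetric] E2_def\<close>)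
  moreover have "G z0 \<bullet> E1 (0, 1) = snd (snd (G z0))" "G z0 \<bullet> E2 (0, 1) = snd (snd (G z0))"
    by (auto simp: E1_def E2_def inner_prod_def)
  ultimately show ?thesis using gradient_parts(3) by (simp add: distrib_left)
qed

lemma hessian_bounded: obtains B where "B \<ge> 0" "\<And>v. H z0 v \<bullet> v \<le> B * (norm v)\<^sup>2"
proof -
  have "linear (H z0)" using twice_diffD(4)[OF td] O3 by (simp add: z0_def)
  then obtain B where B: "B > 0" "\<And>v. norm (H z0 v) \<le> B * norm v" using linear_bounded_pos by blast
  have "H z0 v \<bullet> v \<le> B * (norm v)\<^sup>2" for v
  proof -
    have "H z0 v \<bullet> v \<le> norm (H z0 v) * norm v" by (rule norm_cauchy_schwarz)
    also have "\<dots> \<le> B * norm v * norm v" using B(2) by (intro mult_right_mono) auto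
    finally show ?thesis by (simp add: power2_eq_square mult.assoc)
  qed
  then show thesis using that B by (meson less_imp_le)
qed

text \<open>
  Freezing the variable of \<open>g\<close> in \<open>f + g \<le> \<Phi>\<close>, with \<open>g\<close> bounded below by its paraboloid, bounds \<open>f\<close> from
  above to second order.
\<close>

lemma upper_quadratic:
  obtains r K where "r > 0" "K \<ge> 0"
    "\<And>z. norm (z - (x0, t0)) < r \<Longrightarrow> f z \<le> f (x0, t0) + pf \<bullet> (z - (x0, t0)) + K * (norm (z - (x0, t0)))\<^sup>2"
proof -
  obtain B where B: "B \<ge> 0" "\<And>v. H z0 v \<bullet> v \<le> B * (norm v)\<^sup>2" using hessian_bounded by blast
  have z3: "z0 \<in> O3" using O3 by (simp add: z0_def)
  obtain d where d: "d > 0"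
    "\<And>h. norm h < d \<Longrightarrow> \<bar>\<Phi> (z0 + h) - \<Phi> z0 - G z0 \<bullet> h - (H z0 h \<bullet> h) / 2\<bar> \<le> 1 * (norm h)\<^sup>2"
    using twice_diff_taylor[OF td O3(1) z3, of 1] by auto
  obtain r where r: "r > 0" "ball z0 r \<subseteq> O3" using z3 O3 open_contains_ball by blast
  show thesis
  proof (rule that[of "min r d" "B + 1 + L"])
    fix z assume z: "norm (z - (x0, t0)) < min r d"
    obtain x t where zz: "z = (x, t)" by (cases z)
    define h where "h = (x - x0, 0::'b, t - t0)"
    have nh: "norm h = norm (z - (x0, t0))" by (simp add: h_def zz norm_Pair)
    have zh: "z0 + h = (x, y0, t)" by (simp add: z0_def h_def)
    have "z0 + h \<in> ball z0 r" using z nh by (simp add: dist_norm)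
    then have "(x, y0, t) \<in> O3" using r(2) zh by auto
    then have 1: "f (x, t) + g (y0, t) \<le> \<Phi> (z0 + h)" using le by (simp add: zh)
    have 2: "\<Phi> (z0 + h) \<le> \<Phi> z0 + G z0 \<bullet> h + (H z0 h \<bullet> h) / 2 + (norm h)\<^sup>2"
      using d(2)[of h] z nh by (simp add: abs_le_iff)
    have 3: "(H z0 h \<bullet> h) / 2 \<le> B * (norm h)\<^sup>2"
      using B(2)[of h] mult_nonneg_nonneg[OF B(1) zero_le_power2[of "norm h"]] by linarith
    have 4: "g (y0, t) \<ge> g (y0, t0) + snd pg * (t - t0) - L * (t - t0)\<^sup>2"
      using pg[of "(y0, t)"] by (simp add: norm_Pair inner_prod_def)
    have "(t - t0)\<^sup>2 \<le> (norm h)\<^sup>2" by (simp add: h_def norm_Pair)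
    then have 5: "L * (t - t0)\<^sup>2 \<le> L * (norm h)\<^sup>2" using L by (rule mult_left_mono)
    have 6: "G z0 \<bullet> h = pf \<bullet> (z - (x0, t0)) + snd pg * (t - t0)"
      using first_order[of "x - x0" 0 "t - t0"] by (simp add: h_def zz inner_prod_def)
    have "\<Phi> z0 = f (x0, t0) + g (y0, t0)" using eq by (simp add: z0_def)
    then have "f z \<le> f (x0, t0) + pf \<bullet> (z - (x0, t0)) + (B * (norm h)\<^sup>2 + (norm h)\<^sup>2 + L * (norm h)\<^sup>2)"
      using 1 2 3 4 5 6 zz by simp
    then show "f z \<le> f (x0, t0) + pf \<bullet> (z - (x0, t0)) + (B + 1 + L) * (norm (z - (x0, t0)))\<^sup>2"
      unfolding nh[symmetric] by (simp add: distrib_right)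
  qed (use r d B L in auto)
qed

text \<open>
  The substitute for the theorem on sums: any pair of square roots of the coefficient matrices at the two
  gradients may be used to couple the space variables, and the inequality holds with the Hessian of \<open>\<Phi>\<close>
  evaluated on the coupled directions \<open>(S1 b, S2 b)\<close>.
  
  Suppose that it fails by \<open>D > 0\<close>. Let \<open>\<phi>\<close> be a limit of blow-ups of \<open>f\<close> and \<open>Q\<close> the quadratic form of \<open>\<Phi>\<close> in
  the coupled coordinates; the blow-ups of \<open>g\<close> lie below \<open>Q - \<phi>\<close> in the limit. Approximate \<open>\<phi>\<close> on the
  sphere by \<open>h\<close> with constant Laplacian \<open>c\<close>. With a suitable \<open>c\<close>, both \<open>h\<close> and \<open>Q - h\<close>, even after adding
  \<open>d (|x|\<^sup>2 - 1)\<close>, satisfy the strict inequality of the maximum principle for blow-ups, so neither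
  can be much below \<open>0\<close> at the centre. But there they add up to \<open>-2 d\<close>.
\<close>

theorem coupling_bound:
  assumes \<kappa>: "\<kappa> > 0"
    and S1: "trace_root q \<kappa> (fst (G z0)) S1" and S2: "trace_root q \<kappa> (fst (snd (G z0))) S2"
    and nz: "fst (G z0) \<noteq> 0" "fst (snd (G z0)) \<noteq> 0"
  shows "snd (snd (G z0)) \<le> (\<Sum>b\<in>Basis. H z0 (S1 b, S2 b, 0) \<bullet> (S1 b, S2 b, 0))
     + \<kappa>\<^sup>2 * (H z0 (0, 0, 1) \<bullet> (0, 0, 1) + 4 * L * DIM('b \<times> real))"
proof (rule ccontr)
  assume neg: "\<not> ?thesis"
  define n where "n = real DIM('b \<times> real)"
  have n: "n > 0" by (simp add: n_def)
  have z3: "z0 \<in> O3" using O3 by (simp add: z0_def)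
  have lH: "linear (H z0)" by (rule twice_diffD(4)[OF td z3])
  have l1: "linear S1" and l2: "linear S2" using S1 S2 by (auto simp: trace_root_def)
  define M where "M w = (S1 (fst w), S2 (fst w), \<kappa> * snd w)" for w
  have lM: "linear M" unfolding M_def
    by (rule linearI) (auto simp: linear_add[OF l1] linear_scale[OF l1] linear_add[OF l2] linear_scale[OF l2] algebra_simps)
  define T1 where "T1 = (\<lambda>w. (S1 (fst w), \<kappa> * snd w))"
  define T2 where "T2 = (\<lambda>w. (S2 (fst w), \<kappa> * snd w))"
  have lT: "linear T1" unfolding T1_def
    by (rule linearI) (auto simp: linear_add[OF l1] linear_scale[OF l1] algebra_simps)
  define A where "A w = adjoint M (H z0 (M w))" for w
  have lA: "linear A" unfolding A_def
    using linear_compose[OF linear_compose[OF lM lH] adjoint_linear[OF lM]] by (simp add: o_def)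
  have sA: "A v \<bullet> w = v \<bullet> A w" for v w
    unfolding A_def by (simp add: adjoint_clauses[OF lM] twice_diffD(3)[OF td z3])
  define Q where "Q w = (A w \<bullet> w) / 2" for w
  have Q: "Q w = (H z0 (M w) \<bullet> M w) / 2" for w by (simp add: Q_def A_def adjoint_clauses[OF lM])
  have tdQ: "twice_diff UNIV Q A (\<lambda>_. A)" unfolding Q_def by (rule twice_diff_quadratic[OF lA sA])
  define B where "B = (\<Sum>b\<in>Basis. A b \<bullet> b)"
  have Beq: "B = (\<Sum>b\<in>Basis. H z0 (S1 b, S2 b, 0) \<bullet> (S1 b, S2 b, 0)) + \<kappa>\<^sup>2 * (H z0 (0, 0, 1) \<bullet> (0, 0, 1))"
  proof -
    have "H z0 (0, 0, \<kappa>) = \<kappa> *\<^sub>R H z0 (0, 0, 1)" using linear_scale[OF lH, of \<kappa> "(0, 0, 1)"] by simp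
    then have "H z0 (0, 0, \<kappa>) \<bullet> (0, 0, \<kappa>) = \<kappa>\<^sup>2 * (H z0 (0, 0, 1) \<bullet> (0, 0, 1))"
      by (simp add: inner_prod_def power2_eq_square)
    then show ?thesis unfolding B_def A_def
      by (simp add: adjoint_clauses[OF lM] sum_Basis_prod) (simp add: M_def linear_0[OF l1] linear_0[OF l2])
  qed
  define a b where "a = snd pf" and "b = snd pg"
  have ab: "a + b = snd (snd (G z0))" using gradient_parts by (simp add: a_def b_def)
  define D where "D = a + b - B - 4 * L * \<kappa>\<^sup>2 * n"
  have D: "D > 0" using neg unfolding D_def ab Beq n_def by (simp add: algebra_simps)
  \<comment> \<open>The excess \<open>D\<close> is shared: \<open>2 n d\<close> is spent on the Laplacian of \<open>d |x|\<^sup>2\<close> in each summand, and the five errors \<open>\<alpha>\<close> made on the sphere together stay below \<open>2 d\<close>.\<close>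
  define d where "d = D / (6 * n)"
  have d: "d > 0" "n * d = D / 6" using D n by (simp_all add: d_def)
  define \<alpha> where "\<alpha> = d / 5"
  have \<alpha>: "\<alpha> > 0" using d by (simp add: \<alpha>_def)
  obtain r1 K where r1: "r1 > 0" "K \<ge> 0"
    "\<And>z. norm (z - (x0, t0)) < r1 \<Longrightarrow> f z \<le> f (x0, t0) + pf \<bullet> (z - (x0, t0)) + K * (norm (z - (x0, t0)))\<^sup>2"
    by (rule upper_quadratic) blast
  obtain \<phi> where \<phi>: "continuous_on (cball 0 1) \<phi>"
    "\<And>e r0. 0 < e \<Longrightarrow> 0 < r0 \<Longrightarrow> \<exists>r. 0 < r \<and> r < r0 \<and>
       (\<forall>\<omega>. norm \<omega> \<le> 1 \<longrightarrow> \<bar>blowup f (x0, t0) pf T1 r \<omega> - \<phi> \<omega>\<bar> < e)"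
    using blowup_subseq[OF L scf lT pf r1(1,2,3)] by blast
  \<comment> \<open>This splits the Laplacian \<open>B\<close> of \<open>Q\<close> between \<open>h\<close> and \<open>Q - h\<close> in such a way that both strict inequalities hold.\<close>
  define c where "c = a - 2 * L * \<kappa>\<^sup>2 * n - 3 * (n * d)"
  have "continuous_on (sphere 0 1) \<phi>" by (rule continuous_on_subset[OF \<phi>(1)]) auto
  then obtain h g' H' where h: "twice_diff UNIV h g' H'" "\<And>x. (\<Sum>b\<in>Basis. H' x b \<bullet> b) = c"
    "\<And>x. norm x = 1 \<Longrightarrow> \<bar>h x - \<phi> x\<bar> < \<alpha>"
    using approx_on_sphere_prescribed_laplacian[OF _ \<alpha>, of \<phi> c] by blast
  define h1 where "h1 x = h x + d * (x \<bullet> x) + (- d)" for x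
  define h2 where "h2 x = Q x - h x + d * (x \<bullet> x) + (- d)" for x
  have td1: "twice_diff UNIV h1 (\<lambda>x. g' x + d *\<^sub>R (2 *\<^sub>R x) + 0) (\<lambda>x v. H' x v + d *\<^sub>R (2 *\<^sub>R v) + 0)"
    unfolding h1_def by (intro twice_diff_add h twice_diff_cmult twice_diff_inner_self twice_diff_const)
  have td2: "twice_diff UNIV h2 (\<lambda>x. A x - g' x + d *\<^sub>R (2 *\<^sub>R x) + 0) (\<lambda>x v. A v - H' x v + d *\<^sub>R (2 *\<^sub>R v) + 0)"
    unfolding h2_def by (intro twice_diff_add twice_diff_diff tdQ h twice_diff_cmult twice_diff_inner_self twice_diff_const)
  have lap1: "(\<Sum>b\<in>Basis. (H' x b + d *\<^sub>R (2 *\<^sub>R b) + 0) \<bullet> b) = c + 2 * (n * d)" for x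
    by (simp add: inner_add_left sum.distrib h(2) inner_Basis n_def)
  have lap2: "(\<Sum>b\<in>Basis. (A b - H' x b + d *\<^sub>R (2 *\<^sub>R b) + 0) \<bullet> b) = B - c + 2 * (n * d)" for x
    by (simp add: inner_add_left inner_diff_left sum.distrib sum_subtractf h(2) inner_Basis n_def B_def)
  have c1: "c + 2 * (n * d) < snd pf - 2 * L * \<kappa>\<^sup>2 * DIM('b \<times> real)"
    unfolding c_def d(2) n_def[symmetric] a_def[symmetric] using D by simp
  have c2: "B - c + 2 * (n * d) < snd pg - 2 * L * \<kappa>\<^sup>2 * DIM('b \<times> real)"
    unfolding c_def d(2) n_def[symmetric] b_def[symmetric] using D D_def by argo
  note gp = gradient_parts
  obtain ra where ra: "ra > 0" "\<And>r \<eta>. 0 < r \<Longrightarrow> r < ra \<Longrightarrow>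
     (\<And>\<omega>. norm \<omega> = 1 \<Longrightarrow> blowup f (x0, t0) pf T1 r \<omega> \<le> h1 \<omega> + \<eta>) \<Longrightarrow> 0 \<le> h1 0 + \<eta>"
    by (rule blowup_below_harmonic[OF ptf O1 scf \<kappa> _ _ _ td1 lap1 c1, of S1 T1])
       (use S1 nz in \<open>auto simp: gp T1_def\<close>)
  obtain rb where rb: "rb > 0" "\<And>r \<eta>. 0 < r \<Longrightarrow> r < rb \<Longrightarrow>
     (\<And>\<omega>. norm \<omega> = 1 \<Longrightarrow> blowup g (y0, t0) pg T2 r \<omega> \<le> h2 \<omega> + \<eta>) \<Longrightarrow> 0 \<le> h2 0 + \<eta>"
    by (rule blowup_below_harmonic[OF ptg O2 scg \<kappa> _ _ _ td2 lap2 c2, of S2 T2])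
       (use S2 nz in \<open>auto simp: gp T2_def\<close>)
  obtain BM where BM: "BM > 0" "\<And>w. norm (M w) \<le> BM * norm w" using linear_bounded_pos[OF lM] by blast
  obtain dt where dt: "dt > 0"
    "\<And>h. norm h < dt \<Longrightarrow> \<bar>\<Phi> (z0 + h) - \<Phi> z0 - G z0 \<bullet> h - (H z0 h \<bullet> h) / 2\<bar> \<le> (\<alpha> / BM\<^sup>2) * (norm h)\<^sup>2"
    using twice_diff_taylor[OF td O3(1) z3, of "\<alpha> / BM\<^sup>2"] \<alpha> BM(1) by auto
  obtain ro where ro: "ro > 0" "ball z0 ro \<subseteq> O3" using z3 O3 open_contains_ball by blast
  define r0 where "r0 = min (min ra rb) (min dt ro / BM)"
  have r0: "r0 > 0" using ra rb dt ro BM by (simp add: r0_def)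
  obtain r where r: "0 < r" "r < r0" "\<And>\<omega>. norm \<omega> \<le> 1 \<Longrightarrow> \<bar>blowup f (x0, t0) pf T1 r \<omega> - \<phi> \<omega>\<bar> < \<alpha>"
    using \<phi>(2)[OF \<alpha> r0] by blast
  have s1: "blowup f (x0, t0) pf T1 r \<omega> \<le> h1 \<omega> + 2 * \<alpha>" if w: "norm \<omega> = 1" for \<omega>
    using r(3)[of \<omega>] h(3)[of \<omega>] w by (simp add: h1_def dot_square_norm)
  have s2: "blowup g (y0, t0) pg T2 r \<omega> \<le> h2 \<omega> + 3 * \<alpha>" if w: "norm \<omega> = 1" for \<omega>
  proof -
    define k where "k = r *\<^sub>R M \<omega>"
    have nk: "norm k \<le> r * BM" using BM(2)[of \<omega>] w r by (simp add: k_def)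
    have "r * BM < min dt ro" using r(2) BM(1) by (simp add: r0_def pos_less_divide_eq)
    then have k: "norm k < dt" "norm k < ro" using nk by auto
    have k1: "k = (r *\<^sub>R S1 (fst \<omega>), r *\<^sub>R S2 (fst \<omega>), r * (\<kappa> * snd \<omega>))" by (simp add: k_def M_def)
    have zk: "z0 + k = (x0 + r *\<^sub>R S1 (fst \<omega>), y0 + r *\<^sub>R S2 (fst \<omega>), t0 + r * (\<kappa> * snd \<omega>))"
      by (simp add: z0_def k1)
    have "z0 + k \<in> ball z0 ro" using k(2) by (simp add: dist_norm)
    then have "z0 + k \<in> O3" using ro(2) by blast
    then have "f ((x0, t0) + r *\<^sub>R T1 \<omega>) + g ((y0, t0) + r *\<^sub>R T2 \<omega>) \<le> \<Phi> (z0 + k)"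
      using le unfolding zk T1_def T2_def by simp
    also have "\<Phi> (z0 + k) \<le> \<Phi> z0 + G z0 \<bullet> k + (H z0 k \<bullet> k) / 2 + (\<alpha> / BM\<^sup>2) * (norm k)\<^sup>2"
      using dt(2)[OF k(1)] by (simp add: abs_le_iff)
    also have "(\<alpha> / BM\<^sup>2) * (norm k)\<^sup>2 \<le> (\<alpha> / BM\<^sup>2) * (r * BM)\<^sup>2"
      using \<alpha> nk by (intro mult_left_mono power_mono) auto
    also have "\<dots> = r\<^sup>2 * \<alpha>" using BM by (simp add: power_mult_distrib)
    also have "(H z0 k \<bullet> k) / 2 = r\<^sup>2 * Q \<omega>"
      by (simp add: k_def Q linear_scale[OF lH] power2_eq_square)
    also have "G z0 \<bullet> k = r * (pf \<bullet> T1 \<omega>) + r * (pg \<bullet> T2 \<omega>)"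
      unfolding k1 first_order by (simp add: T1_def T2_def inner_prod_def algebra_simps)
    also have "\<Phi> z0 = f (x0, t0) + g (y0, t0)" using eq by (simp add: z0_def)
    finally have "r\<^sup>2 * (blowup f (x0, t0) pf T1 r \<omega> + blowup g (y0, t0) pg T2 r \<omega>) \<le> r\<^sup>2 * (Q \<omega> + \<alpha>)"
      using r(1) by (simp add: blowup_def distrib_left)
    then have "blowup f (x0, t0) pf T1 r \<omega> + blowup g (y0, t0) pg T2 r \<omega> \<le> Q \<omega> + \<alpha>"
      using r(1) by (simp add: mult_le_cancel_left_pos)
    then show ?thesis
      using r(3)[of \<omega>] h(3)[of \<omega>] w by (simp add: h2_def dot_square_norm)
  qed
  have "0 \<le> h1 0 + 2 * \<alpha>" by (rule ra(2)[OF r(1) _ s1]) (use r in \<open>auto simp: r0_def\<close>)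
  moreover have "0 \<le> h2 0 + 3 * \<alpha>" by (rule rb(2)[OF r(1) _ s2]) (use r in \<open>auto simp: r0_def\<close>)
  moreover have "Q 0 = 0" by (simp add: Q_def)
  ultimately have "2 * d \<le> 5 * \<alpha>" by (simp add: h1_def h2_def)
  then show False using d(1) by (simp add: \<alpha>_def)
qed

end

section \<open>The doubling function\<close>

text \<open>
  The parameter \<open>\<tau> > 0\<close> keeps the function smooth up to time \<open>0\<close>. As \<open>\<tau>\<close> and \<open>t\<close> tend to \<open>0\<close> it becomes
  infinite off the diagonal \<open>x = y\<close> while it stays near \<open>m c\<close> at \<open>x = y = x0\<close>. Away from the diagonal its
  main term is close to a multiple of \<open>|x - y|\<^bsup>1/2\<^esup>\<close>, which is concave in the direction of \<open>x - y\<close>;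
  \<open>|x - x0|\<^sup>2\<close> localizes, and the last term has a large time derivative that pays for all errors.
\<close>

definition doubling_fun :: "real \<Rightarrow> real \<Rightarrow> real \<Rightarrow> real \<Rightarrow> real \<Rightarrow> 'b::euclidean_space \<Rightarrow> 'b \<times> 'b \<times> real \<Rightarrow> real" where
  "doubling_fun m c E \<rho> \<tau> x0 = (\<lambda>(x, y, t).
     m * (c + (\<tau> + \<rho> * t) powr (-1/4) * ((norm (x - y))^4 + (\<tau> + \<rho> * t)^3) powr (1/8)
        + (norm (x - x0))\<^sup>2 + E * (\<tau> + \<rho> * t) powr (1/24)))"

lemma twice_diff_dist2:
  "twice_diff S (\<lambda>z::'b::euclidean_space \<times> 'b \<times> real. (fst z - fst (snd z)) \<bullet> (fst z - fst (snd z)))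
    (\<lambda>z. (2 *\<^sub>R (fst z - fst (snd z)), - 2 *\<^sub>R (fst z - fst (snd z)), 0))
    (\<lambda>_ v. (2 *\<^sub>R (fst v - fst (snd v)), - 2 *\<^sub>R (fst v - fst (snd v)), 0))"
proof (rule twice_diffI)
  fix z :: "'b \<times> 'b \<times> real"
  have 1: "((\<lambda>z::'b \<times> 'b \<times> real. fst z - fst (snd z)) has_derivative (\<lambda>v. fst v - fst (snd v))) (at z)"
    by (auto intro!: derivative_eq_intros)
  show "((\<lambda>z::'b \<times> 'b \<times> real. (fst z - fst (snd z)) \<bullet> (fst z - fst (snd z))) has_derivative
     (\<lambda>v. (2 *\<^sub>R (fst z - fst (snd z)), - 2 *\<^sub>R (fst z - fst (snd z)), 0) \<bullet> v)) (at z)"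
    by (rule has_derivative_eq_rhs[OF has_derivative_inner[OF 1 1]])
       (auto simp: fun_eq_iff inner_commute inner_prod_def algebra_simps)
  have l: "linear (\<lambda>v::'b \<times> 'b \<times> real. (2 *\<^sub>R (fst v - fst (snd v)), - 2 *\<^sub>R (fst v - fst (snd v)), 0::real))"
    by (rule linearI) (auto simp: algebra_simps)
  show "((\<lambda>z::'b \<times> 'b \<times> real. (2 *\<^sub>R (fst z - fst (snd z)), - 2 *\<^sub>R (fst z - fst (snd z)), 0::real)) has_derivative
      (\<lambda>v. (2 *\<^sub>R (fst v - fst (snd v)), - 2 *\<^sub>R (fst v - fst (snd v)), 0))) (at z)"
    by (rule linear_imp_has_derivative[OF l])
qed (auto simp: inner_prod_def inner_commute algebra_simps)

lemma twice_diff_dist_point2: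
  "twice_diff S (\<lambda>z::'b::euclidean_space \<times> 'b \<times> real. (fst z - c) \<bullet> (fst z - c))
    (\<lambda>z. (2 *\<^sub>R (fst z - c), 0, 0)) (\<lambda>_ v. (2 *\<^sub>R fst v, 0, 0))"
proof (rule twice_diffI)
  fix z :: "'b \<times> 'b \<times> real"
  have 1: "((\<lambda>z::'b \<times> 'b \<times> real. fst z - c) has_derivative (\<lambda>v. fst v)) (at z)"
    by (auto intro!: derivative_eq_intros)
  show "((\<lambda>z::'b \<times> 'b \<times> real. (fst z - c) \<bullet> (fst z - c)) has_derivative
     (\<lambda>v. (2 *\<^sub>R (fst z - c), 0, 0) \<bullet> v)) (at z)"
    by (rule has_derivative_eq_rhs[OF has_derivative_inner[OF 1 1]])
       (auto simp: fun_eq_iff inner_commute inner_prod_def algebra_simps)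
  show "((\<lambda>z::'b \<times> 'b \<times> real. (2 *\<^sub>R (fst z - c), 0::'b, 0::real)) has_derivative
      (\<lambda>v. (2 *\<^sub>R fst v, 0, 0))) (at z)"
    by (auto intro!: derivative_eq_intros simp: zero_prod_def)
qed (auto simp: inner_prod_def inner_commute algebra_simps)

lemma powr_C2:
  fixes a :: real
  assumes "x > 0"
  shows "((\<lambda>x. x powr a) has_real_derivative a * x powr (a - 1)) (at x)"
    and "((\<lambda>x. a * x powr (a - 1)) has_real_derivative a * ((a - 1) * x powr (a - 2))) (at x)"
proof -
  show 1: "((\<lambda>x. x powr a) has_real_derivative a * x powr (a - 1)) (at x)" for a
    by (rule has_real_derivative_powr[OF assms])
  show "((\<lambda>x. a * x powr (a - 1)) has_real_derivative a * ((a - 1) * x powr (a - 2))) (at x)"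
    using DERIV_cmult[OF 1[of "a - 1"], of a] by (simp add: algebra_simps)
qed

lemma twice_diff_powr:
  assumes f: "twice_diff S f g H" and pos: "\<And>z. z \<in> S \<Longrightarrow> f z > 0"
  shows "twice_diff S (\<lambda>z. f z powr a) (\<lambda>z. (a * f z powr (a - 1)) *\<^sub>R g z)
    (\<lambda>z v. (a * f z powr (a - 1)) *\<^sub>R H z v + (a * ((a - 1) * f z powr (a - 2)) * (g z \<bullet> v)) *\<^sub>R g z)"
proof (rule twice_diff_compose[OF f, where k="\<lambda>x. x powr a" and ?k1.0="\<lambda>x. a * x powr (a - 1)" and ?k2.0="\<lambda>x. a * ((a - 1) * x powr (a - 2))"])
  show "continuous_on (f ` S) (\<lambda>x. a * ((a - 1) * x powr (a - 2)))"
    using pos by (intro continuous_intros) (auto dest!: pos)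
qed (use pos powr_C2 in auto)

text \<open>
  All fractional powers are expressed through integer powers of the roots \<open>\<theta>\<close> and \<open>Y\<close> below, which reduces the
  estimates to polynomial inequalities.
\<close>

lemma powr_root_powers:
  assumes "x > 0"
  shows "(x powr (1 / real n)) ^ k = x powr (real k / real n)"
  using assms by (simp add: powr_power)

text \<open>
  Exactly the entries of the jet that enter the estimates, in the variables
  \<open>\<theta> = (\<tau> + \<rho> t)\<^bsup>1/24\<^esup>\<close> and \<open>Y = (|x - y|\<^sup>4 + \<theta>\<^sup>7\<^sup>2)\<^bsup>1/8\<^esup>\<close>.
\<close>

definition doubling_fun_jet where
  "doubling_fun_jet m E \<rho> \<tau> x0 G H \<longleftrightarrow> (\<forall>(x::'b::euclidean_space) y t \<theta> Y. \<tau> + \<rho> * t > 0 \<longrightarrow> \<theta> = (\<tau> + \<rho> * t) powr (1/24) \<longrightarrow>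
       Y = ((norm (x - y))^4 + (\<tau> + \<rho> * t)^3) powr (1/8) \<longrightarrow>
       fst (G (x, y, t)) = m *\<^sub>R (((norm (x - y))\<^sup>2 / (2 * \<theta>^6 * Y^7)) *\<^sub>R (x - y) + 2 *\<^sub>R (x - x0)) \<and>
       fst (snd (G (x, y, t))) = - (m *\<^sub>R (((norm (x - y))\<^sup>2 / (2 * \<theta>^6 * Y^7)) *\<^sub>R (x - y))) \<and>
       snd (snd (G (x, y, t))) = m * \<rho> * (- Y / (4 * \<theta>^30) + 3 * \<theta>^48 / (8 * \<theta>^6 * Y^7) + E / (24 * \<theta>^23)) \<and>
       (\<forall>h1 h2. H (x, y, t) (h1, h2, 0) \<bullet> (h1, h2, 0) =
          m * ((1 / \<theta>^6) * ((norm (x - y))\<^sup>2 * (norm (h1 - h2))\<^sup>2 / (2 * Y^7)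
              + ((x - y) \<bullet> (h1 - h2))\<^sup>2 * (1 / Y^7 - 7 * (norm (x - y))^4 / (4 * Y^15)))
            + 2 * (norm h1)\<^sup>2)))"

lemma doubling_fun_twice_diff:
  fixes x0 :: "'b::euclidean_space" and \<tau> \<rho> :: real
  shows "\<exists>G H. twice_diff {z::'b \<times> 'b \<times> real. \<tau> + \<rho> * snd (snd z) > 0} (doubling_fun m c E \<rho> \<tau> x0) G H \<and>
    doubling_fun_jet m E \<rho> \<tau> x0 G H"
proof -
  define S where "S = {z::'b \<times> 'b \<times> real. \<tau> + \<rho> * snd (snd z) > 0}"
  define e where "e = (0::'b, 0::'b, \<rho>)"
  define T where "T z = \<tau> + e \<bullet> z" for z
  have tT: "twice_diff S T (\<lambda>_. e) (\<lambda>_ _. 0)"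
    using twice_diff_add[OF twice_diff_const twice_diff_inner, of S \<tau> e] unfolding T_def by simp
  have T: "T z = \<tau> + \<rho> * snd (snd z)" for z by (simp add: T_def e_def inner_prod_def)
  have Tpos: "T z > 0" if "z \<in> S" for z using that by (simp add: S_def T)
  define s where "s z = (fst z - fst (snd z)) \<bullet> (fst z - fst (snd z))" for z :: "'b \<times> 'b \<times> real"
  define U where "U z = (s z)\<^sup>2 + (T z)^3" for z
  have Upos: "U z > 0" if "z \<in> S" for z
    using Tpos[OF that] unfolding U_def by (intro add_nonneg_pos) auto
  define P where "P z = (fst z - x0) \<bullet> (fst z - x0)" for z :: "'b \<times> 'b \<times> real"
  have ker: "doubling_fun m c E \<rho> \<tau> x0 = (\<lambda>z. m * (c + (T z powr (-1/4) * U z powr (1/8) + (P z + E * T z powr (1/24)))))"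
  proof
    fix z :: "'b \<times> 'b \<times> real"
    obtain x y t where z: "z = (x, y, t)" by (cases z) auto
    have "(s (x, y, t))\<^sup>2 = (norm (x - y))^4"
      by (simp add: s_def power2_norm_eq_inner[symmetric] flip: power_mult)
    then show "doubling_fun m c E \<rho> \<tau> x0 z = m * (c + (T z powr (-1/4) * U z powr (1/8) + (P z + E * T z powr (1/24))))"
      unfolding z U_def by (simp add: doubling_fun_def T P_def power2_norm_eq_inner algebra_simps)
  qed
  define gs where "gs z = (2 *\<^sub>R (fst z - fst (snd z)), - 2 *\<^sub>R (fst z - fst (snd z)), 0::real)" for z :: "'b \<times> 'b \<times> real"
  define Hs where "Hs v = (2 *\<^sub>R (fst v - fst (snd v)), - 2 *\<^sub>R (fst v - fst (snd v)), 0::real)" for v :: "'b \<times> 'b \<times> real"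
  have ts: "twice_diff S s gs (\<lambda>_. Hs)" unfolding s_def gs_def Hs_def by (rule twice_diff_dist2)
  define gU where "gU z = (2 * s z) *\<^sub>R gs z + (3 * (T z)\<^sup>2) *\<^sub>R e" for z
  define HU where "HU z v = ((2 * s z) *\<^sub>R Hs v + (2 * (gs z \<bullet> v)) *\<^sub>R gs z) + ((3 * (T z)\<^sup>2) *\<^sub>R 0 + (6 * T z * (e \<bullet> v)) *\<^sub>R e)" for z v
  have t1: "twice_diff S (\<lambda>z. (s z)\<^sup>2) (\<lambda>z. (2 * s z) *\<^sub>R gs z) (\<lambda>z v. (2 * s z) *\<^sub>R Hs v + (2 * (gs z \<bullet> v)) *\<^sub>R gs z)"
    by (rule twice_diff_compose[OF ts, where k="\<lambda>x. x\<^sup>2" and ?k1.0="\<lambda>x. 2 * x" and ?k2.0="\<lambda>x. 2"])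
       (auto intro!: derivative_eq_intros)
  have t2: "twice_diff S (\<lambda>z. (T z)^3) (\<lambda>z. (3 * (T z)\<^sup>2) *\<^sub>R e) (\<lambda>z v. (3 * (T z)\<^sup>2) *\<^sub>R 0 + (6 * T z * (e \<bullet> v)) *\<^sub>R e)"
    by (rule twice_diff_compose[OF tT, where k="\<lambda>x. x^3" and ?k1.0="\<lambda>x. 3 * x\<^sup>2" and ?k2.0="\<lambda>x. 6 * x"])
       (auto intro!: derivative_eq_intros continuous_intros)
  have tU: "twice_diff S U gU HU"
    unfolding U_def gU_def HU_def by (rule twice_diff_add[OF t1 t2])
  define a1 a2 where "a1 z = -1/4 * T z powr (-1/4 - 1)" and "a2 z = -1/4 * ((-1/4 - 1) * T z powr (-1/4 - 2))" for z
  define b1 b2 where "b1 z = 1/8 * U z powr (1/8 - 1)" and "b2 z = 1/8 * ((1/8 - 1) * U z powr (1/8 - 2))" for z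
  define c1 c2 where "c1 z = 1/24 * T z powr (1/24 - 1)" and "c2 z = 1/24 * ((1/24 - 1) * T z powr (1/24 - 2))" for z
  have tA: "twice_diff S (\<lambda>z. T z powr (-1/4)) (\<lambda>z. a1 z *\<^sub>R e) (\<lambda>z v. a1 z *\<^sub>R 0 + (a2 z * (e \<bullet> v)) *\<^sub>R e)"
    unfolding a1_def a2_def by (rule twice_diff_powr[OF tT Tpos])
  have tB: "twice_diff S (\<lambda>z. U z powr (1/8)) (\<lambda>z. b1 z *\<^sub>R gU z) (\<lambda>z v. b1 z *\<^sub>R HU z v + (b2 z * (gU z \<bullet> v)) *\<^sub>R gU z)"
    unfolding b1_def b2_def by (rule twice_diff_powr[OF tU Upos])
  have tC: "twice_diff S (\<lambda>z. T z powr (1/24)) (\<lambda>z. c1 z *\<^sub>R e) (\<lambda>z v. c1 z *\<^sub>R 0 + (c2 z * (e \<bullet> v)) *\<^sub>R e)"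
    unfolding c1_def c2_def by (rule twice_diff_powr[OF tT Tpos])
  have tP: "twice_diff S P (\<lambda>z. (2 *\<^sub>R (fst z - x0), 0, 0)) (\<lambda>_ v. (2 *\<^sub>R fst v, 0, 0))"
    unfolding P_def by (rule twice_diff_dist_point2)
  define A B where "A z = T z powr (-1/4)" and "B z = U z powr (1/8)" for z
  define G where "G z = m *\<^sub>R (0 + ((A z *\<^sub>R b1 z *\<^sub>R gU z + B z *\<^sub>R a1 z *\<^sub>R e) + ((2 *\<^sub>R (fst z - x0), 0, 0) + E *\<^sub>R c1 z *\<^sub>R e)))" for z
  define H where "H z v = m *\<^sub>R (0 + ((A z *\<^sub>R (b1 z *\<^sub>R HU z v + (b2 z * (gU z \<bullet> v)) *\<^sub>R gU z)
      + B z *\<^sub>R (a1 z *\<^sub>R 0 + (a2 z * (e \<bullet> v)) *\<^sub>R e) + ((a1 z *\<^sub>R e) \<bullet> v) *\<^sub>R (b1 z *\<^sub>R gU z) + ((b1 z *\<^sub>R gU z) \<bullet> v) *\<^sub>R (a1 z *\<^sub>R e))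
      + ((2 *\<^sub>R fst v, 0, 0) + E *\<^sub>R (c1 z *\<^sub>R 0 + (c2 z * (e \<bullet> v)) *\<^sub>R e))))" for z v
  have td: "twice_diff S (doubling_fun m c E \<rho> \<tau> x0) G H"
    unfolding ker G_def H_def A_def B_def
    by (intro twice_diff_cmult twice_diff_add twice_diff_const twice_diff_mult tA tB tC tP)
  have jet: "doubling_fun_jet m E \<rho> \<tau> x0 G H"
    unfolding doubling_fun_jet_def
  proof (intro allI impI)
    fix x y :: 'b and t \<theta> Y :: real
    assume pos: "\<tau> + \<rho> * t > 0" and \<theta>: "\<theta> = (\<tau> + \<rho> * t) powr (1/24)"
      and Y: "Y = ((norm (x - y))^4 + (\<tau> + \<rho> * t)^3) powr (1/8)"
    define z where "z = (x, y, t)"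
    have s0: "s z = (norm (x - y))\<^sup>2" by (simp add: s_def z_def power2_norm_eq_inner)
    have s2: "(s z)\<^sup>2 = (norm (x - y))^4" by (simp add: s0 flip: power_mult)
    have T0: "T z = \<tau> + \<rho> * t" by (simp add: T z_def)
    have U0: "U z = (norm (x - y))^4 + (\<tau> + \<rho> * t)^3" by (simp add: U_def s2 T0)
    have p: "T z > 0" "U z > 0" using Tpos Upos pos by (auto simp: S_def z_def)
    have ty: "\<theta> = T z powr (1/24)" "Y = U z powr (1/8)" unfolding \<theta> Y T0 U0 by auto
    have th: "\<theta> ^ k = T z powr (real k / 24)" "Y ^ k = U z powr (real k / 8)" for k
      using powr_root_powers[OF p(1), of 24 k] powr_root_powers[OF p(2), of 8 k]
      unfolding ty by simp_all
    have th1: "Y = U z powr (1/8)" using th(2)[of 1] by simp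
    have ths: "A z = 1 / \<theta>^6" "a1 z = - 1 / (4 * \<theta>^30)" "B z = Y" "b1 z = 1 / (8 * Y^7)" "b2 z = - 7 / (64 * Y^15)"
      "c1 z = 1 / (24 * \<theta>^23)" "(T z)\<^sup>2 = \<theta>^48"
      unfolding th by (simp_all add: A_def a1_def B_def b1_def b2_def c1_def th1 powr_minus_divide p
         flip: powr_realpow[OF p(1)])
    have e0: "e \<bullet> (h1, h2, 0) = 0" for h1 h2 by (simp add: e_def inner_prod_def)
    have gse: "gs z \<bullet> (h1, h2, 0) = 2 * ((x - y) \<bullet> (h1 - h2))" for h1 h2
      by (simp add: gs_def z_def inner_prod_def inner_diff_left inner_diff_right algebra_simps)
    have gUe: "gU z \<bullet> (h1, h2, 0) = 4 * s z * ((x - y) \<bullet> (h1 - h2))" for h1 h2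
      by (simp add: gU_def inner_add_left e0 gse)
    have Hse: "Hs (h1, h2, 0) \<bullet> (h1, h2, 0) = 2 * (norm (h1 - h2))\<^sup>2" for h1 h2
      by (simp add: Hs_def inner_prod_def power2_norm_eq_inner inner_diff_left inner_diff_right algebra_simps)
    have HUe: "HU z (h1, h2, 0) \<bullet> (h1, h2, 0) = 4 * s z * (norm (h1 - h2))\<^sup>2 + 8 * ((x - y) \<bullet> (h1 - h2))\<^sup>2" for h1 h2
      by (simp add: HU_def inner_add_left e0 gse Hse power2_eq_square)
    have He: "H z (h1, h2, 0) \<bullet> (h1, h2, 0) =
          m * ((1 / \<theta>^6) * ((norm (x - y))\<^sup>2 * (norm (h1 - h2))\<^sup>2 / (2 * Y^7)
              + ((x - y) \<bullet> (h1 - h2))\<^sup>2 * (1 / Y^7 - 7 * (norm (x - y))^4 / (4 * Y^15)))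
            + 2 * (norm h1)\<^sup>2)" for h1 h2
    proof -
      have "H z (h1, h2, 0) \<bullet> (h1, h2, 0) = m * (A z * (b1 z * (HU z (h1, h2, 0) \<bullet> (h1, h2, 0))
          + b2 z * (gU z \<bullet> (h1, h2, 0))\<^sup>2) + 2 * (norm h1)\<^sup>2)"
        by (simp add: H_def inner_add_left e0 power2_eq_square dot_square_norm)
      also have "\<dots> = m * ((1 / \<theta>^6) * (1 / (8 * Y^7) * (4 * s z * (norm (h1 - h2))\<^sup>2 + 8 * ((x - y) \<bullet> (h1 - h2))\<^sup>2)
          + (- 7 / (64 * Y^15)) * (16 * (s z)\<^sup>2 * ((x - y) \<bullet> (h1 - h2))\<^sup>2)) + 2 * (norm h1)\<^sup>2)"
        unfolding HUe gUe ths by (simp add: power_mult_distrib)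
      also have "1 / (8 * Y^7) * (4 * s z * (norm (h1 - h2))\<^sup>2 + 8 * ((x - y) \<bullet> (h1 - h2))\<^sup>2)
          + (- 7 / (64 * Y^15)) * (16 * (s z)\<^sup>2 * ((x - y) \<bullet> (h1 - h2))\<^sup>2)
          = (norm (x - y))\<^sup>2 * (norm (h1 - h2))\<^sup>2 / (2 * Y^7)
              + ((x - y) \<bullet> (h1 - h2))\<^sup>2 * (1 / Y^7 - 7 * (norm (x - y))^4 / (4 * Y^15))"
        unfolding s2 s0 by (simp add: add_divide_distrib algebra_simps)
      finally show ?thesis .
    qed
    have G1: "fst (G z) = m *\<^sub>R (((norm (x - y))\<^sup>2 / (2 * \<theta>^6 * Y^7)) *\<^sub>R (x - y) + 2 *\<^sub>R (x - x0))"
      unfolding G_def ths gU_def gs_def e_def s0 by (simp add: z_def)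
    have G2: "fst (snd (G z)) = - (m *\<^sub>R (((norm (x - y))\<^sup>2 / (2 * \<theta>^6 * Y^7)) *\<^sub>R (x - y)))"
      unfolding G_def ths gU_def gs_def e_def s0 by (simp add: z_def)
    have G3: "snd (snd (G z)) = m * \<rho> * (- Y / (4 * \<theta>^30) + 3 * \<theta>^48 / (8 * \<theta>^6 * Y^7) + E / (24 * \<theta>^23))"
      unfolding G_def ths gU_def gs_def e_def s0 by (simp add: z_def distrib_left distrib_right algebra_simps)
    show "fst (G (x, y, t)) = m *\<^sub>R (((norm (x - y))\<^sup>2 / (2 * \<theta>^6 * Y^7)) *\<^sub>R (x - y) + 2 *\<^sub>R (x - x0)) \<and>
       fst (snd (G (x, y, t))) = - (m *\<^sub>R (((norm (x - y))\<^sup>2 / (2 * \<theta>^6 * Y^7)) *\<^sub>R (x - y))) \<and>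
       snd (snd (G (x, y, t))) = m * \<rho> * (- Y / (4 * \<theta>^30) + 3 * \<theta>^48 / (8 * \<theta>^6 * Y^7) + E / (24 * \<theta>^23)) \<and>
       (\<forall>h1 h2. H (x, y, t) (h1, h2, 0) \<bullet> (h1, h2, 0) =
          m * ((1 / \<theta>^6) * ((norm (x - y))\<^sup>2 * (norm (h1 - h2))\<^sup>2 / (2 * Y^7)
              + ((x - y) \<bullet> (h1 - h2))\<^sup>2 * (1 / Y^7 - 7 * (norm (x - y))^4 / (4 * Y^15)))
            + 2 * (norm h1)\<^sup>2))"
      using G1 G2 G3 He unfolding z_def by blast
  qed
  show ?thesis using td jet unfolding S_def by blast
qed

section \<open>Couplings of the two space variables\<close>

definition rank1 :: "real \<Rightarrow> real \<Rightarrow> 'b::euclidean_space \<Rightarrow> 'b \<Rightarrow> 'b" where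
  "rank1 \<alpha> \<beta> e a = \<alpha> *\<^sub>R a + (\<beta> * (e \<bullet> a)) *\<^sub>R e"

lemma sum_inner_Basis: "(\<Sum>b\<in>Basis. (u \<bullet> b) * (v \<bullet> b)) = u \<bullet> (v::'b::euclidean_space)"
  by (rule euclidean_inner[symmetric])

text \<open>
  The coefficient matrix at a gradient in the direction \<open>e\<close> has the eigenvalue \<open>1 - q\<close> along \<open>e\<close> and \<open>q\<close>
  on its complement. Each sign of \<open>\<alpha> + \<beta>\<close> is allowed: equal signs for the two variables give the
  synchronous coupling, opposite signs the reflection coupling.
\<close>

lemma trace_root_rank1:
  fixes e :: "'b::euclidean_space"
  assumes e: "norm e = 1" and k: "k \<noteq> 0" and nz: "\<alpha> \<noteq> 0" "\<alpha> + \<beta> \<noteq> 0"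
    and a: "\<alpha>\<^sup>2 = q + \<kappa>\<^sup>2" and b: "(\<alpha> + \<beta>)\<^sup>2 = 1 - q + \<kappa>\<^sup>2"
  shows "trace_root q \<kappa> (k *\<^sub>R e) (rank1 \<alpha> \<beta> e)"
proof -
  have ee: "e \<bullet> e = 1" using e by (simp add: dot_square_norm)
  have lin: "linear (rank1 \<alpha> \<beta> e)"
    unfolding rank1_def by (rule linearI) (auto simp: inner_add_right algebra_simps)
  have "a = 0" if "rank1 \<alpha> \<beta> e a = 0" for a
  proof -
    have "e \<bullet> rank1 \<alpha> \<beta> e a = (\<alpha> + \<beta>) * (e \<bullet> a)"
      by (simp add: rank1_def inner_add_right ee algebra_simps)
    then have "e \<bullet> a = 0" using that nz by simp
    then show ?thesis using that nz by (simp add: rank1_def)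
  qed
  then have inj: "inj (rank1 \<alpha> \<beta> e)" using linear_injective_0[OF lin] by blast
  have "(\<Sum>b\<in>Basis. X (rank1 \<alpha> \<beta> e b) \<bullet> rank1 \<alpha> \<beta> e b) = pF q (k *\<^sub>R e) X + \<kappa>\<^sup>2 * (\<Sum>b\<in>Basis. X b \<bullet> b)"
    if X: "linear X" for X :: "'b \<Rightarrow> 'b"
  proof -
    have 1: "(\<Sum>b\<in>Basis. (e \<bullet> b) * (X b \<bullet> e)) = X e \<bullet> e"
    proof -
      have "X e \<bullet> e = X (\<Sum>b\<in>Basis. (e \<bullet> b) *\<^sub>R b) \<bullet> e" by (simp add: euclidean_representation)
      also have "\<dots> = (\<Sum>b\<in>Basis. (e \<bullet> b) * (X b \<bullet> e))"
        by (simp only: linear_sum[OF X] linear_scale[OF X] inner_sum_left inner_scaleR_left)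
      finally show ?thesis by simp
    qed
    have 2: "(\<Sum>b\<in>Basis. (e \<bullet> b) * (X e \<bullet> b)) = X e \<bullet> e"
      unfolding sum_inner_Basis by (rule inner_commute)
    have 3: "(\<Sum>b\<in>Basis. (e \<bullet> b) * (e \<bullet> b)) = 1" unfolding sum_inner_Basis by (rule ee)
    have "X (rank1 \<alpha> \<beta> e b) \<bullet> rank1 \<alpha> \<beta> e b = \<alpha>\<^sup>2 * (X b \<bullet> b) + \<alpha> * \<beta> * ((e \<bullet> b) * (X b \<bullet> e))
       + \<alpha> * \<beta> * ((e \<bullet> b) * (X e \<bullet> b)) + \<beta>\<^sup>2 * (X e \<bullet> e) * ((e \<bullet> b) * (e \<bullet> b))" for b
      unfolding rank1_def linear_add[OF X] linear_scale[OF X]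
      by (simp add: inner_add_left inner_add_right power2_eq_square algebra_simps)
    then have "(\<Sum>b\<in>Basis. X (rank1 \<alpha> \<beta> e b) \<bullet> rank1 \<alpha> \<beta> e b)
      = \<alpha>\<^sup>2 * (\<Sum>b\<in>Basis. X b \<bullet> b) + \<alpha> * \<beta> * (X e \<bullet> e) + \<alpha> * \<beta> * (X e \<bullet> e) + \<beta>\<^sup>2 * (X e \<bullet> e) * 1"
      by (simp only: sum.distrib 1 2 3 flip: sum_distrib_left)
    also have "\<dots> = \<alpha>\<^sup>2 * (\<Sum>b\<in>Basis. X b \<bullet> b) + ((\<alpha> + \<beta>)\<^sup>2 - \<alpha>\<^sup>2) * (X e \<bullet> e)"
      by (simp add: power2_eq_square algebra_simps)
    also have "(\<alpha> + \<beta>)\<^sup>2 - \<alpha>\<^sup>2 = 1 - 2 * q" by (simp add: a b)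
    also have "X e \<bullet> e = X (k *\<^sub>R e) \<bullet> (k *\<^sub>R e) / (norm (k *\<^sub>R e))\<^sup>2"
      using k e by (simp add: linear_scale[OF X] power2_eq_square)
    finally show ?thesis by (simp add: pF_def a algebra_simps)
  qed
  then show ?thesis unfolding trace_root_def using lin inj by blast
qed

text \<open>
  The form of the doubling function acts on the difference of the coupled directions, which is a difference of
  two rank-one maps since the multiples of the identity cancel.
\<close>

lemma coupled_sums:
  fixes e1 e :: "'b::euclidean_space" and \<alpha> \<beta>1 \<beta>2 :: real
  assumes e: "norm e1 = 1" "norm e = 1"
  defines "D \<equiv> \<lambda>b. rank1 \<alpha> \<beta>1 e1 b - rank1 \<alpha> \<beta>2 e b"
  shows "(\<Sum>b\<in>Basis. (norm (D b))\<^sup>2) = \<beta>1\<^sup>2 + \<beta>2\<^sup>2 - 2 * \<beta>1 * \<beta>2 * (e1 \<bullet> e)\<^sup>2"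
    and "(\<Sum>b\<in>Basis. (e \<bullet> D b)\<^sup>2) = \<beta>1\<^sup>2 * (e1 \<bullet> e)\<^sup>2 + \<beta>2\<^sup>2 - 2 * \<beta>1 * \<beta>2 * (e1 \<bullet> e)\<^sup>2"
proof -
  have ee: "e \<bullet> e = 1" "e1 \<bullet> e1 = 1" "e \<bullet> e1 = e1 \<bullet> e" using e by (auto simp: dot_square_norm inner_commute)
  have Db: "D b = (\<beta>1 * (e1 \<bullet> b)) *\<^sub>R e1 - (\<beta>2 * (e \<bullet> b)) *\<^sub>R e" for b
    by (simp add: D_def rank1_def)
  have "(norm (D b))\<^sup>2 = \<beta>1\<^sup>2 * ((e1 \<bullet> b) * (e1 \<bullet> b)) + \<beta>2\<^sup>2 * ((e \<bullet> b) * (e \<bullet> b))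
     - 2 * \<beta>1 * \<beta>2 * (e1 \<bullet> e) * ((e1 \<bullet> b) * (e \<bullet> b))" for b
    unfolding Db power2_norm_eq_inner
    by (simp add: inner_diff_left inner_diff_right ee power2_eq_square algebra_simps)
  then show "(\<Sum>b\<in>Basis. (norm (D b))\<^sup>2) = \<beta>1\<^sup>2 + \<beta>2\<^sup>2 - 2 * \<beta>1 * \<beta>2 * (e1 \<bullet> e)\<^sup>2"
    by (simp add: sum.distrib sum_subtractf sum_inner_Basis ee power2_eq_square flip: sum_distrib_left)
  have "(e \<bullet> D b)\<^sup>2 = (\<beta>1 * (e1 \<bullet> e))\<^sup>2 * ((e1 \<bullet> b) * (e1 \<bullet> b)) + \<beta>2\<^sup>2 * ((e \<bullet> b) * (e \<bullet> b))
     - 2 * \<beta>1 * \<beta>2 * (e1 \<bullet> e) * ((e1 \<bullet> b) * (e \<bullet> b))" for b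
    unfolding Db
    by (simp add: inner_diff_right ee power2_eq_square algebra_simps)
  then show "(\<Sum>b\<in>Basis. (e \<bullet> D b)\<^sup>2) = \<beta>1\<^sup>2 * (e1 \<bullet> e)\<^sup>2 + \<beta>2\<^sup>2 - 2 * \<beta>1 * \<beta>2 * (e1 \<bullet> e)\<^sup>2"
    by (simp add: sum.distrib sum_subtractf sum_inner_Basis ee power2_eq_square flip: sum_distrib_left)
qed

lemma le_of_le_add_square_mult:
  fixes a b C :: real
  assumes "\<And>\<kappa>. \<kappa> > 0 \<Longrightarrow> a \<le> b + \<kappa>\<^sup>2 * C"
  shows "a \<le> b"
proof (rule field_le_epsilon)
  fix e :: real assume e: "e > 0"
  define k where "k = sqrt (e / (\<bar>C\<bar> + 1))"
  have k: "k > 0" "k\<^sup>2 = e / (\<bar>C\<bar> + 1)" using e by (auto simp: k_def)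
  have "k\<^sup>2 * C \<le> k\<^sup>2 * (\<bar>C\<bar> + 1)" by (intro mult_left_mono) auto
  also have "\<dots> = e" using k by simp
  finally show "a \<le> b + e" using assms[OF k(1)] by simp
qed

section \<open>Estimates for the doubling function\<close>

text \<open>
  Here \<open>s = |x - y|\<^sup>2\<close>. With \<open>\<phi> = \<theta>\<^sup>-\<^sup>6 Y\<close> as a function of \<open>s\<close>, \<open>f\<close> and \<open>bQ\<close> are \<open>\<phi>'\<close> and \<open>4 \<phi>''\<close>, so
  that \<open>2 f (x - y)\<close> is the gradient in \<open>x\<close> and \<open>R\<close> its second derivative along \<open>x - y\<close>; \<open>\<zeta>2\<close> is the
  square of the norm of that gradient.
  
  There are three zones. For \<open>\<zeta>2 \<le> 16\<close> (\<open>crude_zone\<close>) the gradient \<open>2 f (x - y)\<close> may be cancelled by that of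
  \<open>|x - x0|\<^sup>2\<close>, but the Hessian is at most of order \<open>\<theta>\<^bsup>-23\<^esup>\<close>. For \<open>\<zeta>2 \<ge> 16\<close> and \<open>s\<^sup>2 \<le> 12 \<theta>\<^sup>7\<^sup>2\<close>
  (\<open>sync_zone\<close>) the profile may fail to be concave, but the synchronous coupling leaves only the effect of the angle
  between the two gradients. For \<open>s\<^sup>2 \<ge> 12 \<theta>\<^sup>7\<^sup>2\<close> (\<open>outer_zone\<close>) concavity and reflection produce a negative
  term of order \<open>1 / (\<theta>\<^sup>6 Y\<^sup>3)\<close>.
\<close>

locale doubling_fun_numbers =
  fixes q \<theta> Y s :: real
  assumes q: "0 \<le> q" "q < 1" and \<theta>: "\<theta> > 0" "\<theta>^24 \<le> (1 - q) / 700"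
    and s: "s \<ge> 0" and Y: "Y > 0" "Y^8 = s\<^sup>2 + \<theta>^72"
begin

definition "f = s / (4 * \<theta>^6 * Y^7)"
definition "bQ = (1 / \<theta>^6) * (1 / Y^7 - 7 * s\<^sup>2 / (4 * Y^15))"
definition "R = 2 * f + bQ * s"
definition "\<zeta>2 = 4 * f\<^sup>2 * s"

lemma f0: "f \<ge> 0" using s \<theta> Y by (simp add: f_def)

lemma th1: "\<theta> \<le> 1"
proof -
  have "\<theta>^24 \<le> 1^24" using \<theta>(2) q by simp
  then show ?thesis using \<theta>(1) by (metis power_mono_iff zero_le_one zero_less_numeral less_imp_le)
qed

lemma Yge: "\<theta>^9 \<le> Y"
proof -
  have "(\<theta>^9)^8 \<le> Y^8" using Y by (simp flip: power_mult)
  then show ?thesis using Y \<theta> by (meson power_mono_iff zero_less_numeral less_imp_le zero_less_power)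
qed

lemma bQ_bound: "\<bar>bQ\<bar> * s \<le> 4 * f"
proof -
  have "7 * s\<^sup>2 / (4 * Y^15) \<le> 7 * Y^8 / (4 * Y^15)"
    using Y \<theta> by (intro divide_right_mono) auto
  also have "\<dots> = (7/4) * (1 / Y^7)" proof -
    have e: "Y^15 = Y^8 * Y^7" by (simp flip: power_add)
    have l: "7 * a / (4 * (a * b)) = (7/4) * (1 / b)" if "a \<noteq> 0" for a b :: real
      using that by simp
    show ?thesis unfolding e by (rule l) (use Y(1) in auto)
  qed
  finally have a: "7 * s\<^sup>2 / (4 * Y^15) \<le> (7/4) * (1 / Y^7)" .
  have b: "7 * s\<^sup>2 / (4 * Y^15) \<ge> 0" "1 / Y^7 \<ge> 0" using Y by auto
  have c: "\<bar>1 / Y^7 - 7 * s\<^sup>2 / (4 * Y^15)\<bar> \<le> 1 / Y^7" using a b by linarith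
  have "\<bar>bQ\<bar> = (1 / \<theta>^6) * \<bar>1 / Y^7 - 7 * s\<^sup>2 / (4 * Y^15)\<bar>"
    unfolding bQ_def abs_mult using \<theta>(1) by simp
  also have "\<dots> \<le> (1 / \<theta>^6) * (1 / Y^7)" by (rule mult_left_mono[OF c]) (use \<theta>(1) in simp)
  finally have "\<bar>bQ\<bar> \<le> (1 / \<theta>^6) * (1 / Y^7)" .
  from this have "\<bar>bQ\<bar> * s \<le> (1 / \<theta>^6) * (1 / Y^7) * s" using s by (rule mult_right_mono)
  also have "\<dots> = 4 * f" by (simp add: f_def)
  finally show ?thesis .
qed

lemma zeta2_eq: "\<zeta>2 = 16 * f^3 * (\<theta>^6 * Y^7)"
proof -
  have "s = 4 * f * (\<theta>^6 * Y^7)" using \<theta> Y by (simp add: f_def)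
  then have "\<zeta>2 = 4 * f\<^sup>2 * (4 * f * (\<theta>^6 * Y^7))" unfolding \<zeta>2_def by simp
  then show ?thesis by (simp add: power2_eq_square power3_eq_cube algebra_simps)
qed

text \<open>
  In the inner region \<open>Y\<close> is comparable with \<open>\<theta>\<^sup>9\<close>, so the negative part of the time derivative, which comes
  from the factor \<open>\<theta>\<^sup>-\<^sup>6\<close>, is absorbed by the derivative of \<open>E \<theta>\<close>. The factor \<open>(1 - q) / 120\<close> is \<open>\<rho> / 24\<close>.
\<close>

lemma inner_Y: "s\<^sup>2 \<le> 12 * \<theta>^72 \<Longrightarrow> 6 * ((1 - q) / 120) * Y / \<theta>^30 \<le> 12 * ((1 - q) / 120) / \<theta>^23"
proof -
  assume "s\<^sup>2 \<le> 12 * \<theta>^72"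
  then have "Y^8 \<le> 13 * \<theta>^72" using Y by simp
  also have "\<dots> \<le> 256 * \<theta>^72" using \<theta> by (intro mult_right_mono) auto
  also have "\<dots> = (2 * \<theta>^9)^8" by (simp add: power_mult_distrib flip: power_mult)
  finally have "Y \<le> 2 * \<theta>^9" using Y \<theta> by (smt (verit) power_mono_iff zero_less_numeral zero_less_power)
  also have "\<theta>^9 \<le> \<theta>^7" using \<theta> th1 by (intro power_decreasing) auto
  finally have "Y \<le> 2 * \<theta>^7" by simp
  then have "6 * ((1 - q) / 120) * Y / \<theta>^30 \<le> 6 * ((1 - q) / 120) * (2 * \<theta>^7) / \<theta>^30"
    using q \<theta> by (intro divide_right_mono mult_left_mono) auto
  also have "\<dots> = 12 * ((1 - q) / 120) / \<theta>^23"
    using \<theta> by (simp add: field_simps flip: power_add)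
  finally show ?thesis .
qed

lemma crude_zone: "\<zeta>2 \<le> 16 \<Longrightarrow> f \<le> 1 / \<theta>^23"
proof -
  assume "\<zeta>2 \<le> 16"
  then have 1: "f^3 * (\<theta>^6 * Y^7) \<le> 1" unfolding zeta2_eq by simp
  have "(\<theta>^9)^7 \<le> Y^7" using Yge \<theta> by (intro power_mono) auto
  then have "\<theta>^69 \<le> \<theta>^6 * Y^7" using \<theta> mult_left_mono[of "(\<theta>^9)^7" "Y^7" "\<theta>^6"]
    by (simp flip: power_mult power_add)
  then have "f^3 * \<theta>^69 \<le> f^3 * (\<theta>^6 * Y^7)" using f0 by (intro mult_left_mono) auto
  then have "(f * \<theta>^23)^3 \<le> 1^3" using 1 by (simp add: power_mult_distrib flip: power_mult)
  then have "f * \<theta>^23 \<le> 1" using f0 \<theta> by (meson mult_nonneg_nonneg power_mono_iff zero_le_one zero_le_power zero_less_numeral less_imp_le)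
  then show ?thesis using \<theta> by (simp add: field_simps)
qed

lemma sync_zone:
  assumes "\<zeta>2 \<ge> 16"
  shows "128 * f / \<zeta>2 \<le> 8 / \<theta>^23"
proof -
  define W where "W = \<theta>^6 * Y^7"
  have W: "W > 0" using \<theta> Y by (simp add: W_def)
  have 1: "f^3 * W \<ge> 1" using assms unfolding zeta2_eq W_def by simp
  have fp: "f > 0" using 1 f0 by (cases "f = 0") auto
  have "(\<theta>^9)^7 \<le> Y^7" using Yge \<theta> by (intro power_mono) auto
  then have "\<theta>^69 \<le> W" unfolding W_def using \<theta> mult_left_mono[of "(\<theta>^9)^7" "Y^7" "\<theta>^6"]
    by (simp flip: power_mult power_add)
  also have "W \<le> (f^3 * W)^2 * W" using 1 W by (simp add: one_le_power)
  also have "\<dots> = (f\<^sup>2 * W)^3" by (simp add: power_mult_distrib power2_eq_square power3_eq_cube algebra_simps flip: power_mult)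
  finally have "(\<theta>^23)^3 \<le> (f\<^sup>2 * W)^3" by (simp flip: power_mult)
  then have 2: "\<theta>^23 \<le> f\<^sup>2 * W" using \<theta> W fp
    by (meson power_mono_iff zero_less_numeral less_imp_le zero_less_power mult_pos_pos)
  have "128 * f / \<zeta>2 = 8 / (f\<^sup>2 * W)"
    unfolding zeta2_eq W_def[symmetric] using fp W by (simp add: field_simps power2_eq_square power3_eq_cube)
  also have "\<dots> \<le> 8 / \<theta>^23" using 2 \<theta> fp W by (intro divide_left_mono mult_pos_pos) auto
  finally show ?thesis .
qed

context
  assumes out: "12 * \<theta>^72 \<le> s\<^sup>2" and Yl: "Y < \<theta>^6"
begin

text \<open>
  The decimal constants rest on \<open>12/13 > 0.9216 = 0.96\<^sup>2\<close>.
\<close>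

lemma s_ge: "(96/100) * Y^4 \<le> s" "(9216/10000) * Y^8 \<le> s\<^sup>2"
proof -
  have "\<theta>^72 \<ge> 0" using \<theta> by simp
  moreover have "9216/10000 * (u + t) \<le> u" if "0 \<le> t" "12 * t \<le> u" for t u :: real
    using that by argo
  ultimately show 1: "(9216/10000) * Y^8 \<le> s\<^sup>2" using out unfolding Y(2) by blast
  have "((96/100) * Y^4)\<^sup>2 = (9216/10000) * Y^8" by (simp add: power2_eq_square flip: power_add)
  then show "(96/100) * Y^4 \<le> s" using 1 s by (metis power2_le_imp_le)
qed

lemma s3_ge: "(88/100) * Y^12 \<le> s^3"
proof -
  have "((96/100) * Y^4)^3 \<le> s^3" using s_ge(1) Y by (intro power_mono) auto
  moreover have "((96/100) * Y^4)^3 = (884736/1000000) * Y^12"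
    by (simp add: power_mult_distrib power3_eq_cube flip: power_mult power_add)
  moreover have "(88/100) * Y^12 \<le> (884736/1000000) * Y^12" using Y by simp
  ultimately show ?thesis by linarith
qed

text \<open>
  In the outer zone the gradient is large automatically, as \<open>\<theta>\<close> is small; the gradient of the localizing term
  cannot cancel it there.
\<close>

lemma zeta2_outer: "\<zeta>2 \<ge> 16"
proof -
  have z: "\<zeta>2 = s^3 / (4 * (\<theta>^12 * Y^14))"
    using \<theta> Y unfolding \<zeta>2_def f_def
    by (simp add: power_divide power_mult_distrib power2_eq_square power3_eq_cube flip: power_add power_mult)
  have "Y\<^sup>2 \<le> (\<theta>^6)\<^sup>2" using Yl Y by (intro power_mono) auto
  then have a: "Y\<^sup>2 \<le> \<theta>^12" by (simp flip: power_mult)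
  have "\<theta>^12 * Y\<^sup>2 \<le> \<theta>^12 * \<theta>^12" using a \<theta> by (intro mult_left_mono) auto
  also have "\<dots> = \<theta>^24" by (simp flip: power_add)
  also have "\<dots> \<le> 1 / 700" using \<theta> q by simp
  finally have b: "\<theta>^12 * Y\<^sup>2 \<le> 1 / 700" .
  have "16 * (4 * (\<theta>^12 * Y^14)) = 64 * (\<theta>^12 * Y\<^sup>2) * Y^12" by (simp flip: power_add)
  also have "\<dots> \<le> 64 * (1/700) * Y^12" using b Y by (intro mult_right_mono mult_left_mono) auto
  also have "\<dots> \<le> (88/100) * Y^12" using Y by simp
  also have "\<dots> \<le> s^3" by (rule s3_ge)
  finally show ?thesis unfolding z using \<theta> Y by (simp add: pos_le_divide_eq)
qed

text \<open>
  The radial second derivative \<open>R\<close> is at most \<open>-11/100 g\<close> with \<open>g = 1 / (\<theta>\<^sup>6 Y\<^sup>3)\<close>. The factor \<open>1 - q\<close> is the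
  gain of the reflection coupling; it has to outweigh the angle between the gradients (the second term,
  \<open>1/20\<close>) and the decrease of \<open>\<theta>\<^sup>-\<^sup>6\<close> in time (the third term, \<open>1/20\<close>). The latter is why the speed
  \<open>\<rho>\<close> is as small as \<open>(1 - q) / 5\<close>.
\<close>

lemma outer_zone:
  "R \<le> 0" "R * (1 - q) + 2 * f * (16 / \<zeta>2) + 6 * ((1 - q) / 120) * Y / \<theta>^30 \<le> 0"
proof -
  define g where "g = 1 / (\<theta>^6 * Y^3)"
  have g: "g > 0" using \<theta> Y by (simp add: g_def)
  have Ye: "Y^15 = Y^12 * Y^3" "Y^15 = Y^7 * Y^8" by (simp_all flip: power_add)
  have R1: "R = (s / (\<theta>^6 * Y^15)) * ((3/2) * Y^8 - (7/4) * s\<^sup>2)"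
  proof -
    have "2 * (s / (4 * t * a)) + (1 / t) * (1 / a - 7 * s\<^sup>2 / (4 * (a * b))) * s
      = (s / (t * (a * b))) * ((3/2) * b - (7/4) * s\<^sup>2)" if "t \<noteq> 0" "a \<noteq> 0" "b \<noteq> 0" for t a b
      using that by (simp add: field_simps)
    from this[of "\<theta>^6" "Y^7" "Y^8"] show ?thesis
      using \<theta>(1) Y(1) unfolding R_def f_def bQ_def Ye(2) by simp
  qed
  have Y8: "(3/2) * Y^8 \<le> (13/8) * s\<^sup>2" using out Y by simp
  have "R \<le> (s / (\<theta>^6 * Y^15)) * (- (1/8) * s\<^sup>2)"
    unfolding R1
  proof (rule mult_left_mono)
    show "(3/2) * Y^8 - (7/4) * s\<^sup>2 \<le> - (1/8) * s\<^sup>2"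
      using Y8 by argo
  qed (use s \<theta> Y in auto)
  also have "\<dots> = - (1/8) * s^3 / (\<theta>^6 * Y^15)" by (simp add: power2_eq_square power3_eq_cube)
  also have "\<dots> \<le> - (1/8) * ((88/100) * Y^12) / (\<theta>^6 * Y^15)"
    using s3_ge \<theta> Y by (intro divide_right_mono) auto
  also have "\<dots> = - (11/100) * g"
  proof -
    have l: "- (1/8) * ((88/100) * a) / (t * (a * b)) = - (11/100) * (1 / (t * b))" if "a \<noteq> 0" for a b t :: real
      using that by simp
    show ?thesis unfolding g_def Ye(1) by (rule l) (use Y(1) in auto)
  qed
  finally have Rg: "R \<le> - (11/100) * g" .
  then show "R \<le> 0" using g by simp
  have "0 < (96/100) * Y^4" using Y(1) by simp
  then have sp: "s > 0" using s_ge(1) by linarith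
  have fp: "f > 0" using sp \<theta> Y by (simp add: f_def)
  have "2 * f * (16 / \<zeta>2) = 32 * (\<theta>^6 * Y^7) / s\<^sup>2"
    using sp \<theta> Y unfolding \<zeta>2_def f_def by (simp add: field_simps power2_eq_square)
  also have "\<dots> \<le> 32 * (\<theta>^6 * Y^7) / ((9216/10000) * Y^8)"
  proof (rule divide_left_mono[OF s_ge(2)])
    show "0 < s\<^sup>2 * ((9216/10000) * Y^8)" using sp Y(1) by (intro mult_pos_pos) auto
  qed (use \<theta>(1) Y(1) in simp)
  also have "\<dots> = (320000/9216) * (\<theta>^12 * Y\<^sup>2) * g"
  proof -
    have e: "Y^8 = Y^7 * Y" "\<theta>^12 = \<theta>^6 * \<theta>^6" by (simp_all flip: power_Suc2 power_add)
    have l: "32 * (t * a) / ((9216/10000) * (a * y)) = (320000/9216) * (t * t * y\<^sup>2) * (1 / (t * y^3))"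
      if "a \<noteq> 0" "t \<noteq> 0" "y \<noteq> 0" for a t y :: real
      using that by (simp add: field_simps power2_eq_square power3_eq_cube)
    show ?thesis unfolding g_def e by (rule l) (use Y(1) \<theta>(1) in auto)
  qed
  also have "\<dots> \<le> (1/20) * (1 - q) * g"
  proof (rule mult_right_mono)
    have "Y\<^sup>2 \<le> (\<theta>^6)\<^sup>2" using Yl Y by (intro power_mono) auto
    then have "Y\<^sup>2 \<le> \<theta>^12" by (simp flip: power_mult)
    then have "\<theta>^12 * Y\<^sup>2 \<le> \<theta>^12 * \<theta>^12" using \<theta> by (intro mult_left_mono) auto
    also have "\<dots> = \<theta>^24" by (simp flip: power_add)
    finally have "\<theta>^12 * Y\<^sup>2 \<le> (1 - q) / 700" using \<theta> by simp
    have l: "(320000/9216) * a \<le> (1/20) * r" if "a \<le> r / 700" "0 < r" for a r :: real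
      using that by argo
    show "(320000/9216) * (\<theta>^12 * Y\<^sup>2) \<le> (1/20) * (1 - q)"
      by (rule l[OF \<open>\<theta>^12 * Y\<^sup>2 \<le> (1 - q) / 700\<close>]) (use q in simp)
  qed (use g in auto)
  finally have e1: "2 * f * (16 / \<zeta>2) \<le> (1/20) * (1 - q) * g" .
  have "Y / \<theta>^30 \<le> g"
  proof -
    have "Y^4 \<le> (\<theta>^6)^4" using Yl Y by (intro power_mono) auto
    then have "Y^4 \<le> \<theta>^24" by (simp flip: power_mult)
    then have "Y * (\<theta>^6 * Y^3) \<le> \<theta>^30"
      using mult_left_mono[of "Y^4" "\<theta>^24" "\<theta>^6"] \<theta> by (simp add: power_numeral_reduce algebra_simps)
    then show ?thesis using \<theta>(1) Y(1) unfolding g_def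
      by (simp add: divide_le_eq le_divide_eq mult.commute)
  qed
  then have e2: "6 * ((1 - q) / 120) * (Y / \<theta>^30) \<le> 6 * ((1 - q) / 120) * g"
    using q by (intro mult_left_mono) auto
  have e3: "R * (1 - q) \<le> - (11/100) * g * (1 - q)" using Rg q by (intro mult_right_mono) auto
  have "R * (1 - q) + 2 * f * (16 / \<zeta>2) + 6 * ((1 - q) / 120) * (Y / \<theta>^30) \<le> - (1/100) * (g * (1 - q))"
  proof -
    have l: "a + b + c \<le> - (1/100) * (g * k)"
      if "a \<le> - (11/100) * g * k" "b \<le> (1/20) * k * g" "c \<le> 6 * (k / 120) * g" for a b c k
      using that by (simp add: mult_ac)
    show ?thesis by (rule l[OF e3 e1 e2])
  qed
  also have "\<dots> \<le> 0" using g q by simp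
  finally show "R * (1 - q) + 2 * f * (16 / \<zeta>2) + 6 * ((1 - q) / 120) * Y / \<theta>^30 \<le> 0" by simp
qed

end

end

text \<open>
  The size of the coupled directions along the second gradient under reflection; \<open>C\<close> is the squared cosine of the angle between
  the gradients. For \<open>C = 1\<close> it equals \<open>4 \<alpha>2\<^sup>2\<close>.
\<close>

lemma reflection_form_bound:
  fixes \<alpha>1 \<alpha>2 C :: real
  assumes "0 \<le> \<alpha>1" "0 \<le> \<alpha>2" "0 \<le> C" "C \<le> 1"
  shows "\<alpha>2\<^sup>2 \<le> (\<alpha>2 - \<alpha>1)\<^sup>2 * C + (- \<alpha>2 - \<alpha>1)\<^sup>2 - 2 * (\<alpha>2 - \<alpha>1) * (- \<alpha>2 - \<alpha>1) * C"
proof -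
  have "(\<alpha>2 - \<alpha>1)\<^sup>2 * C + (- \<alpha>2 - \<alpha>1)\<^sup>2 - 2 * (\<alpha>2 - \<alpha>1) * (- \<alpha>2 - \<alpha>1) * C
     = (\<alpha>1 + \<alpha>2)\<^sup>2 * (1 - C) + 4 * \<alpha>2\<^sup>2 * C"
    by (simp add: power2_eq_square algebra_simps)
  moreover have "\<alpha>2\<^sup>2 * (1 - C) \<le> (\<alpha>1 + \<alpha>2)\<^sup>2 * (1 - C)"
    using assms by (intro mult_right_mono power_mono) auto
  moreover have "\<alpha>2\<^sup>2 * C \<le> 4 * \<alpha>2\<^sup>2 * C" using assms by (intro mult_right_mono) auto
  moreover have "\<alpha>2\<^sup>2 = \<alpha>2\<^sup>2 * (1 - C) + \<alpha>2\<^sup>2 * C" by (simp add: algebra_simps)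
  ultimately show ?thesis by linarith
qed

text \<open>
  The squared sine of the angle between \<open>z\<close> and \<open>z + \<beta>\<close> is at most \<open>|\<beta>|\<^sup>2 / |z + \<beta>|\<^sup>2\<close>. It is applied to the
  gradient \<open>z\<close> of the term in \<open>x - y\<close> and the gradient \<open>\<beta>\<close> of the localizing term.
\<close>

lemma perturbed_direction:
  fixes w z \<beta> :: "'b::real_inner"
  assumes w: "w = z + \<beta>" and \<beta>: "norm \<beta> \<le> 2" and z: "norm z \<ge> 4"
  defines "e1 \<equiv> (1 / norm w) *\<^sub>R w" and "e \<equiv> (1 / norm z) *\<^sub>R z"
  shows "w \<noteq> 0" "1 - (e1 \<bullet> e)\<^sup>2 \<le> 16 / (norm z)\<^sup>2" "(e1 \<bullet> e)\<^sup>2 \<le> 1"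
proof -
  have nz: "norm z > 0" using z by linarith
  have nw: "norm z / 2 \<le> norm w"
  proof -
    have "norm z \<le> norm w + norm \<beta>" using norm_triangle_ineq4[of w \<beta>] by (simp add: w)
    then show ?thesis using \<beta> z by linarith
  qed
  then have wp: "norm w > 0" using nz by linarith
  then show "w \<noteq> 0" by auto
  have "z \<noteq> 0" "w \<noteq> 0" using nz wp by auto
  then have n: "norm e = 1" "norm e1 = 1" by (simp_all add: e_def e1_def)
  then have ee: "e \<bullet> e = 1" by (simp add: dot_square_norm)
  have z': "z = norm z *\<^sub>R e" using nz by (simp add: e_def)
  have "\<bar>e1 \<bullet> e\<bar> \<le> 1" using Cauchy_Schwarz_ineq2[of e1 e] n by simp
  then show "(e1 \<bullet> e)\<^sup>2 \<le> 1" by (simp add: abs_square_le_1)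
  have "(norm w)\<^sup>2 - (w \<bullet> e)\<^sup>2 = (norm \<beta>)\<^sup>2 - (\<beta> \<bullet> e)\<^sup>2"
  proof -
    have "w \<bullet> e = norm z + \<beta> \<bullet> e" unfolding w by (subst z') (simp add: inner_add_left ee)
    moreover have "(norm w)\<^sup>2 = (norm z)\<^sup>2 + 2 * norm z * (\<beta> \<bullet> e) + (norm \<beta>)\<^sup>2"
    proof -
      have "z \<bullet> \<beta> = norm z * (\<beta> \<bullet> e)" by (subst z') (simp add: inner_commute)
      then show ?thesis unfolding w by (simp add: power2_norm_eq_inner inner_add_left inner_add_right inner_commute)
    qed
    ultimately show ?thesis by (simp add: power2_eq_square algebra_simps)
  qed
  also have "\<dots> \<le> 2\<^sup>2" using \<beta> by (smt (verit) norm_ge_zero power_mono zero_le_power2)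
  finally have a: "(norm w)\<^sup>2 - (w \<bullet> e)\<^sup>2 \<le> 4" by simp
  have "1 - (e1 \<bullet> e)\<^sup>2 = ((norm w)\<^sup>2 - (w \<bullet> e)\<^sup>2) / (norm w)\<^sup>2"
    using wp by (simp add: e1_def power_divide diff_divide_distrib)
  also have "\<dots> \<le> 4 / (norm w)\<^sup>2" using a by (intro divide_right_mono) auto
  also have "\<dots> \<le> 4 / (norm z / 2)\<^sup>2"
    using nw nz wp by (intro divide_left_mono power_mono mult_pos_pos) auto
  finally show "1 - (e1 \<bullet> e)\<^sup>2 \<le> 16 / (norm z)\<^sup>2" by (simp add: power_divide)
qed

lemma square_sqrt_diff: "0 \<le> a \<Longrightarrow> 0 \<le> b \<Longrightarrow> (sqrt a - sqrt b)\<^sup>2 \<le> \<bar>a - b\<bar>"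
proof -
  assume ab: "0 \<le> a" "0 \<le> b"
  have "(sqrt a - sqrt b)\<^sup>2 = \<bar>sqrt a - sqrt b\<bar> * \<bar>sqrt a - sqrt b\<bar>"
    by (simp add: power2_eq_square)
  also have "\<dots> \<le> \<bar>sqrt a - sqrt b\<bar> * (sqrt a + sqrt b)"
    using real_sqrt_ge_zero[OF ab(1)] real_sqrt_ge_zero[OF ab(2)]
    by (intro mult_left_mono) linarith+
  also have "\<dots> = \<bar>(sqrt a - sqrt b) * (sqrt a + sqrt b)\<bar>" using ab by (simp add: abs_mult)
  also have "(sqrt a - sqrt b) * (sqrt a + sqrt b) = a - b" using ab by (simp add: algebra_simps)
  finally show ?thesis .
qed

text \<open>
  The doubling function is a strict supersolution for the coupled inequality, so no sum of two subsolutions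
  can touch it. Its time derivative \<open>\<sigma>\<close> contains the large term \<open>(1 - q) / 120 * E / \<theta>\<^bsup>23\<^esup>\<close>; in each of the
  three zones the right-hand side of the coupled (or, in the crude zone, of the uncoupled) inequality
  is smaller.
\<close>

theorem doubling_fun_no_touch:
  fixes w1 w2 :: "'b::euclidean_space \<times> real \<Rightarrow> real"
  assumes touch: "touching_pair q L w1 w2 (doubling_fun m c E \<rho> \<tau> p0) G H O1 O2 O3 x0 y0 t0"
    and jet: "doubling_fun_jet m E \<rho> \<tau> p0 G H"
    and q: "0 \<le> q" "q < 1" and m: "m > 0" and \<rho>: "\<rho> = (1 - q) / 5"
    and near: "norm (x0 - p0) \<le> 1" and pos: "\<tau> + \<rho> * t0 > 0"
    and small: "\<tau> + \<rho> * t0 \<le> (1 - q) / 700"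
    and Ysmall: "((norm (x0 - y0))^4 + (\<tau> + \<rho> * t0)^3) powr (1/8) < (\<tau> + \<rho> * t0) powr (1/4)"
    and E: "(1 - q) / 120 * (E - 12) > 14 * (DIM('b) + 1)"
  shows False
proof -
  interpret touching_pair q L w1 w2 "doubling_fun m c E \<rho> \<tau> p0" G H O1 O2 O3 x0 y0 t0 by fact
  define N where "N = real DIM('b)"
  have N: "N \<ge> 0" by (simp add: N_def)
  define \<theta> where "\<theta> = (\<tau> + \<rho> * t0) powr (1/24)"
  define Y where "Y = ((norm (x0 - y0))^4 + (\<tau> + \<rho> * t0)^3) powr (1/8)"
  define s where "s = (norm (x0 - y0))\<^sup>2"
  define d where "d = x0 - y0"
  have th: "\<theta>^k = (\<tau> + \<rho> * t0) powr (real k / 24)" for k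
    unfolding \<theta>_def using powr_root_powers[OF pos, of 24 k] by simp
  have th24: "\<theta>^24 = \<tau> + \<rho> * t0" using pos by (simp add: th)
  have U: "(norm (x0 - y0))^4 + (\<tau> + \<rho> * t0)^3 > 0" using pos by (intro add_nonneg_pos) auto
  have s2: "s\<^sup>2 = (norm (x0 - y0))^4" by (simp add: s_def flip: power_mult)
  have "\<theta>^72 = (\<theta>^24)^3" by (simp flip: power_mult)
  then have th72: "\<theta>^72 = (\<tau> + \<rho> * t0)^3" by (simp add: th24)
  interpret doubling_fun_numbers q \<theta> Y s
  proof
    show "0 < \<theta>" using pos by (simp add: \<theta>_def)
    show "Y > 0" using U by (simp add: Y_def)
    show "Y^8 = s\<^sup>2 + \<theta>^72"
      unfolding Y_def s2 th72 using powr_root_powers[OF U, of 8 8] U by simp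
  qed (use q small in \<open>auto simp: th24 s_def\<close>)
  have Yl: "Y < \<theta>^6" using Ysmall unfolding th Y_def by simp
  note jets = jet[unfolded doubling_fun_jet_def, rule_format, OF pos \<theta>_def Y_def, folded z0_def s_def d_def]
  have f2: "s / (2 * \<theta>^6 * Y^7) = 2 * f" by (simp add: f_def)
  have G1: "fst (G z0) = m *\<^sub>R ((2 * f) *\<^sub>R d + 2 *\<^sub>R (x0 - p0))"
    and G2: "fst (snd (G z0)) = - (m *\<^sub>R ((2 * f) *\<^sub>R d))"
    and G3: "snd (snd (G z0)) = m * \<rho> * (- Y / (4 * \<theta>^30) + 3 * \<theta>^48 / (8 * \<theta>^6 * Y^7) + E / (24 * \<theta>^23))"
    using jets unfolding f2 by blast+
  have He: "H z0 (h1, h2, 0) \<bullet> (h1, h2, 0) = m * (2 * f * (norm (h1 - h2))\<^sup>2 + bQ * (d \<bullet> (h1 - h2))\<^sup>2 + 2 * (norm h1)\<^sup>2)" for h1 h2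
  proof -
    have e: "H z0 (h1, h2, 0) \<bullet> (h1, h2, 0) = m * ((1 / \<theta>^6) * (s * (norm (h1 - h2))\<^sup>2 / (2 * Y^7)
              + (d \<bullet> (h1 - h2))\<^sup>2 * (1 / Y^7 - 7 * s\<^sup>2 / (4 * Y^15)))
            + 2 * (norm h1)\<^sup>2)"
      using jets unfolding s2[folded d_def, symmetric] by blast
    show ?thesis unfolding e f_def bQ_def by (simp add: algebra_simps)
  qed
  define \<sigma> where "\<sigma> = snd (snd (G z0))"
  have \<sigma>: "\<sigma> \<ge> m * ((1 - q) / 120 * E / \<theta>^23 - 6 * ((1 - q) / 120) * Y / \<theta>^30)"
  proof -
    have "3 * \<theta>^48 / (8 * \<theta>^6 * Y^7) \<ge> 0" using \<theta>(1) Y(1) by simp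
    then have "(1 - q) / 5 * (- Y / (4 * \<theta>^30) + E / (24 * \<theta>^23)) \<le> (1 - q) / 5 * (- Y / (4 * \<theta>^30) + 3 * \<theta>^48 / (8 * \<theta>^6 * Y^7) + E / (24 * \<theta>^23))"
      using q by (intro mult_left_mono) auto
    moreover have "(1 - q) / 5 * (- Y / (4 * \<theta>^30) + E / (24 * \<theta>^23)) = (1 - q) / 120 * E / \<theta>^23 - 6 * ((1 - q) / 120) * Y / \<theta>^30"
    proof -
      have l: "k / 5 * (- Y / (4 * a) + E / (24 * b)) = k / 120 * E / b - 6 * (k / 120) * Y / a"
        if "a \<noteq> 0" "b \<noteq> 0" for k a b
        using that by (simp add: field_simps)
      show ?thesis by (rule l) (use \<theta>(1) in auto)
    qed
    ultimately have "(1 - q) / 120 * E / \<theta>^23 - 6 * ((1 - q) / 120) * Y / \<theta>^30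
      \<le> \<rho> * (- Y / (4 * \<theta>^30) + 3 * \<theta>^48 / (8 * \<theta>^6 * Y^7) + E / (24 * \<theta>^23))"
      unfolding \<rho> by linarith
    from mult_left_mono[OF this, of m] show ?thesis using m unfolding \<sigma>_def G3 by (simp add: mult.assoc)
  qed
  have t23: "1 / \<theta>^23 \<ge> 1" using th1 \<theta>(1) by (simp add: power_le_one)
  have Ebig: "(1 - q) / 120 * E / \<theta>^23 - 12 * ((1 - q) / 120) / \<theta>^23 > 14 * (N + 1) / \<theta>^23"
  proof -
    have "14 * (N + 1) / \<theta>^23 < (1 - q) / 120 * (E - 12) / \<theta>^23"
      using E \<theta>(1) by (intro divide_strict_right_mono) (auto simp: N_def)
    then show ?thesis by (simp add: right_diff_distrib diff_divide_distrib mult.commute)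
  qed
  have c12: "12 * ((1 - q) / 120) / \<theta>^23 \<ge> 0" using q \<theta>(1) by simp
  have sq: "s = d \<bullet> d" by (simp add: s_def d_def power2_norm_eq_inner)
  define z where "z = (2 * f) *\<^sub>R d"
  have nz: "(norm z)\<^sup>2 = \<zeta>2"
  proof -
    have "(norm z)\<^sup>2 = 4 * f\<^sup>2 * (norm d)\<^sup>2" by (simp add: z_def power_mult_distrib)
    then show ?thesis unfolding \<zeta>2_def by (simp add: s_def d_def)
  qed
  show False
  proof (cases "\<zeta>2 \<ge> 16")
    case False
    have inn: "s\<^sup>2 \<le> 12 * \<theta>^72"
      using zeta2_outer[OF _ Yl] False by force
    have fb: "f \<le> 1 / \<theta>^23" using crude_zone False by simp
    have Z: "\<bar>2 * f * (norm a)\<^sup>2 + bQ * (d \<bullet> a)\<^sup>2\<bar> \<le> 6 * f * (norm a)\<^sup>2" for a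
    proof -
      have "(d \<bullet> a)\<^sup>2 \<le> s * (norm a)\<^sup>2"
        using Cauchy_Schwarz_ineq[of d a] by (simp add: sq power2_norm_eq_inner)
      then have "\<bar>bQ\<bar> * (d \<bullet> a)\<^sup>2 \<le> \<bar>bQ\<bar> * (s * (norm a)\<^sup>2)" by (intro mult_left_mono) auto
      also have "\<dots> = (\<bar>bQ\<bar> * s) * (norm a)\<^sup>2" by simp
      also have "\<dots> \<le> 4 * f * (norm a)\<^sup>2" using bQ_bound by (intro mult_right_mono) auto
      finally have "\<bar>bQ * (d \<bullet> a)\<^sup>2\<bar> \<le> 4 * f * (norm a)\<^sup>2" by (simp add: abs_mult)
      moreover have "0 \<le> f * (norm a)\<^sup>2" using f0 by simp
      ultimately show ?thesis by linarith
    qed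
    have c1: "\<bar>H z0 (a, 0, 0) \<bullet> (a, 0, 0)\<bar> \<le> m * (6 * f + 2) * (norm a)\<^sup>2" for a
    proof -
      have "\<bar>2 * f * (norm a)\<^sup>2 + bQ * (d \<bullet> a)\<^sup>2 + 2 * (norm a)\<^sup>2\<bar> \<le> (6 * f + 2) * (norm a)\<^sup>2"
        unfolding distrib_right using Z[of a] zero_le_power2[of "norm a"] by linarith
      then show ?thesis using He[of a 0] m by (simp add: abs_mult mult.assoc)
    qed
    have c2: "\<bar>H z0 (0, a, 0) \<bullet> (0, a, 0)\<bar> \<le> m * (6 * f) * (norm a)\<^sup>2" for a
    proof -
      have "(d \<bullet> (0 - a))\<^sup>2 = (d \<bullet> a)\<^sup>2" by simp
      then show ?thesis using He[of 0 a] m Z[of a] by (simp add: abs_mult mult.assoc)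
    qed
    have "\<sigma> \<le> (N + 1) * (m * (6 * f + 2) + m * (6 * f))"
      using crude_bound[OF c1 c2] unfolding \<sigma>_def N_def by (simp add: add.commute)
    also have "\<dots> = m * ((N + 1) * (12 * f + 2))" by (simp add: algebra_simps)
    also have "\<dots> \<le> m * ((N + 1) * (14 * (1 / \<theta>^23)))"
    proof (intro mult_left_mono)
      show "12 * f + 2 \<le> 14 * (1 / \<theta>^23)" using fb t23 by linarith
    qed (use m N in auto)
    finally have "m * ((1 - q) / 120 * E / \<theta>^23 - 6 * ((1 - q) / 120) * Y / \<theta>^30) \<le> m * (14 * (N + 1) / \<theta>^23)"
      using \<sigma> by (simp add: mult_ac)
    then have "(1 - q) / 120 * E / \<theta>^23 - 6 * ((1 - q) / 120) * Y / \<theta>^30 \<le> 14 * (N + 1) / \<theta>^23"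
      using mult_le_cancel_left_pos[OF m] by blast
    then show False using Ebig inner_Y[OF inn] by linarith
  next
    case True
    have nz4: "norm z \<ge> 4"
    proof -
      have "4\<^sup>2 \<le> (norm z)\<^sup>2" using True nz by simp
      then show ?thesis by (rule power2_le_imp_le) simp
    qed
    define \<beta> where "\<beta> = 2 *\<^sub>R (x0 - p0)"
    have nb: "norm \<beta> \<le> 2" using near by (simp add: \<beta>_def)
    define w where "w = z + \<beta>"
    define e1 where "e1 = (1 / norm w) *\<^sub>R w"
    define e where "e = (1 / norm z) *\<^sub>R z"
    define C where "C = (e1 \<bullet> e)\<^sup>2"
    note pd = perturbed_direction[OF w_def nb nz4, folded e1_def e_def C_def, unfolded nz]
    have zne: "z \<noteq> 0" using nz4 by auto
    have ne: "norm e1 = 1" "norm e = 1" using pd(1) zne by (auto simp: e1_def e_def)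
    have fp: "f > 0" using zne f0 by (auto simp: z_def less_le)
    have dne: "norm d > 0" using zne by (auto simp: z_def)
    have de: "d = norm d *\<^sub>R e" using dne fp by (simp add: e_def z_def)
    have de2: "(d \<bullet> v)\<^sup>2 = s * (e \<bullet> v)\<^sup>2" for v
    proof -
      have "d \<bullet> v = norm d * (e \<bullet> v)" by (subst de) simp
      then show ?thesis by (simp add: power_mult_distrib sq power2_norm_eq_inner)
    qed
    have xi1: "fst (G z0) = (m * norm w) *\<^sub>R e1"
      using pd(1) by (simp add: G1 e1_def w_def z_def \<beta>_def)
    have xi2: "fst (snd (G z0)) = (- m * norm z) *\<^sub>R e"
      using zne by (simp add: G2 e_def z_def)
    have nonz: "fst (G z0) \<noteq> 0" "fst (snd (G z0)) \<noteq> 0"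
      using pd(1) zne m ne unfolding xi1 xi2 by auto
    define Cst where "Cst = H z0 (0, 0, 1) \<bullet> (0, 0, 1) + 4 * L * DIM('b \<times> real) + 2 * m * N"
    \<comment> \<open>The coupled inequality with \<open>S1\<close>, \<open>S2\<close> from \<open>rank1\<close>, after letting \<open>\<kappa>\<close> tend to \<open>0\<close>. The coefficient of the first gradient is fixed as \<open>\<alpha>2 - \<alpha>1\<close>; the one of the second, \<open>\<beta>2\<close>, chooses between synchronous coupling and reflection. \<open>2 (N + 1)\<close> comes from the localizing term.\<close>
    have main: "\<sigma> \<le> m * (B + 2 * (N + 1))"
      if B: "\<And>\<alpha>1 \<alpha>2 \<kappa>::real. \<kappa> > 0 \<Longrightarrow> \<alpha>1 = sqrt (q + \<kappa>\<^sup>2) \<Longrightarrow> \<alpha>2 = sqrt (1 - q + \<kappa>\<^sup>2) \<Longrightarrow>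
         \<exists>\<beta>2. (\<alpha>1 + \<beta>2 = \<alpha>2 \<or> \<alpha>1 + \<beta>2 = - \<alpha>2) \<and>
          2 * f * ((\<alpha>2 - \<alpha>1)\<^sup>2 + \<beta>2\<^sup>2 - 2 * (\<alpha>2 - \<alpha>1) * \<beta>2 * C)
          + bQ * s * ((\<alpha>2 - \<alpha>1)\<^sup>2 * C + \<beta>2\<^sup>2 - 2 * (\<alpha>2 - \<alpha>1) * \<beta>2 * C) \<le> B" for B
    proof (rule le_of_le_add_square_mult)
      fix \<kappa> :: real assume \<kappa>: "\<kappa> > 0"
      define \<alpha>1 where "\<alpha>1 = sqrt (q + \<kappa>\<^sup>2)"
      define \<alpha>2 where "\<alpha>2 = sqrt (1 - q + \<kappa>\<^sup>2)"
      have ap: "q + \<kappa>\<^sup>2 > 0" "1 - q + \<kappa>\<^sup>2 > 0" using q \<kappa> by (auto intro: add_nonneg_pos)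
      then have a: "\<alpha>1 > 0" "\<alpha>2 > 0" "\<alpha>1\<^sup>2 = q + \<kappa>\<^sup>2" "\<alpha>2\<^sup>2 = 1 - q + \<kappa>\<^sup>2" by (auto simp: \<alpha>1_def \<alpha>2_def)
      obtain \<beta>2 where \<beta>2: "\<alpha>1 + \<beta>2 = \<alpha>2 \<or> \<alpha>1 + \<beta>2 = - \<alpha>2"
        and Bb: "2 * f * ((\<alpha>2 - \<alpha>1)\<^sup>2 + \<beta>2\<^sup>2 - 2 * (\<alpha>2 - \<alpha>1) * \<beta>2 * C)
          + bQ * s * ((\<alpha>2 - \<alpha>1)\<^sup>2 * C + \<beta>2\<^sup>2 - 2 * (\<alpha>2 - \<alpha>1) * \<beta>2 * C) \<le> B"
        using B[OF \<kappa> \<alpha>1_def \<alpha>2_def] by blast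
      define S1 where "S1 = rank1 \<alpha>1 (\<alpha>2 - \<alpha>1) e1"
      define S2 where "S2 = rank1 \<alpha>1 \<beta>2 e"
      have r1: "trace_root q \<kappa> (fst (G z0)) S1"
        unfolding S1_def xi1 by (rule trace_root_rank1) (use ne m pd(1) a in auto)
      have r2: "trace_root q \<kappa> (fst (snd (G z0))) S2"
        unfolding S2_def xi2 by (rule trace_root_rank1) (use ne m zne a \<beta>2 in auto)
      have S1sum: "(\<Sum>b\<in>Basis. (norm (S1 b))\<^sup>2) \<le> (N + 1) + \<kappa>\<^sup>2 * N"
      proof -
        have "(\<Sum>b\<in>Basis. (norm (S1 b))\<^sup>2) = pF q (fst (G z0)) (\<lambda>x. x) + \<kappa>\<^sup>2 * (\<Sum>b\<in>(Basis::'b set). b \<bullet> b)"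
          using r1 linear_ident unfolding trace_root_def power2_norm_eq_inner by blast
        also have "pF q (fst (G z0)) (\<lambda>x. x) = q * N + (1 - 2 * q)"
          using nonz(1) by (simp add: pF_def power2_norm_eq_inner N_def)
        also have "(\<Sum>b\<in>(Basis::'b set). b \<bullet> b) = N" by (simp add: N_def)
        finally show ?thesis using q mult_right_mono[of q 1 N] N by linarith
      qed
      have "\<sigma> \<le> (\<Sum>b\<in>Basis. H z0 (S1 b, S2 b, 0) \<bullet> (S1 b, S2 b, 0))
         + \<kappa>\<^sup>2 * (H z0 (0, 0, 1) \<bullet> (0, 0, 1) + 4 * L * DIM('b \<times> real))"
        unfolding \<sigma>_def by (rule coupling_bound[OF \<kappa> r1 r2 nonz])
      also have "(\<Sum>b\<in>Basis. H z0 (S1 b, S2 b, 0) \<bullet> (S1 b, S2 b, 0))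
        = m * (2 * f * (\<Sum>b\<in>Basis. (norm (S1 b - S2 b))\<^sup>2) + bQ * s * (\<Sum>b\<in>Basis. (e \<bullet> (S1 b - S2 b))\<^sup>2)
            + 2 * (\<Sum>b\<in>Basis. (norm (S1 b))\<^sup>2))"
        by (simp only: He de2 sum.distrib mult.assoc flip: sum_distrib_left)
      also have "\<dots> \<le> m * (B + 2 * ((N + 1) + \<kappa>\<^sup>2 * N))"
      proof (rule mult_left_mono)
        show "2 * f * (\<Sum>b\<in>Basis. (norm (S1 b - S2 b))\<^sup>2) + bQ * s * (\<Sum>b\<in>Basis. (e \<bullet> (S1 b - S2 b))\<^sup>2)
            + 2 * (\<Sum>b\<in>Basis. (norm (S1 b))\<^sup>2) \<le> B + 2 * ((N + 1) + \<kappa>\<^sup>2 * N)"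
          unfolding S1_def S2_def coupled_sums[OF ne]
          by (rule add_mono[OF Bb[unfolded C_def] mult_left_mono[OF S1sum[unfolded S1_def]]]) simp
      qed (use m in simp)
      finally show "\<sigma> \<le> m * (B + 2 * (N + 1)) + \<kappa>\<^sup>2 * Cst"
        by (simp add: Cst_def algebra_simps)
    qed
    have mu1: "(\<alpha>2 - \<alpha>1)\<^sup>2 \<le> 1" if "\<alpha>1 = sqrt (q + \<kappa>\<^sup>2)" "\<alpha>2 = sqrt (1 - q + \<kappa>\<^sup>2)" for \<alpha>1 \<alpha>2 \<kappa> :: real
    proof -
      have "(\<alpha>2 - \<alpha>1)\<^sup>2 \<le> \<bar>(1 - q + \<kappa>\<^sup>2) - (q + \<kappa>\<^sup>2)\<bar>"
        unfolding that using q by (intro square_sqrt_diff) auto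
      then show ?thesis using q by linarith
    qed
    have C01: "0 \<le> C" "C \<le> 1" using pd(3) by (auto simp: C_def)
    have C16: "1 - C \<le> 16 / \<zeta>2" by (rule pd(2))
    have z16: "16 / \<zeta>2 \<ge> 0" using True by simp
    have split: "2 * f * (\<mu>\<^sup>2 + \<nu>\<^sup>2 - 2 * \<mu> * \<nu> * C) + bQ * s * (\<mu>\<^sup>2 * C + \<nu>\<^sup>2 - 2 * \<mu> * \<nu> * C)
      = R * (\<mu>\<^sup>2 * C + \<nu>\<^sup>2 - 2 * \<mu> * \<nu> * C) + 2 * f * (\<mu>\<^sup>2 * (1 - C))" for \<mu> \<nu>
      by (simp add: R_def algebra_simps)
    have cr: "2 * f * (\<mu>\<^sup>2 * (1 - C)) \<le> 2 * f * (16 / \<zeta>2)" if "\<mu>\<^sup>2 \<le> 1" for \<mu>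
    proof -
      have "\<mu>\<^sup>2 * (1 - C) \<le> 1 * (1 - C)" using that C01 by (intro mult_right_mono) auto
      then show ?thesis using C16 f0 by (intro mult_left_mono) auto
    qed
    show False
    proof (cases "12 * \<theta>^72 \<le> s\<^sup>2")
      case True
      note oz = outer_zone[OF True Yl]
      have "\<sigma> \<le> m * ((R * (1 - q) + 2 * f * (16 / \<zeta>2)) + 2 * (N + 1))"
      proof (rule main)
        fix \<alpha>1 \<alpha>2 \<kappa> :: real assume \<kappa>: "\<kappa> > 0" and a: "\<alpha>1 = sqrt (q + \<kappa>\<^sup>2)" "\<alpha>2 = sqrt (1 - q + \<kappa>\<^sup>2)"
        have a0: "0 \<le> \<alpha>1" "0 \<le> \<alpha>2" "1 - q \<le> \<alpha>2\<^sup>2" using q by (auto simp: a)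
        have "R * ((\<alpha>2 - \<alpha>1)\<^sup>2 * C + (- \<alpha>2 - \<alpha>1)\<^sup>2 - 2 * (\<alpha>2 - \<alpha>1) * (- \<alpha>2 - \<alpha>1) * C) \<le> R * (1 - q)"
          using reflection_form_bound[OF a0(1,2) C01] a0(3) oz(1) by (intro mult_left_mono_neg) auto
        then show "\<exists>\<beta>2. (\<alpha>1 + \<beta>2 = \<alpha>2 \<or> \<alpha>1 + \<beta>2 = - \<alpha>2) \<and>
          2 * f * ((\<alpha>2 - \<alpha>1)\<^sup>2 + \<beta>2\<^sup>2 - 2 * (\<alpha>2 - \<alpha>1) * \<beta>2 * C)
          + bQ * s * ((\<alpha>2 - \<alpha>1)\<^sup>2 * C + \<beta>2\<^sup>2 - 2 * (\<alpha>2 - \<alpha>1) * \<beta>2 * C) \<le> R * (1 - q) + 2 * f * (16 / \<zeta>2)"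
          unfolding split by (intro exI[of _ "- \<alpha>2 - \<alpha>1"] conjI add_mono cr[OF mu1[OF a]]) auto
      qed
      then have "m * ((1 - q) / 120 * E / \<theta>^23 - 6 * ((1 - q) / 120) * Y / \<theta>^30) \<le> m * ((R * (1 - q) + 2 * f * (16 / \<zeta>2)) + 2 * (N + 1))"
        using \<sigma> by linarith
      then have "(1 - q) / 120 * E / \<theta>^23 - 6 * ((1 - q) / 120) * Y / \<theta>^30 \<le> (R * (1 - q) + 2 * f * (16 / \<zeta>2)) + 2 * (N + 1)"
        using mult_le_cancel_left_pos[OF m] by blast
      then have "14 * (N + 1) * (1 / \<theta>^23) < 2 * (N + 1)" using oz(2) Ebig c12 by simp
      moreover have "14 * (N + 1) * 1 \<le> 14 * (N + 1) * (1 / \<theta>^23)" using t23 N by (intro mult_left_mono) auto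
      ultimately show False using N by simp
    next
      case False
      then have inn: "s\<^sup>2 \<le> 12 * \<theta>^72" by simp
      have "\<sigma> \<le> m * (8 / \<theta>^23 + 2 * (N + 1))"
      proof (rule main)
        fix \<alpha>1 \<alpha>2 \<kappa> :: real assume \<kappa>: "\<kappa> > 0" and a: "\<alpha>1 = sqrt (q + \<kappa>\<^sup>2)" "\<alpha>2 = sqrt (1 - q + \<kappa>\<^sup>2)"
        define \<mu> where "\<mu> = \<alpha>2 - \<alpha>1"
        have mu: "\<mu>\<^sup>2 \<le> 1" unfolding \<mu>_def by (rule mu1[OF a])
        have mc: "0 \<le> \<mu>\<^sup>2 * (1 - C)" "\<mu>\<^sup>2 * (1 - C) \<le> 16 / \<zeta>2"
          using mult_right_mono[OF mu, of "1 - C"] C01 C16 by auto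
        have R6: "R \<le> 6 * f" using bQ_bound s abs_ge_self[of bQ] mult_right_mono[of bQ "\<bar>bQ\<bar>" s] unfolding R_def by linarith
        have "R * (\<mu>\<^sup>2 * C + \<mu>\<^sup>2 - 2 * \<mu> * \<mu> * C) = R * (\<mu>\<^sup>2 * (1 - C))"
          by (simp add: power2_eq_square algebra_simps)
        also have "\<dots> \<le> 6 * f * (\<mu>\<^sup>2 * (1 - C))" using R6 mc by (intro mult_right_mono) auto
        finally have r6: "R * (\<mu>\<^sup>2 * C + \<mu>\<^sup>2 - 2 * \<mu> * \<mu> * C) \<le> 6 * f * (\<mu>\<^sup>2 * (1 - C))" .
        have l: "a + 2 * f * x \<le> 8 * f * x" if "a \<le> 6 * f * x" for a x :: real
        proof -
          have "8 * f * x = 6 * f * x + 2 * f * x" by simp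
          then show ?thesis using that by linarith
        qed
        have "R * (\<mu>\<^sup>2 * C + \<mu>\<^sup>2 - 2 * \<mu> * \<mu> * C) + 2 * f * (\<mu>\<^sup>2 * (1 - C)) \<le> 8 * f * (\<mu>\<^sup>2 * (1 - C))"
          by (rule l[OF r6])
        also have "\<dots> \<le> 8 * f * (16 / \<zeta>2)" using mc f0 by (intro mult_left_mono) auto
        also have "\<dots> = 128 * f / \<zeta>2" by simp
        also have "\<dots> \<le> 8 / \<theta>^23" by (rule sync_zone[OF True])
        finally show "\<exists>\<beta>2. (\<alpha>1 + \<beta>2 = \<alpha>2 \<or> \<alpha>1 + \<beta>2 = - \<alpha>2) \<and>
          2 * f * ((\<alpha>2 - \<alpha>1)\<^sup>2 + \<beta>2\<^sup>2 - 2 * (\<alpha>2 - \<alpha>1) * \<beta>2 * C)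
          + bQ * s * ((\<alpha>2 - \<alpha>1)\<^sup>2 * C + \<beta>2\<^sup>2 - 2 * (\<alpha>2 - \<alpha>1) * \<beta>2 * C) \<le> 8 / \<theta>^23"
          unfolding split \<mu>_def[symmetric] by (intro exI[of _ \<mu>]) (simp add: \<mu>_def)
      qed
      then have "m * ((1 - q) / 120 * E / \<theta>^23 - 6 * ((1 - q) / 120) * Y / \<theta>^30) \<le> m * (8 / \<theta>^23 + 2 * (N + 1))"
        using \<sigma> by linarith
      then have "(1 - q) / 120 * E / \<theta>^23 - 6 * ((1 - q) / 120) * Y / \<theta>^30 \<le> 8 / \<theta>^23 + 2 * (N + 1)"
        using mult_le_cancel_left_pos[OF m] by blast
      then have "14 * (N + 1) * (1 / \<theta>^23) < 8 * (1 / \<theta>^23) + 2 * (N + 1)"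
        using inner_Y[OF inn] Ebig by simp
      moreover have "8 * P + 2 * (N + 1) \<le> 14 * (N + 1) * P" if "P \<ge> 1" for P
      proof -
        have "N * 1 \<le> N * P" using that N by (intro mult_left_mono) auto
        then show ?thesis using that N by (simp add: algebra_simps)
      qed
      ultimately show False using t23 by force
    qed
  qed
qed

lemma doubling_fun_ge:
  assumes "m > 0" "E \<ge> 0"
  shows "doubling_fun m c E \<rho> \<tau> p (x, y, t) \<ge> m * c"
    and "doubling_fun m c E \<rho> \<tau> p (x, y, t) \<ge> m * (c + (norm (x - p))\<^sup>2)"
    and "doubling_fun m c E \<rho> \<tau> p (x, y, t) \<ge> m * (c + E * (\<tau> + \<rho> * t) powr (1/24))"
    and "doubling_fun m c E \<rho> \<tau> p (x, y, t) \<ge> m * (c + (\<tau> + \<rho> * t) powr (-1/4) * ((norm (x - y))^4 + (\<tau> + \<rho> * t)^3) powr (1/8))"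
proof -
  have a: "(\<tau> + \<rho> * t) powr (-1/4) * ((norm (x - y))^4 + (\<tau> + \<rho> * t)^3) powr (1/8) \<ge> 0"
    "(norm (x - p))\<^sup>2 \<ge> 0" "E * (\<tau> + \<rho> * t) powr (1/24) \<ge> 0" using assms by auto
  show "doubling_fun m c E \<rho> \<tau> p (x, y, t) \<ge> m * c"
    "doubling_fun m c E \<rho> \<tau> p (x, y, t) \<ge> m * (c + (norm (x - p))\<^sup>2)"
    "doubling_fun m c E \<rho> \<tau> p (x, y, t) \<ge> m * (c + E * (\<tau> + \<rho> * t) powr (1/24))"
    "doubling_fun m c E \<rho> \<tau> p (x, y, t) \<ge> m * (c + (\<tau> + \<rho> * t) powr (-1/4) * ((norm (x - y))^4 + (\<tau> + \<rho> * t)^3) powr (1/8))"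
    unfolding doubling_fun_def prod.case using a assms by (auto intro!: mult_left_mono)
qed

text \<open>
  Quantifies that the doubling function stays close to \<open>m c\<close> at the base point for a time that depends on \<open>E\<close>
  only.
\<close>

lemma doubling_fun_diagonal:
  assumes "m > 0" "E \<ge> 1" and \<tau>: "0 < \<tau> + \<rho> * t" "\<tau> + \<rho> * t \<le> (1 / (8 * E))^24"
  shows "doubling_fun m c E \<rho> \<tau> p (p, p, t) \<le> m * (c + 1/4)"
proof -
  define T where "T = \<tau> + \<rho> * t"
  define \<theta> where "\<theta> = T powr (1/24)"
  have T: "T > 0" using \<tau> by (simp add: T_def)
  have th: "\<theta>^k = T powr (real k / 24)" for k
    unfolding \<theta>_def using powr_root_powers[OF T, of 24 k] by simp
  have \<theta>0: "\<theta> > 0" using T by (simp add: \<theta>_def)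
  have "\<theta>^24 = T" using T by (simp add: th)
  then have le24: "\<theta>^24 \<le> (1 / (8 * E))^24" using \<tau>(2) by (simp only: T_def)
  have nn: "0 \<le> \<theta>" "0 \<le> 1 / (8 * E)" using \<theta>0 assms(2) by auto
  have \<theta>1: "\<theta> \<le> 1 / (8 * E)"
    by (rule iffD1[OF power_mono_iff[OF nn zero_less_numeral] le24])
  have E8: "1 / (8 * E) \<le> 1/8" using assms(2) by (simp add: divide_le_eq)
  have "E * \<theta> \<le> 1/8" using mult_left_mono[OF \<theta>1, of E] assms(2) by simp
  moreover have "\<theta>^3 \<le> 1/8"
  proof -
    have "\<theta>^3 \<le> \<theta>^1" using \<theta>0 \<theta>1 E8 by (intro power_decreasing) auto
    then show ?thesis using \<theta>1 E8 by simp
  qed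
  moreover have "T powr (-1/4) * (T^3) powr (1/8) = \<theta>^3"
  proof -
    have T3: "T^3 = T powr 3" using T by simp
    show ?thesis unfolding T3 th powr_powr powr_add[symmetric] by simp
  qed
  ultimately have "c + T powr (-1/4) * (T^3) powr (1/8) + E * \<theta> \<le> c + 1/4" by simp
  from mult_left_mono[OF this, of m] show ?thesis
    using assms(1) by (simp add: doubling_fun_def T_def[symmetric] \<theta>_def)
qed

lemma doubling_fun_shift: "m > 0 \<Longrightarrow> doubling_fun m (c + \<mu> / m) E \<rho> \<tau> p z = doubling_fun m c E \<rho> \<tau> p z + \<mu>"
  by (cases z) (simp add: doubling_fun_def distrib_left)

section \<open>Bounded subsolutions with vanishing initial values\<close>

text \<open>
  The assumption \<open>init\<close> is the weak form in which \<open>v\<close> vanishes at time \<open>0\<close>: at nearby points and at times near \<open>s\<close> and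
  near \<open>0\<close>, the two values cannot both be close to \<open>m\<close>. It allows for points at which \<open>v\<close> has
  no continuous extension to time \<open>0\<close>, provided that \<open>v\<close> vanishes at these points at positive times.
\<close>

locale vanishing_subsolution =
  fixes q m :: real and v :: "'b::euclidean_space \<times> real \<Rightarrow> real"
  assumes q: "0 \<le> q" "q < 1" and m: "m > 0"
    and v: "\<And>x t. t > 0 \<Longrightarrow> 0 \<le> v (x, t)" "\<And>x t. t > 0 \<Longrightarrow> v (x, t) \<le> m"
    and cont: "continuous_on (UNIV \<times> {0<..}) v"
    and pt: "ptest q {z. 0 < snd z \<and> 0 < v z} v"
    and init: "\<And>s \<gamma> x0. 0 < s \<Longrightarrow> 0 < \<gamma> \<Longrightarrow> \<exists>\<delta>>0. \<forall>x y t t'. norm (x - x0) \<le> 3 \<and> norm (y - x0) \<le> 4 \<and>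
       norm (x - y) < \<delta> \<and> \<bar>t\<bar> < \<delta> \<and> 0 < t' \<and> t' < \<delta> \<longrightarrow> 0 < t + s \<and> v (x, t + s) + v (y, t') \<le> m + \<gamma>"
begin

text \<open>
  \<open>E\<close> is so large that \<open>E \<theta>\<close> outweighs all errors of the touching argument, and \<open>E \<theta> < 1\<close> forces \<open>\<theta>\<close> to be as
  small as that argument requires. Up to \<open>tstar\<close>, and for small \<open>\<tau>\<close>, the doubling function stays below \<open>3/2 m\<close> at the base point.
\<close>

definition "E = 13 + (1800 * (real DIM('b) + 1) + 700) / (1 - q)"
definition "\<rho> = (1 - q) / 5"
definition "tstar = (1 / (8 * E))^24 / (2 * \<rho>)"

lemma E: "E \<ge> 13" "(1 - q) / 120 * (E - 12) > 14 * (real DIM('b) + 1)" "(1 / E)^24 \<le> (1 - q) / 700"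
proof -
  have p: "(1800 * (real DIM('b) + 1) + 700) / (1 - q) \<ge> 0" using q by simp
  then show 1: "E \<ge> 13" by (simp add: E_def)
  have "(1 - q) / 120 * (E - 12) \<ge> (1 - q) / 120 * ((1800 * (real DIM('b) + 1) + 700) / (1 - q))"
    using q by (intro mult_left_mono) (auto simp: E_def)
  also have "(1 - q) / 120 * ((1800 * (real DIM('b) + 1) + 700) / (1 - q)) = (1800 * (real DIM('b) + 1) + 700) / 120"
  proof -
    have l: "k / 120 * (a / k) = a / 120" if "k \<noteq> 0" for k a :: real using that by simp
    show ?thesis by (rule l) (use q in simp)
  qed
  finally show "(1 - q) / 120 * (E - 12) > 14 * (real DIM('b) + 1)" by simp
  have "700 / (1 - q) \<le> (1800 * (real DIM('b) + 1) + 700) / (1 - q)"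
    using q by (intro divide_right_mono) auto
  then have "700 / (1 - q) \<le> E" unfolding E_def by linarith
  then have "1 / E \<le> (1 - q) / 700" using q 1 by (simp add: field_simps)
  moreover have "(1 / E)^24 \<le> (1 / E)^1" using 1 by (intro power_decreasing) auto
  ultimately show "(1 / E)^24 \<le> (1 - q) / 700" by simp
qed

lemma \<rho>: "\<rho> > 0" using q by (simp add: \<rho>_def)

lemma tstar: "tstar > 0" using E(1) \<rho> by (simp add: tstar_def)

text \<open>
  If the claim fails, the excess of the sum of two sup-convolutions over the doubling function with \<open>c = 9/8\<close>
  has a positive maximum on a compact set. There the doubling function is below \<open>2 m\<close>, which forces \<open>x\<close>
  to be close to \<open>x0\<close>, \<open>y\<close> to be close to \<open>x\<close>, and the time to be below \<open>T\<close>. The time cannot be the initial one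
  either, since then \<open>init\<close> bounds the sum by \<open>9/8 m\<close>. So the maximum is interior, and a shifted doubling
  function touches the sum.
\<close>

lemma doubling:
  assumes s: "0 < s" and t: "0 < tb" "tb \<le> tstar"
  shows "v (x0, tb + s) + v (x0, tb) \<le> 3/2 * m"
proof (rule ccontr)
  assume neg: "\<not> ?thesis"
  obtain \<delta> where \<delta>: "\<delta> > 0" and ini: "\<And>x y t t'. norm (x - x0) \<le> 3 \<Longrightarrow> norm (y - x0) \<le> 4 \<Longrightarrow>
       norm (x - y) < \<delta> \<Longrightarrow> \<bar>t\<bar> < \<delta> \<Longrightarrow> 0 < t' \<Longrightarrow> t' < \<delta> \<Longrightarrow> v (x, t + s) + v (y, t') \<le> m + m / 8"
    using init[OF s, of "m / 8" x0] m by auto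
  \<comment> \<open>The sup-convolutions, with parameter \<open>L = m / \<epsilon>\<^sup>2\<close>, move points by at most \<open>\<epsilon>\<close>. The time interval starts at \<open>3 \<epsilon>\<close>, so that the second function is evaluated at positive times.\<close>
  define \<epsilon> where "\<epsilon> = Min {\<delta> / 16, tb / 8, 1 / 2, \<delta>\<^sup>2 / (32 * \<rho>)}"
  have \<epsilon>: "\<epsilon> > 0" "\<epsilon> \<le> \<delta> / 16" "\<epsilon> \<le> tb / 8" "\<epsilon> \<le> 1 / 2" "\<epsilon> \<le> \<delta>\<^sup>2 / (32 * \<rho>)"
    using \<delta> t \<rho> by (auto simp: \<epsilon>_def)
  define \<tau> where "\<tau> = min ((1 / (8 * E))^24 / 2) (\<delta>\<^sup>2 / 16)"
  have \<tau>: "\<tau> > 0" "\<tau> \<le> (1 / (8 * E))^24 / 2" "\<tau> \<le> \<delta>\<^sup>2 / 16" using \<delta> E(1) by (auto simp: \<tau>_def)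
  define L where "L = m / \<epsilon>\<^sup>2"
  have L: "L > 0" using m \<epsilon> by (simp add: L_def)
  \<comment> \<open>At time \<open>T\<close> one has \<open>\<tau> + \<rho> T > 1\<close>, and the doubling function exceeds \<open>2 m\<close>.\<close>
  define T where "T = 1 / \<rho> + tstar"
  have T: "T > 0" "tstar < T" "1 < \<tau> + \<rho> * T" using \<rho> tstar \<tau>
    by (auto simp: T_def distrib_left add_pos_pos)
  define C1 where "C1 = cball x0 3 \<times> {0..T + 1}"
  define C2 where "C2 = cball x0 4 \<times> {\<epsilon>..T + 1}"
  define U where "U z = v ((0, s) + z)" for z
  have Ueq: "U (x, t) = v (x, t + s)" for x t by (simp add: U_def add.commute)
  have ptU: "ptest q {z. (0, s) + z \<in> {z. 0 < snd z \<and> 0 < v z}} U"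
    using ptest_translate[OF pt, of "(0, s)"] by (simp add: U_def[abs_def])
  have contU: "continuous_on C1 U"
    unfolding U_def using s
    by (intro continuous_on_compose2[OF cont] continuous_intros) (auto simp: C1_def)
  interpret S1: sup_convolution L C1 U
    by unfold_locales (use contU T in \<open>auto simp: C1_def compact_Times\<close>)
  have contv: "continuous_on C2 v"
    by (rule continuous_on_subset[OF cont]) (use \<epsilon>(1) in \<open>auto simp: C2_def\<close>)
  interpret S2: sup_convolution L C2 v
    by unfold_locales (use T \<epsilon> tstar t contv in \<open>auto simp: C2_def compact_Times\<close>)
  define f where "f = supconv L C1 U"
  define g where "g = supconv L C2 v"
  have Ub: "0 \<le> U z" "U z \<le> m" if "z \<in> C1" for z
    using that v s by (cases z; auto simp: Ueq C1_def)+
  have vb: "0 \<le> v z" "v z \<le> m" if "z \<in> C2" for z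
    using that v \<epsilon> by (cases z; auto simp: C2_def)+
  have fle: "f z \<le> m" for z
  proof -
    obtain y where "y \<in> C1" "f z = U y - L * (norm (z - y))\<^sup>2" using S1.attained unfolding f_def by blast
    moreover have "0 \<le> L * (norm (z - y))\<^sup>2" using L by simp
    ultimately show ?thesis using Ub(2)[of y] by linarith
  qed
  have gle: "g z \<le> m" for z
  proof -
    obtain y where "y \<in> C2" "g z = v y - L * (norm (z - y))\<^sup>2" using S2.attained unfolding g_def by blast
    moreover have "0 \<le> L * (norm (z - y))\<^sup>2" using L by simp
    ultimately show ?thesis using vb(2)[of y] by linarith
  qed
  have close: "norm d \<le> \<epsilon>" if "L * (norm d)\<^sup>2 \<le> m" for d :: "'b \<times> real"
  proof -
    have "m * (norm d)\<^sup>2 \<le> m * \<epsilon>\<^sup>2" using that \<epsilon>(1) by (simp add: L_def divide_le_eq)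
    then have "(norm d)\<^sup>2 \<le> \<epsilon>\<^sup>2" using mult_le_cancel_left_pos[OF m] by blast
    then show ?thesis by (rule power2_le_imp_le) (use \<epsilon>(1) in simp)
  qed
  have fge: "U z \<le> f z" if "z \<in> C1" for z using S1.upper[OF that, of z] by (simp add: f_def)
  have gge: "v z \<le> g z" if "z \<in> C2" for z using S2.upper[OF that, of z] by (simp add: g_def)
  have fclose: "norm (z - y) \<le> \<epsilon>" if "z \<in> C1" "y \<in> C1" "f z = U y - L * (norm (z - y))\<^sup>2" for z y
    using close[of "z - y"] fge[OF that(1)] Ub(1)[OF that(1)] Ub(2)[OF that(2)] that(3) by linarith
  have gclose: "norm (z - y) \<le> \<epsilon>" if "z \<in> C2" "y \<in> C2" "g z = v y - L * (norm (z - y))\<^sup>2" for z y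
    using close[of "z - y"] gge[OF that(1)] vb(1)[OF that(1)] vb(2)[OF that(2)] that(3) by linarith
  have cf: "continuous_on A f" and cg: "continuous_on A g" for A
    using semiconvex_continuous[OF S1.semiconvex] semiconvex_continuous[OF S2.semiconvex]
    unfolding f_def g_def by (auto intro: continuous_on_subset)
  have parts: "norm (x - x') \<le> \<epsilon>" "\<bar>t - t'\<bar> \<le> \<epsilon>" if "norm ((x, t) - (x', t')) \<le> \<epsilon>" for x x' :: 'b and t t' :: real
    using that norm_fst_le[of "x - x'" "t - t'"] norm_snd_le[of "t - t'" "x - x'"] by auto
  define O1 where "O1 = ({z. norm (fst z - x0) < 2} \<inter> {z. 5/2 * \<epsilon> < snd z} \<inter> {z. snd z < T}) \<inter> {z. 0 < f z}"
  define O2 where "O2 = ({z. norm (fst z - x0) < 3} \<inter> {z. 5/2 * \<epsilon> < snd z} \<inter> {z. snd z < T}) \<inter> {z. 0 < g z}"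
  have op: "open O1" "open O2" unfolding O1_def O2_def
    by (intro open_Int open_Collect_less continuous_intros cf cg)+
  have int1: "ball x0 3 \<times> {0<..<T + 1} \<subseteq> interior C1"
    by (rule interior_maximal) (auto simp: C1_def open_Times)
  have int2: "ball x0 4 \<times> {\<epsilon><..<T + 1} \<subseteq> interior C2"
    by (rule interior_maximal) (auto simp: C2_def open_Times)
  have pf: "ptest q O1 f" unfolding f_def
  proof (rule ptest_supconv[OF S1.sup_convolution_axioms ptU])
    fix z y assume z: "z \<in> O1" and y: "y \<in> C1" and e: "supconv L C1 U z = U y - L * (norm (z - y))\<^sup>2"
    obtain x t where zz: "z = (x, t)" by (cases z)
    obtain x' t' where yy: "y = (x', t')" by (cases y)
    have zC: "z \<in> C1" using z \<epsilon>(1) by (auto simp: O1_def C1_def zz dist_norm norm_minus_commute)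
    have p: "norm (x - x') \<le> \<epsilon>" "\<bar>t - t'\<bar> \<le> \<epsilon>" using fclose[OF zC y] e parts zz yy unfolding f_def by blast+
    have "norm (x' - x0) \<le> norm (x - x0) + norm (x - x')" using norm_triangle_ineq4[of "x - x0" "x - x'"] by simp
    then have "norm (x' - x0) < 3" using z p \<epsilon>(4) by (auto simp: O1_def zz)
    moreover have "0 < t'" "t' < T + 1" using z p(2) \<epsilon> by (auto simp: O1_def zz)
    ultimately have "y \<in> interior C1" using int1 by (auto simp: yy dist_norm norm_minus_commute)
    moreover have "0 < U y" using e z L unfolding O1_def f_def
      by (smt (verit) IntD2 mem_Collect_eq mult_nonneg_nonneg zero_le_power2)
    moreover have "0 < snd ((0, s) + y)" using y s by (auto simp: C1_def yy)
    ultimately show "y \<in> {z. (0, s) + z \<in> {z. 0 < snd z \<and> 0 < v z}} \<and> y \<in> interior C1"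
      by (simp add: U_def)
  qed
  have pg: "ptest q O2 g" unfolding g_def
  proof (rule ptest_supconv[OF S2.sup_convolution_axioms pt])
    fix z y assume z: "z \<in> O2" and y: "y \<in> C2" and e: "supconv L C2 v z = v y - L * (norm (z - y))\<^sup>2"
    obtain x t where zz: "z = (x, t)" by (cases z)
    obtain x' t' where yy: "y = (x', t')" by (cases y)
    have zC: "z \<in> C2" using z \<epsilon>(1) by (auto simp: O2_def C2_def zz dist_norm norm_minus_commute)
    have p: "norm (x - x') \<le> \<epsilon>" "\<bar>t - t'\<bar> \<le> \<epsilon>" using gclose[OF zC y] e parts zz yy unfolding g_def by blast+
    have "norm (x' - x0) \<le> norm (x - x0) + norm (x - x')" using norm_triangle_ineq4[of "x - x0" "x - x'"] by simp
    then have "norm (x' - x0) < 4" using z p \<epsilon>(4) by (auto simp: O2_def zz)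
    moreover have "\<epsilon> < t'" "t' < T + 1" using z p(2) \<epsilon> by (auto simp: O2_def zz)
    ultimately have "y \<in> interior C2" using int2 by (auto simp: yy dist_norm norm_minus_commute)
    moreover have "0 < v y" using e z L unfolding O2_def g_def
      by (smt (verit) IntD2 mem_Collect_eq mult_nonneg_nonneg zero_le_power2)
    moreover have "0 < snd y" using y \<epsilon> by (auto simp: C2_def yy)
    ultimately show "y \<in> {z. 0 < snd z \<and> 0 < v z} \<and> y \<in> interior C2" by simp
  qed
  define c0 :: real where "c0 = 9/8"
  define \<Phi> where "\<Phi> = doubling_fun m c0 E \<rho> \<tau> x0"
  obtain G0 H0 where td0: "twice_diff {z::'b \<times> 'b \<times> real. \<tau> + \<rho> * snd (snd z) > 0} \<Phi> G0 H0"
    using doubling_fun_twice_diff unfolding \<Phi>_def by blast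
  define Kc where "Kc = cball x0 1 \<times> cball x0 3 \<times> {3 * \<epsilon>..T}"
  have Kc_pos: "Kc \<subseteq> {z. \<tau> + \<rho> * snd (snd z) > 0}"
    using \<tau>(1) \<rho> \<epsilon>(1) by (auto simp: Kc_def intro!: add_pos_nonneg)
  define V where "V z = f (fst z, snd (snd z)) + g (fst (snd z), snd (snd z)) - \<Phi> z" for z
  have "continuous_on Kc V" unfolding V_def
    by (intro continuous_intros continuous_on_compose2[OF cf[of UNIV]] continuous_on_compose2[OF cg[of UNIV]]
        continuous_on_subset[OF twice_diff_cont(1)[OF td0] Kc_pos]) auto
  moreover have "compact Kc" unfolding Kc_def by (intro compact_Times compact_cball compact_Icc)
  moreover have tbT: "3 * \<epsilon> \<le> tb" "tb \<le> T" "\<epsilon> \<le> tb" using \<epsilon>(1,3) t T(2) by auto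
  then have x0K: "(x0, x0, tb) \<in> Kc" by (simp add: Kc_def)
  ultimately obtain P where P: "P \<in> Kc" "\<And>z. z \<in> Kc \<Longrightarrow> V z \<le> V P"
    using continuous_attains_sup[of Kc V] by blast
  obtain xh yh th where PP: "P = (xh, yh, th)" by (cases P)
  define \<mu> where "\<mu> = V P"
  have \<mu>: "\<mu> > 0"
  proof -
    have "v (x0, tb + s) \<le> f (x0, tb)" using fge[of "(x0, tb)"] t T tbT by (simp add: C1_def Ueq)
    moreover have "v (x0, tb) \<le> g (x0, tb)" using gge[of "(x0, tb)"] tbT by (simp add: C2_def)
    moreover have "\<Phi> (x0, x0, tb) \<le> m * (c0 + 1/4)"
      unfolding \<Phi>_def
    proof (rule doubling_fun_diagonal)
      have "\<rho> * tb \<le> \<rho> * tstar" using t \<rho> by (intro mult_left_mono) auto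
      also have "\<dots> = (1 / (8 * E))^24 / 2" using \<rho> by (simp add: tstar_def)
      finally show "\<tau> + \<rho> * tb \<le> (1 / (8 * E))^24" using \<tau>(2) by linarith
    qed (use m E(1) \<tau>(1) \<rho> t in \<open>auto intro!: add_pos_pos\<close>)
    moreover have "m * (c0 + 1/4) \<le> 3/2 * m" using m by (simp add: c0_def)
    ultimately have "V (x0, x0, tb) > 0" using neg by (simp add: V_def)
    then show ?thesis using P(2)[OF x0K] by (simp add: \<mu>_def)
  qed
  have sum\<Phi>: "f (xh, th) + g (yh, th) = \<Phi> P + \<mu>" by (simp add: \<mu>_def V_def PP)
  have \<Phi>2: "\<Phi> P < 2 * m" using sum\<Phi> \<mu> fle[of "(xh, th)"] gle[of "(yh, th)"] by linarith
  have E0: "E \<ge> 0" using E(1) by simp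
  note kg = doubling_fun_ge[OF m E0, where c=c0 and \<rho>=\<rho> and \<tau>=\<tau> and p=x0 and x=xh and y=yh and t=th, folded \<Phi>_def PP]
  have bnd: "a < 1" if "\<Phi> P \<ge> m * (c0 + a)" for a
  proof -
    have "m * (c0 + a) < m * 2" using that \<Phi>2 by simp
    then have "c0 + a < 2" using m by simp
    then show ?thesis by (simp add: c0_def)
  qed
  define \<tau>h where "\<tau>h = \<tau> + \<rho> * th"
  have thK: "3 * \<epsilon> \<le> th" "th \<le> T" using P(1) by (auto simp: PP Kc_def)
  have \<tau>h: "\<tau>h > 0" using Kc_pos P(1) by (auto simp: \<tau>h_def PP)
  have xh1: "norm (xh - x0) < 1"
    using bnd[OF kg(2)] by (simp add: power_less_one_iff abs_square_less_1)
  have Ys: "((norm (xh - yh))^4 + \<tau>h^3) powr (1/8) < \<tau>h powr (1/4)"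
  proof -
    have "\<tau>h powr (-1/4) * ((norm (xh - yh))^4 + \<tau>h^3) powr (1/8) < 1"
      using bnd[OF kg(4)] by (simp add: \<tau>h_def)
    then have "\<tau>h powr (1/4) * (\<tau>h powr (-1/4) * ((norm (xh - yh))^4 + \<tau>h^3) powr (1/8)) < \<tau>h powr (1/4) * 1"
      using \<tau>h by (intro mult_strict_left_mono) auto
    then show ?thesis using \<tau>h by (simp add: mult.assoc[symmetric] flip: powr_add)
  qed
  have \<tau>h0: "\<tau>h < (1 / E)^24"
  proof -
    have "E * \<tau>h powr (1/24) < 1" using bnd[OF kg(3)] by (simp add: \<tau>h_def)
    then have "\<tau>h powr (1/24) < 1 / E" using E(1) by (simp add: field_simps)
    then have "(\<tau>h powr (1/24))^24 < (1 / E)^24" by (intro power_strict_mono) auto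
    then show ?thesis using powr_root_powers[OF \<tau>h, of 24 24] \<tau>h by simp
  qed
  have \<tau>h1: "\<tau>h < 1" using \<tau>h0 power_le_one[of "1 / E" 24] E(1) by simp
  \<comment> \<open>Raise the bound \<open>Ys\<close> to the fourth power.\<close>
  have rh: "(norm (xh - yh))\<^sup>2 < \<tau>h"
  proof -
    have "((norm (xh - yh))^4) powr (1/8) \<le> ((norm (xh - yh))^4 + \<tau>h^3) powr (1/8)"
      using \<tau>h by (intro powr_mono2) auto
    then have "((norm (xh - yh))^4) powr (1/8) < \<tau>h powr (1/4)" using Ys by linarith
    then have "(((norm (xh - yh))^4) powr (1/8))^4 < (\<tau>h powr (1/4))^4"
      by (intro power_strict_mono) auto
    moreover have "(\<tau>h powr (1/4))^4 = \<tau>h" using powr_root_powers[OF \<tau>h, of 4 4] \<tau>h by simp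
    moreover have "(((norm (xh - yh))^4) powr (1/8))^4 = (norm (xh - yh))\<^sup>2"
    proof (cases "xh = yh")
      case False
      then have n: "norm (xh - yh) > 0" by simp
      show ?thesis
        using powr_root_powers[of "norm (xh - yh)^4" 8 4] n
        by (simp add: powr_powr flip: powr_numeral)
    qed simp
    ultimately show ?thesis by simp
  qed
  have thT: "th < T"
  proof (rule ccontr)
    assume "\<not> th < T"
    then have "th = T" using thK by simp
    then show False using T(3) \<tau>h1 by (simp add: \<tau>h_def)
  qed
  have rh1: "norm (xh - yh) < 1"
  proof -
    have "(norm (xh - yh))\<^sup>2 < 1\<^sup>2" using rh \<tau>h1 by simp
    then show ?thesis by (rule power2_less_imp_less) simp
  qed
  have yh2: "norm (yh - x0) < 2"
    using norm_triangle_ineq4[of "xh - x0" "xh - yh"] xh1 rh1 by simp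
  have th3: "3 * \<epsilon> < th"
  proof (rule ccontr)
    assume "\<not> 3 * \<epsilon> < th"
    then have th: "th = 3 * \<epsilon>" using thK by simp
    have z1: "(xh, th) \<in> C1" using xh1 thK \<epsilon>(1) T by (auto simp: C1_def dist_norm norm_minus_commute)
    have z2: "(yh, th) \<in> C2" using yh2 thK \<epsilon>(1) T by (auto simp: C2_def dist_norm norm_minus_commute)
    obtain y1 where y1: "y1 \<in> C1" "f (xh, th) = U y1 - L * (norm ((xh, th) - y1))\<^sup>2"
      using S1.attained unfolding f_def by blast
    obtain y2 where y2: "y2 \<in> C2" "g (yh, th) = v y2 - L * (norm ((yh, th) - y2))\<^sup>2"
      using S2.attained unfolding g_def by blast
    obtain x' t' where yy1: "y1 = (x', t')" by (cases y1)
    obtain y' t'' where yy2: "y2 = (y', t'')" by (cases y2)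
    have p1: "norm (xh - x') \<le> \<epsilon>" "\<bar>th - t'\<bar> \<le> \<epsilon>" using fclose[OF z1 y1] parts unfolding yy1 by blast+
    have p2: "norm (yh - y') \<le> \<epsilon>" "\<bar>th - t''\<bar> \<le> \<epsilon>" using gclose[OF z2 y2] parts unfolding yy2 by blast+
    have "\<tau>h \<le> (\<delta> / 2)\<^sup>2"
    proof -
      have "\<rho> * th \<le> \<rho> * (3 * (\<delta>\<^sup>2 / (32 * \<rho>)))" unfolding th using \<epsilon>(5) \<rho> by (intro mult_left_mono) auto
      also have "\<dots> = 3 * \<delta>\<^sup>2 / 32" using \<rho> by simp
      finally have "\<tau>h \<le> 5 * \<delta>\<^sup>2 / 32" using \<tau>(3) by (simp add: \<tau>h_def)
      also have "\<dots> \<le> \<delta>\<^sup>2 / 4" by simp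
      finally show ?thesis by (simp add: power_divide)
    qed
    then have "(norm (xh - yh))\<^sup>2 < (\<delta> / 2)\<^sup>2" using rh by linarith
    then have r: "norm (xh - yh) < \<delta> / 2" by (rule power2_less_imp_less) (use \<delta> in simp)
    have "norm (x' - y') = norm ((xh - yh) - (xh - x') + (yh - y'))" by simp
    then have "norm (x' - y') \<le> norm (xh - yh) + norm (xh - x') + norm (yh - y')"
      using norm_triangle_ineq[of "(xh - yh) - (xh - x')" "yh - y'"] norm_triangle_ineq4[of "xh - yh" "xh - x'"]
      by linarith
    then have d: "norm (x' - y') < \<delta>" using r p1(1) p2(1) \<epsilon>(2) \<delta> by linarith
    have "v (x', t' + s) + v (y', t'') \<le> m + m / 8"
    proof (rule ini[OF _ _ d])
      show "norm (x' - x0) \<le> 3" "norm (y' - x0) \<le> 4"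
        using y1(1) y2(1) by (auto simp: yy1 yy2 C1_def C2_def dist_norm norm_minus_commute)
      show "\<bar>t'\<bar> < \<delta>" using p1(2) th \<epsilon> \<delta> by linarith
      show "0 < t''" using y2(1) \<epsilon>(1) by (auto simp: yy2 C2_def)
      show "t'' < \<delta>" using p2(2) th \<epsilon> \<delta> by linarith
    qed
    moreover have "f (xh, th) \<le> v (x', t' + s)" using y1(2) L by (simp add: yy1 Ueq)
    moreover have "g (yh, th) \<le> v (y', t'')" using y2(2) L by (simp add: yy2)
    moreover have "m + m / 8 \<le> \<Phi> P" using kg(1) m by (simp add: c0_def)
    ultimately show False using sum\<Phi> \<mu> by linarith
  qed
  define O3 where "O3 = ball x0 1 \<times> ball x0 3 \<times> {3 * \<epsilon><..<T}"
  have O3K: "O3 \<subseteq> Kc" by (auto simp: O3_def Kc_def)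
  obtain G H where td: "twice_diff {z::'b \<times> 'b \<times> real. \<tau> + \<rho> * snd (snd z) > 0} (doubling_fun m (c0 + \<mu> / m) E \<rho> \<tau> x0) G H"
    and jet: "doubling_fun_jet m E \<rho> \<tau> x0 G H"
    using doubling_fun_twice_diff by blast
  have fpos: "f (xh, th) > 0" "g (yh, th) > 0"
  proof -
    have "m < \<Phi> P + \<mu>" using kg(1) m \<mu> by (simp add: c0_def)
    then show "f (xh, th) > 0" "g (yh, th) > 0" using sum\<Phi> fle[of "(xh, th)"] gle[of "(yh, th)"] by linarith+
  qed
  have "touching_pair q L f g (doubling_fun m (c0 + \<mu> / m) E \<rho> \<tau> x0) G H O1 O2 O3 xh yh th"
  proof
    show "L \<ge> 0" using L by simp
    show "semiconvex L f" unfolding f_def by (rule S1.semiconvex)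
    show "semiconvex L g" unfolding g_def by (rule S2.semiconvex)
    show "ptest q O1 f" "open O1" "ptest q O2 g" "open O2" using pf pg op by auto
    show "(xh, th) \<in> O1" using xh1 th3 thT fpos \<epsilon>(1) by (simp add: O1_def)
    show "(yh, th) \<in> O2" using yh2 th3 thT fpos \<epsilon>(1) by (simp add: O2_def)
    show "\<exists>p. \<forall>y. f y \<ge> f (xh, th) + p \<bullet> (y - (xh, th)) - L * (norm (y - (xh, th)))\<^sup>2"
      unfolding f_def by (rule S1.lower_support)
    show "\<exists>p. \<forall>y. g y \<ge> g (yh, th) + p \<bullet> (y - (yh, th)) - L * (norm (y - (yh, th)))\<^sup>2"
      unfolding g_def by (rule S2.lower_support)
    show "twice_diff O3 (doubling_fun m (c0 + \<mu> / m) E \<rho> \<tau> x0) G H"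
      by (rule twice_diff_subset[OF td]) (use O3K Kc_pos in blast)
    show "open O3" unfolding O3_def by (intro open_Times open_ball open_greaterThanLessThan)
    show "(xh, yh, th) \<in> O3" using xh1 yh2 th3 thT by (simp add: O3_def dist_norm norm_minus_commute)
    show "f (x, t) + g (y, t) \<le> doubling_fun m (c0 + \<mu> / m) E \<rho> \<tau> x0 (x, y, t)" if "(x, y, t) \<in> O3" for x y t
      using P(2)[of "(x, y, t)"] that O3K unfolding doubling_fun_shift[OF m] \<Phi>_def[symmetric] by (auto simp: V_def \<mu>_def)
    show "f (xh, th) + g (yh, th) = doubling_fun m (c0 + \<mu> / m) E \<rho> \<tau> x0 (xh, yh, th)"
      unfolding doubling_fun_shift[OF m] \<Phi>_def[symmetric] using sum\<Phi> by (simp add: PP)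
  qed
  then show False
  proof (rule doubling_fun_no_touch[OF _ jet q m])
    show "\<rho> = (1 - q) / 5" by (rule \<rho>_def)
    show "norm (xh - x0) \<le> 1" using xh1 by simp
    show "0 < \<tau> + \<rho> * th" using \<tau>h by (simp add: \<tau>h_def)
    show "\<tau> + \<rho> * th \<le> (1 - q) / 700" using \<tau>h0 E(3) by (simp add: \<tau>h_def)
    show "((norm (xh - yh))^4 + (\<tau> + \<rho> * th)^3) powr (1/8) < (\<tau> + \<rho> * th) powr (1/4)"
      using Ys by (simp add: \<tau>h_def)
    show "(1 - q) / 120 * (E - 12) > 14 * (DIM('b) + 1)" using E(2) by (simp add: add.commute)
  qed
qed

text \<open>
  Continuity of \<open>v\<close> at positive times allows \<open>s \<rightarrow> 0\<close> in the doubled estimate.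
\<close>

lemma small_time_bound:
  assumes t: "0 < t" "t \<le> tstar"
  shows "v (x, t) \<le> 3/4 * m"
proof -
  have c: "isCont v (x, t)"
    using cont t continuous_on_eq_continuous_at[of "UNIV \<times> {0<..}" v]
    by (simp add: open_Times)
  have "((\<lambda>s. v (x, t + s)) \<longlongrightarrow> v (x, t)) (at_right 0)"
  proof (rule isCont_tendsto_compose[OF c])
    have "((\<lambda>s. (x, t + s)) \<longlongrightarrow> (x, t + 0)) (at_right 0)" by (intro tendsto_intros)
    then show "((\<lambda>s. (x, t + s)) \<longlongrightarrow> (x, t)) (at_right 0)" by simp
  qed
  then have "((\<lambda>s. v (x, t + s) + v (x, t)) \<longlongrightarrow> v (x, t) + v (x, t)) (at_right 0)"
    by (intro tendsto_intros)
  moreover have "eventually (\<lambda>s. v (x, t + s) + v (x, t) \<le> 3/2 * m) (at_right 0)"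
    using doubling[OF _ t] by (auto simp: eventually_at_filter)
  ultimately have "v (x, t) + v (x, t) \<le> 3/2 * m"
    by (rule tendsto_upperbound) simp
  then show ?thesis by simp
qed

text \<open>
  Once \<open>v \<le> 3/4 m\<close> holds for short times, it persists: otherwise \<open>v\<close> minus the small supersolution
  \<open>d (k t + |y - x|\<^sup>2)\<close> has a maximum above \<open>3/4 m\<close>, at a time after \<open>tstar\<close>, and the crude test inequality
  fails there by the choice of \<open>k\<close>.
\<close>

lemma global_bound:
  assumes t: "0 < t"
  shows "v (x, t) \<le> 3/4 * m"
proof (rule ccontr)
  assume neg: "\<not> ?thesis"
  define gap where "gap = v (x, t) - 3/4 * m"
  have gap: "gap > 0" using neg by (simp add: gap_def)
  define k where "k = 2 * (real DIM('b) + 1) + 1"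
  have k: "k > 0" by (simp add: k_def add_nonneg_pos)
  define X where "X = 1 + k * t"
  have X: "X > 0" using k t by (simp add: X_def add_pos_pos)
  define d where "d = gap / (2 * X)"
  have d: "d > 0" using gap X by (simp add: d_def)
  have dk: "d * k * t < gap"
  proof -
    have "d * (k * t) \<le> d * X" using d by (intro mult_left_mono) (auto simp: X_def)
    also have "\<dots> = gap / 2" using X by (simp add: d_def)
    finally show ?thesis using gap by (simp add: mult.assoc)
  qed
  define P where "P = (\<lambda>z::'b \<times> real. (fst z, 0::real))"
  have lP: "linear P" unfolding P_def by (rule linearI) auto
  have aP: "adjoint P = P" by (rule adjoint_unique) (auto simp: P_def inner_prod_def)
  define \<psi> where "\<psi> z = d * ((0, k) \<bullet> z + (- (x, 0) + P z) \<bullet> (- (x, 0) + P z))" for z :: "'b \<times> real"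
  have \<psi>: "\<psi> (y, r) = d * (k * r + (norm (y - x))\<^sup>2)" for y r
    by (simp add: \<psi>_def P_def inner_prod_def power2_norm_eq_inner)
  have td: "twice_diff UNIV \<psi> (\<lambda>z. d *\<^sub>R ((0, k) + adjoint P (2 *\<^sub>R (- (x, 0) + P z)))) (\<lambda>z w. d *\<^sub>R (0 + adjoint P (2 *\<^sub>R P w)))"
    unfolding \<psi>_def
    by (rule twice_diff_cmult, rule twice_diff_add, rule twice_diff_inner,
        rule twice_diff_affine[OF twice_diff_inner_self[of UNIV] lP UNIV_I])
  define T where "T = m / (d * k)"
  define r where "r = sqrt (m / d)"
  define K where "K = cball x r \<times> {min t tstar..max t T}"
  have cv: "continuous_on K (\<lambda>z. v z - \<psi> z)"
    by (intro continuous_intros continuous_on_subset[OF cont] continuous_on_subset[OF twice_diff_cont(1)[OF td]])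
       (use t tstar in \<open>auto simp: K_def\<close>)
  have r0: "r \<ge> 0" using m d by (simp add: r_def)
  have xtK: "(x, t) \<in> K" using r0 by (simp add: K_def)
  have cK: "compact K" unfolding K_def by (intro compact_Times compact_cball compact_Icc)
  obtain z where z: "z \<in> K" "\<And>y. y \<in> K \<Longrightarrow> v y - \<psi> y \<le> v z - \<psi> z"
    using continuous_attains_sup[OF cK _ cv] xtK by blast
  have pos: "v z - \<psi> z > 3/4 * m"
    using z(2)[OF xtK] dk by (simp add: \<psi> gap_def mult.assoc)
  have z0: "snd z > 0" using z(1) t tstar by (auto simp: K_def)
  have glob: "v y - \<psi> y \<le> v z - \<psi> z" if y: "y \<in> ball z (snd z)" for y
  proof (cases "y \<in> K")
    case False
    obtain a b where yy: "y = (a, b)" by (cases y)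
    have "\<bar>b - snd z\<bar> \<le> dist y z" using dist_snd_le[of y z] by (simp add: yy dist_real_def)
    then have b: "b > 0" using y by (simp add: dist_commute)
    have \<psi>0: "\<psi> y \<ge> 0" using d k b by (simp add: yy \<psi>)
    show ?thesis
    proof (cases "b < min t tstar")
      case True
      then have "v y \<le> 3/4 * m" using small_time_bound b by (simp add: yy)
      then show ?thesis using \<psi>0 pos by linarith
    next
      case f1: False
      have "m \<le> \<psi> y"
      proof (cases "b > max t T")
        case True
        then have "d * k * T \<le> d * k * b" using d k by (intro mult_left_mono) auto
        moreover have "d * k * T = m" using d k by (simp add: T_def)
        moreover have "d * k * b \<le> \<psi> y" using d by (simp add: yy \<psi> distrib_left)
        ultimately show ?thesis by linarith
      next
        case False
        then have "norm (a - x) > r" using \<open>y \<notin> K\<close> f1 by (auto simp: K_def yy dist_norm norm_minus_commute)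
        then have "r\<^sup>2 \<le> (norm (a - x))\<^sup>2" using r0 by (intro power_mono) auto
        then have "d * r\<^sup>2 \<le> d * (norm (a - x))\<^sup>2" using d by (intro mult_left_mono) auto
        moreover have "d * r\<^sup>2 = m" using d m by (simp add: r_def)
        moreover have "d * (norm (a - x))\<^sup>2 \<le> \<psi> y" using d k b by (simp add: yy \<psi> distrib_left)
        ultimately show ?thesis by linarith
      qed
      moreover have "v y \<le> m" using v b by (simp add: yy)
      ultimately show ?thesis using pos m by linarith
    qed
  qed (use z in auto)
  have "0 < v z"
  proof -
    have "\<psi> z \<ge> 0" using d k z0 by (cases z) (simp add: \<psi>)
    then show ?thesis using pos m by linarith
  qed
  then have zD: "z \<in> {z. 0 < snd z \<and> 0 < v z}" using z0 by simp
  have tdb: "twice_diff (ball z (snd z)) \<psi> (\<lambda>z. d *\<^sub>R ((0, k) + adjoint P (2 *\<^sub>R (- (x, 0) + P z)))) (\<lambda>z w. d *\<^sub>R (0 + adjoint P (2 *\<^sub>R P w)))"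
    by (rule twice_diff_subset[OF td]) simp
  have hess: "fst (d *\<^sub>R (0 + adjoint P (2 *\<^sub>R P (a, 0)))) \<bullet> a = 2 * d * (norm a)\<^sup>2" for a
    unfolding aP by (simp add: P_def dot_square_norm)
  have "snd (d *\<^sub>R ((0, k) + adjoint P (2 *\<^sub>R (- (x, 0) + P z)))) \<le> (DIM('b) + 1) * (2 * d)"
  proof (rule ptestD(2)[OF pt zD z0 tdb glob])
    fix a :: 'b
    show "\<bar>fst (d *\<^sub>R (0 + adjoint P (2 *\<^sub>R P (a, 0)))) \<bullet> a\<bar> \<le> 2 * d * (norm a)\<^sup>2"
      unfolding hess using d by simp
  qed
  then have "snd (d *\<^sub>R ((0, k) + P (2 *\<^sub>R (- (x, 0) + P z)))) \<le> (DIM('b) + 1) * (2 * d)"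
    unfolding aP .
  then have "d * k \<le> (real DIM('b) + 1) * (2 * d)" by (simp add: P_def add.commute)
  also have "\<dots> < d * k" using d by (simp add: k_def algebra_simps)
  finally show False by simp
qed

end

section \<open>From the envelope formulation to test inequalities\<close>

lemma lower_envelope_eqI:
  fixes G :: "real^'n \<Rightarrow> real^'n^'n \<Rightarrow> real"
  assumes "\<xi> \<noteq> 0" "transpose X = X"
    and c: "\<And>e. e > 0 \<Longrightarrow> \<exists>r0>0. \<forall>\<eta> Y. norm (\<eta> - \<xi>) < r0 \<and> norm (Y - X) < r0 \<longrightarrow> \<bar>G \<eta> Y - G \<xi> X\<bar> \<le> e"
  shows "lower_envelope G \<xi> X = G \<xi> X"
  unfolding lower_envelope_def
proof (rule tendsto_Lim)
  show "\<not> trivial_limit (at_right (0::real))" by simp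
  let ?S = "\<lambda>r. {G \<eta> Y | \<eta> Y. \<eta> \<noteq> 0 \<and> transpose Y = Y \<and> norm (\<eta> - \<xi>) < r \<and> norm (Y - X) < r}"
  show "((\<lambda>r. Inf (?S r)) \<longlongrightarrow> G \<xi> X) (at_right 0)"
  proof (rule tendstoI)
    fix e :: real assume e: "e > 0"
    obtain r0 where r0: "r0 > 0" "\<And>\<eta> Y. norm (\<eta> - \<xi>) < r0 \<Longrightarrow> norm (Y - X) < r0 \<Longrightarrow> \<bar>G \<eta> Y - G \<xi> X\<bar> \<le> e / 2"
      using c[of "e / 2"] e by auto
    have "dist (Inf (?S r)) (G \<xi> X) < e" if r: "0 < r" "r < r0" for r
    proof -
      have mem: "G \<xi> X \<in> ?S r" using assms(1,2) r by (auto intro!: exI[of _ \<xi>] exI[of _ X])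
      have lo: "G \<xi> X - e / 2 \<le> y" if y: "y \<in> ?S r" for y
      proof -
        obtain \<eta> Y where e: "y = G \<eta> Y" "norm (\<eta> - \<xi>) < r" "norm (Y - X) < r" using y by blast
        then have "\<bar>G \<eta> Y - G \<xi> X\<bar> \<le> e / 2" using r by (intro r0(2)) auto
        then show ?thesis unfolding e(1) by linarith
      qed
      have "G \<xi> X - e / 2 \<le> Inf (?S r)" by (rule cInf_greatest) (use mem lo in auto)
      moreover have "Inf (?S r) \<le> G \<xi> X"
        by (rule cInf_lower[OF mem]) (use lo in \<open>auto simp: bdd_below_def\<close>)
      ultimately show ?thesis using e by (simp add: dist_real_def abs_less_iff)
    qed
    then show "\<forall>\<^sub>F r in at_right 0. dist (Inf (?S r)) (G \<xi> X) < e"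
      using r0(1) by (auto simp: eventually_at_right[of 0 "r0"] intro!: exI[of _ r0])
  qed
qed

text \<open>
  Since \<open>Lim\<close> is meaningful only for convergent families, the monotone infima are shown to
  converge first; the upper bound serves this purpose.
\<close>

lemma lower_envelope_ge:
  fixes G :: "real^'n \<Rightarrow> real^'n^'n \<Rightarrow> real"
  assumes X: "transpose X = X" and r0: "r0 > 0"
    and lo: "\<And>\<eta> Y. norm (\<eta> - \<xi>) < r0 \<Longrightarrow> norm (Y - X) < r0 \<Longrightarrow> B \<le> G \<eta> Y"
    and up: "\<And>\<eta> Y. norm (\<eta> - \<xi>) < r0 \<Longrightarrow> norm (Y - X) < r0 \<Longrightarrow> G \<eta> Y \<le> B'"
  shows "B \<le> lower_envelope G \<xi> X"
proof -
  let ?S = "\<lambda>r. {G \<eta> Y | \<eta> Y. \<eta> \<noteq> 0 \<and> transpose Y = Y \<and> norm (\<eta> - \<xi>) < r \<and> norm (Y - X) < r}"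
  define h where "h r = Inf (?S r)" for r
  have S: "B \<le> y" "y \<le> B'" if y: "y \<in> ?S r" and r: "r \<le> r0" for y r
  proof -
    obtain \<eta> Y where "y = G \<eta> Y" "norm (\<eta> - \<xi>) < r" "norm (Y - X) < r" using y by blast
    then show "B \<le> y" "y \<le> B'" using lo[of \<eta> Y] up[of \<eta> Y] r by auto
  qed
  have bdd: "bdd_below (?S r)" if "r \<le> r0" for r
    by (rule bdd_belowI[of _ B]) (rule S(1)[OF _ that])
  have ne: "?S r \<noteq> {}" if r: "0 < r" for r
  proof -
    have "\<exists>\<eta>. \<eta> \<noteq> 0 \<and> norm (\<eta> - \<xi>) < r"
    proof (cases "\<xi> = 0")
      case True
      obtain \<eta> :: "real^'n" where "norm \<eta> = r / 2" using vector_choose_size[of "r / 2"] r by auto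
      then show ?thesis using r True by (intro exI[of _ \<eta>]) auto
    qed (use r in \<open>auto intro!: exI[of _ \<xi>]\<close>)
    then show ?thesis using X r by fastforce
  qed
  have hB: "B \<le> h r" "h r \<le> B'" if r: "0 < r" "r \<le> r0" for r
  proof -
    show "B \<le> h r" unfolding h_def by (rule cInf_greatest[OF ne[OF r(1)]]) (rule S(1)[OF _ r(2)])
    obtain y where y: "y \<in> ?S r" using ne[OF r(1)] by blast
    have "h r \<le> y" unfolding h_def by (rule cInf_lower[OF y bdd[OF r(2)]])
    also have "y \<le> B'" by (rule S(2)[OF y r(2)])
    finally show "h r \<le> B'" .
  qed
  have mono: "h r' \<le> h r" if "0 < r" "r \<le> r'" "r' \<le> r0" for r r'
    unfolding h_def by (rule cInf_superset_mono[OF ne[OF that(1)] bdd[OF that(3)]]) (use that in fastforce)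
  define l where "l = Sup (h ` {0<..r0})"
  have bddh: "bdd_above (h ` {0<..r0})" by (rule bdd_aboveI[of _ B']) (use hB(2) in auto)
  have "(h \<longlongrightarrow> l) (at_right 0)"
  proof (rule order_tendstoI)
    fix a assume "a < l"
    then obtain r1 where r1: "0 < r1" "r1 \<le> r0" "a < h r1"
      unfolding l_def using less_cSup_iff[OF _ bddh] r0 by auto
    have "a < h r" if "0 < r" "r < r1" for r using mono[of r r1] r1 that by simp
    then show "\<forall>\<^sub>F r in at_right 0. a < h r"
      using r1(1) by (auto simp: eventually_at_right[of 0 r1] intro!: exI[of _ r1])
  next
    fix a assume a: "l < a"
    have "h r < a" if "0 < r" "r < r0" for r
      using cSup_upper[OF _ bddh, of "h r"] that a unfolding l_def by force
    then show "\<forall>\<^sub>F r in at_right 0. h r < a"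
      using r0 by (auto simp: eventually_at_right[of 0 r0] intro!: exI[of _ r0])
  qed
  then have "lower_envelope G \<xi> X = l"
    unfolding lower_envelope_def h_def by (intro tendsto_Lim) auto
  moreover have "h r0 \<le> l" unfolding l_def by (rule cSup_upper[OF _ bddh]) (use r0 in auto)
  ultimately show ?thesis using hB(1)[of r0] r0 by simp
qed

lemma norm_matrix_vector_le:
  fixes A :: "real^'n^'m"
  shows "norm (A *v x) \<le> norm A * norm x"
proof -
  have "norm (A *v x) = L2_set (\<lambda>i. norm ((A *v x) $ i)) UNIV" by (simp add: norm_vec_def)
  also have "\<dots> \<le> L2_set (\<lambda>i. norm (A $ i) * norm x) UNIV"
  proof (rule L2_set_mono)
    fix i
    have "(A *v x) $ i = A $ i \<bullet> x" by (simp add: matrix_vector_mult_def inner_vec_def)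
    then show "norm ((A *v x) $ i) \<le> norm (A $ i) * norm x" by (simp add: Cauchy_Schwarz_ineq2)
  qed simp
  also have "\<dots> = norm A * norm x" by (simp add: L2_set_left_distrib norm_vec_def)
  finally show ?thesis .
qed

lemma quadratic_form_perturb:
  fixes X Y :: "real^'n^'n" and M r :: real
  assumes "\<And>a. \<bar>(X *v a) \<bullet> a\<bar> \<le> M * (norm a)\<^sup>2" "norm (Y - X) \<le> r"
  shows "\<bar>(Y *v a) \<bullet> a\<bar> \<le> (M + r) * (norm a)\<^sup>2"
proof -
  have "\<bar>((Y - X) *v a) \<bullet> a\<bar> \<le> norm ((Y - X) *v a) * norm a" by (rule Cauchy_Schwarz_ineq2)
  also have "\<dots> \<le> (norm (Y - X) * norm a) * norm a"
    by (intro mult_right_mono norm_matrix_vector_le) auto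
  also have "\<dots> = norm (Y - X) * (norm a)\<^sup>2" by (simp add: power2_eq_square)
  also have "\<dots> \<le> r * (norm a)\<^sup>2" using assms by (intro mult_right_mono) auto
  finally have "\<bar>((Y - X) *v a) \<bullet> a\<bar> \<le> r * (norm a)\<^sup>2" .
  moreover have "(Y *v a) \<bullet> a = (X *v a) \<bullet> a + ((Y - X) *v a) \<bullet> a"
    by (simp add: matrix_vector_mult_diff_rdistrib inner_diff_left)
  ultimately show ?thesis using assms(1)[of a] by (simp add: distrib_right)
qed

lemma exponent_inverse:
  assumes "1 < (p::ereal)"
  shows "0 \<le> real_of_ereal (1 / p)" "real_of_ereal (1 / p) < 1"
  using assms by (cases p; auto simp: one_ereal_def)+

lemma trace_eq_sum: "trace X = (\<Sum>b\<in>Basis. (X *v b) \<bullet> b)" for X :: "real^'n^'n"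
proof -
  have "(\<Sum>b\<in>(Basis::(real^'n) set). (X *v b) \<bullet> b) = (\<Sum>i\<in>UNIV. (X *v axis i 1) \<bullet> axis i 1)"
  proof -
    have B: "(Basis::(real^'n) set) = range (\<lambda>i. axis i 1)" by (auto simp: Basis_vec_def)
    show ?thesis unfolding B by (subst sum.reindex) (auto simp: inj_on_def axis_eq_axis)
  qed
  also have "\<dots> = (\<Sum>i\<in>UNIV. X $ i $ i)"
    by (simp add: inner_axis matrix_vector_mul_component inner_commute[of _ "axis _ _"] inner_axis')
  finally show ?thesis by (simp add: trace_def)
qed

lemma pLap_F_eq_pF: "pLap_F p \<xi> X = pF (real_of_ereal (1 / p)) \<xi> ((*v) X)"
  by (simp add: pLap_F_def pF_def trace_eq_sum)

lemma pF_crude_bound: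
  fixes X :: "'b::euclidean_space \<Rightarrow> 'b" and M :: real
  assumes q: "0 \<le> q" "q < 1" and X: "\<And>a. \<bar>X a \<bullet> a\<bar> \<le> M * (norm a)\<^sup>2"
  shows "\<bar>pF q \<xi> X\<bar> \<le> (DIM('b) + 1) * M"
proof -
  obtain b :: 'b where b: "b \<in> Basis" using nonempty_Basis by blast
  have M: "0 \<le> M" using X[of b] b by simp
  have "\<bar>\<Sum>b\<in>Basis. X b \<bullet> b\<bar> \<le> (\<Sum>b\<in>(Basis::'b set). M)"
  proof (rule order_trans[OF sum_abs sum_mono])
    fix b :: 'b assume "b \<in> Basis"
    then show "\<bar>X b \<bullet> b\<bar> \<le> M" using X[of b] by simp
  qed
  then have t: "\<bar>\<Sum>b\<in>Basis. X b \<bullet> b\<bar> \<le> DIM('b) * M" by simp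
  have a: "\<bar>q * (\<Sum>b\<in>Basis. X b \<bullet> b)\<bar> \<le> 1 * (DIM('b) * M)"
    unfolding abs_mult using t q M by (intro mult_mono) auto
  have r: "\<bar>(X \<xi> \<bullet> \<xi>) / (norm \<xi>)\<^sup>2\<bar> \<le> M"
  proof (cases "\<xi> = 0")
    case False
    then show ?thesis using X[of \<xi>] by (simp add: abs_divide divide_le_eq)
  qed (use M in simp)
  have b: "\<bar>(1 - 2 * q) * ((X \<xi> \<bullet> \<xi>) / (norm \<xi>)\<^sup>2)\<bar> \<le> 1 * M"
    unfolding abs_mult using r q by (intro mult_mono) auto
  have "\<bar>pF q \<xi> X\<bar> \<le> 1 * (DIM('b) * M) + 1 * M"
    unfolding pF_def by (rule order_trans[OF abs_triangle_ineq add_mono[OF a b]])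
  then show ?thesis by (simp add: distrib_right)
qed

lemma pLap_F_continuous:
  assumes "\<xi> \<noteq> 0"
  shows "isCont (\<lambda>z. pLap_F p (fst z) (snd z)) (\<xi>, X)"
proof -
  have e: "pLap_F p (fst z) (snd z) = real_of_ereal (1 / p) * (\<Sum>i\<in>UNIV. snd z $ i $ i)
     + (1 - 2 * real_of_ereal (1 / p)) * ((\<Sum>i\<in>UNIV. (\<Sum>j\<in>UNIV. snd z $ i $ j * fst z $ j) * fst z $ i) / (fst z \<bullet> fst z))" for z
  proof -
    have "(snd z *v fst z) \<bullet> fst z = (\<Sum>i\<in>UNIV. (\<Sum>j\<in>UNIV. snd z $ i $ j * fst z $ j) * fst z $ i)"
      by (simp add: inner_vec_def matrix_vector_mult_def)
    then show ?thesis by (simp add: pLap_F_def trace_def power2_norm_eq_inner)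
  qed
  show ?thesis unfolding e
    by (intro continuous_intros) (use assms in auto)
qed

lemma envelope_at_regular_gradient:
  assumes "\<xi> \<noteq> 0" "transpose X = X"
  shows "lower_envelope (pLap_F p) \<xi> X = pLap_F p \<xi> X" "upper_envelope (pLap_F p) \<xi> X = pLap_F p \<xi> X"
proof -
  have *: "\<exists>r0>0. \<forall>\<eta> Y. norm (\<eta> - \<xi>) < r0 \<and> norm (Y - X) < r0 \<longrightarrow> \<bar>pLap_F p \<eta> Y - pLap_F p \<xi> X\<bar> \<le> e"
    if e: "e > 0" for e
  proof -
    obtain d where d: "d > 0" "\<And>z. dist z (\<xi>, X) < d \<Longrightarrow> dist (pLap_F p (fst z) (snd z)) (pLap_F p \<xi> X) < e"
      using pLap_F_continuous[OF assms(1), where p=p and X=X] e unfolding continuous_at_eps_delta by (metis fst_conv snd_conv)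
    show ?thesis
    proof (intro exI[of _ "d / 2"] conjI allI impI)
      fix \<eta> Y assume "norm (\<eta> - \<xi>) < d / 2 \<and> norm (Y - X) < d / 2"
      then have "dist (\<eta>, Y) (\<xi>, X) < d"
        using sqrt_sum_squares_le_sum_abs[of "dist \<eta> \<xi>" "dist Y X"]
        by (simp add: norm_Pair dist_norm)
      from d(2)[OF this] show "\<bar>pLap_F p \<eta> Y - pLap_F p \<xi> X\<bar> \<le> e" by (simp add: dist_real_def)
    qed (use d in simp)
  qed
  show "lower_envelope (pLap_F p) \<xi> X = pLap_F p \<xi> X"
    by (rule lower_envelope_eqI[OF assms *])
  have "lower_envelope (\<lambda>\<eta> Y. - pLap_F p \<eta> Y) \<xi> X = - pLap_F p \<xi> X"
    by (rule lower_envelope_eqI[OF assms]) (use * in \<open>simp add: abs_minus_commute\<close>)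
  then show "upper_envelope (pLap_F p) \<xi> X = pLap_F p \<xi> X" by (simp add: upper_envelope_def)
qed

lemma envelope_crude_bound:
  fixes X :: "real^'n^'n" and M :: real
  assumes p: "1 < p" and X: "transpose X = X" and M: "\<And>a. \<bar>(X *v a) \<bullet> a\<bar> \<le> M * (norm a)\<^sup>2"
  shows "- ((real CARD('n) + 1) * M) \<le> lower_envelope (pLap_F p) \<xi> X"
    and "upper_envelope (pLap_F p) \<xi> X \<le> (real CARD('n) + 1) * M"
proof -
  let ?N = "real CARD('n) + 1"
  have b: "\<bar>pLap_F p \<eta> Y\<bar> \<le> ?N * (M + r)" if "norm (Y - X) < r" for r \<eta> Y
    using pF_crude_bound[OF exponent_inverse[OF p] quadratic_form_perturb[OF M, of Y r]] that
    by (simp add: pLap_F_eq_pF add.commute)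
  have "- (?N * (M + r)) \<le> lower_envelope (pLap_F p) \<xi> X" if "r > 0" for r
    by (rule lower_envelope_ge[OF X that, where B'="?N * (M + r)"]) (use b[of _ r] in \<open>auto simp: abs_le_iff minus_le_iff\<close>)
  moreover have "- (?N * (M + r)) \<le> lower_envelope (\<lambda>\<eta> Y. - pLap_F p \<eta> Y) \<xi> X" if "r > 0" for r
    by (rule lower_envelope_ge[OF X that, where B'="?N * (M + r)"]) (use b[of _ r] in \<open>auto simp: abs_le_iff minus_le_iff\<close>)
  ultimately have *: "- (?N * (M + r)) \<le> lower_envelope (pLap_F p) \<xi> X" "upper_envelope (pLap_F p) \<xi> X \<le> ?N * (M + r)"
    if "r > 0" for r using that unfolding upper_envelope_def by (auto simp: minus_le_iff)
  have N: "?N > 0" by simp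
  show "- (?N * M) \<le> lower_envelope (pLap_F p) \<xi> X"
  proof (rule field_le_epsilon)
    fix e :: real assume "e > 0"
    then show "- (?N * M) \<le> lower_envelope (pLap_F p) \<xi> X + e"
      using *(1)[of "e / ?N"] N by (simp add: distrib_left)
  qed
  show "upper_envelope (pLap_F p) \<xi> X \<le> ?N * M"
  proof (rule field_le_epsilon)
    fix e :: real assume "e > 0"
    then show "upper_envelope (pLap_F p) \<xi> X \<le> ?N * M + e"
      using *(2)[of "e / ?N"] N by (simp add: distrib_left)
  qed
qed

lemma twice_diff_imp_C2_on:
  assumes "twice_diff S f g H"
  shows "C2_on S f"
  unfolding C2_on_def
proof (intro exI conjI ballI)
  define K where "K z = (if z \<in> S then Blinfun (H z) else 0)" for z
  have K: "blinfun_apply (K z) = H z" if "z \<in> S" for z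
    using that twice_diffD(4)[OF assms that] by (simp add: K_def bounded_linear_Blinfun_apply linear_conv_bounded_linear)
  fix z assume z: "z \<in> S"
  show "(f has_derivative (\<lambda>v. g z \<bullet> v)) (at z)" by (rule twice_diffD(1)[OF assms z])
  show "(g has_derivative blinfun_apply (K z)) (at z)" using twice_diffD(2)[OF assms z] K[OF z] by simp
next
  define K where "K z = (if z \<in> S then Blinfun (H z) else 0)" for z
  have K: "blinfun_apply (K z) = H z" if "z \<in> S" for z
    using that twice_diffD(4)[OF assms that] by (simp add: K_def bounded_linear_Blinfun_apply linear_conv_bounded_linear)
  show "continuous_on S (\<lambda>z. if z \<in> S then Blinfun (H z) else 0)"
    unfolding K_def[symmetric]
  proof (rule continuous_on_blinfun_componentwise)
    fix i :: 'a
    show "continuous_on S (\<lambda>z. blinfun_apply (K z) i)"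
      using twice_diff_cont(3)[OF assms, of i] by (rule continuous_on_eq) (simp add: K)
  qed
qed

lemma spatial_jet:
  fixes \<phi> :: "(real^'n) \<times> real \<Rightarrow> real"
  assumes td: "twice_diff S \<phi> g H" and S: "open S" "(x, t) \<in> S"
  defines "X \<equiv> hessian (\<lambda>y. \<phi> (y, t)) x"
  shows "deriv (\<lambda>s. \<phi> (x, s)) t = snd (g (x, t))"
    and "gradient (\<lambda>y. \<phi> (y, t)) x = fst (g (x, t))"
    and "X *v a = fst (H (x, t) (a, 0))"
    and "transpose X = X"
proof -
  note d = twice_diffD[OF td]
  have "((\<lambda>s. (x, s)) has_derivative (\<lambda>s. (0, s))) (at t)" by (auto intro!: derivative_eq_intros)
  from has_derivative_compose[OF this d(1)[OF S(2)]]
  have "((\<lambda>s. \<phi> (x, s)) has_derivative (\<lambda>s. snd (g (x, t)) * s)) (at t)" by (simp add: inner_prod_def)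
  then have "((\<lambda>s. \<phi> (x, s)) has_real_derivative snd (g (x, t))) (at t)" by (simp add: has_field_derivative_def)
  then show "deriv (\<lambda>s. \<phi> (x, s)) t = snd (g (x, t))" by (rule DERIV_imp_deriv)
  have gr: "gradient (\<lambda>y. \<phi> (y, t)) y = fst (g (y, t))" if y: "(y, t) \<in> S" for y
  proof -
    have "((\<lambda>y. (y, t)) has_derivative (\<lambda>v. (v, 0))) (at y)" by (auto intro!: derivative_eq_intros)
    from has_derivative_compose[OF this d(1)[OF y]]
    have "((\<lambda>y. \<phi> (y, t)) has_derivative (\<lambda>v. fst (g (y, t)) \<bullet> v)) (at y)" by (simp add: inner_prod_def)
    then have "frechet_derivative (\<lambda>y. \<phi> (y, t)) (at y) = (\<lambda>v. fst (g (y, t)) \<bullet> v)"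
      by (rule frechet_derivative_at[symmetric])
    then show ?thesis by (simp add: gradient_def inner_axis vec_eq_iff)
  qed
  show "gradient (\<lambda>y. \<phi> (y, t)) x = fst (g (x, t))" by (rule gr[OF S(2)])
  define S' where "S' = (\<lambda>y. (y, t)) -` S"
  have oS: "open S'" unfolding S'_def by (intro open_vimage S(1) continuous_intros)
  have xS: "x \<in> S'" using S(2) by (simp add: S'_def)
  have "((\<lambda>y. (y, t)) has_derivative (\<lambda>v. (v, 0))) (at x)" by (auto intro!: derivative_eq_intros)
  from has_derivative_fst[OF has_derivative_compose[OF this d(2)[OF S(2)]]]
  have "((\<lambda>y. fst (g (y, t))) has_derivative (\<lambda>v. fst (H (x, t) (v, 0)))) (at x)" .
  then have "((gradient (\<lambda>y. \<phi> (y, t))) has_derivative (\<lambda>v. fst (H (x, t) (v, 0)))) (at x)"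
    by (rule has_derivative_transform_within_open[OF _ oS xS]) (simp add: gr S'_def)
  then have fr: "frechet_derivative (gradient (\<lambda>y. \<phi> (y, t))) (at x) = (\<lambda>v. fst (H (x, t) (v, 0)))"
    and lin: "linear (\<lambda>v. fst (H (x, t) (v, 0)))"
    by (auto intro: frechet_derivative_at[symmetric] has_derivative_linear)
  have X: "X = matrix (\<lambda>v. fst (H (x, t) (v, 0)))" by (simp add: X_def hessian_def jacobian_def fr)
  show "X *v a = fst (H (x, t) (a, 0))"
    using matrix_vector_mul(2)[OF lin] unfolding X by metis
  have "fst (H (x, t) (axis j 1, 0)) $ i = fst (H (x, t) (axis i 1, 0)) $ j" for i j
    using d(3)[OF S(2), of "(axis j 1, 0)" "(axis i 1, 0)"]
    by (simp add: inner_prod_def inner_axis inner_axis')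
  then show "transpose X = X" by (simp add: X transpose_def matrix_def vec_eq_iff)
qed

lemma DERIV_max_power:
  assumes n: "n \<ge> 2"
  shows "((\<lambda>x::real. (max 0 x)^n) has_real_derivative real n * (max 0 x)^(n - 1)) (at x)"
proof -
  consider "x > 0" | "x < 0" | "x = 0" by linarith
  then show ?thesis
  proof cases
    case 1
    have "((\<lambda>x. x^n) has_real_derivative real n * x^(n - 1)) (at x)"
      using DERIV_pow[of n x] by simp
    then show ?thesis using 1
      by (subst DERIV_cong_ev[OF refl _ refl, of _ "\<lambda>x. x^n"])
         (auto simp: max_def intro!: eventually_nhds_in_open[of "{0<..}", THEN eventually_mono])
  next
    case 2
    have z: "(0::real)^(n - Suc 0) = 0" "(0::real)^n = 0" using n by (simp_all add: power_0_left)
    have "((\<lambda>x. 0) has_real_derivative 0) (at x)" by simp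
    moreover have "real n * (max 0 x)^(n - 1) = 0" using 2 z by (simp add: max_def)
    ultimately show ?thesis using 2 n z
      by (simp only:, subst DERIV_cong_ev[OF refl _ refl, of _ "\<lambda>x. 0"])
         (auto simp: max_def power_0_left intro!: eventually_nhds_in_open[of "{..<0}", THEN eventually_mono])
  next
    case 3
    have lim: "((\<lambda>h::real. \<bar>h\<bar>^(n - 1)) \<longlongrightarrow> 0) (at 0)"
    proof -
      have "((\<lambda>h::real. \<bar>h\<bar>^(n - 1)) \<longlongrightarrow> \<bar>0\<bar>^(n - 1)) (at 0)" by (intro tendsto_intros)
      moreover have "\<bar>0::real\<bar>^(n - 1) = 0" using n by (simp add: power_0_left)
      ultimately show ?thesis by (simp only:)
    qed
    have "((\<lambda>h::real. ((max 0 (0 + h))^n - (max 0 0)^n) / h) \<longlongrightarrow> 0) (at 0)"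
    proof (rule Lim_null_comparison[OF _ lim])
      have "norm (((max 0 (0 + h))^n - (max 0 0)^n) / h) \<le> \<bar>h\<bar>^(n - 1)" if "h \<noteq> 0" for h :: real
      proof (cases "h > 0")
        case True
        have hn: "h^n = h^(n - 1) * h" using n by (simp flip: power_Suc2)
        have z: "(0::real)^n = 0" using n by (simp add: power_0_left)
        have mx: "max 0 (0 + h) = h" "max 0 (0::real) = 0" using True by auto
        have "((max 0 (0 + h))^n - (max 0 0)^n) / h = h^(n - 1)"
          unfolding mx z hn using True by simp
        then show ?thesis using True by simp
      qed (use n that in \<open>simp add: max_def\<close>)
      then show "\<forall>\<^sub>F h in at 0. norm (((max 0 (0 + h))^n - (max 0 0)^n) / h) \<le> \<bar>h::real\<bar>^(n - 1)"
        by (auto simp: eventually_at_filter)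
    qed
    moreover have "real n * (max 0 (0::real))^(n - 1) = 0" using n by (simp add: power_0_left)
    ultimately show ?thesis unfolding 3 DERIV_def by (simp only:)
  qed
qed

lemma twice_diff_cong_open:
  assumes "twice_diff S f g H" "open S" "\<And>z. z \<in> S \<Longrightarrow> f' z = f z" "\<And>z. z \<in> S \<Longrightarrow> g' z = g z" "\<And>z. z \<in> S \<Longrightarrow> H' z = H z"
  shows "twice_diff S f' g' H'"
proof (rule twice_diffI)
  fix z assume z: "z \<in> S"
  note d = twice_diffD[OF assms(1) z]
  have "(f' has_derivative (\<lambda>v. g z \<bullet> v)) (at z)"
    by (rule has_derivative_transform_within_open[OF d(1) assms(2) z]) (simp add: assms(3))
  then show "(f' has_derivative (\<lambda>v. g' z \<bullet> v)) (at z)" using assms(4)[OF z] by simp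
  have "(g' has_derivative H z) (at z)"
    by (rule has_derivative_transform_within_open[OF d(2) assms(2) z]) (simp add: assms(4))
  then show "(g' has_derivative H' z) (at z)" using assms(5)[OF z] by simp
  fix v w show "H' z v \<bullet> w = v \<bullet> H' z w" using d(3) assms(5)[OF z] by simp
next
  fix v show "continuous_on S (\<lambda>z. H' z v)"
    using twice_diff_cont(3)[OF assms(1), of v] by (rule continuous_on_eq) (simp add: assms(5))
qed

lemma twice_diff_Un:
  assumes "twice_diff S f g H" "twice_diff T f g H" "open S" "open T"
  shows "twice_diff (S \<union> T) f g H"
  using assms unfolding twice_diff_def by (auto intro: continuous_on_open_Un)

text \<open>
  Viscosity solutions are tested with functions that are defined and touch globally. A test function near \<open>z0\<close>
  is made global by interpolating, with a cut-off that equals \<open>1\<close> to second order at \<open>z0\<close>, between it and a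
  large constant; the contact inequality holds for both, hence for their convex combinations.
\<close>

lemma localise_test_function:
  fixes \<psi> :: "'a::euclidean_space \<Rightarrow> real"
  assumes td: "twice_diff (ball z0 r) \<psi> g H" and r: "r > 0"
    and loc: "\<And>y. y \<in> ball z0 r \<Longrightarrow> w y - \<psi> y \<le> w z0 - \<psi> z0"
    and bd: "\<And>y. y \<in> D \<Longrightarrow> w y \<le> B"
  shows "\<exists>\<phi> g' H'. twice_diff UNIV \<phi> g' H' \<and> g' z0 = g z0 \<and> H' z0 = H z0 \<and>
     (\<forall>y\<in>D. w y - \<phi> y \<le> w z0 - \<phi> z0)"
proof -
  \<comment> \<open>The cut-off is \<open>(max 0 (1 - c |z - z0|\<^sup>4))\<^sup>3\<close>: the fourth power makes its jet at \<open>z0\<close> trivial, and the cube makes it twice continuously differentiable across the sphere of radius \<open>r / 2\<close>.\<close>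
  define c where "c = 1 / (r / 2)^4"
  have c: "c > 0" using r by (simp add: c_def)
  define s where "s z = (- z0 + z) \<bullet> (- z0 + z)" for z
  have s: "s z = (norm (z - z0))\<^sup>2" for z by (simp add: s_def power2_norm_eq_inner)
  have ts: "twice_diff UNIV s (\<lambda>z. 2 *\<^sub>R (- z0 + z)) (\<lambda>_ v. 2 *\<^sub>R v)"
    unfolding s_def by (rule twice_diff_translate[OF twice_diff_inner_self UNIV_I])
  define n where "n z = 1 - c * (s z)\<^sup>2" for z
  define gn where "gn z = (- (2 * c * s z)) *\<^sub>R (2 *\<^sub>R (- z0 + z))" for z
  define Hn where "Hn z v = (- (2 * c * s z)) *\<^sub>R (2 *\<^sub>R v) + ((- (2 * c)) * ((2 *\<^sub>R (- z0 + z)) \<bullet> v)) *\<^sub>R (2 *\<^sub>R (- z0 + z))" for z v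
  have tn: "twice_diff UNIV n gn Hn"
    unfolding n_def gn_def Hn_def
    by (rule twice_diff_compose[OF ts, where k="\<lambda>x. 1 - c * x\<^sup>2" and ?k1.0="\<lambda>x. - (2 * c * x)" and ?k2.0="\<lambda>x. - (2 * c)"])
       (auto intro!: derivative_eq_intros)
  define cf where "cf z = (max 0 (n z))^3" for z
  define gcf where "gcf z = (3 * (max 0 (n z))\<^sup>2) *\<^sub>R gn z" for z
  define Hcf where "Hcf z v = (3 * (max 0 (n z))\<^sup>2) *\<^sub>R Hn z v + ((6 * max 0 (n z)) * (gn z \<bullet> v)) *\<^sub>R gn z" for z v
  have tcf: "twice_diff UNIV cf gcf Hcf"
    unfolding cf_def gcf_def Hcf_def
  proof (rule twice_diff_compose[OF tn, where k="\<lambda>x. (max 0 x)^3" and ?k1.0="\<lambda>x. 3 * (max 0 x)\<^sup>2" and ?k2.0="\<lambda>x. 6 * max 0 x"])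
    show "((\<lambda>x. (max 0 x)^3) has_real_derivative 3 * (max 0 (n z))\<^sup>2) (at (n z))" for z
      using DERIV_max_power[of 3 "n z"] by simp
    show "((\<lambda>x. 3 * (max 0 x)\<^sup>2) has_real_derivative 6 * max 0 (n z)) (at (n z))" for z
      using DERIV_cmult[OF DERIV_max_power[of 2 "n z"], of 3] by simp
  qed (intro continuous_intros)
  define M where "M = max (B - w z0 + \<psi> z0) 0"
  define \<phi> where "\<phi> z = M + cf z * (\<psi> z - M)" for z
  define g1 where "g1 z = 0 + (cf z *\<^sub>R (g z - 0) + (\<psi> z - M) *\<^sub>R gcf z)" for z
  define H1 where "H1 z v = 0 + (cf z *\<^sub>R (H z v - 0) + (\<psi> z - M) *\<^sub>R Hcf z v + (gcf z \<bullet> v) *\<^sub>R (g z - 0) + ((g z - 0) \<bullet> v) *\<^sub>R gcf z)" for z v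
  have t1: "twice_diff (ball z0 r) \<phi> g1 H1"
    unfolding \<phi>_def g1_def H1_def
    by (intro twice_diff_add twice_diff_const twice_diff_mult twice_diff_diff td twice_diff_subset[OF tcf]) auto
  have out: "n z \<le> 0" if "z \<notin> cball z0 (r / 2)" for z
  proof -
    have "(r / 2)^4 \<le> (norm (z - z0))^4"
      using that r by (intro power_mono) (auto simp: dist_norm norm_minus_commute)
    also have "\<dots> = (s z)\<^sup>2" by (simp add: s flip: power_mult)
    finally have "c * (r / 2)^4 \<le> c * (s z)\<^sup>2" using c by (intro mult_left_mono) auto
    then show ?thesis using r by (simp add: n_def c_def)
  qed
  define g' where "g' z = (if z \<in> ball z0 r then g1 z else 0)" for z
  define H' where "H' z = (if z \<in> ball z0 r then H1 z else (\<lambda>_. 0))" for z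
  have zero: "cf z = 0" "gcf z = 0" "Hcf z v = 0" if "z \<notin> cball z0 (r / 2)" for z v
    using out[OF that] by (auto simp: cf_def gcf_def Hcf_def max_def)
  have A: "twice_diff (ball z0 r) \<phi> g' H'"
    by (rule twice_diff_cong_open[OF t1]) (auto simp: g'_def H'_def)
  have B': "twice_diff (- cball z0 (r / 2)) \<phi> g' H'"
  proof (rule twice_diff_cong_open[OF twice_diff_const[of _ M]])
    fix z assume "z \<in> - cball z0 (r / 2)"
    then have z: "z \<notin> cball z0 (r / 2)" by simp
    show "\<phi> z = M" "g' z = 0" "H' z = (\<lambda>_. 0)"
      using zero[OF z] by (auto simp: \<phi>_def g'_def H'_def g1_def H1_def)
  qed (simp add: open_Compl)
  have cover: "ball z0 r \<union> - cball z0 (r / 2) = UNIV" using r by auto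
  have td': "twice_diff UNIV \<phi> g' H'"
    using twice_diff_Un[OF A B'] unfolding cover by (simp add: open_Compl)
  have s0: "s z0 = 0" by (simp add: s)
  have at0: "n z0 = 1" "gn z0 = 0" "Hn z0 v = 0" for v by (auto simp: n_def gn_def Hn_def s0)
  have cf0: "cf z0 = 1" "gcf z0 = 0" "Hcf z0 v = 0" for v by (auto simp: cf_def gcf_def Hcf_def at0)
  have "g' z0 = g z0" "H' z0 = H z0" using r by (auto simp: g'_def H'_def g1_def H1_def cf0)
  moreover have "w y - \<phi> y \<le> w z0 - \<phi> z0" if y: "y \<in> D" for y
  proof -
    have \<phi>0: "\<phi> z0 = \<psi> z0" by (simp add: \<phi>_def cf0)
    have far: "w y - M \<le> w z0 - \<psi> z0" using bd[OF y] by (simp add: M_def)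
    show ?thesis
    proof (cases "y \<in> cball z0 (r / 2)")
      case False
      then show ?thesis using zero(1)[OF False] far \<phi>0 by (simp add: \<phi>_def)
    next
      case True
      have "n y \<le> 1" using c by (simp add: n_def)
      then have ch: "0 \<le> cf y" "cf y \<le> 1" by (auto simp: cf_def power_le_one)
      have "y \<in> ball z0 r" using True r by auto
      then have near: "w y - \<psi> y \<le> w z0 - \<psi> z0" by (rule loc)
      have "w y - \<phi> y = cf y * (w y - \<psi> y) + (1 - cf y) * (w y - M)"
        by (simp add: \<phi>_def algebra_simps)
      also have "\<dots> \<le> cf y * (w z0 - \<psi> z0) + (1 - cf y) * (w z0 - \<psi> z0)"
        using ch near far by (intro add_mono mult_left_mono) auto
      finally show ?thesis using \<phi>0 by (simp add: algebra_simps)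
    qed
  qed
  ultimately show ?thesis using td' by blast
qed

text \<open>
  At a noncritical point the envelopes coincide with \<open>F\<close>, and in general they obey the crude bound. Both signs are
  treated at once with the factor \<open>\<sigma>\<close>, as \<open>F\<close> is odd.
\<close>

theorem viscosity_ptest:
  fixes u :: "(real^'n) \<times> real \<Rightarrow> real"
  assumes p: "1 < p" and vs: "viscosity_solution p \<Omega> u"
    and bd: "bounded (u ` (\<Omega> \<times> {0<..}))"
  shows "ptest (real_of_ereal (1 / p)) (\<Omega> \<times> {0<..}) u"
    and "ptest (real_of_ereal (1 / p)) (\<Omega> \<times> {0<..}) (\<lambda>z. - u z)"
proof -
  let ?q = "real_of_ereal (1 / p)"
  let ?D = "\<Omega> \<times> {0<..}"
  obtain B where B: "\<And>y. y \<in> ?D \<Longrightarrow> \<bar>u y\<bar> \<le> B" using bd unfolding bounded_iff by force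
  have core: "(fst (g z) \<noteq> 0 \<longrightarrow> snd (g z) \<le> pF ?q (fst (g z)) (\<lambda>a. fst (H z (a, 0)))) \<and>
        (\<forall>M::real. (\<forall>a. \<bar>fst (H z (a, 0)) \<bullet> a\<bar> \<le> M * (norm a)\<^sup>2) \<longrightarrow> snd (g z) \<le> (DIM(real^'n) + 1) * M)"
    if sg: "\<sigma> = 1 \<or> \<sigma> = -1" and z: "z \<in> ?D" and r: "0 < r" and td: "twice_diff (ball z r) \<psi> g H"
      and loc: "\<And>y. y \<in> ball z r \<Longrightarrow> \<sigma> * u y - \<psi> y \<le> \<sigma> * u z - \<psi> z" for \<sigma> r :: real and z \<psi> g H
  proof -
    obtain x t where zz: "z = (x, t)" "x \<in> \<Omega>" "t > 0" using z by auto
    have bd': "\<sigma> * u y \<le> B" if "y \<in> ?D" for y using B[OF that] sg by auto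
    obtain \<phi> g' H' where \<phi>: "twice_diff UNIV \<phi> g' H'" "g' z = g z" "H' z = H z"
      "\<And>y. y \<in> ?D \<Longrightarrow> \<sigma> * u y - \<phi> y \<le> \<sigma> * u z - \<phi> z"
      using localise_test_function[where w="\<lambda>y. \<sigma> * u y" and D="?D", OF td r loc bd'] by auto
    define \<Psi> where "\<Psi> y = \<sigma> * \<phi> y" for y
    have tdP: "twice_diff UNIV \<Psi> (\<lambda>y. \<sigma> *\<^sub>R g' y) (\<lambda>y v. \<sigma> *\<^sub>R H' y v)"
      unfolding \<Psi>_def by (rule twice_diff_cmult[OF \<phi>(1)])
    have C2: "C2_on ?D \<Psi>" by (rule twice_diff_imp_C2_on[OF twice_diff_subset[OF tdP]]) simp
    define X where "X = hessian (\<lambda>y. \<Psi> (y, t)) x"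
    note jet = spatial_jet[OF tdP open_UNIV UNIV_I, where x=x and t=t, folded X_def]
    have X: "X *v a = \<sigma> *\<^sub>R fst (H z (a, 0))" for a
      using jet(3)[of a] \<phi>(3) by (simp add: zz(1))
    have gr: "gradient (\<lambda>y. \<Psi> (y, t)) x = \<sigma> *\<^sub>R fst (g z)" "deriv (\<lambda>s. \<Psi> (x, s)) t = \<sigma> * snd (g z)"
      using jet(1,2) \<phi>(2) by (auto simp: zz(1))
    have s2: "\<sigma> * \<sigma> = 1" using sg by auto
    have main: "snd (g z) \<le> (if \<sigma> = 1 then upper_envelope (pLap_F p) (\<sigma> *\<^sub>R fst (g z)) X
        else - lower_envelope (pLap_F p) (\<sigma> *\<^sub>R fst (g z)) X)"
    proof (cases "\<sigma> = 1")
      case True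
      have "\<forall>y\<in>?D. u y - \<Psi> y \<le> u (x, t) - \<Psi> (x, t)" using \<phi>(4) True by (auto simp: \<Psi>_def zz(1))
      then have "deriv (\<lambda>s. \<Psi> (x, s)) t - upper_envelope (pLap_F p) (gradient (\<lambda>y. \<Psi> (y, t)) x) X \<le> 0"
        using vs zz C2 unfolding viscosity_solution_def X_def by blast
      then show ?thesis unfolding gr using True by simp
    next
      case False
      then have m1: "\<sigma> = -1" using sg by simp
      have "\<forall>y\<in>?D. u (x, t) - \<Psi> (x, t) \<le> u y - \<Psi> y" using \<phi>(4) m1 by (force simp: \<Psi>_def zz(1))
      then have "deriv (\<lambda>s. \<Psi> (x, s)) t - lower_envelope (pLap_F p) (gradient (\<lambda>y. \<Psi> (y, t)) x) X \<ge> 0"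
        using vs zz C2 unfolding viscosity_solution_def X_def by blast
      then show ?thesis unfolding gr using m1 by simp
    qed
    show ?thesis
    proof (intro conjI impI allI)
      assume nz: "fst (g z) \<noteq> 0"
      then have nz': "\<sigma> *\<^sub>R fst (g z) \<noteq> 0" using sg by auto
      have pl: "pLap_F p (\<sigma> *\<^sub>R fst (g z)) X = \<sigma> * pF ?q (fst (g z)) (\<lambda>a. fst (H z (a, 0)))"
      proof -
        have lin: "linear (H z)" using twice_diffD(4)[OF td] r by simp
        have "H z (\<sigma> *\<^sub>R fst (g z), 0) = \<sigma> *\<^sub>R H z (fst (g z), 0)"
          using linear_scale[OF lin, of \<sigma> "(fst (g z), 0)"] by simp
        then show ?thesis using sg
          by (auto simp: pLap_F_eq_pF pF_def X sum_negf)
      qed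
      show "snd (g z) \<le> pF ?q (fst (g z)) (\<lambda>a. fst (H z (a, 0)))"
        using main sg unfolding envelope_at_regular_gradient[OF nz' jet(4)] pl by auto
    next
      fix M :: real assume M: "\<forall>a. \<bar>fst (H z (a, 0)) \<bullet> a\<bar> \<le> M * (norm a)\<^sup>2"
      have XM: "\<bar>(X *v a) \<bullet> a\<bar> \<le> M * (norm a)\<^sup>2" for a using M sg by (auto simp: X)
      show "snd (g z) \<le> (DIM(real^'n) + 1) * M"
        using main sg envelope_crude_bound[OF p jet(4) XM, of "\<sigma> *\<^sub>R fst (g z)"] by (auto simp: add.commute)
    qed
  qed
  show "ptest ?q ?D u" unfolding ptest_def
    using core[of 1] by (intro ballI allI impI) simp
  show "ptest ?q ?D (\<lambda>z. - u z)" unfolding ptest_def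
    using core[of "-1"] by (intro ballI allI impI) simp
qed

section \<open>Exponential barriers\<close>

lemma pF_scale:
  assumes "linear X" "k \<noteq> 0"
  shows "pF q (k *\<^sub>R \<xi>) X = pF q \<xi> X"
proof -
  have "X (k *\<^sub>R \<xi>) \<bullet> (k *\<^sub>R \<xi>) = k\<^sup>2 * (X \<xi> \<bullet> \<xi>)"
    by (simp add: linear_scale[OF assms(1)] power2_eq_square)
  moreover have "(norm (k *\<^sub>R \<xi>))\<^sup>2 = k\<^sup>2 * (norm \<xi>)\<^sup>2"
    by (simp add: power_mult_distrib)
  ultimately show ?thesis using assms(2) unfolding pF_def by simp
qed

lemma pF_add: "pF q \<xi> (\<lambda>a. X a + Y a) = pF q \<xi> X + pF q \<xi> Y"
  by (simp add: pF_def inner_add_left sum.distrib add_divide_distrib algebra_simps)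

lemma pF_cmult: "pF q \<xi> (\<lambda>a. c *\<^sub>R X a) = c * pF q \<xi> X"
  by (simp add: pF_def algebra_simps flip: sum_distrib_left)

lemma pF_dyad: "\<xi> \<noteq> 0 \<Longrightarrow> pF q \<xi> (\<lambda>a. (\<xi> \<bullet> a) *\<^sub>R \<xi>) = (1 - q) * (norm \<xi>)\<^sup>2"
  using sum_inner_Basis[of \<xi> \<xi>]
  by (simp add: pF_def power2_norm_eq_inner[symmetric] power2_eq_square algebra_simps)

lemma pF_scalar: "\<xi> \<noteq> 0 \<Longrightarrow> pF q (\<xi>::'b::euclidean_space) (\<lambda>a. c *\<^sub>R a) = c * (q * DIM('b) + (1 - 2 * q))"
  by (simp add: pF_def power2_norm_eq_inner algebra_simps)

lemma twice_diff_exp: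
  assumes "twice_diff S e g H"
  shows "twice_diff S (\<lambda>z. c * exp (e z)) (\<lambda>z. (c * exp (e z)) *\<^sub>R g z)
    (\<lambda>z v. (c * exp (e z)) *\<^sub>R (H z v + (g z \<bullet> v) *\<^sub>R g z))"
proof -
  have "twice_diff S (\<lambda>z. exp (e z)) (\<lambda>z. exp (e z) *\<^sub>R g z)
    (\<lambda>z v. exp (e z) *\<^sub>R H z v + (exp (e z) * (g z \<bullet> v)) *\<^sub>R g z)"
    by (rule twice_diff_compose[OF assms]) (auto intro!: derivative_eq_intros continuous_intros)
  from twice_diff_cmult[OF this, of c] show ?thesis
    by (simp add: scaleR_add_right mult.assoc)
qed

text \<open>
  Test inequalities for \<open>c exp e\<close> in terms of the exponent: \<open>e\<close> is governed by the equation with the additional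
  term \<open>(1 - q) |\<nabla>e|\<^sup>2\<close>, which is where the constant \<open>1 / (4 (1 - q))\<close> originates.
\<close>

lemma ptest_exponential:
  fixes w :: "'b::euclidean_space \<times> real \<Rightarrow> real"
  assumes pt: "ptest q D w" "z \<in> D" "0 < r" and td: "twice_diff (ball z r) e g H"
    and loc: "\<And>y. y \<in> ball z r \<Longrightarrow> w y - c * exp (e y) \<le> w z - c * exp (e z)"
  shows "c \<noteq> 0 \<Longrightarrow> fst (g z) \<noteq> 0 \<Longrightarrow>
      c * snd (g z) \<le> c * (pF q (fst (g z)) (\<lambda>a. fst (H z (a, 0))) + (1 - q) * (norm (fst (g z)))\<^sup>2)"
    and "c > 0 \<Longrightarrow> fst (g z) = 0 \<Longrightarrow> (\<And>a. \<bar>fst (H z (a, 0)) \<bullet> a\<bar> \<le> M * (norm a)\<^sup>2) \<Longrightarrow>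
      snd (g z) \<le> (real DIM('b) + 1) * M"
proof -
  define k where "k = c * exp (e z)"
  note tde = twice_diff_exp[OF td, of c]
  note pd = ptestD[OF pt tde loc]
  have lin: "linear (H z)" using twice_diffD(4)[OF td] pt(3) by simp
  { assume c: "c \<noteq> 0" and nz: "fst (g z) \<noteq> 0"
    have k: "k \<noteq> 0" using c by (simp add: k_def)
    define X where "X = (\<lambda>a. fst (H z (a, 0)) + (fst (g z) \<bullet> a) *\<^sub>R fst (g z))"
    have lX: "linear (\<lambda>a. k *\<^sub>R X a)"
    proof -
      have "fst (H z (a + b, 0)) = fst (H z (a, 0)) + fst (H z (b, 0))" for a b
        using linear_add[OF lin, of "(a, 0)" "(b, 0)"] by simp
      moreover have "fst (H z (s *\<^sub>R a, 0)) = s *\<^sub>R fst (H z (a, 0))" for a s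
        using linear_scale[OF lin, of s "(a, 0)"] by simp
      ultimately show ?thesis
        unfolding X_def by (intro linearI) (auto simp: inner_add_right algebra_simps)
    qed
    have "k * snd (g z) \<le> pF q (k *\<^sub>R fst (g z)) (\<lambda>a. k *\<^sub>R X a)"
      using pd(1) nz k unfolding k_def[symmetric] X_def by (simp add: inner_prod_def)
    also have "\<dots> = k * pF q (fst (g z)) X" 
      using pF_scale[OF lX k] pF_cmult by (rule trans)
    also have "pF q (fst (g z)) X = pF q (fst (g z)) (\<lambda>a. fst (H z (a, 0))) + (1 - q) * (norm (fst (g z)))\<^sup>2"
      unfolding X_def pF_add pF_dyad[OF nz] ..
    finally have "exp (e z) * (c * snd (g z)) \<le> exp (e z) * (c * (pF q (fst (g z)) (\<lambda>a. fst (H z (a, 0))) + (1 - q) * (norm (fst (g z)))\<^sup>2))"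
      unfolding k_def by (simp add: mult_ac)
    then show "c * snd (g z) \<le> c * (pF q (fst (g z)) (\<lambda>a. fst (H z (a, 0))) + (1 - q) * (norm (fst (g z)))\<^sup>2)"
      by simp }
  { assume c: "c > 0" and z0: "fst (g z) = 0" and M: "\<And>a. \<bar>fst (H z (a, 0)) \<bullet> a\<bar> \<le> M * (norm a)\<^sup>2"
    have k: "k > 0" using c by (simp add: k_def)
    have "snd (k *\<^sub>R g z) \<le> (DIM('b) + 1) * (k * M)"
      unfolding k_def
    proof (rule pd(2))
      fix a :: 'b
      have eq: "fst ((c * exp (e z)) *\<^sub>R (H z (a, 0) + (g z \<bullet> (a, 0)) *\<^sub>R g z)) \<bullet> a = k * (fst (H z (a, 0)) \<bullet> a)"
        using z0 by (simp add: k_def inner_prod_def)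
      show "\<bar>fst ((c * exp (e z)) *\<^sub>R (H z (a, 0) + (g z \<bullet> (a, 0)) *\<^sub>R g z)) \<bullet> a\<bar> \<le> c * exp (e z) * M * (norm a)\<^sup>2"
        unfolding eq abs_mult using mult_left_mono[OF M[of a], of k] k by (simp add: k_def mult.assoc)
    qed
    then have "k * snd (g z) \<le> k * ((real DIM('b) + 1) * M)" by (simp add: mult_ac add.commute)
    then show "snd (g z) \<le> (real DIM('b) + 1) * M" using k by (simp add: mult_le_cancel_left_pos) }
qed

lemma twice_diff_space_dist2:
  fixes y :: "'b::euclidean_space"
  shows "twice_diff S (\<lambda>z::'b \<times> real. (norm (fst z - y))\<^sup>2) (\<lambda>z. (2 *\<^sub>R (fst z - y), 0)) (\<lambda>_ v. (2 *\<^sub>R fst v, 0))"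
proof (rule twice_diffI)
  fix z :: "'b \<times> real"
  have 1: "((\<lambda>z::'b \<times> real. fst z - y) has_derivative (\<lambda>v. fst v)) (at z)"
    by (auto intro!: derivative_eq_intros)
  show "((\<lambda>z::'b \<times> real. (norm (fst z - y))\<^sup>2) has_derivative (\<lambda>v. (2 *\<^sub>R (fst z - y), 0) \<bullet> v)) (at z)"
    unfolding power2_norm_eq_inner
    by (rule has_derivative_eq_rhs[OF has_derivative_inner[OF 1 1]])
       (auto simp: fun_eq_iff inner_commute inner_prod_def algebra_simps)
  show "((\<lambda>z::'b \<times> real. (2 *\<^sub>R (fst z - y), 0::real)) has_derivative (\<lambda>v. (2 *\<^sub>R fst v, 0))) (at z)"
    by (auto intro!: derivative_eq_intros)
qed (auto simp: inner_prod_def inner_commute algebra_simps)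

lemma twice_diff_time:
  "twice_diff S (\<lambda>z::'b::euclidean_space \<times> real. snd z) (\<lambda>_. (0, 1)) (\<lambda>_ _. 0)"
  using twice_diff_inner[of S "(0, 1) :: 'b \<times> real"] by (simp add: inner_prod_def)

text \<open>
  The barrier is the exponential of a linear function of time plus \<open>a\<close> times a smoothed distance from \<open>y\<close>. It
  exceeds \<open>B\<close> on the sphere of radius \<open>R\<close>, and also at all points after time \<open>T\<close> below, so \<open>u\<close> could exceed it
  only at an interior maximum, where the slope \<open>A\<close> in time is too large for the test inequality.
\<close>

lemma upper_barrier:
  fixes y :: "'b::euclidean_space" and u :: "'b \<times> real \<Rightarrow> real"
  assumes q: "0 \<le> q" "q < 1" and pt: "ptest q (\<Omega> \<times> {0<..}) u"
    and R: "R > 0" "cball y R \<subseteq> \<Omega>" and r0: "r0 > 0"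
    and cont: "continuous_on (cball y R \<times> {0..}) u" and u0: "\<And>x. x \<in> cball y R \<Longrightarrow> u (x, 0) = 0"
    and B: "B > 0" "\<And>x t. x \<in> cball y R \<Longrightarrow> 0 < t \<Longrightarrow> u (x, t) \<le> B"
    and a: "a > 0" and t: "t > 0"
  shows "u (y, t) \<le> B * exp ((a * ((real DIM('b) + 1) / r0) + (1 - q) * a\<^sup>2 + 1) * t - a * (sqrt (R\<^sup>2 + r0\<^sup>2) - r0))"
proof (rule ccontr)
  assume neg: "\<not> ?thesis"
  define A where "A = a * ((real DIM('b) + 1) / r0) + (1 - q) * a\<^sup>2 + 1"
  have "a * ((real DIM('b) + 1) / r0) \<ge> 0" "(1 - q) * a\<^sup>2 \<ge> 0" using a r0 q by auto
  then have A: "A \<ge> 1" unfolding A_def by linarith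
  define R1 where "R1 = sqrt (R\<^sup>2 + r0\<^sup>2)"
  define \<sigma> where "\<sigma> z = r0\<^sup>2 + (norm (fst z - y))\<^sup>2" for z :: "'b \<times> real"
  have \<sigma>: "\<sigma> z > 0" "\<sigma> z \<ge> r0\<^sup>2" for z using r0 by (auto simp: \<sigma>_def intro: add_pos_nonneg)
  have t\<sigma>: "twice_diff UNIV \<sigma> (\<lambda>z. (2 *\<^sub>R (fst z - y), 0)) (\<lambda>_ v. (2 *\<^sub>R fst v, 0))"
    using twice_diff_add[OF twice_diff_const[of UNIV "r0\<^sup>2"] twice_diff_space_dist2[of UNIV y]]
    unfolding \<sigma>_def by simp
  define e :: "'b \<times> real \<Rightarrow> real" where "e z = - a * R1 + (A * snd z + a * \<sigma> z powr (1/2))" for z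
  define g :: "'b \<times> real \<Rightarrow> 'b \<times> real" where "g z = 0 + (A *\<^sub>R (0, 1) + a *\<^sub>R (1/2 * \<sigma> z powr (1/2 - 1)) *\<^sub>R (2 *\<^sub>R (fst z - y), 0))" for z :: "'b \<times> real"
  define H :: "'b \<times> real \<Rightarrow> 'b \<times> real \<Rightarrow> 'b \<times> real" where "H z v = 0 + (A *\<^sub>R 0 + a *\<^sub>R ((1/2 * \<sigma> z powr (1/2 - 1)) *\<^sub>R (2 *\<^sub>R fst v, 0)
      + (1/2 * ((1/2 - 1) * \<sigma> z powr (1/2 - 2)) * ((2 *\<^sub>R (fst z - y), 0) \<bullet> v)) *\<^sub>R (2 *\<^sub>R (fst z - y), 0)))" for z v :: "'b \<times> real"
  have td: "twice_diff UNIV e g H"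
    unfolding e_def g_def H_def
    by (intro twice_diff_add twice_diff_const twice_diff_cmult twice_diff_time twice_diff_powr[OF t\<sigma>] \<sigma>)
  have sq: "\<sigma> z powr (1/2) = sqrt (\<sigma> z)" for z using \<sigma>(1)[of z] by (simp add: powr_half_sqrt less_imp_le)
  have sr0: "sqrt (\<sigma> z) \<ge> r0" for z using \<sigma>(2)[of z] r0 by (simp add: real_le_rsqrt)
  have sp: "sqrt (\<sigma> z) > 0" for z using \<sigma>(1) by simp
  have m: "\<sigma> z powr (1/2 - 1) = 1 / sqrt (\<sigma> z)" "\<sigma> z powr (1/2 - 2) = 1 / (\<sigma> z * sqrt (\<sigma> z))" for z
    using \<sigma>(1)[of z] unfolding powr_diff sq by (auto simp: field_simps power2_eq_square)
  have g: "fst (g z) = (a / sqrt (\<sigma> z)) *\<^sub>R (fst z - y)" "snd (g z) = A" for z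
    unfolding g_def m by simp_all
  define XG where "XG z h = (1 / sqrt (\<sigma> z)) *\<^sub>R h - (((fst z - y) \<bullet> h) / (\<sigma> z * sqrt (\<sigma> z))) *\<^sub>R (fst z - y)" for z :: "'b \<times> real" and h
  have H: "fst (H z (h, 0)) = a *\<^sub>R XG z h" for z h
  proof -
    define d where "d = fst z - y"
    show ?thesis
      unfolding H_def m XG_def d_def[symmetric] by (simp add: inner_prod_def algebra_simps)
  qed
  have XGb: "\<bar>XG z h \<bullet> h\<bar> \<le> (1 / r0) * (norm h)\<^sup>2" for z h
  proof -
    define d where "d = fst z - y"
    have "(d \<bullet> h)\<^sup>2 \<le> (norm d)\<^sup>2 * (norm h)\<^sup>2"
      using Cauchy_Schwarz_ineq[of d h] by (simp add: power2_norm_eq_inner)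
    also have "\<dots> \<le> \<sigma> z * (norm h)\<^sup>2" by (intro mult_right_mono) (auto simp: \<sigma>_def d_def)
    finally have c: "(d \<bullet> h)\<^sup>2 / (\<sigma> z * sqrt (\<sigma> z)) \<le> (norm h)\<^sup>2 / sqrt (\<sigma> z)"
      using \<sigma>(1)[of z] sp[of z] by (simp add: field_simps)
    have c0: "0 \<le> (d \<bullet> h)\<^sup>2 / (\<sigma> z * sqrt (\<sigma> z))" using \<sigma>(1)[of z] by simp
    have X: "XG z h \<bullet> h = (norm h)\<^sup>2 / sqrt (\<sigma> z) - (d \<bullet> h)\<^sup>2 / (\<sigma> z * sqrt (\<sigma> z))"
      by (simp add: XG_def d_def inner_diff_left power2_eq_square dot_square_norm)
    have "(norm h)\<^sup>2 / sqrt (\<sigma> z) \<le> (norm h)\<^sup>2 / r0"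
      using sr0[of z] sp[of z] r0 by (intro divide_left_mono mult_pos_pos) auto
    then show ?thesis using c c0 unfolding X by simp
  qed
  define w where "w z = B * exp (e z)" for z
  define T where "T = a * R1 + t"
  have R1: "R1 \<ge> 0" by (simp add: R1_def)
  have T: "T \<ge> t" using R1 a by (simp add: T_def)
  define K where "K = cball y R \<times> {0..T}"
  have cK: "compact K" unfolding K_def by (intro compact_Times compact_cball compact_Icc)
  have cW: "continuous_on K (\<lambda>z. u z - w z)"
    unfolding w_def
    by (intro continuous_intros continuous_on_subset[OF cont] continuous_on_subset[OF twice_diff_cont(1)[OF td]])
       (auto simp: K_def)
  have ytK: "(y, t) \<in> K" using R T t by (simp add: K_def)
  obtain z where z: "z \<in> K" "\<And>y. y \<in> K \<Longrightarrow> u y - w y \<le> u z - w z"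
    using continuous_attains_sup[OF cK _ cW] ytK by blast
  have "w (y, t) = B * exp (A * t - a * (sqrt (R\<^sup>2 + r0\<^sup>2) - r0))"
    unfolding w_def e_def sq using r0 by (simp add: \<sigma>_def R1_def algebra_simps)
  then have "u (y, t) - w (y, t) > 0" using neg unfolding A_def by simp
  then have pos: "u z - w z > 0" using z(2)[OF ytK] by linarith
  obtain x s where zz: "z = (x, s)" by (cases z)
  have wp: "w z > 0" for z using B by (simp add: w_def)
  have xs: "x \<in> cball y R" "0 \<le> s" "s \<le> T" using z(1) by (auto simp: zz K_def)
  have s0: "s > 0"
  proof (rule ccontr)
    assume "\<not> s > 0"
    then have "u z = 0" using xs u0 by (simp add: zz)
    then show False using pos wp[of z] by linarith
  qed
  have uB: "u z \<le> B" using B(2) xs s0 by (simp add: zz)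
  have wB: "w z < B" using uB pos by linarith
  then have ez: "e z < 0" using B by (simp add: w_def)
  have sT: "s < T"
  proof (rule ccontr)
    assume "\<not> s < T"
    then have "s = T" using xs by simp
    moreover have "1 * T \<le> A * T" using A T t by (intro mult_right_mono) auto
    moreover have "0 \<le> a * sqrt (\<sigma> z)" using a sp[of z] by simp
    ultimately have "e z \<ge> 0" using t unfolding e_def sq by (simp add: zz T_def)
    then show False using ez by simp
  qed
  have xR: "norm (x - y) < R"
  proof (rule ccontr)
    assume "\<not> norm (x - y) < R"
    then have "norm (x - y) = R" using xs by (simp add: dist_norm norm_minus_commute)
    then have "sqrt (\<sigma> z) = R1" by (simp add: \<sigma>_def R1_def zz add.commute)
    moreover have "0 \<le> A * s" using A s0 by simp
    ultimately show False using ez unfolding e_def sq by (simp add: zz)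
  qed
  define O' where "O' = ball y R \<times> {0<..<T}"
  have "open O'" "z \<in> O'" using s0 sT xR by (auto simp: O'_def zz dist_norm norm_minus_commute intro: open_Times)
  then obtain r where r: "r > 0" "ball z r \<subseteq> O'" using open_contains_ball by blast
  have loc: "u v - B * exp (e v) \<le> u z - B * exp (e z)" if "v \<in> ball z r" for v
  proof -
    have "v \<in> K" using r(2) that by (auto simp: O'_def K_def)
    then show ?thesis using z(2) by (simp add: w_def)
  qed
  have zD: "z \<in> \<Omega> \<times> {0<..}" using xs s0 R(2) by (auto simp: zz)
  note pe = ptest_exponential[OF pt zD r(1) twice_diff_subset[OF td subset_UNIV] loc]
  show False
  proof (cases "fst (g z) = 0")
    case True
    have "snd (g z) \<le> (real DIM('b) + 1) * (a * (1 / r0))"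
    proof (rule pe(2)[OF _ B(1) True])
      fix h
      show "\<bar>fst (H z (h, 0)) \<bullet> h\<bar> \<le> a * (1 / r0) * (norm h)\<^sup>2"
        unfolding H using mult_left_mono[OF XGb[of z h], of a] a by (simp add: abs_mult)
    qed
    moreover have "(1 - q) * a\<^sup>2 \<ge> 0" using q by simp
    ultimately show False using g(2)[of z] unfolding A_def by (simp add: mult_ac)
  next
    case False
    have "B * snd (g z) \<le> B * (pF q (fst (g z)) (\<lambda>h. fst (H z (h, 0))) + (1 - q) * (norm (fst (g z)))\<^sup>2)"
      by (rule pe(1)) (use B False in auto)
    then have 1: "A \<le> pF q (fst (g z)) (\<lambda>h. fst (H z (h, 0))) + (1 - q) * (norm (fst (g z)))\<^sup>2"
      using B g(2) by (simp add: mult_le_cancel_left_pos)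
    have "pF q (fst (g z)) (\<lambda>h. fst (H z (h, 0))) = a * pF q (fst (g z)) (XG z)"
      unfolding H pF_cmult ..
    also have "\<dots> \<le> a * ((real DIM('b) + 1) * (1 / r0))"
      using pF_crude_bound[where \<xi>="fst (g z)" and X="XG z", OF q XGb] a
      by (intro mult_left_mono) (auto simp: add.commute)
    finally have 2: "pF q (fst (g z)) (\<lambda>h. fst (H z (h, 0))) \<le> a * ((real DIM('b) + 1) / r0)" by simp
    have "(norm (fst (g z)))\<^sup>2 = a\<^sup>2 * ((norm (x - y))\<^sup>2 / \<sigma> z)"
      using \<sigma>(1)[of z] by (simp add: g(1) zz power_mult_distrib power_divide)
    also have "\<dots> \<le> a\<^sup>2 * 1"
    proof (rule mult_left_mono)
      show "(norm (x - y))\<^sup>2 / \<sigma> z \<le> 1" using \<sigma>(1)[of z] by (simp add: \<sigma>_def zz divide_le_eq)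
    qed simp
    finally have "(1 - q) * (norm (fst (g z)))\<^sup>2 \<le> (1 - q) * a\<^sup>2" using q by (intro mult_left_mono) auto
    then show False using 1 2 unfolding A_def by linarith
  qed
qed

text \<open>
  The exponent \<open>(1 - q) a\<^sup>2 t - a D\<close> is minimal for \<open>a = D / (2 (1 - q) t)\<close>, with the minimum
  \<open>-D\<^sup>2 / (4 (1 - q) t)\<close>. Smoothing the distance at scale \<open>r0 = R - d\<close> keeps \<open>D \<ge> d\<close>.
\<close>

corollary upper_decay:
  fixes y :: "'b::euclidean_space" and u :: "'b \<times> real \<Rightarrow> real"
  assumes q: "0 \<le> q" "q < 1" and pt: "ptest q (\<Omega> \<times> {0<..}) u"
    and R: "R > 0" "cball y R \<subseteq> \<Omega>" and d: "0 < d" "d < R"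
    and cont: "continuous_on (cball y R \<times> {0..}) u" and u0: "\<And>x. x \<in> cball y R \<Longrightarrow> u (x, 0) = 0"
    and B: "B > 0" "\<And>x t. x \<in> cball y R \<Longrightarrow> 0 < t \<Longrightarrow> u (x, t) \<le> B"
  obtains C where "C > 0" "\<And>t. 0 < t \<Longrightarrow> t \<le> 1 \<Longrightarrow> u (y, t) \<le> C * exp (- d\<^sup>2 / (4 * (1 - q)) / t)"
proof -
  define r0 where "r0 = R - d"
  have r0: "r0 > 0" using d by (simp add: r0_def)
  define D where "D = sqrt (R\<^sup>2 + r0\<^sup>2) - r0"
  have "R \<le> sqrt (R\<^sup>2 + r0\<^sup>2)" using R by (simp add: real_le_rsqrt)
  then have D: "D \<ge> d" by (simp add: D_def r0_def)
  define k where "k = 1 / (4 * (1 - q))"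
  have k: "k > 0" using q by (simp add: k_def)
  define c where "c = (real DIM('b) + 1) / r0"
  define C where "C = B * exp (2 * k * D * c + 1)"
  show thesis
  proof (rule that[of C])
    show "C > 0" using B by (simp add: C_def)
    fix t :: real assume t: "0 < t" "t \<le> 1"
    define a where "a = 2 * k * D / t"
    have a: "a > 0" using k D d t by (simp add: a_def)
    have "u (y, t) \<le> B * exp ((a * c + (1 - q) * a\<^sup>2 + 1) * t - a * D)"
      using upper_barrier[OF q pt R r0 cont u0 B a t(1)] unfolding c_def D_def .
    also have "(a * c + (1 - q) * a\<^sup>2 + 1) * t - a * D = 2 * k * D * c + t - k * D\<^sup>2 / t"
    proof -
      have k4: "(1 - q) * (4 * k) = 1" using q by (simp add: k_def)
      have "(1 - q) * a\<^sup>2 * t = ((1 - q) * (4 * k)) * (k * D\<^sup>2 / t)"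
        using t by (simp add: a_def power2_eq_square)
      then have "(1 - q) * a\<^sup>2 * t = k * D\<^sup>2 / t" unfolding k4 by simp
      moreover have "a * c * t = 2 * k * D * c" using t by (simp add: a_def)
      moreover have "a * D = 2 * (k * D\<^sup>2 / t)" by (simp add: a_def power2_eq_square)
      ultimately show ?thesis by (simp add: distrib_right)
    qed
    also have "B * exp (2 * k * D * c + t - k * D\<^sup>2 / t) \<le> B * exp ((2 * k * D * c + 1) + (- d\<^sup>2 / (4 * (1 - q)) / t))"
    proof -
      have "d\<^sup>2 \<le> D\<^sup>2" using D d by (intro power_mono) auto
      then have "k * d\<^sup>2 / t \<le> k * D\<^sup>2 / t" using k t by (intro divide_right_mono mult_left_mono) auto
      moreover have "- d\<^sup>2 / (4 * (1 - q)) / t = - (k * d\<^sup>2 / t)" by (simp add: k_def)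
      ultimately show ?thesis using B t by simp
    qed
    also have "\<dots> = C * exp (- d\<^sup>2 / (4 * (1 - q)) / t)" unfolding C_def exp_add by simp
    finally show "u (y, t) \<le> C * exp (- d\<^sup>2 / (4 * (1 - q)) / t)" .
  qed
qed

lemma exp_minus_le_power:
  fixes y :: real
  assumes "y > 0" "M > 0"
  shows "exp (- y) \<le> (real M / y) ^ M"
proof -
  have "(y / real M) ^ M \<le> exp (y / real M) ^ M"
  proof (rule power_mono)
    show "y / real M \<le> exp (y / real M)" using exp_ge_add_one_self[of "y / real M"] by linarith
  qed (use assms in simp)
  also have "\<dots> = exp y" using assms by (simp flip: exp_of_nat_mult)
  finally have 1: "(y / real M) ^ M \<le> exp y" .
  have 2: "(y / real M) ^ M > 0" using assms by simp
  have "exp (- y) = 1 / exp y" by (simp add: exp_minus inverse_eq_divide)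
  also have "\<dots> \<le> 1 / (y / real M) ^ M" using 1 2 by (intro divide_left_mono) auto
  also have "\<dots> = (real M / y) ^ M" by (simp add: power_divide)
  finally show ?thesis .
qed

text \<open>
  The Gaussian \<open>t\<^sup>-\<^sup>n exp (-k r\<^sup>2 / t)\<close>, written as an exponential.
\<close>

definition heat_profile :: "real \<Rightarrow> nat \<Rightarrow> real \<Rightarrow> real \<Rightarrow> real" where
  "heat_profile k n r t = exp (- k * r\<^sup>2 / t - real n * ln t)"

lemma heat_profile_eq: "t > 0 \<Longrightarrow> heat_profile k n r t = exp (- k * r\<^sup>2 / t) / t ^ n"
  by (simp add: heat_profile_def exp_diff exp_of_nat_mult)

text \<open>
  At a positive distance from the centre the Gaussian is bounded and tends to \<open>0\<close> as \<open>t \<rightarrow> 0\<close>, as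
  \<open>t \<rightarrow> \<infinity>\<close>, and as \<open>r \<rightarrow> \<infinity>\<close> for bounded \<open>t\<close>. This confines the comparison to a compact set even if \<open>\<Omega>\<close> is
  unbounded.
\<close>

lemma heat_profile_decay:
  assumes k: "k > 0" and n: "n > 0" and r0: "\<rho> > 0"
  obtains A where "A \<ge> 1" "\<And>r t. r \<ge> \<rho> \<Longrightarrow> t > 0 \<Longrightarrow> heat_profile k n r t \<le> A * t / r"
    "\<And>r t. r \<ge> \<rho> \<Longrightarrow> t \<ge> 1 \<Longrightarrow> heat_profile k n r t \<le> 1 / t"
    "\<And>r t. r \<ge> \<rho> \<Longrightarrow> t > 0 \<Longrightarrow> heat_profile k n r t \<le> A"
proof -
  define c where "c = (real (Suc n) / k) ^ Suc n"
  have c: "c \<ge> 0" using k by (simp add: c_def)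
  have D: "heat_profile k n r t \<le> c / \<rho> ^ (2 * n + 1) * t / r" if r: "r \<ge> \<rho>" and t: "t > 0" for r t
  proof -
    have rp: "r > 0" using r r0 by simp
    have "exp (- (k * r\<^sup>2 / t)) \<le> (real (Suc n) / (k * r\<^sup>2 / t)) ^ Suc n"
      by (rule exp_minus_le_power) (use k rp t in auto)
    also have "real (Suc n) / (k * r\<^sup>2 / t) = (real (Suc n) / k) * (t / r\<^sup>2)"
      by simp
    also have "\<dots> ^ Suc n = c * (t ^ Suc n / r ^ (2 * n + 1) / r)"
    proof -
      have "2 * Suc n = Suc (2 * n + 1)" by simp
      then have "(r\<^sup>2) ^ Suc n = r ^ (2 * n + 1) * r"
        unfolding power_mult[symmetric] by (simp only: power_Suc2)
      then show ?thesis unfolding c_def power_mult_distrib power_divide[of t] by simp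
    qed
    finally have "exp (- k * r\<^sup>2 / t) / t ^ n \<le> c * (t ^ Suc n / r ^ (2 * n + 1) / r) / t ^ n"
      using t by (intro divide_right_mono) auto
    also have "\<dots> = c * t / r / r ^ (2 * n + 1)" using t by simp
    also have "\<dots> \<le> c * t / r / \<rho> ^ (2 * n + 1)"
      using c t rp r r0 by (intro divide_left_mono power_mono mult_pos_pos) auto
    also have "\<dots> = c / \<rho> ^ (2 * n + 1) * t / r" by simp
    finally show ?thesis unfolding heat_profile_eq[OF t] .
  qed
  define C where "C = c / \<rho> ^ (2 * n + 1)"
  have C: "C \<ge> 0" using c r0 by (simp add: C_def)
  have L: "heat_profile k n r t \<le> 1 / t" if r: "r \<ge> \<rho>" and t: "t \<ge> 1" for r t
  proof -
    have "exp (- k * r\<^sup>2 / t) \<le> 1" using k t by simp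
    moreover have "t ^ 1 \<le> t ^ n" using t n by (intro power_increasing) auto
    ultimately have "exp (- k * r\<^sup>2 / t) / t ^ n \<le> 1 / t" using t by (intro frac_le) auto
    then show ?thesis using heat_profile_eq[of t k n r] t by simp
  qed
  define A where "A = 1 + C + C / \<rho>"
  have A: "A \<ge> 1" "C \<le> A" "C / \<rho> \<le> A" using C r0 by (simp_all add: A_def)
  show thesis
  proof (rule that[of A])
    show "A \<ge> 1" by (rule A)
    fix r t :: real assume r: "r \<ge> \<rho>"
    { assume t: "t > 0"
      have "heat_profile k n r t \<le> C * t / r" using D[OF r t] by (simp add: C_def)
      also have "\<dots> \<le> A * t / r" using A t r r0 by (intro divide_right_mono mult_right_mono) auto
      finally show "heat_profile k n r t \<le> A * t / r" . }
    { assume t: "t \<ge> 1" show "heat_profile k n r t \<le> 1 / t" by (rule L[OF r t]) }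
    { assume t: "t > 0"
      show "heat_profile k n r t \<le> A"
      proof (cases "t \<ge> 1")
        case True
        then have "1 / t \<le> 1" by simp
        then show ?thesis using L[OF r True] A by linarith
      next
        case False
        have "heat_profile k n r t \<le> C * t / r" using D[OF r t] by (simp add: C_def)
        also have "\<dots> \<le> C * 1 / \<rho>" using False t C r r0 by (intro frac_le mult_mono) auto
        finally show ?thesis using A by simp
      qed }
  qed
qed

lemma heat_profile_jet:
  fixes z' :: "'b::euclidean_space"
  shows "twice_diff {z. snd z > 0} (\<lambda>z::'b \<times> real. - k * (norm (fst z - z'))\<^sup>2 / snd z - c * ln (snd z))
    (\<lambda>z. ((- 2 * k / snd z) *\<^sub>R (fst z - z'), k * (norm (fst z - z'))\<^sup>2 / (snd z)\<^sup>2 - c / snd z))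
    (\<lambda>z v. ((- 2 * k / snd z) *\<^sub>R fst v + (2 * k * snd v / (snd z)\<^sup>2) *\<^sub>R (fst z - z'),
      (2 * k / (snd z)\<^sup>2) * ((fst z - z') \<bullet> fst v) - 2 * k * (norm (fst z - z'))\<^sup>2 * snd v / (snd z)^3
        + c * snd v / (snd z)\<^sup>2))"
  (is "twice_diff ?S ?f ?g ?H")
proof -
  define d where "d z = fst z - z'" for z :: "'b \<times> real"
  define \<sigma> where "\<sigma> z = (norm (d z))\<^sup>2" for z :: "'b \<times> real"
  have dd: "(d has_derivative fst) (at z)" for z
    unfolding d_def by (auto intro!: derivative_eq_intros)
  have d\<sigma>: "(\<sigma> has_derivative (\<lambda>v. 2 * (d z \<bullet> fst v))) (at z)" for z
    using twice_diffD(1)[OF twice_diff_space_dist2[of UNIV z'], of z]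
    unfolding \<sigma>_def[abs_def] d_def by (simp add: inner_prod_def)
  have cont: "continuous_on ?S d" "continuous_on ?S \<sigma>"
    unfolding \<sigma>_def d_def by (intro continuous_intros)+
  show ?thesis
    unfolding d_def[symmetric] \<sigma>_def[symmetric]
  proof (rule twice_diffI)
    fix z :: "'b \<times> real" assume z: "z \<in> ?S"
    show "((\<lambda>z. - k * \<sigma> z / snd z - c * ln (snd z)) has_derivative
        (\<lambda>v. ((- 2 * k / snd z) *\<^sub>R d z, k * \<sigma> z / (snd z)\<^sup>2 - c / snd z) \<bullet> v)) (at z)"
      using z by (auto intro!: derivative_eq_intros d\<sigma>
          simp: fun_eq_iff inner_prod_def field_simps power2_eq_square)
    show "((\<lambda>z. ((- 2 * k / snd z) *\<^sub>R d z, k * \<sigma> z / (snd z)\<^sup>2 - c / snd z)) has_derivative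
      (\<lambda>v. ((- 2 * k / snd z) *\<^sub>R fst v + (2 * k * snd v / (snd z)\<^sup>2) *\<^sub>R d z,
        (2 * k / (snd z)\<^sup>2) * (d z \<bullet> fst v) - 2 * k * \<sigma> z * snd v / (snd z)^3
          + c * snd v / (snd z)\<^sup>2))) (at z)"
      using z by (auto intro!: derivative_eq_intros d\<sigma> dd
          simp: fun_eq_iff field_simps power2_eq_square power3_eq_cube)
  next
    fix v
    show "continuous_on ?S (\<lambda>z. ((- 2 * k / snd z) *\<^sub>R fst v + (2 * k * snd v / (snd z)\<^sup>2) *\<^sub>R d z,
        (2 * k / (snd z)\<^sup>2) * (d z \<bullet> fst v) - 2 * k * \<sigma> z * snd v / (snd z)^3
          + c * snd v / (snd z)\<^sup>2))"
      by (intro continuous_intros cont) auto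
  qed (simp add: inner_prod_def inner_add_left inner_add_right inner_commute algebra_simps)
qed

text \<open>
  With \<open>e = -k |x - z'|\<^sup>2 / t - n ln t\<close> the terms of order \<open>t\<^sup>-\<^sup>2\<close> in the equation for the exponent
  cancel for this \<open>k\<close>, and those of order \<open>1/t\<close> have the right sign for large \<open>n\<close>. If the multiple of the Gaussian
  exceeded \<open>u\<close>, their difference would have a positive maximum. It is not on the boundary, where \<open>u = 1\<close>, and not
  near time \<open>0\<close> or infinity, where the Gaussian is small and \<open>u \<ge> 0\<close>.
\<close>

lemma lower_barrier:
  fixes z' :: "'b::euclidean_space" and u :: "'b \<times> real \<Rightarrow> real"
  assumes q: "0 \<le> q" "q < 1" and \<Omega>: "open \<Omega>" and pt: "ptest q (\<Omega> \<times> {0<..}) (\<lambda>z. - u z)"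
    and nonneg: "\<And>x t. x \<in> \<Omega> \<Longrightarrow> 0 < t \<Longrightarrow> 0 \<le> u (x, t)"
    and cont: "continuous_on (closure \<Omega> \<times> {0<..}) u"
    and bdry: "\<And>x t. x \<in> frontier \<Omega> \<Longrightarrow> 0 < t \<Longrightarrow> u (x, t) = 1"
    and \<rho>: "\<rho> > 0" "\<And>x. x \<in> closure \<Omega> \<Longrightarrow> \<rho> \<le> norm (x - z')"
  shows "\<exists>A>0. \<exists>n. \<forall>x\<in>\<Omega>. \<forall>t>0. heat_profile (1 / (4 * (1 - q))) n (norm (x - z')) t / A \<le> u (x, t)"
proof -
  define k where "k = 1 / (4 * (1 - q))"
  have k: "k > 0" using q by (simp add: k_def)
  have kk: "(1 - q) * (4 * k) = 1" using q by (simp add: k_def)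
  obtain n :: nat where n: "real n > 2 * k * (q * DIM('b) + (1 - 2 * q)) \<and> real n > 0"
    using reals_Archimedean2[of "max (2 * k * (q * DIM('b) + (1 - 2 * q))) 0"] by auto
  obtain A where A: "A \<ge> 1" "\<And>r t. r \<ge> \<rho> \<Longrightarrow> t > 0 \<Longrightarrow> heat_profile k n r t \<le> A * t / r"
    "\<And>r t. r \<ge> \<rho> \<Longrightarrow> t \<ge> 1 \<Longrightarrow> heat_profile k n r t \<le> 1 / t"
    "\<And>r t. r \<ge> \<rho> \<Longrightarrow> t > 0 \<Longrightarrow> heat_profile k n r t \<le> A"
    using heat_profile_decay[OF k _ \<rho>(1), of n] n by auto
  define e where "e z = - k * (norm (fst z - z'))\<^sup>2 / snd z - real n * ln (snd z)" for z :: "'b \<times> real"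
  define \<phi> where "\<phi> z = exp (e z)" for z
  have \<phi>h: "\<phi> z = heat_profile k n (norm (fst z - z')) (snd z)" for z
    by (simp add: \<phi>_def e_def heat_profile_def)
  have \<phi>0: "\<phi> z > 0" for z by (simp add: \<phi>_def)
  have main: "\<phi> (x0, t0) / A \<le> u (x0, t0)" if x0: "x0 \<in> \<Omega>" and t0: "0 < t0" for x0 t0
  proof (rule ccontr)
    assume neg: "\<not> ?thesis"
    define \<epsilon> where "\<epsilon> = \<phi> (x0, t0) / A - u (x0, t0)"
    have \<epsilon>: "\<epsilon> > 0" using neg by (simp add: \<epsilon>_def)
    define t1 where "t1 = \<rho> * \<epsilon> / 2"
    define t2 where "t2 = 1 + 1 / \<epsilon>"
    define R where "R = t2 / \<epsilon> + 1"
    have t12: "t1 > 0" "t2 \<ge> 1" "R > 0" using \<epsilon> \<rho> by (simp_all add: t1_def t2_def R_def add_pos_pos)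
    define K where "K = (closure \<Omega> \<inter> cball z' R) \<times> {t1..t2}"
    have cK: "compact K"
      unfolding K_def by (intro compact_Times closed_Int_compact) auto
    have outside: "\<phi> z / A < \<epsilon>" if z: "fst z \<in> closure \<Omega>" "snd z > 0" "z \<notin> K" for z
    proof -
      obtain x t where zz: "z = (x, t)" by (cases z)
      have r: "\<rho> \<le> norm (x - z')" using \<rho>(2) z by (simp add: zz)
      have rp: "norm (x - z') > 0" using r \<rho>(1) by linarith
      have t: "t > 0" using z by (simp add: zz)
      have "\<phi> z \<le> A * t / norm (x - z')" using A(2)[OF r t] by (simp add: \<phi>h zz)
      then have 1: "\<phi> z / A \<le> t / norm (x - z')" using A(1) by (simp add: divide_le_eq mult_ac)
      consider "t < t1" | "t > t2" | "t \<le> t2" "norm (x - z') > R"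
        using z by (force simp: zz K_def dist_norm norm_minus_commute)
      then show ?thesis
      proof cases
        case 1
        have "t / norm (x - z') \<le> t1 / \<rho>" using 1 t r \<rho>(1) by (intro frac_le) auto
        also have "\<dots> < \<epsilon>" using \<rho>(1) \<epsilon> by (simp add: t1_def)
        finally show ?thesis using \<open>\<phi> z / A \<le> t / norm (x - z')\<close> by linarith
      next
        case 2
        have t1': "t \<ge> 1" using 2 t12 by linarith
        have "\<phi> z \<le> 1 / t" using A(3)[OF r t1'] by (simp add: \<phi>h zz)
        moreover have "\<phi> z / A \<le> \<phi> z / 1" using A(1) \<phi>0[of z] by (intro divide_left_mono) auto
        moreover have "1 / t < \<epsilon>"
        proof -
          have "1 / \<epsilon> < t" using 2 by (simp add: t2_def)
          then show ?thesis using \<epsilon> t by (simp add: field_simps)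
        qed
        ultimately show ?thesis by simp
      next
        case 3
        have "t / norm (x - z') \<le> t2 / norm (x - z')" using 3 rp by (intro divide_right_mono) auto
        also have "\<dots> < \<epsilon>"
        proof -
          have "t2 / \<epsilon> < norm (x - z')" using 3 by (simp add: R_def)
          then show ?thesis using \<epsilon> rp by (simp add: field_simps)
        qed
        finally show ?thesis using 1 by linarith
      qed
    qed
    have td: "twice_diff {z. snd z > 0} e
       (\<lambda>z. ((- 2 * k / snd z) *\<^sub>R (fst z - z'), k * (norm (fst z - z'))\<^sup>2 / (snd z)\<^sup>2 - real n / snd z))
       (\<lambda>z v. ((- 2 * k / snd z) *\<^sub>R fst v + (2 * k * snd v / (snd z)\<^sup>2) *\<^sub>R (fst z - z'),
      (2 * k / (snd z)\<^sup>2) * ((fst z - z') \<bullet> fst v) - 2 * k * (norm (fst z - z'))\<^sup>2 * snd v / (snd z)^3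
        + real n * snd v / (snd z)\<^sup>2))"
      unfolding e_def by (rule heat_profile_jet)
    have K: "(x0, t0) \<in> K"
    proof (rule ccontr)
      assume "(x0, t0) \<notin> K"
      then have "\<phi> (x0, t0) / A < \<epsilon>" using outside[of "(x0, t0)"] x0 t0 closure_subset by auto
      then show False using nonneg[OF x0 t0] by (simp add: \<epsilon>_def)
    qed
    have "continuous_on K (\<lambda>z. \<phi> z / A - u z)"
      unfolding \<phi>_def using A(1) t12
      by (intro continuous_intros continuous_on_subset[OF cont] continuous_on_subset[OF twice_diff_cont(1)[OF td]])
         (auto simp: K_def)
    then obtain z where z: "z \<in> K" "\<And>y. y \<in> K \<Longrightarrow> \<phi> y / A - u y \<le> \<phi> z / A - u z"
      using continuous_attains_sup[OF cK] K by blast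
    have ez: "\<epsilon> \<le> \<phi> z / A - u z" using z(2)[OF K] by (simp add: \<epsilon>_def)
    obtain x t where zz: "z = (x, t)" by (cases z)
    have xt: "x \<in> closure \<Omega>" "t > 0" using z(1) t12 by (auto simp: zz K_def)
    have r: "\<rho> \<le> norm (x - z')" using \<rho>(2) xt by simp
    have "\<phi> z \<le> A" using A(4)[OF r xt(2)] by (simp add: \<phi>h zz)
    then have "\<phi> z / A \<le> 1" using A(1) by simp
    then have "u z < 1" using ez \<epsilon> by linarith
    then have "x \<notin> frontier \<Omega>" using bdry[OF _ xt(2)] zz by force
    then have x: "x \<in> \<Omega>" using xt(1) \<Omega> by (simp add: frontier_def interior_open)
    have zD: "z \<in> \<Omega> \<times> {0<..}" using x xt by (simp add: zz)
    have "open (\<Omega> \<times> {0::real<..})" using \<Omega> by (intro open_Times) auto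
    then obtain s where s: "s > 0" "ball z s \<subseteq> \<Omega> \<times> {0<..}" using zD open_contains_ball by blast
    have glob: "\<phi> y / A - u y \<le> \<phi> z / A - u z" if y: "y \<in> \<Omega> \<times> {0<..}" for y
    proof (cases "y \<in> K")
      case True then show ?thesis by (rule z(2))
    next
      case False
      have "fst y \<in> closure \<Omega>" "snd y > 0" using y closure_subset[of \<Omega>] by auto
      then have "\<phi> y / A < \<epsilon>" using False by (rule outside)
      moreover have "u y \<ge> 0" using nonneg y by auto
      ultimately show ?thesis using ez by linarith
    qed
    have loc: "- u y - (- 1 / A) * exp (e y) \<le> - u z - (- 1 / A) * exp (e z)" if "y \<in> ball z s" for y
      using glob[of y] s(2) that by (auto simp: \<phi>_def)
    have td': "twice_diff (ball z s) e
       (\<lambda>z. ((- 2 * k / snd z) *\<^sub>R (fst z - z'), k * (norm (fst z - z'))\<^sup>2 / (snd z)\<^sup>2 - real n / snd z))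
       (\<lambda>z v. ((- 2 * k / snd z) *\<^sub>R fst v + (2 * k * snd v / (snd z)\<^sup>2) *\<^sub>R (fst z - z'),
      (2 * k / (snd z)\<^sup>2) * ((fst z - z') \<bullet> fst v) - 2 * k * (norm (fst z - z'))\<^sup>2 * snd v / (snd z)^3
        + real n * snd v / (snd z)\<^sup>2))"
      by (rule twice_diff_subset[OF td]) (use s in auto)
    define \<xi> where "\<xi> = (- 2 * k / t) *\<^sub>R (x - z')"
    have nz: "\<xi> \<noteq> 0" using r \<rho>(1) k xt by (auto simp: \<xi>_def)
    have "(- 1 / A) * (k * (norm (x - z'))\<^sup>2 / t\<^sup>2 - real n / t)
        \<le> (- 1 / A) * (pF q \<xi> (\<lambda>a. (- 2 * k / t) *\<^sub>R a) + (1 - q) * (norm \<xi>)\<^sup>2)"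
      using ptest_exponential(1)[OF pt zD s(1) td' loc] nz A(1) by (simp add: zz \<xi>_def)
    then have "pF q \<xi> (\<lambda>a. (- 2 * k / t) *\<^sub>R a) + (1 - q) * (norm \<xi>)\<^sup>2 \<le> k * (norm (x - z'))\<^sup>2 / t\<^sup>2 - real n / t"
      using A(1) by (simp add: mult_le_cancel_left divide_le_cancel)
    moreover have "(1 - q) * (norm \<xi>)\<^sup>2 = k * (norm (x - z'))\<^sup>2 / t\<^sup>2"
    proof -
      have "(1 - q) * (norm \<xi>)\<^sup>2 = ((1 - q) * (4 * k)) * (k * (norm (x - z'))\<^sup>2 / t\<^sup>2)"
        by (simp add: \<xi>_def power_mult_distrib power_divide power2_eq_square)
      then show ?thesis unfolding kk by simp
    qed
    ultimately have "real n / t \<le> 2 * k * (q * DIM('b) + (1 - 2 * q)) / t"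
      unfolding pF_scalar[OF nz] by simp
    then have "real n \<le> 2 * k * (q * DIM('b) + (1 - 2 * q))" using xt by (simp add: divide_le_cancel)
    then show False using n by simp
  qed
  show ?thesis
    by (rule exI[of _ A]) (use A(1) main in \<open>auto simp: \<phi>h k_def\<close>)
qed

section \<open>Nonnegativity\<close>

text \<open>
  The negative part of \<open>u\<close>, extended by \<open>0\<close>, satisfies the assumptions of \<open>vanishing_subsolution\<close>. To verify
  \<open>init\<close>, consider a limit \<open>l\<close> of points where it fails: if \<open>l \<in> \<Omega>\<close>, then \<open>v\<close> is small near \<open>(l, 0)\<close>, and
  otherwise \<open>v(l, s) = 0\<close> at the positive time \<open>s\<close>.
\<close>

theorem nonneg_of_nonneg_boundary_data:
  fixes u :: "'b::euclidean_space \<times> real \<Rightarrow> real"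
  assumes q: "0 \<le> q" "q < 1" and \<Omega>: "open \<Omega>" and pt: "ptest q (\<Omega> \<times> {0<..}) (\<lambda>z. - u z)"
    and bd: "bounded (u ` (\<Omega> \<times> {0<..}))"
    and cont: "continuous_on (closure \<Omega> \<times> {0..} - frontier \<Omega> \<times> {0}) u"
    and ic: "\<And>x. x \<in> \<Omega> \<Longrightarrow> 0 \<le> u (x, 0)"
    and bdry: "\<And>x t. x \<in> frontier \<Omega> \<Longrightarrow> 0 < t \<Longrightarrow> 0 \<le> u (x, t)"
    and xt: "x \<in> \<Omega>" "0 < t"
  shows "0 \<le> u (x, t)"
proof (rule ccontr)
  assume neg: "\<not> ?thesis"
  define v where "v z = (if fst z \<in> \<Omega> then max (- u z) 0 else 0)" for z
  define m where "m = (SUP z\<in>UNIV \<times> {0<..}. v z)"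
  have frd: "x \<notin> frontier \<Omega>" if "x \<in> \<Omega>" for x using \<Omega> that by (simp add: frontier_def interior_open)
  obtain B where B: "\<And>y. y \<in> \<Omega> \<times> {0<..} \<Longrightarrow> \<bar>u y\<bar> \<le> B" using bd unfolding bounded_iff by force
  have vB: "v z \<le> \<bar>B\<bar>" if "snd z > 0" for z
    using B[of z] that by (auto simp: v_def mem_Times_iff)
  have v0: "0 \<le> v z" for z by (simp add: v_def)
  have bdd: "bdd_above (v ` (UNIV \<times> {0<..}))" using vB by (intro bdd_aboveI2[where M="\<bar>B\<bar>"]) auto
  have vm: "v (y, s) \<le> m" if "0 < s" for y s
    unfolding m_def by (rule cSUP_upper[OF _ bdd]) (use that in auto)
  have m: "m > 0"
  proof -
    have "0 < v (x, t)" using neg xt by (simp add: v_def)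
    then show ?thesis using vm[OF xt(2), of x] by linarith
  qed
  have contv: "continuous_on (UNIV \<times> {0<..}) v"
  proof -
    have U: "UNIV \<times> {0<..} = closure \<Omega> \<times> {0<..} \<union> (- \<Omega>) \<times> {0::real<..}"
      using closure_subset by auto
    have c1: "closedin (top_of_set (UNIV \<times> {0::real<..})) (closure \<Omega> \<times> {0<..})"
      "closedin (top_of_set (UNIV \<times> {0::real<..})) ((- \<Omega>) \<times> {0<..})"
      using \<Omega> by (intro closedin_Times closedin_subtopology_refl[THEN iffD2]; simp add: closed_Compl)+
    have cu: "continuous_on (closure \<Omega> \<times> {0<..}) (\<lambda>z. max (- u z) 0)"
      by (intro continuous_intros continuous_on_subset[OF cont]) auto
    show ?thesis
      unfolding U v_def
    proof (rule continuous_on_cases_local[OF _ _ cu continuous_on_const])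
      show "max (- u z) 0 = 0"
        if "z \<in> closure \<Omega> \<times> {0<..} \<and> fst z \<notin> \<Omega> \<or> z \<in> (- \<Omega>) \<times> {0<..} \<and> fst z \<in> \<Omega>" for z
      proof -
        have "fst z \<in> frontier \<Omega>" "snd z > 0" using that \<Omega> by (auto simp: frontier_def interior_open)
        then have "0 \<le> u (fst z, snd z)" by (rule bdry)
        then show ?thesis by simp
      qed
    qed (use c1 U in auto)
  qed
  have ptv: "ptest q {z. 0 < snd z \<and> 0 < v z} v"
    unfolding ptest_def
  proof (intro ballI allI impI)
    fix z \<psi> H and g :: "'b \<times> real \<Rightarrow> 'b \<times> real" and r :: real
    assume z: "z \<in> {z. 0 < snd z \<and> 0 < v z}" and r: "0 < r" and td: "twice_diff (ball z r) \<psi> g H"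
      and mx: "\<forall>y\<in>ball z r. v y - \<psi> y \<le> v z - \<psi> z"
    have zD: "z \<in> \<Omega> \<times> {0<..}" and vz: "v z = - u z"
      using z by (auto simp: v_def mem_Times_iff max_def split: if_splits)
    have "open (\<Omega> \<times> {0::real<..})" using \<Omega> by (intro open_Times) auto
    then obtain s where s: "s > 0" "ball z s \<subseteq> \<Omega> \<times> {0<..}" using zD open_contains_ball by blast
    have td': "twice_diff (ball z (min r s)) \<psi> g H" by (rule twice_diff_subset[OF td]) auto
    have mx': "- u y - \<psi> y \<le> - u z - \<psi> z" if "y \<in> ball z (min r s)" for y
    proof -
      have "fst y \<in> \<Omega>" using s(2) that by auto
      then have "- u y \<le> v y" by (simp add: v_def)
      moreover have "v y - \<psi> y \<le> v z - \<psi> z" using mx that by simp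
      ultimately show ?thesis using vz by linarith
    qed
    have rs: "0 < min r s" using r s by simp
    show "(fst (g z) \<noteq> 0 \<longrightarrow> snd (g z) \<le> pF q (fst (g z)) (\<lambda>a. fst (H z (a, 0)))) \<and>
        (\<forall>M::real. (\<forall>a. \<bar>fst (H z (a, 0)) \<bullet> a\<bar> \<le> M * (norm a)\<^sup>2) \<longrightarrow> snd (g z) \<le> (DIM('b) + 1) * M)"
      using ptestD[OF pt zD rs td' mx'] by blast
  qed
  have init: "\<exists>\<delta>>0. \<forall>x y t t'. norm (x - x0) \<le> 3 \<and> norm (y - x0) \<le> 4 \<and>
       norm (x - y) < \<delta> \<and> \<bar>t\<bar> < \<delta> \<and> 0 < t' \<and> t' < \<delta> \<longrightarrow> 0 < t + s \<and> v (x, t + s) + v (y, t') \<le> m + \<gamma>"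
    if s: "0 < s" and \<gamma>: "0 < \<gamma>" for s \<gamma> and x0 :: 'b
  proof (rule ccontr)
    assume no: "\<not> ?thesis"
    define bad where "bad j x y t t' \<longleftrightarrow> norm (x - x0) \<le> 3 \<and> norm (y - x0) \<le> 4 \<and> norm (x - y) < 1 / real (Suc j) \<and>
        \<bar>t\<bar> < 1 / real (Suc j) \<and> 0 < t' \<and> t' < 1 / real (Suc j) \<and> \<not> (0 < t + s \<and> v (x, t + s) + v (y, t') \<le> m + \<gamma>)"
      for j x y t t'
    have "\<exists>x y t t'. bad j x y t t'" for j
    proof -
      have "1 / real (Suc j) > 0" by simp
      then show ?thesis using no unfolding bad_def by blast
    qed
    then obtain X Y T T' where bad: "\<And>j. bad j (X j) (Y j) (T j) (T' j)" by metis
    have "X j \<in> cball x0 3" for j using bad[of j] by (simp add: bad_def dist_norm norm_minus_commute)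
    then obtain l r where l: "strict_mono r" "(X \<circ> r) \<longlonglongrightarrow> l"
      using compact_cball[of x0 3] unfolding compact_def by blast
    have inv: "(\<lambda>j. 1 / real (Suc (r j))) \<longlonglongrightarrow> 0"
      using LIMSEQ_subseq_LIMSEQ[OF LIMSEQ_inverse_real_of_nat l(1)]
      by (simp add: o_def inverse_eq_divide)
    have XY: "(\<lambda>j. Y (r j) - X (r j)) \<longlonglongrightarrow> 0"
    proof (rule Lim_null_comparison[OF _ inv])
      show "\<forall>\<^sub>F j in sequentially. norm (Y (r j) - X (r j)) \<le> 1 / real (Suc (r j))"
        using bad unfolding bad_def by (intro always_eventually allI) (metis less_imp_le norm_minus_commute)
    qed
    have Xl: "(\<lambda>j. X (r j)) \<longlonglongrightarrow> l" using l(2) by (simp add: o_def)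
    have Yl: "(\<lambda>j. Y (r j)) \<longlonglongrightarrow> l" using tendsto_add[OF XY Xl] by simp
    have Tl: "(\<lambda>j. T (r j)) \<longlonglongrightarrow> 0"
    proof (rule Lim_null_comparison[OF _ inv])
      show "\<forall>\<^sub>F j in sequentially. norm (T (r j)) \<le> 1 / real (Suc (r j))"
        using bad unfolding bad_def by (intro always_eventually allI) (simp add: less_imp_le)
    qed
    have T'l: "(\<lambda>j. T' (r j)) \<longlonglongrightarrow> 0"
    proof (rule Lim_null_comparison[OF _ inv])
      show "\<forall>\<^sub>F j in sequentially. norm (T' (r j)) \<le> 1 / real (Suc (r j))"
        using bad unfolding bad_def by (intro always_eventually allI) (simp add: less_imp_le)
    qed
    have Ts: "(\<lambda>j. T (r j) + s) \<longlonglongrightarrow> s" using tendsto_add[OF Tl tendsto_const[of s]] by simp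
    have evs: "\<forall>\<^sub>F j in sequentially. 0 < T (r j) + s" using order_tendstoD(1)[OF Ts s] .
    have T'p: "0 < T' j" for j using bad[of j] by (simp add: bad_def)
    have "\<forall>\<^sub>F j in sequentially. v (X (r j), T (r j) + s) + v (Y (r j), T' (r j)) \<le> m + \<gamma>"
    proof (cases "l \<in> \<Omega>")
      case True
      have l0: "(l, 0::real) \<in> closure \<Omega> \<times> {0..} - frontier \<Omega> \<times> {0}"
        using True closure_subset[of \<Omega>] frd[OF True] by auto
      have evY: "\<forall>\<^sub>F j in sequentially. Y (r j) \<in> \<Omega>" using topological_tendstoD[OF Yl \<Omega> True] .
      have "(\<lambda>j. u (Y (r j), T' (r j))) \<longlonglongrightarrow> u (l, 0)"
      proof (rule continuous_on_tendsto_compose[OF cont tendsto_Pair[OF Yl T'l] l0])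
        show "\<forall>\<^sub>F j in sequentially. (Y (r j), T' (r j)) \<in> closure \<Omega> \<times> {0..} - frontier \<Omega> \<times> {0}"
          using evY by eventually_elim (use closure_subset[of \<Omega>] T'p in \<open>auto simp: less_imp_le dest: frd\<close>)
      qed
      moreover have "- \<gamma> < u (l, 0)" using ic[OF True] \<gamma> by linarith
      ultimately have "\<forall>\<^sub>F j in sequentially. - \<gamma> < u (Y (r j), T' (r j))" by (rule order_tendstoD(1))
      then show ?thesis using evs
      proof eventually_elim
        case (elim j)
        have "v (Y (r j), T' (r j)) \<le> \<gamma>" using elim \<gamma> by (simp add: v_def)
        then show ?case using vm[OF elim(2), of "X (r j)"] by linarith
      qed
    next
      case False
      have "(\<lambda>j. v (X (r j), T (r j) + s)) \<longlonglongrightarrow> v (l, s)"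
        by (rule continuous_on_tendsto_compose[OF contv tendsto_Pair[OF Xl Ts]])
           (use s evs in auto)
      moreover have "v (l, s) < \<gamma>" using False \<gamma> by (simp add: v_def)
      ultimately have "\<forall>\<^sub>F j in sequentially. v (X (r j), T (r j) + s) < \<gamma>" by (rule order_tendstoD(2))
      then show ?thesis
      proof eventually_elim
        case (elim j)
        then show ?case using vm[OF T'p, of "Y (r j)" "r j"] by linarith
      qed
    qed
    then have "\<forall>\<^sub>F j in sequentially. False"
      using evs by eventually_elim (use bad in \<open>auto simp: bad_def\<close>)
    then show False by simp
  qed
  interpret vanishing_subsolution q m v
    by unfold_locales (use q m v0 vm contv ptv init in auto)
  have "m \<le> 3/4 * m"
    unfolding m_def[symmetric]
  proof -
    have "(SUP z\<in>UNIV \<times> {0<..}. v z) \<le> 3/4 * m"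
      by (rule cSUP_least) (use global_bound in auto)
    then show ?thesis by (simp add: m_def)
  qed
  then show False using m by simp
qed

section \<open>Invariant level surfaces are parallel to the boundary\<close>

lemma cball_subset_of_less_infdist_frontier:
  fixes y :: "'b::euclidean_space"
  assumes "y \<in> \<Omega>" "0 \<le> R" "R < infdist y (frontier \<Omega>)"
  shows "cball y R \<subseteq> \<Omega>"
proof (rule ccontr)
  assume "\<not> ?thesis"
  then have "cball y R \<inter> frontier \<Omega> \<noteq> {}"
  proof (intro connected_Int_frontier)
    show "cball y R \<inter> \<Omega> \<noteq> {}" using assms by (auto intro: centre_in_cball[THEN iffD2])
  qed auto
  then obtain z where "z \<in> frontier \<Omega>" "dist y z \<le> R" by auto
  then show False using infdist_le[of z "frontier \<Omega>" y] assms(3) by linarith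
qed

text \<open>
  If \<open>d(x) < d(y)\<close> for two points of the surface, the lower estimate at \<open>x\<close> and the upper estimate at \<open>y\<close> are
  incompatible with \<open>u(x, t) = u(y, t)\<close> for small \<open>t\<close>.
\<close>

theorem theorem3p8:
  fixes \<Omega> \<Gamma> \<Sigma> :: "(real^'n) set"
    and u :: "(real^'n) \<times> real \<Rightarrow> real"
    and p :: ereal
  assumes "CARD('n) \<ge> 2"
    and "open \<Omega>" and "connected \<Omega>" and "\<Omega> \<noteq> {}"
    and "\<Gamma> = frontier \<Omega>" and "\<Gamma> \<noteq> {}"
    and "\<Gamma> = frontier (UNIV - closure \<Omega>)"
    and "1 < p"
    and "viscosity_solution p \<Omega> u"
    and "bounded (u ` (\<Omega> \<times> {0<..}))"
    and "continuous_on (closure \<Omega> \<times> {0..} - \<Gamma> \<times> {0}) u"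
    and "\<forall>x\<in>\<Omega>. u (x, 0) = 0"
    and "\<forall>x\<in>\<Gamma>. \<forall>t>0. u (x, t) = 1"
    and "time_invariant_level_surface \<Omega> u \<Sigma>"
  shows "\<exists>R>0. \<forall>x\<in>\<Sigma>. infdist x \<Gamma> = R"
proof -
  note \<Omega> = assms(2) and \<Gamma> = assms(5,6,7) and cont = assms(11)[unfolded assms(5)]
  define q where "q = real_of_ereal (1 / p)"
  have q: "0 \<le> q" "q < 1" using exponent_inverse[OF assms(8)] by (simp_all add: q_def)
  have pt: "ptest q (\<Omega> \<times> {0<..}) u" "ptest q (\<Omega> \<times> {0<..}) (\<lambda>z. - u z)"
    using viscosity_ptest[OF assms(8-10)] by (simp_all add: q_def)
  have nonneg: "0 \<le> u (x, t)" if "x \<in> \<Omega>" "0 < t" for x t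
    by (rule nonneg_of_nonneg_boundary_data[OF q \<Omega> pt(2) assms(10) cont _ _ that])
       (use assms(12,13) \<Gamma>(1) in auto)
  obtain B where B: "\<And>y. y \<in> \<Omega> \<times> {0<..} \<Longrightarrow> \<bar>u y\<bar> \<le> B" using assms(10) unfolding bounded_iff by force
  obtain a where \<Sigma>: "\<Sigma> \<subseteq> \<Omega>" "\<And>x t. x \<in> \<Sigma> \<Longrightarrow> 0 < t \<Longrightarrow> u (x, t) = a t"
    using assms(14) unfolding time_invariant_level_surface_def by auto
  have cl: "closed \<Gamma>" by (simp add: \<Gamma>(1))
  have not\<Gamma>: "x \<notin> \<Gamma>" if "x \<in> \<Omega>" for x using \<Omega> that by (simp add: \<Gamma>(1) frontier_def interior_open)
  have key: "\<not> infdist x \<Gamma> < infdist y \<Gamma>" if x: "x \<in> \<Sigma>" and y: "y \<in> \<Sigma>" for x y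
  proof
    assume less: "infdist x \<Gamma> < infdist y \<Gamma>"
    define d where "d = (2 * infdist x \<Gamma> + infdist y \<Gamma>) / 3"
    define R where "R = (infdist x \<Gamma> + infdist y \<Gamma>) / 2"
    have d: "0 < d" "d < R" "infdist x \<Gamma> < d" and R: "0 < R" "R < infdist y \<Gamma>"
      using less infdist_nonneg[of x \<Gamma>] unfolding d_def R_def by auto
    have yO: "y \<in> \<Omega>" and xO: "x \<in> \<Omega>" using \<Sigma>(1) x y by auto
    have ball: "cball y R \<subseteq> \<Omega>"
      by (rule cball_subset_of_less_infdist_frontier[OF yO]) (use R \<Gamma>(1) in auto)
    define k where "k = 1 / (4 * (1 - q))"
    have k: "k > 0" using q by (simp add: k_def)
    have cb: "continuous_on (cball y R \<times> {0..}) u"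
      by (rule continuous_on_subset[OF assms(11)]) (use ball closure_subset[of \<Omega>] not\<Gamma> in blast)
    have u0: "u (w, 0) = 0" if "w \<in> cball y R" for w using assms(12) ball that by blast
    have uB: "u (w, t) \<le> \<bar>B\<bar> + 1" if "w \<in> cball y R" "0 < t" for w t
      using B[of "(w, t)"] ball that by force
    have B1: "\<bar>B\<bar> + 1 > 0" by simp
    obtain C where C: "C > 0" "\<And>t. 0 < t \<Longrightarrow> t \<le> 1 \<Longrightarrow> u (y, t) \<le> C * exp (- d\<^sup>2 / (4 * (1 - q)) / t)"
      using upper_decay[OF q pt(1) R(1) ball d(1,2) cb u0 B1 uB] by blast
    obtain z where z: "z \<in> \<Gamma>" "infdist x \<Gamma> = dist x z" using infdist_attains_inf[OF cl \<Gamma>(2)] by blast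
    have "z \<in> frontier (UNIV - closure \<Omega>)" using z(1) \<Gamma>(3) by simp
    then have "z \<in> closure (UNIV - closure \<Omega>)" unfolding frontier_def by (rule DiffD1)
    moreover have "d - dist x z > 0" using d z by simp
    ultimately have "\<exists>z'\<in>UNIV - closure \<Omega>. dist z' z < d - dist x z"
      using closure_approachable[of z "UNIV - closure \<Omega>"] by simp
    then obtain z' where z': "z' \<notin> closure \<Omega>" "dist z' z < d - dist x z" by blast
    have xz': "norm (x - z') < d" using dist_triangle[of x z' z] z'(2) by (simp add: dist_norm norm_minus_commute)
    define \<rho> where "\<rho> = infdist z' (closure \<Omega>)"
    have \<rho>: "\<rho> > 0" unfolding \<rho>_def using z' assms(4) by (intro infdist_pos_not_in_closed) auto
    have far: "\<rho> \<le> norm (w - z')" if "w \<in> closure \<Omega>" for w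
      using infdist_le[OF that, of z'] by (simp add: \<rho>_def dist_norm norm_minus_commute)
    have cc: "continuous_on (closure \<Omega> \<times> {0<..}) u" by (rule continuous_on_subset[OF cont]) auto
    have u1: "u (w, t) = 1" if "w \<in> frontier \<Omega>" "0 < t" for w t using assms(13) \<Gamma>(1) that by auto
    have "\<exists>A>0. \<exists>n. \<forall>x\<in>\<Omega>. \<forall>t>0. heat_profile (1 / (4 * (1 - q))) n (norm (x - z')) t / A \<le> u (x, t)"
      by (rule lower_barrier[OF q \<Omega> pt(2) nonneg cc u1 \<rho> far])
    then obtain A n where A: "A > 0"
      "\<And>x t. x \<in> \<Omega> \<Longrightarrow> 0 < t \<Longrightarrow> heat_profile (1 / (4 * (1 - q))) n (norm (x - z')) t / A \<le> u (x, t)"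
      by blast
    define \<eta> where "\<eta> = k * (d\<^sup>2 - (norm (x - z'))\<^sup>2)"
    have \<eta>: "\<eta> > 0" unfolding \<eta>_def using k xz' by (intro mult_pos_pos) (auto intro: power_strict_mono)
    \<comment> \<open>Small enough for \<open>exp (\<eta> / t) > A C\<close>, as \<open>exp (\<eta> / t) > \<eta> / t\<close>.\<close>
    define t where "t = min 1 (\<eta> / (A * C))"
    have t: "0 < t" "t \<le> 1" "t \<le> \<eta> / (A * C)" using \<eta> A(1) C(1) by (auto simp: t_def)
    have "heat_profile k n (norm (x - z')) t / A \<le> C * exp (- d\<^sup>2 / (4 * (1 - q)) / t)"
      using A(2)[OF xO t(1)] C(2)[OF t(1,2)] \<Sigma>(2)[OF x t(1)] \<Sigma>(2)[OF y t(1)] unfolding k_def by linarith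
    then have "heat_profile k n (norm (x - z')) t \<le> A * (C * exp (- d\<^sup>2 / (4 * (1 - q)) / t))"
      using A(1) by (simp add: pos_divide_le_eq mult.commute)
    moreover have "- d\<^sup>2 / (4 * (1 - q)) / t = - (k * d\<^sup>2 / t)" by (simp add: k_def)
    ultimately have "exp (- k * (norm (x - z'))\<^sup>2 / t) / t ^ n \<le> A * C * exp (- (k * d\<^sup>2 / t))"
      unfolding heat_profile_eq[OF t(1)] by (simp only: mult.assoc)
    moreover have "exp (- k * (norm (x - z'))\<^sup>2 / t) / 1 \<le> exp (- k * (norm (x - z'))\<^sup>2 / t) / t ^ n"
      using t by (intro divide_left_mono) (auto intro: power_le_one)
    ultimately have "exp (- k * (norm (x - z'))\<^sup>2 / t) \<le> A * C * exp (- (k * d\<^sup>2 / t))" by simp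
    then have "exp (k * d\<^sup>2 / t) * exp (- k * (norm (x - z'))\<^sup>2 / t) \<le> exp (k * d\<^sup>2 / t) * (A * C * exp (- (k * d\<^sup>2 / t)))"
      by (intro mult_left_mono) auto
    also have "\<dots> = A * C" by (simp add: exp_minus)
    also have "exp (k * d\<^sup>2 / t) * exp (- k * (norm (x - z'))\<^sup>2 / t) = exp (\<eta> / t)"
      unfolding exp_add[symmetric] by (simp add: \<eta>_def algebra_simps diff_divide_distrib)
    finally have "exp (\<eta> / t) \<le> A * C" .
    moreover have "A * C \<le> \<eta> / t" using t A(1) C(1) by (simp add: field_simps)
    ultimately show False using exp_ge_add_one_self[of "\<eta> / t"] by linarith
  qed
  show ?thesis
  proof (cases "\<Sigma> = {}")
    case True
    then show ?thesis by (auto intro: exI[of _ 1])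
  next
    case False
    then obtain x where x: "x \<in> \<Sigma>" by blast
    have "infdist x \<Gamma> > 0" using not\<Gamma> \<Sigma>(1) x cl \<Gamma>(2) by (intro infdist_pos_not_in_closed) auto
    moreover have "infdist y \<Gamma> = infdist x \<Gamma>" if "y \<in> \<Sigma>" for y
      using key[OF x that] key[OF that x] by linarith
    ultimately show ?thesis by blast
  qed
qed

end
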